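(* Let $X$ and $Y$ be compact connected Riemann surfaces of genus $g(X)$ and $g(Y)$ respectively, and let $f:X\to Y$ be a non-constant holomorphic map. Let $m$ be the degree of $f$ and let $V=\sum_{p\in X}V_f(p)$ be the sum of the ramification indices of $f$ at the points of $X$. Then $$g(X)=m\bigl(g(Y)-1\bigr)+1+\frac{V}{2}.$$
   Context: For $p\in X$ there are charts of $X$ centered at $p$ and of $Y$ centered at $f(p)$ in which $f$ has the form $\tau\mapsto\tau^n$ with $n\ge 1$ an integer; the ramification index of $f$ at $p$ is, in this convention, $V_f(p)=n-1$. The degree of $f$ is $m=\sum_{p\in f^{-1}(q)}(V_f(p)+1)$, which is independent of $q\in Y$. The genus is the topological genus (number of handles). *)

theory Defs
  imports "HOL-Analysis.Analysis"
begin

section \<open>Riemann surfaces\<close>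

text \<open>
  A chart is a pair of its domain and its coordinate map; the values of the coordinate map
  outside the domain are irrelevant.
\<close>

type_synonym 'a chart = "'a set \<times> ('a \<Rightarrow> complex)"

definition complex_chart :: "'a topology \<Rightarrow> 'a chart \<Rightarrow> bool" where
  "complex_chart X = (\<lambda>(U, \<phi>).
     openin X U \<and> open (\<phi> ` U) \<and>
     homeomorphic_map (subtopology X U) (top_of_set (\<phi> ` U)) \<phi>)"

definition holo_compatible :: "'a chart \<Rightarrow> 'a chart \<Rightarrow> bool" where
  "holo_compatible = (\<lambda>(U, \<phi>) (V, \<psi>).
     (\<psi> \<circ> inv_into U \<phi>) holomorphic_on \<phi> ` (U \<inter> V) \<and>
     (\<phi> \<circ> inv_into V \<psi>) holomorphic_on \<psi> ` (U \<inter> V))"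

text \<open>
  Second countability is not required: it follows from compactness in the only case used here.
  Connectedness is left as a separate assumption. The atlas need not be maximal.
\<close>

locale riemann_surface =
  fixes X :: "'a topology" and A :: "'a chart set"
  assumes Hausdorff: "Hausdorff_space X"
    and charts: "c \<in> A \<Longrightarrow> complex_chart X c"
    and covers: "topspace X = (\<Union>c\<in>A. fst c)"
    and compatible: "c \<in> A \<Longrightarrow> d \<in> A \<Longrightarrow> holo_compatible c d"

text \<open>The charts of the complex structure defined by an atlas, i.e. its maximal atlas.\<close>

definition max_atlas :: "'a topology \<Rightarrow> 'a chart set \<Rightarrow> 'a chart set" where
  "max_atlas X A = {c. complex_chart X c \<and> (\<forall>d\<in>A. holo_compatible c d)}"

section \<open>Holomorphic maps, ramification and degree\<close>

definition holomorphic_map ::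
  "'a topology \<Rightarrow> 'a chart set \<Rightarrow> 'b topology \<Rightarrow> 'b chart set \<Rightarrow> ('a \<Rightarrow> 'b) \<Rightarrow> bool" where
  "holomorphic_map X A Y B f \<longleftrightarrow>
     continuous_map X Y f \<and>
     (\<forall>(U, \<phi>)\<in>A. \<forall>(V, \<psi>)\<in>B.
        (\<psi> \<circ> f \<circ> inv_into U \<phi>) holomorphic_on \<phi> ` {x \<in> U. f x \<in> V})"

definition chart_centered_at :: "'a \<Rightarrow> 'a chart \<Rightarrow> bool" where
  "chart_centered_at p = (\<lambda>(U, \<phi>). p \<in> U \<and> \<phi> p = 0)"

definition local_power_form ::
  "'a topology \<Rightarrow> 'a chart set \<Rightarrow> 'b topology \<Rightarrow> 'b chart set \<Rightarrow> ('a \<Rightarrow> 'b) \<Rightarrow> 'a \<Rightarrow> nat \<Rightarrow> bool" where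
  "local_power_form X A Y B f p n \<longleftrightarrow>
     (\<exists>(U, \<phi>)\<in>max_atlas X A. \<exists>(V, \<psi>)\<in>max_atlas Y B.
        chart_centered_at p (U, \<phi>) \<and> chart_centered_at (f p) (V, \<psi>) \<and>
        f ` U \<subseteq> V \<and> (\<forall>x\<in>U. \<psi> (f x) = \<phi> x ^ n))"

text \<open>Unramified points have index 0, not 1.\<close>

definition ramification_index ::
  "'a topology \<Rightarrow> 'a chart set \<Rightarrow> 'b topology \<Rightarrow> 'b chart set \<Rightarrow> ('a \<Rightarrow> 'b) \<Rightarrow> 'a \<Rightarrow> nat" where
  "ramification_index X A Y B f p = (THE n. n \<ge> 1 \<and> local_power_form X A Y B f p n) - 1"

text \<open>
  The degree is the value common to all fibres. For a non-constant holomorphic map on a compact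
  connected surface the fibres are finite; stating this excludes the convention that a sum over
  an infinite set is 0.
\<close>

definition map_degree ::
  "'a topology \<Rightarrow> 'a chart set \<Rightarrow> 'b topology \<Rightarrow> 'b chart set \<Rightarrow> ('a \<Rightarrow> 'b) \<Rightarrow> nat" where
  "map_degree X A Y B f =
     (THE m. \<forall>q\<in>topspace Y. finite {p \<in> topspace X. f p = q} \<and>
        m = (\<Sum>p | p \<in> topspace X \<and> f p = q. ramification_index X A Y B f p + 1))"

text \<open>
  The sum over all points of the surface, restricted to the ramification points. By compactness
  there are only finitely many of them, while the sum over the whole surface would be 0 by
  convention.
\<close>

definition total_ramification ::
  "'a topology \<Rightarrow> 'a chart set \<Rightarrow> 'b topology \<Rightarrow> 'b chart set \<Rightarrow> ('a \<Rightarrow> 'b) \<Rightarrow> nat" where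
  "total_ramification X A Y B f =
     (\<Sum>p | p \<in> topspace X \<and> ramification_index X A Y B f p \<noteq> 0. ramification_index X A Y B f p)"

section \<open>Genus\<close>

text \<open>
  A handle is a torus with an open disc removed. On the torus
  $|z| = |w| = 1$ with $z = e^{ia}$, $w = e^{ib}$, the ball of radius 1 about $(1,1)$
  cuts out the disc $4\sin^2(a/2) + 4\sin^2(b/2) < 1$.
\<close>

definition handle :: "(complex \<times> complex) set" where
  "handle = sphere 0 1 \<times> sphere 0 1 - ball (1, 1) 1"

definition handle_rim :: "(complex \<times> complex) set" where
  "handle_rim = (sphere 0 1 \<times> sphere 0 1) \<inter> sphere (1, 1) 1"

text \<open>
  A surface has genus \<open>g\<close> if it is a 2-sphere with \<open>g\<close> handles: it is the union of a copy \<open>S\<close> of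
  the sphere with \<open>g\<close> disjoint open round discs removed and of \<open>g\<close> disjoint handles, the \<open>i\<close>-th
  handle meeting \<open>S\<close> exactly in its rim, which is the boundary circle of the \<open>i\<close>-th disc.
  Because a handle is a one-holed torus rather than a cylinder, no condition on the orientation of
  the glueing is needed (a torus has orientation-reversing self-homeomorphisms), and non-orientable
  surfaces do not arise.
\<close>

definition has_genus :: "'a topology \<Rightarrow> nat \<Rightarrow> bool" where
  "has_genus X g \<longleftrightarrow>
     (\<exists>(c :: nat \<Rightarrow> real ^ 3) r S \<phi> H \<psi>.
        (\<forall>i<g. c i \<in> sphere 0 1 \<and> 0 < r i \<and> r i < 2) \<and>
        disjoint_family_on (\<lambda>i. sphere 0 1 \<inter> cball (c i) (r i)) {..<g} \<and>
        closedin X S \<and>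
        homeomorphic_map (top_of_set (sphere 0 1 - (\<Union>i<g. ball (c i) (r i))))
          (subtopology X S) \<phi> \<and>
        disjoint_family_on H {..<g} \<and>
        (\<forall>i<g. closedin X (H i) \<and>
           homeomorphic_map (top_of_set handle) (subtopology X (H i)) (\<psi> i) \<and>
           S \<inter> H i = \<phi> ` (sphere 0 1 \<inter> sphere (c i) (r i)) \<and>
           S \<inter> H i = \<psi> i ` handle_rim) \<and>
        topspace X = S \<union> (\<Union>i<g. H i))"

end

theory Submission
 imports Defs "HOL-Complex_Analysis.Complex_Analysis"
begin

text \<open>
 The Euler characteristic of a surface is made independent of the way the surface is cut into cells
 by counting, for a finite set of points removed, the nowhere zero continuous complex functions modulo
 squares: this is the mod 2 cohomology, and it can be computed from any cellulation with the help of
 logarithms on discs and punctured discs. A sphere with \<open>g\<close> handles has a cellulation of Euler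
 characteristic \<open>2 - 2 g\<close>. A cellulation of \<open>Y\<close> that is fine enough and whose graph passes through the
 branch points lifts to \<open>X\<close>, since \<open>f\<close> is a power map in suitable discs; every arc and every cell has \<open>m\<close>
 lifts, and every branch point \<open>q\<close> has \<open>m\<close> minus the ramification over \<open>q\<close> preimages.
 Comparing Euler characteristics gives \<open>2 - 2 g(X) = m (2 - 2 g(Y)) - V\<close>.
\<close>

section \<open>Square classes and Euler characteristics\<close>

text \<open>For the spaces at hand the nowhere zero functions modulo exponentials form H^1(T; Z), so
  the square classes are H^1(T; Z)/2; a graph with c components and Euler characteristic e has 2^(c
  - e) of them. Removing the centre of every cell lets the surface retract radially onto its graph,
  which fixes the count with \<open>card K\<close> punctures. Putting a point p back halves the
  count as long as another puncture q remains, because there is a continuous function with a simple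
  zero at p, a simple pole at q and no others. The last puncture admits no such function, so the
  invariant is taken on the surface minus one point, which may be any point. Two unrelated
  cellulations are thereby compared without a common refinement. Branch points are placed on the
  graph because a square minus some boundary points is still contractible, so that roots of the
  coordinate exist on it, whereas a branch point inside a cell would obstruct the lifts of that
  cell.\<close>

definition cs :: "'a topology => ('a => complex) => bool" where
 "cs T F \<longleftrightarrow> continuous_map T euclidean F & (\<forall>x\<in>topspace T. F x ~= 0)"

definition sqeq :: "'a topology => ('a => complex) => ('a => complex) => bool" where
 "sqeq T F G \<longleftrightarrow> (\<exists>A. cs T A & (\<forall>x\<in>topspace T. F x = G x * (A x)\<^sup>2))"

text \<open>Classes are counted through systems of representatives rather than as sets of functions:
  functions are total, and their values off \<open>topspace T\<close> are arbitrary.\<close>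

definition transv :: "'a topology => ('a => complex) set => bool" where
 "transv T B \<longleftrightarrow> (\<forall>b\<in>B. cs T b) & (\<forall>F. cs T F --> (\<exists>!b. b \<in> B & sqeq T F b))"

definition sqcard :: "'a topology => nat => bool" where
 "sqcard T k \<longleftrightarrow> (\<exists>B. transv T B & finite B & card B = k)"

lemma cs_one: "cs T (%x. 1)"
 by (simp add: cs_def)

lemma continuous_map_comp_cont:
 "continuous_map T euclidean F ==> F ` topspace T \<subseteq> S ==> continuous_on S h ==> continuous_map T euclidean (%x. h (F x))"
 using continuous_map_compose[of T "top_of_set S" F euclidean h]
 by (auto simp: continuous_map_in_subtopology o_def)

lemma continuous_map_comp_cont2:
 assumes "continuous_map T euclidean F" "continuous_map T euclidean G"
  "(%x. (F x, G x)) ` topspace T \<subseteq> S" "continuous_on S (%z. h (fst z) (snd z))"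
 shows "continuous_map T euclidean (%x. h (F x) (G x))"
proof -
 have "continuous_map T euclidean (%x. (F x, G x))"
  using assms(1,2) continuous_map_pairedI[of T euclidean F euclidean G]
  by (metis prod_topology_euclidean)
 from continuous_map_comp_cont[OF this assms(3,4)] show ?thesis by simp
qed

lemma cs_mult: "cs T F ==> cs T G ==> cs T (%x. F x * G x)"
 unfolding cs_def
 by (auto intro!: continuous_map_comp_cont2[where h="(*)" and S=UNIV] continuous_intros)

lemma cs_inverse: "cs T F ==> cs T (%x. inverse (F x))"
 unfolding cs_def
 by (auto intro!: continuous_map_comp_cont[where h=inverse and S="-{0}"] continuous_intros)

lemma cs_exp: "continuous_map T euclidean h ==> cs T (%x. exp (h x))"
 unfolding cs_def
 by (auto intro!: continuous_map_comp_cont[where h=exp and S="UNIV"] continuous_intros)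

lemma cs_power: "cs T F ==> cs T (%x. F x ^ n)"
 unfolding cs_def
 by (auto intro!: continuous_map_comp_cont[where h="%z. z^n" and S="UNIV"] continuous_intros)

lemma cs_cong: "cs T F ==> (!!x. x \<in> topspace T ==> F x = G x) ==> cs T G"
 unfolding cs_def by (metis continuous_map_eq)

lemma cs_power_int: assumes "cs T F" shows "cs T (%x. F x powi n)"
proof (cases "n \<ge> 0")
 case True
 then show ?thesis using cs_power[OF assms, of "nat n"] by (simp add: power_int_def)
next
 case False
 then show ?thesis using cs_power[OF cs_inverse[OF assms], of "nat (-n)"] by (simp add: power_int_def)
qed

lemma cs_sub: "cs (subtopology X Z) F ==> Z' \<subseteq> Z ==> cs (subtopology X Z') F"
 unfolding cs_def by (auto intro: continuous_map_from_subtopology_mono)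

lemma sqeq_sub: "sqeq (subtopology X Z) F G ==> Z' \<subseteq> Z ==> sqeq (subtopology X Z') F G"
 unfolding sqeq_def by (auto intro: cs_sub)

lemma sqeq_refl: "sqeq T F F"
 unfolding sqeq_def using cs_one by force

lemma sqeqI: "cs T A ==> (!!x. x \<in> topspace T ==> F x = G x * (A x)\<^sup>2) ==> sqeq T F G"
 unfolding sqeq_def by blast

lemma sqeq_cong: "(!!x. x \<in> topspace T ==> F x = G x) ==> sqeq T F G"
 by (rule sqeqI[OF cs_one]) simp

lemma sqeq_sym: assumes "sqeq T F G" shows "sqeq T G F"
proof -
 obtain A where A: "cs T A" "\<forall>x\<in>topspace T. F x = G x * (A x)\<^sup>2"
  using assms unfolding sqeq_def by blast
 show ?thesis
 proof (rule sqeqI[OF cs_inverse[OF A(1)]])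
  fix x assume x: "x \<in> topspace T"
  then have "A x ~= 0" "F x = G x * (A x)\<^sup>2" using A unfolding cs_def by blast+
  then show "G x = F x * (inverse (A x))\<^sup>2" by (simp add: field_simps)
 qed
qed

lemma sqeq_trans [trans]: assumes "sqeq T F G" "sqeq T G H" shows "sqeq T F H"
proof -
 obtain A B where A: "cs T A" "\<forall>x\<in>topspace T. F x = G x * (A x)\<^sup>2"
  and B: "cs T B" "\<forall>x\<in>topspace T. G x = H x * (B x)\<^sup>2"
  using assms unfolding sqeq_def by blast
 show ?thesis
  by (rule sqeqI[OF cs_mult[OF A(1) B(1)]]) (simp add: A(2) B(2) power_mult_distrib)
qed

lemma sqeq_mult: assumes "sqeq T F G" "sqeq T F' G'"
 shows "sqeq T (%x. F x * F' x) (%x. G x * G' x)"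
proof -
 obtain A B where A: "cs T A" "\<forall>x\<in>topspace T. F x = G x * (A x)\<^sup>2"
  and B: "cs T B" "\<forall>x\<in>topspace T. F' x = G' x * (B x)\<^sup>2"
  using assms unfolding sqeq_def by blast
 show ?thesis
  by (rule sqeqI[OF cs_mult[OF A(1) B(1)]]) (simp add: A(2) B(2) power_mult_distrib)
qed

text \<open>Half the logarithm provides the square root.\<close>

lemma sqeq_exp: "continuous_map T euclidean h ==> sqeq T (%x. exp (h x)) (%x. 1)"
 by (rule sqeqI[of _ "%x. exp (h x / 2)"])
   (auto intro!: cs_exp continuous_map_comp_cont[where h="%x. x/2" and S=UNIV] continuous_intros simp: exp_double[symmetric])

text \<open>Passage to quotients: injectivity of a restriction map need only be tested against the
  class of 1.\<close>

lemma sqeq_div_iff: assumes "cs T G" shows "sqeq T (%x. F x * inverse (G x)) (%x. 1) \<longleftrightarrow> sqeq T F G"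
proof
 assume "sqeq T (%x. F x * inverse (G x)) (%x. 1)"
 from sqeq_mult[OF this sqeq_refl[of _ G]] have "sqeq T (%x. F x * inverse (G x) * G x) G" by simp
 then show "sqeq T F G"
  by (rule sqeq_trans[rotated]) (rule sqeq_cong, use assms in \<open>auto simp: cs_def\<close>)
next
 assume "sqeq T F G"
 from sqeq_mult[OF this sqeq_refl[of _ "%x. inverse (G x)"]]
 show "sqeq T (%x. F x * inverse (G x)) (%x. 1)"
  by (rule sqeq_trans) (rule sqeq_cong, use assms in \<open>auto simp: cs_def\<close>)
qed

lemma sqeq_mult_cancel: assumes "cs T R" "sqeq T (%x. R x * F x) (%x. R x * G x)" shows "sqeq T F G"
proof -
 have *: "sqeq T H (%x. inverse (R x) * (R x * H x))" for H
  by (rule sqeq_cong) (use assms in \<open>auto simp: cs_def\<close>)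
 have "sqeq T (%x. inverse (R x) * (R x * F x)) (%x. inverse (R x) * (R x * G x))"
  by (rule sqeq_mult[OF sqeq_refl assms(2)])
 then show ?thesis using * sqeq_trans sqeq_sym by blast
qed

section \<open>Counting square classes by representatives\<close>

text \<open>Equivalent functions satisfy the same predicate under \<open>SOME\<close>, so the chosen
  representative depends on the class alone.\<close>

lemma transv_exists: "\<exists>B. transv T B"
proof -
 define rep where "rep F = (SOME G. cs T G & sqeq T F G)" for F
 have rep: "cs T (rep F) & sqeq T F (rep F)" if "cs T F" for F
  unfolding rep_def by (rule someI[of _ F]) (use that sqeq_refl in auto)
 have eq: "rep F = rep G" if "sqeq T F G" for F G
 proof -
  have "(%H. cs T H & sqeq T F H) = (%H. cs T H & sqeq T G H)"
   using that sqeq_trans sqeq_sym by metis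
  then show ?thesis unfolding rep_def by simp
 qed
 have "transv T (rep ` {F. cs T F})"
  unfolding transv_def
 proof (intro conjI allI impI ballI)
  fix F assume F: "cs T F"
  show "\<exists>!b. b \<in> rep ` {F. cs T F} & sqeq T F b"
  proof (rule ex1I[of _ "rep F"])
   fix b assume "b \<in> rep ` {F. cs T F} & sqeq T F b"
   then obtain G where G: "cs T G" "b = rep G" "sqeq T F (rep G)" by auto
   have "sqeq T F G" using G rep sqeq_trans sqeq_sym by blast
   then show "b = rep F" using eq G by simp
  qed (use F rep in auto)
 qed (use rep in auto)
 then show ?thesis by blast
qed

lemma transvD:
 assumes "transv T B"
 shows "b \<in> B ==> cs T b" "cs T F ==> \<exists>b\<in>B. sqeq T F b"
  "b \<in> B ==> c \<in> B ==> sqeq T b c ==> b = c"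
proof -
 show 1: "b \<in> B ==> cs T b" for b using assms unfolding transv_def by blast
 have ex: "\<exists>!b. b \<in> B & sqeq T F b" if "cs T F" for F
  using assms that unfolding transv_def by blast
 then show "cs T F ==> \<exists>b\<in>B. sqeq T F b" by blast
 show "b = c" if "b \<in> B" "c \<in> B" "sqeq T b c"
  using ex[OF 1[OF that(1)]] that sqeq_refl[of T b] by blast
qed

lemma transv_bij: assumes "transv T B" "transv T' B'"
 and "!!b. b \<in> B ==> cs T' (h b)"
 and "!!F. cs T' F ==> \<exists>b\<in>B. sqeq T' F (h b)"
 and "!!b c. b \<in> B ==> c \<in> B ==> sqeq T' (h b) (h c) ==> b = c"
 shows "(finite B \<longleftrightarrow> finite B') & card B = card B'"
proof -
 define k where "k b = (THE c. c \<in> B' & sqeq T' (h b) c)" for b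
 have k: "k b \<in> B' & sqeq T' (h b) (k b)" if "b \<in> B" for b
 proof -
  have "\<exists>!c. c \<in> B' & sqeq T' (h b) c" using assms(2,3) that unfolding transv_def by blast
  then show ?thesis unfolding k_def by (rule theI')
 qed
 have "bij_betw k B B'"
 proof (rule bij_betwI')
  fix b c assume bc: "b \<in> B" "c \<in> B"
  show "(k b = k c) = (b = c)"
   using k[OF bc(1)] k[OF bc(2)] assms(5) bc by (metis sqeq_sym sqeq_trans)
 next
  fix c assume c: "c \<in> B'"
  then have "cs T' c" by (rule transvD(1)[OF assms(2)])
  then obtain b where b: "b \<in> B" "sqeq T' c (h b)" using assms(4) by blast
  have "sqeq T' c (k b)" using b k sqeq_trans by blast
  then have "c = k b" using c k[OF b(1)] transvD(3)[OF assms(2)] by blast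
  then show "\<exists>x\<in>B. c = k x" using b by blast
 qed (use k in auto)
 then show ?thesis
  by (auto simp: bij_betw_finite bij_betw_same_card)
qed

lemma sqcard_iff: assumes B: "transv T B" shows "sqcard T k \<longleftrightarrow> finite B & card B = k"
proof
 assume "sqcard T k"
 then obtain B' where B': "transv T B'" "finite B'" "card B' = k" unfolding sqcard_def by blast
 have "(finite B \<longleftrightarrow> finite B') & card B = card B'"
 proof (rule transv_bij[OF B B'(1), where h="%b. b"])
  show "b \<in> B ==> cs T b" for b by (rule transvD(1)[OF B])
  show "cs T F ==> \<exists>b\<in>B. sqeq T F b" for F by (rule transvD(2)[OF B])
  show "b \<in> B ==> c \<in> B ==> sqeq T b c ==> b = c" for b c by (rule transvD(3)[OF B])
 qed
 then show "finite B & card B = k" using B' by simp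
qed (use B in \<open>auto simp: sqcard_def\<close>)

lemma sqcard_unique: "sqcard T k ==> sqcard T l ==> k = l"
 using transv_exists[of T] by (auto simp: sqcard_iff)

text \<open>In the following three lemmas the restriction homomorphism is bijective, surjective with a
 kernel of order two, or injective with a cokernel of order two.\<close>

lemma sqcard_restrict_bij:
 assumes sub: "Z \<subseteq> Z'"
  and surj: "!!F. cs (subtopology X Z) F ==> \<exists>F'. cs (subtopology X Z') F' & sqeq (subtopology X Z) F' F"
  and inj: "!!F. cs (subtopology X Z') F ==> sqeq (subtopology X Z) F (%x. 1) ==> sqeq (subtopology X Z') F (%x. 1)"
 shows "sqcard (subtopology X Z) k \<longleftrightarrow> sqcard (subtopology X Z') k"
proof -
 obtain B' where B': "transv (subtopology X Z') B'" using transv_exists by blast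
 obtain B where B: "transv (subtopology X Z) B" using transv_exists by blast
 have "(finite B' \<longleftrightarrow> finite B) & card B' = card B"
 proof (rule transv_bij[OF B' B, where h="%b. b"])
  show "cs (subtopology X Z) b" if "b \<in> B'" for b
   using transvD(1)[OF B' that] cs_sub sub by blast
  show "\<exists>b\<in>B'. sqeq (subtopology X Z) F b" if F: "cs (subtopology X Z) F" for F
  proof -
   obtain F' where F': "cs (subtopology X Z') F'" "sqeq (subtopology X Z) F' F" using surj F by blast
   obtain b where "b \<in> B'" "sqeq (subtopology X Z') F' b" using transvD(2)[OF B' F'(1)] by blast
   then show ?thesis using F' sqeq_sub[OF _ sub] sqeq_trans sqeq_sym by blast
  qed
  show "b = c" if "b \<in> B'" "c \<in> B'" "sqeq (subtopology X Z) b c" for b c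
  proof -
   have cc: "cs (subtopology X Z') b" "cs (subtopology X Z') c" using that transvD(1)[OF B'] by auto
   have "sqeq (subtopology X Z) (%x. b x * inverse (c x)) (%x. 1)"
    using sqeq_div_iff[OF cs_sub[OF cc(2) sub]] that by blast
   then have "sqeq (subtopology X Z') (%x. b x * inverse (c x)) (%x. 1)"
    using inj cs_mult cs_inverse cc by blast
   then show ?thesis using sqeq_div_iff[OF cc(2)] that transvD(3)[OF B'] by blast
  qed
 qed
 then show ?thesis unfolding sqcard_iff[OF B] sqcard_iff[OF B'] by auto
qed

text \<open>The classes on T' fall into two cosets, the image of \<open>h\<close> and its translate
  by \<open>R\<close>; \<open>ne\<close> keeps the two disjoint.\<close>

lemma transv_double:
 assumes B: "transv T B" and B': "transv T' B'"
  and h: "!!b. b \<in> B ==> cs T' (h b)"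
  and R: "cs T' R"
  and ex: "!!F. cs T' F ==> \<exists>b\<in>B. sqeq T' F (h b) | sqeq T' F (%x. R x * h b x)"
  and inj: "!!b c. b \<in> B ==> c \<in> B ==> sqeq T' (h b) (h c) ==> b = c"
  and ne: "!!b c. b \<in> B ==> c \<in> B ==> ~ sqeq T' (h b) (%x. R x * h c x)"
 shows "(finite B \<longleftrightarrow> finite B') & card B' = 2 * card B"
proof -
 define B2 where "B2 = h ` B Un (%b x. R x * h b x) ` B"
 have inj1: "inj_on h B" using inj sqeq_refl by (metis inj_onI)
 have inj2: "inj_on (%b x. R x * h b x) B"
 proof (rule inj_onI)
  fix b c assume bc: "b \<in> B" "c \<in> B" "(%x. R x * h b x) = (%x. R x * h c x)"
  then have "sqeq T' (%x. R x * h b x) (%x. R x * h c x)" by (simp add: sqeq_refl)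
  from sqeq_mult_cancel[OF R this] show "b = c" using inj bc by blast
 qed
 have dis: "h ` B Int (%b x. R x * h b x) ` B = {}"
 proof -
  have "h b ~= (%x. R x * h c x)" if "b \<in> B" "c \<in> B" for b c
   using ne[OF that] sqeq_refl[of T' "h b"] by auto
  then show ?thesis by blast
 qed
 have fin: "finite B2 \<longleftrightarrow> finite B" unfolding B2_def
  using inj1 inj2 by (auto dest: finite_imageD)
 have card: "card B2 = 2 * card B"
 proof (cases "finite B")
  case True
  then have "card B2 = card (h ` B) + card ((%b x. R x * h b x) ` B)"
   unfolding B2_def by (intro card_Un_disjoint) (use dis in auto)
  then show ?thesis using inj1 inj2 by (simp add: card_image)
 qed (use fin in auto)
 have tr: "transv T' B2"
  unfolding transv_def
 proof (intro conjI ballI allI impI)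
  fix b assume "b \<in> B2" then show "cs T' b"
   unfolding B2_def using h R cs_mult by blast
 next
  fix F assume F: "cs T' F"
  obtain b where b: "b \<in> B2" "sqeq T' F b" using ex[OF F] unfolding B2_def by blast
  have uniq: "c = d" if cd: "c \<in> B2" "d \<in> B2" "sqeq T' c d" for c d
  proof -
   consider (a) b1 b2 where "b1 \<in> B" "b2 \<in> B" "c = h b1" "d = h b2"
    | (b) b1 b2 where "b1 \<in> B" "b2 \<in> B" "c = h b1" "d = (%x. R x * h b2 x)"
    | (c) b1 b2 where "b1 \<in> B" "b2 \<in> B" "d = h b1" "c = (%x. R x * h b2 x)"
    | (d) b1 b2 where "b1 \<in> B" "b2 \<in> B" "c = (%x. R x * h b1 x)" "d = (%x. R x * h b2 x)"
    using cd(1,2) unfolding B2_def by blast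
   then show ?thesis
   proof cases
    case a then show ?thesis using inj cd by blast
   next
    case b then show ?thesis using ne cd by blast
   next
    case c then show ?thesis using ne cd sqeq_sym by blast
   next
    case d then show ?thesis using inj cd sqeq_mult_cancel[OF R] by blast
   qed
  qed
  show "\<exists>!b. b \<in> B2 & sqeq T' F b"
   using b uniq by (metis sqeq_sym sqeq_trans)
 qed
 have "(finite B2 \<longleftrightarrow> finite B') & card B2 = card B'"
  using transv_bij[OF tr B', of "%b. b"] transvD[OF tr] by blast+
 then show ?thesis using fin card by auto
qed

lemma sqcard_restrict_surj:
 assumes sub: "Z \<subseteq> Z'"
  and surj: "!!F. cs (subtopology X Z) F ==> \<exists>F'. cs (subtopology X Z') F' & sqeq (subtopology X Z) F' F"
  and R: "cs (subtopology X Z') R" "sqeq (subtopology X Z) R (%x. 1)" "~ sqeq (subtopology X Z') R (%x. 1)"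
  and ker: "!!F. cs (subtopology X Z') F ==> sqeq (subtopology X Z) F (%x. 1) ==>
    sqeq (subtopology X Z') F (%x. 1) | sqeq (subtopology X Z') F R"
  and k: "sqcard (subtopology X Z) k"
 shows "sqcard (subtopology X Z') (2 * k)"
proof -
 obtain B' where B': "transv (subtopology X Z') B'" using transv_exists by blast
 obtain B where B: "transv (subtopology X Z) B" "finite B" "card B = k" using k unfolding sqcard_def by blast
 have "\<exists>F'. cs (subtopology X Z') F' & sqeq (subtopology X Z) F' b" if "b \<in> B" for b
  using surj transvD(1)[OF B(1) that] by blast
 then obtain h where h: "!!b. b \<in> B ==> cs (subtopology X Z') (h b) & sqeq (subtopology X Z) (h b) b"
  by metis
 \<comment> \<open>Functions in the same class on Z have a quotient in the kernel, whose only
   classes are those of 1 and \<open>R\<close>.\<close>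
 have q: "sqeq (subtopology X Z') F G | sqeq (subtopology X Z') F (%x. R x * G x)"
  if "cs (subtopology X Z') F" "cs (subtopology X Z') G" "sqeq (subtopology X Z) F G" for F G
 proof -
  have G: "cs (subtopology X Z) G" using that cs_sub sub by blast
  let ?D = "%x. F x * inverse (G x)"
  have "sqeq (subtopology X Z) ?D (%x. 1)" using sqeq_div_iff[OF G] that by blast
  moreover have cD: "cs (subtopology X Z') ?D" using that cs_mult cs_inverse by blast
  ultimately have "sqeq (subtopology X Z') ?D (%x. 1) | sqeq (subtopology X Z') ?D R"
   using ker by blast
  then show ?thesis
  proof
   assume "sqeq (subtopology X Z') ?D R"
   from sqeq_mult[OF this sqeq_refl[of _ G]]
   have "sqeq (subtopology X Z') (%x. ?D x * G x) (%x. R x * G x)" .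
   moreover have "sqeq (subtopology X Z') F (%x. ?D x * G x)"
    by (rule sqeq_cong) (use that(2) in \<open>auto simp: cs_def\<close>)
   ultimately show ?thesis using sqeq_trans by blast
  qed (use sqeq_div_iff[OF that(2)] in blast)
 qed
 have "(finite B \<longleftrightarrow> finite B') & card B' = 2 * card B"
 proof (rule transv_double[OF B(1) B', where h=h and R=R])
  show "\<exists>b\<in>B. sqeq (subtopology X Z') F (h b) | sqeq (subtopology X Z') F (%x. R x * h b x)"
   if F: "cs (subtopology X Z') F" for F
  proof -
   obtain b where b: "b \<in> B" "sqeq (subtopology X Z) F b"
    using transvD(2)[OF B(1) cs_sub[OF F sub]] by blast
   then have "sqeq (subtopology X Z) F (h b)" using h sqeq_trans sqeq_sym by blast
   then show ?thesis using q[OF F] h b by blast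
  qed
  have 2: "b = c" if "b \<in> B" "c \<in> B" "sqeq (subtopology X Z) (h b) (h c)" for b c
   using h that transvD(3)[OF B(1)] sqeq_trans sqeq_sym by meson
  then show "b = c" if "b \<in> B" "c \<in> B" "sqeq (subtopology X Z') (h b) (h c)" for b c
   using sqeq_sub[OF _ sub] that by blast
  show "~ sqeq (subtopology X Z') (h b) (%x. R x * h c x)" if "b \<in> B" "c \<in> B" for b c
  proof
   assume *: "sqeq (subtopology X Z') (h b) (%x. R x * h c x)"
   have "sqeq (subtopology X Z) (%x. R x * h c x) (%x. 1 * h c x)"
    by (rule sqeq_mult[OF R(2) sqeq_refl])
   then have "sqeq (subtopology X Z) (h b) (h c)" using sqeq_trans[OF sqeq_sub[OF * sub]] by simp
   then have "b = c" using 2 that by blast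
   have hb: "cs (subtopology X Z') (h b)" using h that by blast
   have "sqeq (subtopology X Z') (%x. h b x * 1) (%x. h b x * R x)"
    using * \<open>b = c\<close> by (simp add: mult.commute)
   then have "sqeq (subtopology X Z') (%x. 1) R" by (rule sqeq_mult_cancel[OF hb])
   then show False using R sqeq_sym by blast
  qed
 qed (use h R in auto)
 then show ?thesis using B unfolding sqcard_iff[OF B'] by auto
qed

lemma sqcard_restrict_inj:
 assumes sub: "Z \<subseteq> Z'"
  and inj: "!!F. cs (subtopology X Z') F ==> sqeq (subtopology X Z) F (%x. 1) ==> sqeq (subtopology X Z') F (%x. 1)"
  and R: "cs (subtopology X Z) R"
  and ex: "!!F. cs (subtopology X Z) F ==> \<exists>G. cs (subtopology X Z') G &
    (sqeq (subtopology X Z) F G | sqeq (subtopology X Z) F (%x. R x * G x))"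
  and ne: "!!G. cs (subtopology X Z') G ==> ~ sqeq (subtopology X Z) R G"
 shows "sqcard (subtopology X Z) k \<longleftrightarrow> (\<exists>l. sqcard (subtopology X Z') l & k = 2 * l)"
proof -
 obtain B' where B': "transv (subtopology X Z') B'" using transv_exists by blast
 obtain B where B: "transv (subtopology X Z) B" using transv_exists by blast
 have inj': "sqeq (subtopology X Z') F G"
  if "cs (subtopology X Z') F" "cs (subtopology X Z') G" "sqeq (subtopology X Z) F G" for F G
 proof -
  have "sqeq (subtopology X Z) (%x. F x * inverse (G x)) (%x. 1)"
   using sqeq_div_iff[OF cs_sub[OF that(2) sub]] that by blast
  then have "sqeq (subtopology X Z') (%x. F x * inverse (G x)) (%x. 1)"
   using inj cs_mult cs_inverse that by blast
  then show ?thesis using sqeq_div_iff[OF that(2)] by blast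
 qed
 have "(finite B' \<longleftrightarrow> finite B) & card B = 2 * card B'"
 proof (rule transv_double[OF B' B, where h="%b. b" and R=R])
  show "cs (subtopology X Z) b" if "b \<in> B'" for b
   using transvD(1)[OF B' that] cs_sub sub by blast
  show "\<exists>b\<in>B'. sqeq (subtopology X Z) F b | sqeq (subtopology X Z) F (%x. R x * b x)"
   if F: "cs (subtopology X Z) F" for F
  proof -
   obtain G where G: "cs (subtopology X Z') G"
    "sqeq (subtopology X Z) F G | sqeq (subtopology X Z) F (%x. R x * G x)" using ex F by blast
   obtain b where b: "b \<in> B'" "sqeq (subtopology X Z') G b" using transvD(2)[OF B' G(1)] by blast
   have "sqeq (subtopology X Z) G b" using b sqeq_sub sub by blast
   moreover from sqeq_mult[OF sqeq_refl this]
   have "sqeq (subtopology X Z) (%x. R x * G x) (%x. R x * b x)" .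
   ultimately show ?thesis using G b sqeq_trans by blast
  qed
  show "b = c" if "b \<in> B'" "c \<in> B'" "sqeq (subtopology X Z) b c" for b c
   using inj' that transvD[OF B'] by blast
  show "~ sqeq (subtopology X Z) b (%x. R x * c x)" if "b \<in> B'" "c \<in> B'" for b c
  proof
   assume *: "sqeq (subtopology X Z) b (%x. R x * c x)"
   have c: "cs (subtopology X Z') b" "cs (subtopology X Z') c" using that transvD(1)[OF B'] by auto
   from sqeq_mult[OF * sqeq_refl]
   have "sqeq (subtopology X Z) (%x. b x * inverse (c x)) (%x. R x * c x * inverse (c x))" .
   also have "sqeq (subtopology X Z) (%x. R x * c x * inverse (c x)) R"
    by (rule sqeq_cong) (use cs_sub[OF c(2) sub] in \<open>auto simp: cs_def\<close>)
   finally have "sqeq (subtopology X Z) R (%x. b x * inverse (c x))" by (rule sqeq_sym)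
   then show False using ne cs_mult cs_inverse c by blast
  qed
 qed (use R in auto)
 then show ?thesis unfolding sqcard_iff[OF B] sqcard_iff[OF B'] by auto
qed


section \<open>Pasting functions; embeddings of compact sets\<close>

lemma paste2:
 assumes "closedin T A" "closedin T B" "A Un B = topspace T"
  "continuous_map (subtopology T A) Y f" "continuous_map (subtopology T B) Y g"
  "!!x. x \<in> A ==> x \<in> B ==> f x = g x"
 shows "continuous_map T Y (%x. if x \<in> A then f x else g x)"
proof (rule pasting_lemma_closed[where I="{True,False}" and T="%b. if b then A else B" and f="%b. if b then f else g"])
 fix x assume "x \<in> topspace T"
 then have "x \<in> A | x \<in> B" using assms(3) by blast
 then show "\<exists>j. j \<in> {True, False} & x \<in> (if j then A else B) & (if x \<in> A then f x else g x) = (if j then f else g) x"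
  by (cases "x \<in> A") auto
qed (use assms in \<open>auto split: if_splits\<close>)

lemma cs_paste2:
 assumes AB: "A \<subseteq> topspace X" "B \<subseteq> topspace X" "closedin (subtopology X (A Un B)) A" "closedin (subtopology X (A Un B)) B"
  and f: "cs (subtopology X A) f" and g: "cs (subtopology X B) g"
  and eq: "!!x. x \<in> A ==> x \<in> B ==> f x = g x"
 shows "cs (subtopology X (A Un B)) (%x. if x \<in> A then f x else g x)"
 unfolding cs_def
proof
 show "continuous_map (subtopology X (A Un B)) euclidean (%x. if x \<in> A then f x else g x)"
 proof (rule paste2[OF AB(3,4)])
  show "continuous_map (subtopology (subtopology X (A Un B)) A) euclidean f"
   "continuous_map (subtopology (subtopology X (A Un B)) B) euclidean g"
   using f g unfolding cs_def by (simp_all add: subtopology_subtopology Int_absorb1)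
 qed (use AB eq in auto)
 show "\<forall>x\<in>topspace (subtopology X (A Un B)). (if x \<in> A then f x else g x) ~= 0"
  using f g AB unfolding cs_def by auto
qed

text \<open>Compactness against the Hausdorff property makes the inverse continuous. This is why
  arcs and cells can be described by continuity and injectivity alone.\<close>

lemma compact_inj_embedding:
 assumes X: "Hausdorff_space X" and D: "compact D" and kp: "continuous_map (top_of_set D) X kp" "inj_on kp D"
 shows "homeomorphic_maps (top_of_set D) (subtopology X (kp ` D)) kp (inv_into D kp)"
  "closedin X (kp ` D)"
proof -
 have sub: "kp ` D \<subseteq> topspace X" using kp(1) by (auto simp: continuous_map_def)
 have "homeomorphic_map (top_of_set D) (subtopology X (kp ` D)) kp"
 proof (rule continuous_imp_homeomorphic_map)
  show "compact_space (top_of_set D)" using D by (simp add: compact_space_subtopology)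
  show "Hausdorff_space (subtopology X (kp ` D))" using X by (rule Hausdorff_space_subtopology)
 qed (use kp sub in \<open>auto simp: continuous_map_in_subtopology\<close>)
 then show "homeomorphic_maps (top_of_set D) (subtopology X (kp ` D)) kp (inv_into D kp)"
  using homeomorphic_map_maps[of "top_of_set D" "subtopology X (kp ` D)" kp]
 proof -
  obtain g where g: "homeomorphic_maps (top_of_set D) (subtopology X (kp ` D)) kp g"
   using \<open>homeomorphic_map (top_of_set D) (subtopology X (kp ` D)) kp\<close> homeomorphic_map_maps by blast
  show ?thesis
  proof (rule homeomorphic_maps_eq[OF g])
   fix y assume "y \<in> topspace (subtopology X (kp ` D))"
   then obtain d where d: "d \<in> D" "y = kp d" by auto
   then show "g y = inv_into D kp y" using g kp(2) unfolding homeomorphic_maps_def by auto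
  qed auto
 qed
 have "compactin X (kp ` D)"
  by (rule image_compactin[OF _ kp(1)]) (simp add: D compactin_subtopology)
 then show "closedin X (kp ` D)" by (rule compactin_imp_closedin[OF X])
qed

lemma continuous_map_on_image_iff:
 assumes X: "Hausdorff_space X" and D: "compact D" and kp: "continuous_map (top_of_set D) X kp" "inj_on kp D"
  and D': "D' \<subseteq> D"
 shows "continuous_map (subtopology X (kp ` D')) Y g \<longleftrightarrow> continuous_map (top_of_set D') Y (g \<circ> kp)"
proof -
 have sub: "kp ` D \<subseteq> topspace X" using kp(1) by (auto simp: continuous_map_def)
 have hm: "continuous_map (top_of_set D) X kp" "continuous_map (subtopology X (kp ` D)) (top_of_set D) (inv_into D kp)"
  using compact_inj_embedding(1)[OF X D kp] kp unfolding homeomorphic_maps_def by auto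
 have 1: "continuous_map (top_of_set D') (subtopology X (kp ` D')) kp"
  unfolding continuous_map_in_subtopology
  using continuous_map_from_subtopology_mono[OF hm(1) D'] by simp
 have "continuous_map (subtopology X (kp ` D')) (top_of_set D) (inv_into D kp)"
  by (rule continuous_map_from_subtopology_mono[OF hm(2)]) (use D' in auto)
 then have 2: "continuous_map (subtopology X (kp ` D')) (top_of_set D') (inv_into D kp)"
  unfolding continuous_map_in_subtopology using D' kp(2) by (auto simp: inv_into_f_f subset_iff)
 show ?thesis
 proof
  assume "continuous_map (subtopology X (kp ` D')) Y g"
  then show "continuous_map (top_of_set D') Y (g \<circ> kp)" using 1 continuous_map_compose by blast
 next
  assume "continuous_map (top_of_set D') Y (g \<circ> kp)"
  from continuous_map_compose[OF 2 this]
  show "continuous_map (subtopology X (kp ` D')) Y g"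
  proof (rule continuous_map_eq)
   fix x assume "x \<in> topspace (subtopology X (kp ` D'))"
   then obtain d where "d \<in> D'" "x = kp d" by auto
   then show "(g \<circ> kp \<circ> inv_into D kp) x = g x" using D' kp(2) by (auto simp: inv_into_f_f subset_iff)
  qed
 qed
qed

lemma cs_on_image_iff:
 assumes X: "Hausdorff_space X" and D: "compact D" and kp: "continuous_map (top_of_set D) X kp" "inj_on kp D"
  and D': "D' \<subseteq> D"
 shows "cs (subtopology X (kp ` D')) g \<longleftrightarrow> continuous_on D' (g \<circ> kp) & (\<forall>d\<in>D'. g (kp d) ~= 0)"
proof -
 have "kp ` D \<subseteq> topspace X" using kp(1) by (auto simp: continuous_map_def)
 then show ?thesis
  unfolding cs_def continuous_map_on_image_iff[OF assms] using D' by auto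
qed

section \<open>Euler characteristic of a graph\<close>

text \<open>A space with c components, c finite, has 2^c clopen sets; this number is the order of
  H^0 with coefficients Z/2.\<close>

definition clp :: "'a topology => 'a set set" where
 "clp T = {U. openin T U & closedin T U}"

lemma clp_sub_iff: assumes "closedin X T"
 shows "U \<in> clp (subtopology X T) \<longleftrightarrow> U \<subseteq> T & closedin X U & closedin X (T - U)"
proof -
 have sub: "T \<subseteq> topspace X" using assms by (rule closedin_subset)
 have ts: "topspace X Int T = T" using sub by blast
 show ?thesis
  unfolding clp_def openin_closedin_eq using assms sub
  by (auto simp: closedin_closed_subtopology ts)
qed

lemma clp_Un: "U \<in> clp T ==> V \<in> clp T ==> U Un V \<in> clp T"
 and clp_Diff: "U \<in> clp T ==> V \<in> clp T ==> U - V \<in> clp T"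
 unfolding clp_def by auto

lemma clp_le: "U \<in> clp T ==> U \<subseteq> topspace T"
 unfolding clp_def by (auto dest: openin_subset)

text \<open>The exponents are the ranks of H^0 and H^1 modulo 2; a graph has no higher cohomology. A
  relation is used because the existence of the two exponents is part of what is proved.\<close>

definition euler :: "'a topology => int => bool" where
 "euler T e \<longleftrightarrow> (\<exists>c r. card (clp T) = 2 ^ c & sqcard T (2 ^ r) & e = int c - int r)"

text \<open>Graphs built on a base set \<open>B\<close>; the integer is the Euler characteristic of the part added to
 the base.\<close>

inductive graphext :: "'a topology => 'a set => 'a set => int => bool" for X B where
 base: "graphext X B B 0"
| point: "graphext X B T e ==> x \<in> topspace X ==> x ~: T ==> graphext X B (insert x T) (e + 1)"
| arc: "graphext X B T e ==> continuous_map (top_of_set {0..1::real}) X ga ==> inj_on ga {0..1} ==>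
  T Int ga ` {0..1} = {ga 0, ga 1} ==> graphext X B (T Un ga ` {0..1}) (e - 1)"

abbreviation graph :: "'a topology => 'a set => int => bool" where
 "graph X \<equiv> graphext X {}"

lemma sqeq_subE:
 assumes "sqeq (subtopology X Z) F G" "Z \<subseteq> topspace X"
 obtains A where "cs (subtopology X Z) A" "!!x. x \<in> Z ==> F x = G x * (A x)\<^sup>2"
proof -
 obtain A where A: "cs (subtopology X Z) A" "\<forall>x\<in>topspace (subtopology X Z). F x = G x * (A x)\<^sup>2"
  using assms(1) unfolding sqeq_def by blast
 have "topspace (subtopology X Z) = Z" using assms(2) by auto
 then show thesis using that A by simp
qed

text \<open>Applied to the quotient of two square roots of one function: a sign cannot jump on a
  connected set.\<close>

lemma continuous_sign_const:
 assumes "connected S" "continuous_on S C" "!!t. t \<in> S ==> (C t)\<^sup>2 = (1::complex)" "a \<in> S" "b \<in> S"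
 shows "C a = C b"
proof (rule ccontr)
 assume ne: "C a ~= C b"
 have S: "C t = 1 | C t = -1" if "t \<in> S" for t using assms(3)[OF that] by (simp add: power2_eq_1_iff)
 then have "C ` S \<subseteq> {1, -1}" by blast
 then have "finite (C ` S)" by (rule finite_subset) simp
 then obtain k where "\<forall>x\<in>S. C x = k"
  using continuous_finite_range_constant[OF assms(1,2)] unfolding constant_on_def by blast
 then have "C a = k" "C b = k" using assms(4,5) by auto
 then show False using ne by simp
qed

lemma graphext_closed:
 assumes X: "Hausdorff_space X" and g: "graphext X B T e" and B: "closedin X B"
 shows "closedin X T"
 using g
proof induction
 case (arc T e ga)
 then have "closedin X (ga ` {0..1})" by (intro compact_inj_embedding(2)[OF X]) auto
 then show ?case using arc by blast
next
 case (point T e x)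
 then show ?case using closedin_Hausdorff_singleton[OF X] closedin_Un[of X "{x}" T] by simp
qed (rule B)

lemma euler_empty: "euler (subtopology X {}) 0"
proof -
 have "clp (subtopology X {}) = {{}}" unfolding clp_def by auto
 moreover have "sqcard (subtopology X {}) 1"
  unfolding sqcard_def
 proof (intro exI conjI)
  show "transv (subtopology X {}) {%x. 1}"
   unfolding transv_def by (auto simp: cs_one intro!: sqeq_cong)
 qed auto
 ultimately show ?thesis unfolding euler_def by (intro exI[of _ 0]) auto
qed

lemma sqeq_paste2:
 assumes AB: "A \<subseteq> topspace X" "B \<subseteq> topspace X" "closedin (subtopology X (A Un B)) A" "closedin (subtopology X (A Un B)) B"
  and f: "cs (subtopology X A) f" "!!x. x \<in> A ==> F x = G x * (f x)\<^sup>2"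
  and g: "cs (subtopology X B) g" "!!x. x \<in> B ==> F x = G x * (g x)\<^sup>2"
  and eq: "!!x. x \<in> A ==> x \<in> B ==> f x = g x"
 shows "sqeq (subtopology X (A Un B)) F G"
 by (rule sqeqI[OF cs_paste2[OF AB f(1) g(1) eq]]) (use f g in auto)

text \<open>An isolated point can be put into any clopen set or left out, which doubles their
  number; every nonzero value has a square root, so the square classes stay the same.\<close>

lemma euler_point:
 assumes X: "Hausdorff_space X" and T: "closedin X T" and x: "x \<in> topspace X" "x ~: T"
  and e: "euler (subtopology X T) e"
 shows "euler (subtopology X (insert x T)) (e + 1)"
proof -
 obtain c r where cr: "card (clp (subtopology X T)) = 2 ^ c" "sqcard (subtopology X T) (2 ^ r)" "e = int c - int r"
  using e unfolding euler_def by blast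
 have Ts: "T \<subseteq> topspace X" using T by (rule closedin_subset)
 have xc: "closedin X {x}" using closedin_Hausdorff_singleton X x by metis
 have T': "closedin X (insert x T)" using closedin_Un[OF xc T] by simp
 have ins: "T Un {x} = insert x T" by auto
 have cl: "closedin (subtopology X (T Un {x})) T" "closedin (subtopology X (T Un {x})) {x}"
  using T xc by (auto intro: closedin_subset_topspace)
 have csx: "cs (subtopology X {x}) (%_. z)" if "z ~= 0" for z :: complex using that unfolding cs_def by auto
 have sq: "sqcard (subtopology X T) k \<longleftrightarrow> sqcard (subtopology X (insert x T)) k" for k
 proof (rule sqcard_restrict_bij)
  fix F assume F: "cs (subtopology X T) F"
  have "cs (subtopology X (T Un {x})) (%y. if y \<in> T then F y else 1)"
   by (rule cs_paste2[OF Ts _ cl F csx]) (use x in auto)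
  then have "cs (subtopology X (insert x T)) (%y. if y \<in> T then F y else 1)" unfolding ins .
  moreover have "sqeq (subtopology X T) (%y. if y \<in> T then F y else 1) F"
   by (rule sqeq_cong) auto
  ultimately show "\<exists>F'. cs (subtopology X (insert x T)) F' & sqeq (subtopology X T) F' F" by blast
 next
  fix F assume F: "cs (subtopology X (insert x T)) F" "sqeq (subtopology X T) F (%x. 1)"
  then obtain A where A: "cs (subtopology X T) A" "!!y. y \<in> T ==> F y = 1 * (A y)\<^sup>2"
   unfolding sqeq_def using Ts by auto
  have Fx: "F x ~= 0" using F x unfolding cs_def by auto
  have "sqeq (subtopology X (T Un {x})) F (%x. 1)"
   by (rule sqeq_paste2[OF Ts _ cl A csx[of "csqrt (F x)"]]) (use x Fx in auto)
  then show "sqeq (subtopology X (insert x T)) F (%x. 1)" unfolding ins .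
 qed auto
 have "bij_betw (%U. (U - {x}, x \<in> U)) (clp (subtopology X (insert x T))) (clp (subtopology X T) \<times> (UNIV :: bool set))"
 proof (rule bij_betw_byWitness[where f'="%(U, b). if b then insert x U else U"])
  show "\<forall>U\<in>clp (subtopology X (insert x T)). (case (U - {x}, x \<in> U) of (U, b) => if b then insert x U else U) = U"
   by auto
  show "\<forall>a'\<in>clp (subtopology X T) \<times> UNIV. ((case a' of (U, b) => if b then insert x U else U) - {x},
    x \<in> (case a' of (U, b) => if b then insert x U else U)) = a'"
   using x clp_le[of _ "subtopology X T"] by (auto split: if_splits)
  have a: "closedin X U ==> closedin X (insert x U)" for U using closedin_Un[OF xc, of U] by simp
  have b: "closedin X (U - {x})" if "closedin X U" "U \<subseteq> insert x T" for U
  proof -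
   have "U - {x} = U Int T" using that x by auto
   then show ?thesis using that T by auto
  qed
  show "(%U. (U - {x}, x \<in> U)) ` clp (subtopology X (insert x T)) \<subseteq> clp (subtopology X T) \<times> UNIV"
  proof (rule image_subsetI)
   fix U assume "U \<in> clp (subtopology X (insert x T))"
   then have U: "U \<subseteq> insert x T" "closedin X U" "closedin X (insert x T - U)"
    unfolding clp_sub_iff[OF T'] by auto
   have eq: "T - (U - {x}) = (insert x T - U) - {x}" using x by auto
   have "closedin X (T - (U - {x}))" unfolding eq using b[OF U(3)] by blast
   then have "U - {x} \<in> clp (subtopology X T)" unfolding clp_sub_iff[OF T] using b[OF U(2,1)] U(1) by auto
   then show "(U - {x}, x \<in> U) \<in> clp (subtopology X T) \<times> UNIV" by simp
  qed
  show "(%(U, b). if b then insert x U else U) ` (clp (subtopology X T) \<times> UNIV) \<subseteq> clp (subtopology X (insert x T))"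
  proof
   fix V assume "V \<in> (%(U, b). if b then insert x U else U) ` (clp (subtopology X T) \<times> UNIV)"
   then obtain U b where U: "U \<in> clp (subtopology X T)" and V: "V = (if b then insert x U else U)" by auto
   then have U: "U \<subseteq> T" "closedin X U" "closedin X (T - U)"
    unfolding clp_sub_iff[OF T] by auto
   have eq: "insert x T - insert x U = T - U" "insert x T - U = insert x (T - U)" using x U by auto
   show "V \<in> clp (subtopology X (insert x T))"
    unfolding clp_sub_iff[OF T'] V using U a[OF U(2)] a[OF U(3)] by (auto simp: eq)
  qed
 qed
 then have "card (clp (subtopology X (insert x T))) = card (clp (subtopology X T) \<times> (UNIV :: bool set))"
  by (rule bij_betw_same_card)
 also have "\<dots> = 2 ^ Suc c"
  unfolding card_cartesian_product cr(1) by simp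
 finally have c: "card (clp (subtopology X (insert x T))) = 2 ^ Suc c" .
 have "e + 1 = int (Suc c) - int r" using cr(3) by simp
 then show ?thesis
  unfolding euler_def using c cr(2)[unfolded sq] by blast
qed

text \<open>If no clopen set of T separates the ends, the arc closes a loop and creates the class of
  \<open>R\<close>, so r grows by one. If some clopen set does, two components merge and
  \<open>R\<close> is a square, so c drops by one. Either way c - r drops by one.\<close>

lemma euler_arc:
 assumes X: "Hausdorff_space X" and T: "closedin X T"
  and ga: "continuous_map (top_of_set {0..1::real}) X ga" "inj_on ga {0..1}"
  and int: "T Int ga ` {0..1} = {ga 0, ga 1}"
  and e: "euler (subtopology X T) e"
 shows "euler (subtopology X (T Un ga ` {0..1})) (e - 1)"
proof -
 let ?I = "{0..1::real}" let ?A = "ga ` {0..1}" let ?Z = "T Un ga ` {0..1}"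
 obtain c r where cr: "card (clp (subtopology X T)) = 2 ^ c" "sqcard (subtopology X T) (2 ^ r)" "e = int c - int r"
  using e unfolding euler_def by blast
 have Ts: "T \<subseteq> topspace X" using T by (rule closedin_subset)
 have A: "closedin X ?A" using compact_inj_embedding(2)[OF X _ ga] by simp
 have As: "?A \<subseteq> topspace X" using A by (rule closedin_subset)
 have Z: "closedin X ?Z" using A T by blast
 have cl: "closedin (subtopology X ?Z) T" "closedin (subtopology X ?Z) ?A"
  using T A by (auto intro: closedin_subset_topspace)
 have csA: "cs (subtopology X ?A) g \<longleftrightarrow> continuous_on ?I (g \<circ> ga) & (\<forall>d\<in>?I. g (ga d) ~= 0)" for g
  by (rule cs_on_image_iff[OF X _ ga]) auto
 define \<iota> where "\<iota> = inv_into ?I ga"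
 have \<iota>: "\<iota> (ga t) = t" if "t \<in> ?I" for t using that ga(2) unfolding \<iota>_def by simp
 have csI: "cs (subtopology X ?A) (%x. h (\<iota> x))" if "continuous_on ?I h" "!!t. t \<in> ?I ==> h t ~= 0" for h
  unfolding csA using that \<iota> by (auto intro: continuous_on_eq)
 have endT: "ga t \<in> T \<longleftrightarrow> t = 0 | t = 1" if "t \<in> ?I" for t
 proof -
  have "ga t \<in> T \<longleftrightarrow> ga t \<in> {ga 0, ga 1}" using that int by blast
  then show ?thesis using that ga(2) by (auto simp: inj_on_def)
 qed
 have surj: "\<exists>F'. cs (subtopology X ?Z) F' & sqeq (subtopology X T) F' F" if F: "cs (subtopology X T) F" for F
 proof -
  have F0: "F (ga 0) ~= 0" "F (ga 1) ~= 0"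
  proof -
   have "ga 0 \<in> topspace (subtopology X T)" "ga 1 \<in> topspace (subtopology X T)" using endT[of 0] endT[of 1] Ts by auto
   then show "F (ga 0) ~= 0" "F (ga 1) ~= 0" using F unfolding cs_def by blast+
  qed
  \<comment> \<open>Linear interpolation of logarithms joins the two prescribed nonzero end
    values.\<close>
  define L where "L t = exp ((1 - complex_of_real t) * Ln (F (ga 0)) + of_real t * Ln (F (ga 1)))" for t
  have L: "cs (subtopology X ?A) (%x. L (\<iota> x))"
   by (rule csI) (auto simp: L_def intro!: continuous_intros)
  have eq: "F x = L (\<iota> x)" if "x \<in> T" "x \<in> ?A" for x
  proof -
   from that obtain t where t: "t \<in> ?I" "x = ga t" by auto
   then have "t = 0 | t = 1" using endT that by simp
   then show ?thesis using t \<iota> F0 by (auto simp: L_def)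
  qed
  have "cs (subtopology X ?Z) (%x. if x \<in> T then F x else L (\<iota> x))"
   by (rule cs_paste2[OF Ts As cl F L eq])
  moreover have "sqeq (subtopology X T) (%x. if x \<in> T then F x else L (\<iota> x)) F"
   by (rule sqeq_cong) auto
  ultimately show ?thesis by blast
 qed
 \<comment> \<open>Constant on T, this function winds once around 0 along the arc; it generates the
   kernel of the restriction to T.\<close>
 define R where "R x = (if x \<in> T then 1 else exp (2 * of_real pi * \<i> * of_real (\<iota> x)))" for x
 have cT1: "cs (subtopology X T) (%x. 1)" by (rule cs_one)
 have R: "cs (subtopology X ?Z) R"
  unfolding R_def
 proof (rule cs_paste2[OF Ts As cl cT1])
  show "cs (subtopology X ?A) (%x. exp (2 * of_real pi * \<i> * of_real (\<iota> x)))"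
   by (rule csI) (auto intro!: continuous_intros)
  show "1 = exp (2 * of_real pi * \<i> * of_real (\<iota> x))" if "x \<in> T" "x \<in> ?A" for x
   using that endT \<iota> by (auto simp: image_iff)
 qed
 have RT: "sqeq (subtopology X T) R (%x. 1)" by (rule sqeq_cong) (auto simp: R_def)
 have RA: "R x = exp (2 * of_real pi * \<i> * of_real (\<iota> x))" if "x \<in> ?A" for x
  using that endT \<iota> by (auto simp: R_def)
 have ker: "sqeq (subtopology X ?Z) F (%x. 1) | sqeq (subtopology X ?Z) F R"
  if F: "cs (subtopology X ?Z) F" "sqeq (subtopology X T) F (%x. 1)" for F
 proof -
  obtain S where S: "cs (subtopology X T) S" "!!y. y \<in> T ==> F y = 1 * (S y)\<^sup>2"
   using F unfolding sqeq_def using Ts by auto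
  have FA: "continuous_on ?I (F \<circ> ga)" "!!t. t \<in> ?I ==> (F \<circ> ga) t ~= 0"
   using cs_sub[OF F(1), of ?A] unfolding csA by auto
  obtain h where h: "continuous_on ?I h" "!!t. t \<in> ?I ==> (F \<circ> ga) t = exp (h t)"
   using continuous_logarithm_on_contractible[OF FA(1) convex_imp_contractible FA(2)] by auto
  have sg: "S (ga t) = exp (h t / 2) | S (ga t) = - exp (h t / 2)" if "t = 0 | t = 1" for t
  proof -
   have "(S (ga t))\<^sup>2 = (exp (h t / 2))\<^sup>2"
    using S(2)[of "ga t"] h(2)[of t] that endT[of t] by (auto simp: exp_double[symmetric])
   then show ?thesis by (simp add: power2_eq_iff)
  qed
  \<comment> \<open>On the arc F has the root exp(h/2). The sign s adjusts it to the root S at the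
    start. At the far end the two either agree, and F is a square, or are opposite, and F is
    \<open>R\<close> times a square.\<close>
  define s where "s = S (ga 0) / exp (h 0 / 2)"
  have s: "s = 1 | s = -1" using sg[of 0] unfolding s_def by auto
  have S0: "S (ga 0) = s * exp (h 0 / 2)" unfolding s_def by simp
  have s2: "s\<^sup>2 = 1" using s by auto
  show ?thesis
  proof (cases "S (ga 1) = s * exp (h 1 / 2)")
   case True
   have "sqeq (subtopology X ?Z) F (%x. 1)"
   proof (rule sqeq_paste2[OF Ts As cl S])
    show "cs (subtopology X ?A) (%x. s * exp (h (\<iota> x) / 2))"
     by (rule csI) (use s in \<open>auto intro!: continuous_intros h\<close>)
    show "F x = 1 * (s * exp (h (\<iota> x) / 2))\<^sup>2" if "x \<in> ?A" for x
     using that \<iota> h(2) s2 by (auto simp: exp_double[symmetric] power_mult_distrib)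
    show "S x = s * exp (h (\<iota> x) / 2)" if "x \<in> T" "x \<in> ?A" for x
     using that endT \<iota> S0 True by auto
   qed
   then show ?thesis by blast
  next
   case False
   then have S1: "S (ga 1) = - s * exp (h 1 / 2)" using sg[of 1] s by auto
   have "sqeq (subtopology X ?Z) F R"
   proof (rule sqeq_paste2[OF Ts As cl S(1)])
    show "F x = R x * (S x)\<^sup>2" if "x \<in> T" for x using that S(2) by (simp add: R_def)
    \<comment> \<open>The factor exp(-pi i t), a root of 1/\<open>R\<close>, turns the sign around
      between the ends.\<close>
    show "cs (subtopology X ?A) (%x. s * exp (h (\<iota> x) / 2 - of_real pi * \<i> * of_real (\<iota> x)))"
     by (rule csI) (use s in \<open>auto intro!: continuous_intros h\<close>)
    show "F x = R x * (s * exp (h (\<iota> x) / 2 - of_real pi * \<i> * of_real (\<iota> x)))\<^sup>2" if "x \<in> ?A" for x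
    proof -
     from that obtain t where t: "t \<in> ?I" "x = ga t" by auto
     have "R x * (s * exp (h t / 2 - of_real pi * \<i> * of_real t))\<^sup>2
       = exp (2 * of_real pi * \<i> * of_real t) * exp (2 * (h t / 2 - of_real pi * \<i> * of_real t))"
      using RA[OF that] t \<iota> s2 by (simp add: power_mult_distrib exp_double[symmetric])
     also have "\<dots> = exp (h t)" by (simp add: exp_add[symmetric] algebra_simps)
     finally show ?thesis using t h(2) \<iota> by simp
    qed
    show "S x = s * exp (h (\<iota> x) / 2 - of_real pi * \<i> * of_real (\<iota> x))" if "x \<in> T" "x \<in> ?A" for x
    proof -
     from that obtain t where t: "t \<in> ?I" "x = ga t" by auto
     then have "t = 0 | t = 1" using endT that by simp
     then show ?thesis using t \<iota> S0 S1 by (auto simp: exp_diff)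
    qed
   qed
   then show ?thesis by blast
  qed
 qed
 have conA: "U Int ?A = {} | ?A \<subseteq> U" if U: "U \<in> clp (subtopology X ?Z)" for U
 proof -
  have "connectedin X ?A" by (rule connectedin_continuous_map_image[OF ga(1)]) (simp add: connectedin_subtopology)
  moreover have "closedin X U" "closedin X (?Z - U)" "U \<subseteq> ?Z" using U unfolding clp_sub_iff[OF Z] by auto
  ultimately have "~ (closedin X U & closedin X (?Z - U) & ?A \<subseteq> U Un (?Z - U) & U Int (?Z - U) Int ?A = {} & U Int ?A ~= {} & (?Z - U) Int ?A ~= {})"
   unfolding connectedin_closedin by blast
  then show ?thesis using \<open>closedin X U\<close> \<open>closedin X (?Z - U)\<close> by auto
 qed
 \<comment> \<open>The arc is connected, so the clopen sets of the enlarged graph correspond to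
   those of T that contain both of its ends or neither.\<close>
 have clpZ: "bij_betw (%U. U Int T) (clp (subtopology X ?Z)) {U \<in> clp (subtopology X T). ga 0 \<in> U \<longleftrightarrow> ga 1 \<in> U}"
 proof (rule bij_betw_byWitness[where f'="%U. if ga 0 \<in> U then U Un ?A else U"])
  show "\<forall>U\<in>clp (subtopology X ?Z). (if ga 0 \<in> U Int T then U Int T Un ?A else U Int T) = U"
  proof
   fix U assume U: "U \<in> clp (subtopology X ?Z)"
   then have "U \<subseteq> ?Z" unfolding clp_sub_iff[OF Z] by auto
   moreover have "ga 0 \<in> T" "?A \<subseteq> U ==> ga 0 \<in> U" "U Int ?A = {} ==> ga 0 ~: U" using endT by auto
   ultimately show "(if ga 0 \<in> U Int T then U Int T Un ?A else U Int T) = U" using conA[OF U] by auto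
  qed
  show "\<forall>U\<in>{U \<in> clp (subtopology X T). ga 0 \<in> U \<longleftrightarrow> ga 1 \<in> U}. (if ga 0 \<in> U then U Un ?A else U) Int T = U"
   unfolding clp_sub_iff[OF T] using endT by auto
  show "(%U. U Int T) ` clp (subtopology X ?Z) \<subseteq> {U \<in> clp (subtopology X T). ga 0 \<in> U \<longleftrightarrow> ga 1 \<in> U}"
  proof (rule image_subsetI)
   fix U assume U: "U \<in> clp (subtopology X ?Z)"
   then have U': "closedin X U" "closedin X (?Z - U)" "U \<subseteq> ?Z" unfolding clp_sub_iff[OF Z] by auto
   have eq: "T - U Int T = (?Z - U) Int T" by auto
   have "U Int T \<in> clp (subtopology X T)"
    unfolding clp_sub_iff[OF T] eq using U' T by auto
   moreover have "ga 0 \<in> T" "?A \<subseteq> U ==> ga 0 \<in> U" "U Int ?A = {} ==> ga 0 ~: U"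
    "ga 1 \<in> T" "?A \<subseteq> U ==> ga 1 \<in> U" "U Int ?A = {} ==> ga 1 ~: U" using endT by auto
   ultimately show "U Int T \<in> {U \<in> clp (subtopology X T). ga 0 \<in> U \<longleftrightarrow> ga 1 \<in> U}" using conA[OF U] by auto
  qed
  show "(%U. if ga 0 \<in> U then U Un ?A else U) ` {U \<in> clp (subtopology X T). ga 0 \<in> U \<longleftrightarrow> ga 1 \<in> U} \<subseteq> clp (subtopology X ?Z)"
  proof (rule image_subsetI)
   fix U assume "U \<in> {U \<in> clp (subtopology X T). ga 0 \<in> U \<longleftrightarrow> ga 1 \<in> U}"
   then have U: "U \<in> clp (subtopology X T)" and io: "ga 0 \<in> U \<longleftrightarrow> ga 1 \<in> U" by auto
   have U': "closedin X U" "closedin X (T - U)" "U \<subseteq> T" using U unfolding clp_sub_iff[OF T] by auto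
   show "(if ga 0 \<in> U then U Un ?A else U) \<in> clp (subtopology X ?Z)"
   proof (cases "ga 0 \<in> U")
    case True
    then have "?Z - (U Un ?A) = T - U" using endT io True by auto
    then show ?thesis unfolding clp_sub_iff[OF Z] using True U' A by auto
   next
    case False
    then have "?Z - U = (T - U) Un ?A" using endT io U' False by auto
    then show ?thesis unfolding clp_sub_iff[OF Z] using False U' A by auto
   qed
  qed
 qed
 show ?thesis
 proof (cases "\<exists>W\<in>clp (subtopology X T). ga 0 \<in> W & ga 1 ~: W")
  case False
  have "T - W \<in> clp (subtopology X T)" if "W \<in> clp (subtopology X T)" for W
   using that T unfolding clp_sub_iff[OF T] by (auto simp: double_diff)
  then have io: "ga 0 \<in> W \<longleftrightarrow> ga 1 \<in> W" if "W \<in> clp (subtopology X T)" for W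
   using False that endT[of 0] endT[of 1] by (metis DiffD2 DiffI atLeastAtMost_iff order_refl zero_le_one)
  then have "{U \<in> clp (subtopology X T). ga 0 \<in> U \<longleftrightarrow> ga 1 \<in> U} = clp (subtopology X T)" by blast
  then have c: "card (clp (subtopology X ?Z)) = 2 ^ c" using clpZ cr(1) by (simp add: bij_betw_same_card)
  have nR: "~ sqeq (subtopology X ?Z) R (%x. 1)"
  proof
   assume "sqeq (subtopology X ?Z) R (%x. 1)"
   then obtain C where C: "cs (subtopology X ?Z) C" "!!x. x \<in> ?Z ==> R x = 1 * (C x)\<^sup>2"
    by (rule sqeq_subE) (use Ts As in auto)
   define W where "W = {x \<in> T. C x = 1}"
   have CT: "C x = 1 | C x = -1" if "x \<in> T" for x
    using C(2)[of x] that by (auto simp: R_def power2_eq_1_iff)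
   have cm: "continuous_map (subtopology X T) euclidean C"
    using cs_sub[OF C(1), of T] unfolding cs_def by auto
   have "closedin (subtopology X T) {x \<in> topspace (subtopology X T). C x \<in> {v}}" for v
    by (rule closedin_continuous_map_preimage[OF cm]) simp
   then have clv: "closedin (subtopology X T) {x \<in> T. C x = v}" for v using Ts by (simp add: Int_absorb1)
   have "T - W = {x \<in> T. C x = -1}" unfolding W_def using CT by fastforce
   then have W: "W \<in> clp (subtopology X T)"
    unfolding clp_sub_iff[OF T] using clv[of 1] clv[of "-1"] closedin_trans_full[OF _ T] W_def
    by auto
   \<comment> \<open>If \<open>R\<close> is the square of C, this product has square 1 and is
     constant along the arc. As the exponential changes sign, C has opposite values at the ends, and
     C = 1 cuts out a clopen set that separates them.\<close>
   let ?D = "%t. C (ga t) * exp (- of_real pi * \<i> * of_real t)"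
   have "?D 0 = ?D 1"
   proof (rule continuous_sign_const[of "{0..1::real}"])
    have "continuous_on ?I (C \<circ> ga)" using cs_sub[OF C(1), of ?A] unfolding csA by auto
    then show "continuous_on ?I ?D" by (auto intro!: continuous_intros simp: o_def)
    show "(?D t)\<^sup>2 = 1" if "t \<in> ?I" for t
    proof -
     have "(?D t)\<^sup>2 = R (ga t) * exp (2 * (- of_real pi * \<i> * of_real t))"
      using C(2)[of "ga t"] that by (simp add: power_mult_distrib exp_double[symmetric])
     also have "\<dots> = 1" using RA[of "ga t"] that \<iota> by (simp add: exp_add[symmetric])
     finally show ?thesis .
    qed
   qed auto
   then have "C (ga 1) = - C (ga 0)" by (simp add: exp_minus)
   then have "ga 0 \<in> W \<longleftrightarrow> ga 1 ~: W" using CT[of "ga 0"] CT[of "ga 1"] endT[of 0] endT[of 1]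
    unfolding W_def by auto
   then show False using io[OF W] by blast
  qed
  have "sqcard (subtopology X ?Z) (2 * 2 ^ r)"
   by (rule sqcard_restrict_surj[OF _ surj R RT nR ker cr(2)]) auto
  then have "sqcard (subtopology X ?Z) (2 ^ Suc r)" by simp
  moreover have "e - 1 = int c - int (Suc r)" using cr(3) by simp
  ultimately show ?thesis unfolding euler_def using c by blast
 next
  case True
  then obtain W where W: "W \<in> clp (subtopology X T)" "ga 0 \<in> W" "ga 1 ~: W" by blast
  have W': "closedin X W" "closedin X (T - W)" "W \<subseteq> T" using W(1) unfolding clp_sub_iff[OF T] by auto
  have "sqeq (subtopology X ?Z) R (%x. 1)"
  proof (rule sqeq_paste2[OF Ts As cl])
   have eq: "W Un (T - W) = T" using W' by auto
   \<comment> \<open>The sign that is 1 on W and -1 on the rest matches exp(pi i t) at both ends,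
     which gives a root of \<open>R\<close>.\<close>
   have "cs (subtopology X (W Un (T - W))) (%x. if x \<in> W then 1 else -1)"
    by (rule cs_paste2) (use W' Ts eq in \<open>auto simp: cs_def intro: closedin_subset_topspace\<close>)
   then show "cs (subtopology X T) (%x. if x \<in> W then 1 else -1)" unfolding eq .
   show "cs (subtopology X ?A) (%x. exp (of_real pi * \<i> * of_real (\<iota> x)))"
    by (rule csI) (auto intro!: continuous_intros)
   show "R x = 1 * (exp (of_real pi * \<i> * of_real (\<iota> x)))\<^sup>2" if "x \<in> ?A" for x
    using RA[OF that] by (simp add: exp_double[symmetric] mult.assoc)
   show "(if x \<in> W then 1 else -1) = exp (of_real pi * \<i> * of_real (\<iota> x))" if "x \<in> T" "x \<in> ?A" for x
   proof -
    from that obtain t where t: "t \<in> ?I" "x = ga t" by auto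
    then have "t = 0 | t = 1" using endT that by simp
    then show ?thesis using t \<iota> W by auto
   qed
  qed (auto simp: R_def)
  then have "sqeq (subtopology X ?Z) F (%x. 1)"
   if F: "cs (subtopology X ?Z) F" "sqeq (subtopology X T) F (%x. 1)" for F
   using ker[OF F] sqeq_trans by blast
  then have sq: "sqcard (subtopology X ?Z) (2 ^ r)"
   using sqcard_restrict_bij[of T ?Z X] surj cr(2) by blast
  let ?C = "clp (subtopology X T)"
  let ?P = "{U \<in> ?C. ga 0 \<in> U \<longleftrightarrow> ga 1 \<in> U}" let ?N = "{U \<in> ?C. ~ (ga 0 \<in> U \<longleftrightarrow> ga 1 \<in> U)}"
  \<comment> \<open>Symmetric difference with W exchanges the clopen sets that extend over the arc
    with those that do not, so exactly half of them extend.\<close>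
  have bij: "bij_betw (%U. (U - W) Un (W - U)) ?P ?N"
   by (rule bij_betw_byWitness[where f'="%U. (U - W) Un (W - U)"]) (use W in \<open>auto intro!: clp_Un clp_Diff\<close>)
  have fin: "finite ?C" using cr(1) by (metis card.infinite power_not_zero zero_neq_numeral)
  have "card ?C = card ?P + card ?N"
   by (subst card_Un_disjoint[symmetric]) (use fin in \<open>auto intro: arg_cong[of _ _ card]\<close>)
  then have *: "2 ^ c = 2 * card (clp (subtopology X ?Z))"
   using bij_betw_same_card[OF bij] bij_betw_same_card[OF clpZ] cr(1) by simp
  then obtain c' where c': "c = Suc c'" by (cases c) auto
  then have "card (clp (subtopology X ?Z)) = 2 ^ c'" using * by simp
  moreover have "e - 1 = int c' - int r" using cr(3) c' by simp
  ultimately show ?thesis unfolding euler_def using sq by blast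
 qed
qed

lemma graph_euler:
 assumes X: "Hausdorff_space X" and g: "graph X T e"
 shows "euler (subtopology X T) e"
 using g
proof induction
 case base
 then show ?case by (rule euler_empty)
next
 case (point T e x)
 then show ?case using euler_point[OF X graphext_closed[OF X point(1)]] by simp
next
 case (arc T e ga)
 then show ?case using euler_arc[OF X graphext_closed[OF X arc(1)]] by simp
qed

section \<open>Punctured discs\<close>

text \<open>On a circle around 0 the k-th power winds k times, while an exponential has winding
  number zero.\<close>

lemma punctured_disc_exp_trivial:
 fixes h :: "complex => complex"
 assumes "r > 0" "continuous_on (ball 0 r - {0}) h"
  "!!w. w \<in> ball 0 r - {0} ==> w powi k = exp (h w)"
 shows "k = 0"
proof -
 define rh where "rh = r / 2"
 have rh: "rh > 0" "rh < r" using assms unfolding rh_def by auto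
 let ?w = "%t. complex_of_real rh * exp (\<i> * of_real t)"
 have w: "?w t \<in> ball 0 r - {0}" for t using rh by (simp add: norm_mult)
 \<comment> \<open>The difference of two logarithms of one function along the circle is a multiple
   of 2 pi i, hence constant; comparing the parameters 0 and 2 pi leaves k = 0.\<close>
 define ph where "ph t = h (?w t) - (of_real (ln rh) + \<i> * of_real t) * of_int k" for t
 have cph: "continuous_on UNIV ph"
  unfolding ph_def
  by (intro continuous_intros continuous_on_compose2[OF assms(2)]) (use w in auto)
 have ww: "?w t = exp (of_real (ln rh) + \<i> * of_real t)" for t
 proof -
  have "complex_of_real rh = exp (of_real (ln rh))" using rh by (metis exp_ln exp_of_real)
  then show ?thesis by (simp add: exp_add)
 qed
 have "exp (ph t) = 1" for t
 proof -
  have "exp (h (?w t)) = ?w t powi k" using assms(3) w by metis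
  also have "\<dots> = exp ((of_real (ln rh) + \<i> * of_real t) * of_int k)"
   unfolding ww by (simp add: exp_power_int mult.commute)
  finally show ?thesis unfolding ph_def exp_diff by simp
 qed
 then have Z: "\<exists>n. ph t = of_int (2 * n) * of_real pi * \<i>" for t
  using exp_eq[of "ph t" 0 for t] by simp
 have "ph constant_on UNIV"
 proof (rule continuous_discrete_range_constant[OF _ cph])
  fix x :: real
  show "\<exists>e>0. \<forall>y. y \<in> UNIV & ph y ~= ph x --> e <= norm (ph y - ph x)"
  proof (intro exI[of _ "2*pi"] conjI allI impI)
   fix y assume y: "y \<in> UNIV & ph y ~= ph x"
   obtain m n where mn: "ph y = of_int (2 * n) * of_real pi * \<i>" "ph x = of_int (2 * m) * of_real pi * \<i>" using Z by metis
   then have "n ~= m" using y by auto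
   have "ph y - ph x = of_real (2 * pi) * of_int (n - m) * \<i>" unfolding mn by (simp add: algebra_simps)
   then have "norm (ph y - ph x) = 2 * pi * \<bar>real_of_int (n - m)\<bar>" by (simp only: norm_mult norm_of_real norm_of_int norm_ii) simp
   moreover have "\<bar>real_of_int (n - m)\<bar> \<ge> 1" using \<open>n ~= m\<close> by linarith
   ultimately show "2*pi <= norm (ph y - ph x)" by simp
  qed simp
 qed simp
 then have "ph 0 = ph (2 * pi)" unfolding constant_on_def by auto
 then have "\<i> * of_real (2 * pi) * of_int k = 0"
  unfolding ph_def by (simp add: exp_two_pi_i' algebra_simps)
 then show ?thesis by simp
qed

lemma exp_periodic_int: "exp (s + of_int n * (2 * of_real pi * \<i>)) = exp (s::complex)"
 by (simp add: exp_add exp_eq exI[of _ n] algebra_simps)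

text \<open>Pulled back along exp to a half plane, f has a logarithm H. Its increment under the
  period 2 pi i is a constant 2 pi i k, and H(s) - k s descends to the punctured disc.\<close>

lemma punctured_disc_log:
 assumes r: "r > 0" and f: "continuous_on (ball 0 r - {0}) f" "!!w. w \<in> ball 0 r - {0} ==> f w ~= (0::complex)"
 obtains k h where "continuous_on (ball 0 r - {0}) h" "!!w. w \<in> ball 0 r - {0} ==> f w = w powi k * exp (h w)"
proof -
 define P where "P = {s. Re s < ln r}"
 have P: "convex P" "open P" unfolding P_def by (simp_all add: convex_halfspace_Re_lt open_halfspace_Re_lt)
 have eP: "exp s \<in> ball 0 r - {0} \<longleftrightarrow> s \<in> P" for s
 proof -
  have "exp (Re s) < r \<longleftrightarrow> Re s < ln r" using r by (metis exp_less_cancel_iff exp_ln)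
  then show ?thesis by (simp add: P_def norm_exp_eq_Re)
 qed
 have "continuous_on P (%s. f (exp s))"
  by (rule continuous_on_compose2[OF f(1)]) (use eP in \<open>auto intro!: continuous_intros\<close>)
 then obtain H where H: "continuous_on P H" "!!s. s \<in> P ==> f (exp s) = exp (H s)"
  using continuous_logarithm_on_contractible[of P "%s. f (exp s)"] convex_imp_contractible[OF P(1)] f(2) eP by metis
 let ?p = "2 * of_real pi * \<i> :: complex"
 have Pp: "s + of_int n * ?p \<in> P \<longleftrightarrow> s \<in> P" for s n by (simp add: P_def)
 have Z: "\<exists>n. H (s + ?p) - H s = of_int n * ?p" if s: "s \<in> P" for s
 proof -
  have "exp (H (s + ?p)) = exp (H s)"
   using H(2)[of s] H(2)[of "s + ?p"] s Pp[of s 1] exp_periodic_int[of s 1] by simp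
  then show ?thesis by (auto simp: exp_eq algebra_simps)
 qed
 have "(%s. H (s + ?p) - H s) constant_on P"
 proof (rule continuous_discrete_range_constant)
  show "connected P" using P convex_connected by blast
  show "continuous_on P (%s. H (s + ?p) - H s)"
   by (intro continuous_intros H(1) continuous_on_compose2[OF H(1)]) (use Pp[of _ 1] in auto)
  fix x assume x: "x \<in> P"
  show "\<exists>e>0. \<forall>y. y \<in> P & H (y + ?p) - H y ~= H (x + ?p) - H x --> e <= norm (H (y + ?p) - H y - (H (x + ?p) - H x))"
  proof (intro exI[of _ "2*pi"] conjI allI impI)
   fix y assume y: "y \<in> P & H (y + ?p) - H y ~= H (x + ?p) - H x"
   obtain m n where mn: "H (y + ?p) - H y = of_int n * ?p" "H (x + ?p) - H x = of_int m * ?p" using Z x y by metis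
   then have "n ~= m" using y by auto
   have "H (y + ?p) - H y - (H (x + ?p) - H x) = of_real (2 * pi) * of_int (n - m) * \<i>" unfolding mn by (simp add: algebra_simps)
   then have "norm (H (y + ?p) - H y - (H (x + ?p) - H x)) = 2 * pi * \<bar>real_of_int (n - m)\<bar>"
    by (simp only: norm_mult norm_of_real norm_of_int norm_ii) simp
   moreover have "\<bar>real_of_int (n - m)\<bar> \<ge> 1" using \<open>n ~= m\<close> by linarith
   ultimately show "2*pi <= norm (H (y + ?p) - H y - (H (x + ?p) - H x))" by simp
  qed simp
 qed
 then obtain c where c: "!!s. s \<in> P ==> H (s + ?p) - H s = c" unfolding constant_on_def by blast
 have "complex_of_real (ln r - 1) \<in> P" by (simp add: P_def)
 then obtain k where k: "!!s. s \<in> P ==> H (s + ?p) = H s + of_int k * ?p" using Z c by (metis add.commute diff_eq_eq)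
 define \<Phi> where "\<Phi> s = H s - of_int k * s" for s
 have \<Phi>1: "\<Phi> (s + ?p) = \<Phi> s" if "s \<in> P" for s using k[OF that] by (simp add: \<Phi>_def algebra_simps)
 have \<Phi>n: "\<Phi> (s + of_nat n * ?p) = \<Phi> s" if "s \<in> P" for s n
 proof (induction n)
  case (Suc n)
  have "s + of_nat n * ?p \<in> P" using that Pp[of s "int n"] by simp
  from \<Phi>1[OF this] show ?case using Suc by (simp add: algebra_simps)
 qed simp
 have \<Phi>: "\<Phi> s = \<Phi> t" if st: "s \<in> P" "t \<in> P" "exp s = exp t" for s t
 proof -
  obtain n :: int where n: "s = t + of_int n * ?p" using st(3) by (auto simp: exp_eq algebra_simps)
  show ?thesis
  proof (cases "n \<ge> 0")
   case True
   then show ?thesis using \<Phi>n[OF st(2), of "nat n"] n by simp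
  next
   case False
   then have "t = s + of_nat (nat (- n)) * ?p" using n by (simp add: algebra_simps)
   then show ?thesis using \<Phi>n[OF st(1), of "nat (-n)"] by simp
  qed
 qed
 have cP: "continuous_on P \<Phi>" unfolding \<Phi>_def by (intro continuous_intros H)
 \<comment> \<open>\<open>Ln\<close> jumps across the negative axis, but a periodic function does
   not see the jump. Continuity is checked on the discs slit along the negative and along the
   positive axis, the second with the branch Ln(-w) + i pi.\<close>
 define h where "h w = \<Phi> (Ln w)" for w
 have LnP: "Ln w \<in> P" if "w \<in> ball 0 r - {0}" for w
 proof -
  have "exp (Ln w) = w" using that by simp
  then show ?thesis using eP that by metis
 qed
 have h: "h (exp s) = \<Phi> s" if "s \<in> P" for s
  unfolding h_def by (rule \<Phi>) (use that LnP eP in auto)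
 have S1: "continuous_on ((ball 0 r - {0}) Int - \<real>\<^sub>\<le>\<^sub>0) h"
  unfolding h_def
 proof (rule continuous_on_compose2[OF cP])
  show "Ln ` ((ball 0 r - {0}) Int - \<real>\<^sub>\<le>\<^sub>0) \<subseteq> P" using LnP by blast
 qed (auto intro!: continuous_intros)
 have S2: "continuous_on ((ball 0 r - {0}) Int - \<real>\<^sub>\<ge>\<^sub>0) h"
 proof (rule continuous_on_eq)
  have e: "exp (Ln (- w) + \<i> * of_real pi) = w" if "w ~= 0" for w using that by (simp add: exp_add)
  have i: "Ln (- w) + \<i> * of_real pi \<in> P" if "w \<in> ball 0 r - {0}" for w
   using eP e that by (metis DiffE insertCI)
  show "continuous_on ((ball 0 r - {0}) Int - \<real>\<^sub>\<ge>\<^sub>0) (%w. \<Phi> (Ln (- w) + \<i> * of_real pi))"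
  proof (rule continuous_on_compose2[OF cP])
   show "(%w. Ln (- w) + \<i> * of_real pi) ` ((ball 0 r - {0}) Int - \<real>\<^sub>\<ge>\<^sub>0) \<subseteq> P" using i by blast
  qed (auto intro!: continuous_intros simp: complex_nonneg_Reals_iff complex_nonpos_Reals_iff)
  show "\<Phi> (Ln (- w) + \<i> * of_real pi) = h w" if "w \<in> (ball 0 r - {0}) Int - \<real>\<^sub>\<ge>\<^sub>0" for w
   using h[OF i] e that by auto
 qed
 have op: "open ((ball 0 r - {0}) Int - \<real>\<^sub>\<le>\<^sub>0 :: complex set)" "open ((ball 0 r - {0}) Int - \<real>\<^sub>\<ge>\<^sub>0 :: complex set)"
  using open_delete[OF open_ball, of 0 r 0] closed_nonpos_Reals_complex closed_nonneg_Reals_complex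
  by (auto intro!: open_Int open_Compl)
 have "continuous_on ((ball 0 r - {0}) Int - \<real>\<^sub>\<le>\<^sub>0 Un (ball 0 r - {0}) Int - \<real>\<^sub>\<ge>\<^sub>0) h"
  by (rule continuous_on_open_Un[OF op S1 S2])
 moreover have "(ball 0 r - {0}) Int - \<real>\<^sub>\<le>\<^sub>0 Un (ball 0 r - {0}) Int - \<real>\<^sub>\<ge>\<^sub>0 = ball 0 r - {0 :: complex}"
  by (auto simp: complex_nonneg_Reals_iff complex_nonpos_Reals_iff complex_eq_iff)
 ultimately have "continuous_on (ball 0 r - {0}) h" by simp
 moreover have "f w = w powi k * exp (h w)" if w: "w \<in> ball 0 r - {0}" for w
 proof -
  have s: "Ln w \<in> P" using LnP w by auto
  have "f w = exp (H (Ln w))" using H(2)[OF s] w by simp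
  also have "H (Ln w) = Ln w * of_int k + h w" unfolding h_def \<Phi>_def by simp
  also have "exp \<dots> = exp (Ln w) powi k * exp (h w)" by (simp add: exp_add exp_power_int mult.commute)
  finally show ?thesis using w by simp
 qed
 ultimately show thesis using that by blast
qed


section \<open>Parametrized discs and the filling of a puncture\<close>

lemma continuous_map_local:
 assumes "!!x. x \<in> V ==> \<exists>N. openin X N & x \<in> N & N \<subseteq> V & continuous_map (subtopology X N) Y F"
 shows "continuous_map (subtopology X V) Y F"
proof -
 obtain N where N: "!!x. x \<in> V ==> openin X (N x) & x \<in> N x & N x \<subseteq> V & continuous_map (subtopology X (N x)) Y F"
  using assms by metis
 show ?thesis
 proof (rule pasting_lemma[where I=V and T=N and f="%_. F"])
  show "openin (subtopology X V) (N i)" if "i \<in> V" for i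
   using N[OF that] by (meson subset_openin_subtopology)
  show "continuous_map (subtopology (subtopology X V) (N i)) Y F" if "i \<in> V" for i
  proof -
   have "V Int N i = N i" using N[OF that] by blast
   then show ?thesis using N[OF that] by (simp add: subtopology_subtopology)
  qed
  show "\<exists>j. j \<in> V & x \<in> N j & F x = F x" if "x \<in> topspace (subtopology X V)" for x
  proof -
   have x: "x \<in> V" using that by simp
   have "x \<in> N x" using N[OF x] by blast
   with x show ?thesis by blast
  qed
 qed auto
qed

lemma cs_local:
 assumes "!!x. x \<in> V ==> \<exists>N. openin X N & x \<in> N & N \<subseteq> V & cs (subtopology X N) F"
 shows "cs (subtopology X V) F"
 unfolding cs_def
proof
 show "continuous_map (subtopology X V) euclidean F"
 proof (rule continuous_map_local)
  fix x assume "x \<in> V"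
  from assms[OF this] show "\<exists>N. openin X N & x \<in> N & N \<subseteq> V & continuous_map (subtopology X N) euclidean F"
   unfolding cs_def by blast
 qed
 show "\<forall>x\<in>topspace (subtopology X V). F x ~= 0"
 proof
  fix x assume "x \<in> topspace (subtopology X V)"
  then have "x \<in> V" by simp
  then obtain N where N: "openin X N" "x \<in> N" "cs (subtopology X N) F" using assms by blast
  then have "x \<in> topspace (subtopology X N)" using openin_subset by fastforce
  then show "F x ~= 0" using N(3) unfolding cs_def by blast
 qed
qed

text \<open>A parametrized open disc: an open embedding of a round disc.\<close>

definition pdisc :: "'a topology => real => (complex => 'a) => bool" where
 "pdisc X r g \<longleftrightarrow> r > 0 & continuous_map (top_of_set (ball 0 r)) X g & inj_on g (ball 0 r) &
   (\<forall>W. open W --> W \<subseteq> ball 0 r --> openin X (g ` W))"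

lemma pdisc_shrink: "pdisc X r g ==> 0 < r' ==> r' <= r ==> pdisc X r' g"
 unfolding pdisc_def
 by (meson continuous_map_from_subtopology_mono inj_on_subset order_trans subset_ball)

lemma continuous_map_on_disc_iff:
 assumes g: "pdisc X r g" and W: "W \<subseteq> ball 0 r"
 shows "continuous_map (subtopology X (g ` W)) Y F \<longleftrightarrow> continuous_map (top_of_set W) Y (F \<circ> g)"
proof -
 have cg: "continuous_map (top_of_set (ball 0 r)) X g" and inj: "inj_on g (ball 0 r)"
  and op: "!!W. open W ==> W \<subseteq> ball 0 r ==> openin X (g ` W)" using g unfolding pdisc_def by auto
 let ?i = "inv_into (ball 0 r) g"
 have 1: "continuous_map (top_of_set W) (subtopology X (g ` W)) g"
  unfolding continuous_map_in_subtopology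
  using continuous_map_from_subtopology_mono[OF cg W] by simp
 have "continuous_map (subtopology X (g ` W)) euclidean ?i"
  unfolding continuous_map_def
 proof (intro conjI allI impI)
  fix U :: "complex set" assume "openin euclidean U"
  then have "open U" by simp
  have iw: "?i (g w) = w" if "w \<in> ball 0 r" for w using inj that by simp
  have ts: "topspace (subtopology X (g ` W)) = g ` W"
   using openin_subset[OF op[of "ball 0 r"]] W by auto
  have "{x \<in> g ` W. ?i x \<in> U} = g ` (U Int ball 0 r) Int g ` W"
  proof (intro equalityI subsetI)
   fix x assume "x \<in> {x \<in> g ` W. ?i x \<in> U}"
   then obtain w where w: "w \<in> W" "x = g w" "?i (g w) \<in> U" by blast
   then have "w \<in> U Int ball 0 r" using iw[of w] W by auto
   then show "x \<in> g ` (U Int ball 0 r) Int g ` W" using w by blast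
  next
   fix x assume x: "x \<in> g ` (U Int ball 0 r) Int g ` W"
   then obtain w where w: "w \<in> U" "w \<in> ball 0 r" "x = g w" by blast
   then show "x \<in> {x \<in> g ` W. ?i x \<in> U}" using x iw[of w] by auto
  qed
  moreover have "openin X (g ` (U Int ball 0 r))" using \<open>open U\<close> by (intro op) auto
  ultimately show "openin (subtopology X (g ` W)) {x \<in> topspace (subtopology X (g ` W)). ?i x \<in> U}"
   unfolding ts by (simp add: openin_subtopology_Int)
 qed simp
 then have 2: "continuous_map (subtopology X (g ` W)) (top_of_set W) ?i"
  unfolding continuous_map_in_subtopology using W inj by (auto simp: inv_into_f_f subset_iff)
 show ?thesis
 proof
  assume "continuous_map (subtopology X (g ` W)) Y F"
  then show "continuous_map (top_of_set W) Y (F \<circ> g)" using 1 continuous_map_compose by blast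
 next
  assume "continuous_map (top_of_set W) Y (F \<circ> g)"
  from continuous_map_compose[OF 2 this]
  show "continuous_map (subtopology X (g ` W)) Y F"
  proof (rule continuous_map_eq)
   fix x assume "x \<in> topspace (subtopology X (g ` W))"
   then obtain d where "d \<in> W" "x = g d" by auto
   then show "(F \<circ> g \<circ> ?i) x = F x" using W inj by (auto simp: inv_into_f_f subset_iff)
  qed
 qed
qed

lemma pdisc_image_subset: "pdisc X r g ==> W \<subseteq> ball 0 r ==> g ` W \<subseteq> topspace X"
 unfolding pdisc_def by (auto simp: continuous_map_def)

lemma cs_on_disc_iff:
 assumes g: "pdisc X r g" and W: "W \<subseteq> ball 0 r"
 shows "cs (subtopology X (g ` W)) F \<longleftrightarrow> continuous_on W (%w. F (g w)) & (\<forall>w\<in>W. F (g w) ~= 0)"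
 unfolding cs_def continuous_map_on_disc_iff[OF assms] using pdisc_image_subset[OF assms]
 by (auto simp: o_def)

lemma pdisc_closed_cball:
 assumes X: "Hausdorff_space X" and g: "pdisc X r g" and s: "s < r"
 shows "closedin X (g ` cball 0 s)"
proof -
 have "continuous_map (top_of_set (cball 0 s)) X g" "inj_on g (cball 0 s)"
  using g s unfolding pdisc_def
  by (auto intro: continuous_map_from_subtopology_mono inj_on_subset)
 then show ?thesis using compact_inj_embedding(2)[OF X compact_cball] by blast
qed

lemma continuous_on_disc_fill:
 fixes f :: "complex => complex"
 assumes "continuous_on (ball 0 r - {0}) f" "(f \<longlongrightarrow> l) (at 0)"
 shows "continuous_on (ball 0 r) (%w. if w = 0 then l else f w)"
proof (rule continuous_at_imp_continuous_on, rule ballI)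
 fix w :: complex assume w: "w \<in> ball 0 r"
 let ?f = "%w. if w = 0 then l else f w"
 show "isCont ?f w"
 proof (cases "w = 0")
  case True
  have "(?f \<longlongrightarrow> l) (at 0)"
   by (rule Lim_transform_eventually[OF assms(2)]) (simp add: eventually_at_filter)
  then show ?thesis using True by (simp add: isCont_def)
 next
  case False
  have o: "open (ball 0 r - {0 :: complex})" by auto
  have "isCont f w" using assms(1) w False unfolding continuous_on_eq_continuous_at[OF o] by auto
  moreover have "\<forall>\<^sub>F x in nhds w. f x = ?f x"
   using False by (auto simp: eventually_nhds intro!: exI[of _ "-{0}"])
  ultimately show ?thesis using isCont_cong[of f ?f w] by simp
 qed
qed

text \<open>By \<open>L\<close> the function R winds once around the puncture. A class that extends
  cannot have odd winding there. Conversely a power of R removes the winding of any function, what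
  remains is an exponential near the puncture and can be cut off to 1, and a power of R is a square
  or R times a square.\<close>

lemma punctured_filling:
 assumes X: "Hausdorff_space X" and g: "pdisc X r g" and gP: "g ` ball 0 r Int P = {}"
  and P: "closedin X P"
  and R: "cs (subtopology X (topspace X - insert (g 0) P)) R"
  and L: "((%w. R (g w) / w) \<longlongrightarrow> L) (at 0)" "L ~= 0"
 shows "sqcard (subtopology X (topspace X - insert (g 0) P)) k \<longleftrightarrow>
   (\<exists>l. sqcard (subtopology X (topspace X - P)) l & k = 2 * l)"
proof -
 define V where "V = topspace X - P"
 define V0 where "V0 = topspace X - insert (g 0) P"
 let ?B = "ball 0 r" let ?Bp = "ball 0 r - {0 :: complex}"
 have r: "r > 0" and inj: "inj_on g ?B" using g unfolding pdisc_def by auto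
 have opg: "openin X (g ` W)" if "open W" "W \<subseteq> ?B" for W using g that unfolding pdisc_def by blast
 have gs: "g ` ?B \<subseteq> topspace X" using pdisc_image_subset[OF g] by blast
 have g0: "g w = g 0 \<longleftrightarrow> w = 0" if "w \<in> ?B" for w using inj that r by (auto simp: inj_on_def)
 have sub: "V0 \<subseteq> V" unfolding V0_def V_def by blast
 have subt: "V \<subseteq> topspace X" "V0 \<subseteq> topspace X" unfolding V0_def V_def by auto
 have gV: "g ` ?B \<subseteq> V" using gs gP unfolding V_def by auto
 have gV0: "g ` ?Bp \<subseteq> V0" using gs gP g0 unfolding V0_def by fastforce
 have pcl: "closedin X {g 0}" using closedin_Hausdorff_singleton[OF X, of "g 0"] gs r by (simp add: image_subset_iff)
 have oV: "openin X V" unfolding V_def using P by (simp add: openin_diff)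
 have oV0: "openin X V0" unfolding V0_def using closedin_Un[OF pcl P] by (simp add: openin_diff)
 have conB0: "connected ?Bp" by (rule connected_open_delete) auto
 have opB0: "open ?Bp" by auto
 have csB: "cs (subtopology X V) F ==> continuous_on ?B (%w. F (g w)) & (\<forall>w\<in>?B. F (g w) ~= 0)" for F
  using cs_sub[OF _ gV, of X F] cs_on_disc_iff[OF g, of ?B F] by blast
 have csB0: "cs (subtopology X V0) F ==> continuous_on ?Bp (%w. F (g w)) & (\<forall>w\<in>?Bp. F (g w) ~= 0)" for F
  using cs_sub[OF _ gV0, of X F] cs_on_disc_iff[OF g, of ?Bp F] by blast
 \<comment> \<open>R(g w)/w extends over 0 by the value L, so it has a logarithm v on the whole
   disc, and R = w exp(v) off the centre.\<close>
 define u where "u w = (if w = 0 then L else R (g w) / w)" for w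
 have R0: "cs (subtopology X V0) R" using R unfolding V0_def .
 have "continuous_on ?B u" unfolding u_def
  by (rule continuous_on_disc_fill[OF _ L(1)]) (use csB0[OF R0] in \<open>auto intro!: continuous_intros\<close>)
 moreover have "u w ~= 0" if "w \<in> ?B" for w using csB0[OF R0] that L(2) by (auto simp: u_def)
 ultimately obtain v where v: "continuous_on ?B v" "!!w. w \<in> ?B ==> u w = exp (v w)"
  using continuous_logarithm_on_ball by metis
 have Rv: "R (g w) = w * exp (v w)" if "w \<in> ?Bp" for w using v(2)[of w] that by (auto simp: u_def field_simps)
 have v0: "continuous_on ?Bp v" using v(1) by (rule continuous_on_subset) auto
 have "sqcard (subtopology X V0) k \<longleftrightarrow> (\<exists>l. sqcard (subtopology X V) l & k = 2 * l)"
 proof (rule sqcard_restrict_inj[OF sub _ R0])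
  fix F assume F: "cs (subtopology X V) F" "sqeq (subtopology X V0) F (%x. 1)"
  obtain A where A: "cs (subtopology X V0) A" "!!x. x \<in> V0 ==> F x = 1 * (A x)\<^sup>2"
   using F(2) by (rule sqeq_subE) (use subt in auto)
  obtain b where b: "continuous_on ?B b" "!!w. w \<in> ?B ==> F (g w) = exp (b w)"
   using continuous_logarithm_on_ball[of 0 r "%w. F (g w)"] csB[OF F(1)] by metis
  have b0: "continuous_on ?Bp b" using b(1) by (rule continuous_on_subset) auto
  \<comment> \<open>The root A of F near the puncture is compared with exp(b/2), a root that extends
    over it; their ratio is a constant sign.\<close>
  let ?q = "%w. A (g w) * exp (- b w / 2)"
  have "(?q w)\<^sup>2 = 1" if "w \<in> ?Bp" for w
  proof -
   have "g w \<in> V0" using gV0 that by blast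
   then have "(A (g w))\<^sup>2 = exp (b w)" using A(2)[of "g w"] b(2)[of w] that by simp
   then show ?thesis by (simp add: power_mult_distrib exp_double[symmetric] exp_add[symmetric])
  qed
  moreover have "continuous_on ?Bp ?q"
   by (intro continuous_intros b0) (use csB0[OF A(1)] in auto)
  ultimately have qc: "?q w = ?q w'" if "w \<in> ?Bp" "w' \<in> ?Bp" for w w'
   using continuous_sign_const[OF conB0, of ?q] that by blast
  have "complex_of_real (r/2) \<in> ?Bp" using r by auto
  then obtain s where s: "!!w. w \<in> ?Bp ==> ?q w = s" using qc by blast
  have As: "A (g w) = s * exp (b w / 2)" if "w \<in> ?Bp" for w
   using s[OF that] by (auto simp: exp_minus field_simps)
  have s0: "s ~= 0" using s[of "complex_of_real (r/2)"] csB0[OF A(1)] r by auto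
  have s2: "s\<^sup>2 = 1" using \<open>!!w. w \<in> ?Bp ==> (?q w)\<^sup>2 = 1\<close>[of "complex_of_real (r/2)"] s[of "complex_of_real (r/2)"] r by simp
  define A' where "A' x = (if x = g 0 then s * exp (b 0 / 2) else A x)" for x
  have "cs (subtopology X V) A'"
  proof (rule cs_local)
   fix x assume x: "x \<in> V"
   show "\<exists>N. openin X N & x \<in> N & N \<subseteq> V & cs (subtopology X N) A'"
   proof (cases "x = g 0")
    case True
    have "cs (subtopology X (g ` ?B)) A'"
     unfolding cs_on_disc_iff[OF g subset_refl]
    proof
     have eq: "A' (g w) = s * exp (b w / 2)" if "w \<in> ?B" for w
      using As[of w] g0[OF that] that by (auto simp: A'_def)
     show "continuous_on ?B (%w. A' (g w))"
      by (rule continuous_on_eq[of _ "%w. s * exp (b w / 2)"]) (auto intro!: continuous_intros b simp: eq)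
     show "\<forall>w\<in>?B. A' (g w) ~= 0" using eq s0 by auto
    qed
    then show ?thesis using opg[of ?B] gV True r by (intro exI[of _ "g ` ?B"]) auto
   next
    case False
    then have "x \<in> V0" using x unfolding V_def V0_def by auto
    moreover have "cs (subtopology X V0) A'"
     by (rule cs_cong[OF A(1)]) (auto simp: A'_def V0_def)
    ultimately show ?thesis using oV0 sub by blast
   qed
  qed
  moreover have "F x = 1 * (A' x)\<^sup>2" if "x \<in> V" for x
  proof (cases "x = g 0")
   case True
   then show ?thesis using b(2)[of 0] r s2 by (simp add: A'_def power_mult_distrib exp_double[symmetric])
  next
   case False
   then have "x \<in> V0" using that unfolding V_def V0_def by auto
   then show ?thesis using A(2) False by (simp add: A'_def)
  qed
  ultimately show "sqeq (subtopology X V) F (%x. 1)" by (intro sqeqI) auto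
 next
  fix F assume F: "cs (subtopology X V0) F"
  obtain n h where h: "continuous_on ?Bp h" "!!w. w \<in> ?Bp ==> F (g w) = w powi n * exp (h w)"
   using punctured_disc_log[OF r, of "%w. F (g w)"] csB0[OF F] by metis
  \<comment> \<open>Dividing by the n-th power of R removes the winding number n, so M is an
    exponential on the punctured disc.\<close>
  define M where "M x = F x * R x powi (- n)" for x
  have M: "cs (subtopology X V0) M" unfolding M_def using cs_mult[OF F cs_power_int[OF R0]] .
  have Mg: "M (g w) = exp (h w - of_int n * v w)" if "w \<in> ?Bp" for w
  proof -
   have "M (g w) = w powi n * exp (h w) * (w powi (- n) * exp (v w) powi (-n))"
    unfolding M_def using Rv h(2) that by (simp add: power_int_mult_distrib)
   also have "\<dots> = (w powi n * w powi (- n)) * (exp (h w) * exp (of_int (-n) * v w))"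
    by (simp only: exp_power_int mult_ac)
   also have "w powi n * w powi (- n) = 1" using that by (simp add: power_int_minus)
   finally show ?thesis by (simp add: exp_add[symmetric] exp_diff exp_minus field_simps)
  qed
  \<comment> \<open>Equal to 1 up to radius r/3 and to 0 from 2r/3 on: the exponential M is divided
    out near the puncture, and nothing changes outside the disc.\<close>
  define cut where "cut w = complex_of_real (max 0 (min 1 (2 - 3 * norm w / r)))" for w :: complex
  have cut1: "cut w = 1" if "norm w <= r/3" for w
  proof -
   have "3 * norm w / r <= 1" using that r by (simp add: field_simps)
   then show ?thesis by (simp add: cut_def)
  qed
  have cut0: "cut w = 0" if "norm w \<ge> 2*r/3" for w
  proof -
   have "3 * norm w / r \<ge> 2" using that r by (simp add: field_simps)
   then show ?thesis by (simp add: cut_def)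
  qed
  have ccut: "continuous_on S cut" for S unfolding cut_def using r by (intro continuous_intros) auto
  define H where "H x = (if x \<in> g ` ?Bp then (let w = inv_into ?B g x in cut w * (h w - of_int n * v w)) else 0)" for x
  have Hg: "H (g w) = cut w * (h w - of_int n * v w)" if "w \<in> ?Bp" for w
  proof -
   have "inv_into ?B g (g w) = w" using inj that by (intro inv_into_f_f) auto
   then show ?thesis using that by (auto simp: H_def Let_def)
  qed
  have Hout: "H x = 0" if "x ~: g ` cball 0 (2*r/3)" for x
  proof (cases "x \<in> g ` ?Bp")
   case True
   then obtain w where w: "w \<in> ?Bp" "x = g w" by blast
   then have "norm w > 2*r/3" using that by (metis dist_0_norm imageI mem_cball not_le)
   then show ?thesis using Hg[OF w(1)] w(2) cut0[of w] by simp
  qed (simp add: H_def)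
  have cH: "continuous_map (subtopology X V0) euclidean H"
  proof (rule continuous_map_local)
   fix x assume x: "x \<in> V0"
   show "\<exists>N. openin X N & x \<in> N & N \<subseteq> V0 & continuous_map (subtopology X N) euclidean H"
   proof (cases "x \<in> g ` ?Bp")
    case True
    have "continuous_map (subtopology X (g ` ?Bp)) euclidean H"
     unfolding continuous_map_on_disc_iff[OF g Diff_subset] o_def
    proof -
     have "continuous_on ?Bp (%w. H (g w))"
      by (rule continuous_on_eq[of _ "%w. cut w * (h w - of_int n * v w)"])
       (use Hg in \<open>simp_all add: continuous_intros h v0 ccut\<close>)
     then show "continuous_map (top_of_set ?Bp) euclidean (%w. H (g w))" by simp
    qed
    then show ?thesis using True gV0 opg[OF opB0] by blast
   next
    case False
    let ?N = "V0 - g ` cball 0 (2*r/3)"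
    have "openin X ?N" using oV0 pdisc_closed_cball[OF X g] r by (simp add: openin_diff)
    moreover have "x \<in> ?N"
    proof -
     have "x ~= g 0" using x unfolding V0_def by auto
     moreover have "cball 0 (2*r/3) \<subseteq> ?B" using r by auto
     ultimately show ?thesis using False x by blast
    qed
    moreover have "continuous_map (subtopology X ?N) euclidean H"
     by (rule continuous_map_eq[of _ _ "%x. 0"]) (auto simp: Hout)
    ultimately show ?thesis by blast
   qed
  qed
  \<comment> \<open>Near the puncture G is constantly 1, which is why it extends.\<close>
  define G where "G x = (if x = g 0 then 1 else M x * exp (- H x))" for x
  have eH: "cs (subtopology X V0) (%x. exp (- H x))"
   by (rule cs_exp) (use cH in \<open>auto intro: continuous_map_minus\<close>)
  have G0: "cs (subtopology X V0) G"
   by (rule cs_cong[OF cs_mult[OF M eH]]) (auto simp: G_def V0_def)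
  have "cs (subtopology X V) G"
  proof (rule cs_local)
   fix x assume x: "x \<in> V"
   show "\<exists>N. openin X N & x \<in> N & N \<subseteq> V & cs (subtopology X N) G"
   proof (cases "x = g 0")
    case True
    let ?C = "ball 0 (r/3)"
    have CB: "?C \<subseteq> ?B" using r by auto
    have "G (g w) = 1" if "w \<in> ?C" for w
    proof (cases "w = 0")
     case False
     then have w: "w \<in> ?Bp" using that CB by blast
     then show ?thesis using that g0[of w] Hg[OF w] Mg[OF w] cut1[of w]
      by (simp add: G_def exp_add[symmetric])
    qed (simp add: G_def)
    then have "cs (subtopology X (g ` ?C)) G"
     unfolding cs_on_disc_iff[OF g CB] by (auto intro: continuous_on_eq[of _ "%w. 1"])
    moreover have "g ` ?C \<subseteq> V" "x \<in> g ` ?C" using CB gV True r by auto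
    ultimately show ?thesis using opg[of ?C] CB by blast
   next
    case False
    then have "x \<in> V0" using x unfolding V_def V0_def by auto
    then show ?thesis using G0 oV0 sub by blast
   qed
  qed
  moreover have "sqeq (subtopology X V0) F G | sqeq (subtopology X V0) F (%x. R x * G x)"
  proof -
   have "sqeq (subtopology X V0) (%x. M x * exp (- H x)) (%x. M x * 1)"
    by (rule sqeq_mult[OF sqeq_refl sqeq_exp]) (use cH in \<open>auto intro: continuous_map_minus\<close>)
   moreover have "sqeq (subtopology X V0) G (%x. M x * exp (- H x))"
    by (rule sqeq_cong) (auto simp: G_def V0_def)
   ultimately have MG: "sqeq (subtopology X V0) M G" using sqeq_trans sqeq_sym by fastforce
   have Rx: "R x ~= 0" if "x \<in> topspace (subtopology X V0)" for x using R0 that unfolding cs_def by blast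
   obtain j where "n = 2 * j | n = 2 * j + 1" by (metis evenE oddE)
   then show ?thesis
   proof
    assume n: "n = 2 * j"
    have "sqeq (subtopology X V0) F M"
    proof (rule sqeqI[OF cs_power_int[OF R0, of j]])
     fix x assume x: "x \<in> topspace (subtopology X V0)"
     have "(R x powi j)\<^sup>2 = R x powi n" unfolding n using Rx[OF x] by (simp add: power_int_mult power_int_power mult.commute)
     then show "F x = M x * (R x powi j)\<^sup>2" unfolding M_def using Rx[OF x] by (simp add: power_int_minus)
    qed
    then show ?thesis using MG sqeq_trans by blast
   next
    assume n: "n = 2 * j + 1"
    have "sqeq (subtopology X V0) F (%x. R x * M x)"
    proof (rule sqeqI[OF cs_power_int[OF R0, of j]])
     fix x assume x: "x \<in> topspace (subtopology X V0)"
     have "(R x powi j)\<^sup>2 * R x = R x powi n" unfolding n using Rx[OF x]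
      by (simp add: power_int_add power_int_mult power_int_power mult.commute)
     moreover have "R x powi n * R x powi (- n) = 1" using Rx[OF x] by (simp add: power_int_minus)
     ultimately show "F x = R x * M x * (R x powi j)\<^sup>2" unfolding M_def by (metis (no_types) mult.assoc mult.commute mult_1)
    qed
    moreover have "sqeq (subtopology X V0) (%x. R x * M x) (%x. R x * G x)"
     by (rule sqeq_mult[OF sqeq_refl MG])
    ultimately show ?thesis using sqeq_trans by blast
   qed
  qed
  ultimately show "\<exists>G. cs (subtopology X V) G &
    (sqeq (subtopology X V0) F G | sqeq (subtopology X V0) F (%x. R x * G x))" by blast
 next
  fix G assume G: "cs (subtopology X V) G"
  show "~ sqeq (subtopology X V0) R G"
  proof
   assume "sqeq (subtopology X V0) R G"
   then obtain A where A: "cs (subtopology X V0) A" "!!x. x \<in> V0 ==> R x = G x * (A x)\<^sup>2"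
    by (rule sqeq_subE) (use subt in auto)
   obtain b where b: "continuous_on ?B b" "!!w. w \<in> ?B ==> G (g w) = exp (b w)"
    using continuous_logarithm_on_ball[of 0 r "%w. G (g w)"] csB[OF G] by metis
   obtain n h where h: "continuous_on ?Bp h" "!!w. w \<in> ?Bp ==> A (g w) = w powi n * exp (h w)"
    using punctured_disc_log[OF r, of "%w. A (g w)"] csB0[OF A(1)] by metis
   have b0: "continuous_on ?Bp b" using b(1) by (rule continuous_on_subset) auto
   \<comment> \<open>Winding numbers in R = G A^2: the left side winds once, the right side 2n
     times.\<close>
   have "1 - 2 * n = 0"
   proof (rule punctured_disc_exp_trivial[OF r, of "%w. b w + 2 * h w - v w"])
    show "continuous_on ?Bp (%w. b w + 2 * h w - v w)" by (intro continuous_intros b0 h v0)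
    fix w assume w: "w \<in> ?Bp"
    have "w * exp (v w) = exp (b w) * (w powi n * exp (h w))\<^sup>2"
    proof -
     have "g w \<in> V0" using gV0 w by blast
     then show ?thesis using A(2)[of "g w"] Rv[OF w] h(2)[OF w] b(2)[of w] w by simp
    qed
    also have "\<dots> = w powi (2 * n) * exp (b w + 2 * h w)"
    proof -
     have "(w powi n)\<^sup>2 = w powi (2 * n)" using w by (simp add: power_int_mult power_int_power mult.commute)
     then show ?thesis by (simp add: power_mult_distrib exp_add exp_double)
    qed
    finally have "w = w powi (2 * n) * (exp (b w + 2 * h w) / exp (v w))" by (simp add: field_simps)
    then have "w = w powi (2 * n) * exp (b w + 2 * h w - v w)" by (simp only: exp_diff)
    moreover have "w powi (1 - 2 * n) = w / w powi (2 * n)" using w by (simp add: power_int_diff)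
    moreover have "w powi (2 * n) ~= 0" using w by auto
    ultimately show "w powi (1 - 2 * n) = exp (b w + 2 * h w - v w)" by (metis nonzero_mult_div_cancel_left)
   qed
   then show False by presburger
  qed
 qed
 then show ?thesis unfolding V_def V0_def .
qed

section \<open>Charts and coordinate discs\<close>

lemma pdisc_open: "pdisc X r g ==> open W ==> W \<subseteq> ball 0 r ==> openin X (g ` W)"
 unfolding pdisc_def by blast

lemma chart_facts:
 assumes "complex_chart X (U, ph)"
 shows "openin X U" "open (ph ` U)" "inj_on ph U" "continuous_map (subtopology X U) euclidean ph"
  "continuous_map (top_of_set (ph ` U)) X (inv_into U ph)"
  "open W ==> openin X {x \<in> U. ph x \<in> W}" "U \<subseteq> topspace X"
proof -
 have 1: "openin X U" "open (ph ` U)" and h: "homeomorphic_map (subtopology X U) (top_of_set (ph ` U)) ph"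
  using assms unfolding complex_chart_def by auto
 have U: "U \<subseteq> topspace X" using 1 openin_subset by blast
 have ts: "topspace (subtopology X U) = U" using U by auto
 show inj: "inj_on ph U" using h unfolding homeomorphic_map_def ts by blast
 have c: "continuous_map (subtopology X U) (top_of_set (ph ` U)) ph"
  using h homeomorphic_imp_continuous_map by blast
 then show c2: "continuous_map (subtopology X U) euclidean ph" by (simp add: continuous_map_in_subtopology)
 obtain g where g: "homeomorphic_maps (subtopology X U) (top_of_set (ph ` U)) ph g"
  using h homeomorphic_map_maps by blast
 have "continuous_map (top_of_set (ph ` U)) (subtopology X U) (inv_into U ph)"
 proof (rule continuous_map_eq)
  show "continuous_map (top_of_set (ph ` U)) (subtopology X U) g" using g unfolding homeomorphic_maps_def by blast
  fix y assume "y \<in> topspace (top_of_set (ph ` U))"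
  then obtain x where x: "x \<in> U" "y = ph x" by auto
  have "g (ph x) = x" using g x(1) ts unfolding homeomorphic_maps_def by blast
  then show "g y = inv_into U ph y" using x inj by simp
 qed
 then show "continuous_map (top_of_set (ph ` U)) X (inv_into U ph)" by (simp add: continuous_map_in_subtopology)
 show "openin X {x \<in> U. ph x \<in> W}" if "open W"
 proof -
  have "openin (subtopology X U) {x \<in> topspace (subtopology X U). ph x \<in> W}"
   by (rule openin_continuous_map_preimage[OF c2]) (use that in simp)
  then show ?thesis unfolding ts using 1(1) openin_trans_full by blast
 qed
 show "openin X U" "open (ph ` U)" "U \<subseteq> topspace X" using 1 U by auto
qed

text \<open>Discs are read off the charts of the atlas and only translated, so that the passage from
  one disc to another is holomorphic; \<open>hdisc_change\<close> rests on this.\<close>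

definition hdisc :: "'a chart set => 'a => real => (complex => 'a) => bool" where
 "hdisc A p r g \<longleftrightarrow> r > 0 & (\<exists>U ph. (U, ph) \<in> A & p \<in> U & ball (ph p) r \<subseteq> ph ` U &
   g = (%w. inv_into U ph (ph p + w)))"

lemma chart_pdisc:
 assumes c: "complex_chart X (U, ph)" and p: "p \<in> U" and r: "r > 0" and b: "ball (ph p) r \<subseteq> ph ` U"
  and g: "g = (%w. inv_into U ph (ph p + w))"
 shows "pdisc X r g" "g 0 = p" "!!w. w \<in> ball 0 r ==> g w \<in> U & ph (g w) = ph p + w"
proof -
 have in': "ph p + w \<in> ph ` U" if "w \<in> ball 0 r" for w using that b by (auto simp: subset_iff dist_norm)
 show gw: "g w \<in> U & ph (g w) = ph p + w" if "w \<in> ball 0 r" for w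
  unfolding g using inv_into_into[OF in'[OF that]] f_inv_into_f[OF in'[OF that]] by (rule conjI)
 show "g 0 = p" unfolding g add_0_right by (rule inv_into_f_f[OF chart_facts(3)[OF c] p])
 have "continuous_map (top_of_set (ball 0 r)) (top_of_set (ph ` U)) (%w. ph p + w)"
  using in' by (auto simp: continuous_map_in_subtopology intro!: continuous_intros)
 from continuous_map_compose[OF this chart_facts(5)[OF c]]
 have "continuous_map (top_of_set (ball 0 r)) X g" unfolding g comp_def .
 moreover have "inj_on g (ball 0 r)"
 proof (rule inj_onI)
  fix z z' assume z: "z \<in> ball 0 r" "z' \<in> ball 0 r" "g z = g z'"
  have "ph p + z = ph (g z)" by (rule conjunct2[OF gw[OF z(1)], symmetric])
  also have "\<dots> = ph p + z'" unfolding z(3) by (rule conjunct2[OF gw[OF z(2)]])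
  finally show "z = z'" by simp
 qed
 moreover have "openin X (g ` W)" if W: "open W" "W \<subseteq> ball 0 r" for W
 proof -
  have "g ` W = {x \<in> U. ph x \<in> (%w. ph p + w) ` W}"
  proof (intro equalityI subsetI)
   fix x assume "x \<in> g ` W" then obtain w where w: "w \<in> W" "x = g w" by blast
   then show "x \<in> {x \<in> U. ph x \<in> (%w. ph p + w) ` W}" using gw[of w] W by auto
  next
   fix x assume "x \<in> {x \<in> U. ph x \<in> (%w. ph p + w) ` W}"
   then obtain w where w: "x \<in> U" "w \<in> W" "ph x = ph p + w" by blast
   then have "g w = x" using gw[of w] W inj_onD[OF chart_facts(3)[OF c], of "g w" x] by auto
   then show "x \<in> g ` W" using w by blast
  qed
  moreover have "open ((%w. ph p + w) ` W)" by (rule open_translation[OF W(1)])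
  ultimately show ?thesis using chart_facts(6)[OF c, of "(%w. ph p + w) ` W"] by argo
 qed
 ultimately show "pdisc X r g" unfolding pdisc_def using r by blast
qed

lemma chart_disc_exists:
 assumes c: "complex_chart X (U, ph)" and p: "p \<in> U" and N: "openin X N" "p \<in> N"
 obtains r where "r > 0" "ball (ph p) r \<subseteq> ph ` U" "(%w. inv_into U ph (ph p + w)) ` ball 0 r \<subseteq> N"
proof -
 obtain r0 where r0: "r0 > 0" "ball (ph p) r0 \<subseteq> ph ` U"
  using chart_facts(2)[OF c] p open_contains_ball by blast
 let ?g = "%w. inv_into U ph (ph p + w)"
 note pd = chart_pdisc[OF c p r0 refl]
 have "openin (top_of_set (ball 0 r0)) {w \<in> topspace (top_of_set (ball 0 r0)). ?g w \<in> N}"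
  by (rule openin_continuous_map_preimage) (use pd(1) N in \<open>auto simp: pdisc_def\<close>)
 then have "open {w \<in> ball 0 r0. ?g w \<in> N}" using openin_open_trans by fastforce
 moreover have "0 \<in> {w \<in> ball 0 r0. ?g w \<in> N}" using pd(2) N r0 by simp
 ultimately obtain r where r: "r > 0" "ball 0 r \<subseteq> {w \<in> ball 0 r0. ?g w \<in> N}" using open_contains_ball by blast
 have "ball 0 (min r r0) \<subseteq> {w \<in> ball 0 r0. ?g w \<in> N}" using r(2) by (auto simp: subset_iff)
 then have "?g ` ball 0 (min r r0) \<subseteq> N" by blast
 moreover have "ball (ph p) (min r r0) \<subseteq> ph ` U" using r0(2) by (meson min.cobounded2 order_trans subset_ball)
 ultimately show thesis using that[of "min r r0"] r r0 by simp
qed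

section \<open>Functions with one simple zero and one simple pole\<close>

context
 fixes X :: "'a topology" and A :: "'a chart set"
 assumes rs: "riemann_surface X A"
begin

lemma atlas_chart: "(U, ph) \<in> A ==> complex_chart X (U, ph)"
 using rs unfolding riemann_surface_def by blast

lemma hdisc_pdisc: assumes "hdisc A p r g" shows "pdisc X r g" "g 0 = p"
 using assms chart_pdisc(1,2) atlas_chart unfolding hdisc_def by meson+

lemma hdisc_exists:
 assumes "openin X N" "p \<in> N"
 obtains r g where "hdisc A p r g" "g ` ball 0 r \<subseteq> N"
proof -
 have "p \<in> topspace X" using assms openin_subset by blast
 then obtain U ph where U: "(U, ph) \<in> A" "p \<in> U"
  using rs unfolding riemann_surface_def by fastforce
 obtain r where "r > 0" "ball (ph p) r \<subseteq> ph ` U" "(%w. inv_into U ph (ph p + w)) ` ball 0 r \<subseteq> N"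
  using chart_disc_exists[OF atlas_chart[OF U(1)] U(2) assms] by blast
 then show thesis using that U unfolding hdisc_def by blast
qed

text \<open>The coordinate change is injective and holomorphic, hence has nonzero derivative at the
  point; the two limits differ by this factor.\<close>

lemma hdisc_change:
 assumes g: "hdisc A p r g" and g': "hdisc A p r' g'"
  and L: "((%w. R (g w) / w) \<longlongrightarrow> L) (at 0)" "L ~= (0::complex)"
 shows "\<exists>L'. L' ~= 0 & ((%w. R (g' w) / w) \<longlongrightarrow> L') (at 0)"
proof -
 obtain U ph where U: "(U, ph) \<in> A" "p \<in> U" "ball (ph p) r \<subseteq> ph ` U" "g = (%w. inv_into U ph (ph p + w))" "r > 0"
  using g unfolding hdisc_def by blast
 obtain U' ph' where U': "(U', ph') \<in> A" "p \<in> U'" "ball (ph' p) r' \<subseteq> ph' ` U'" "g' = (%w. inv_into U' ph' (ph' p + w))" "r' > 0"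
  using g' unfolding hdisc_def by blast
 note c = atlas_chart[OF U(1)] and c' = atlas_chart[OF U'(1)]
 have "holo_compatible (U, ph) (U', ph')" using rs U U' unfolding riemann_surface_def by blast
 then have hol: "(ph \<circ> inv_into U' ph') holomorphic_on ph' ` (U Int U')" unfolding holo_compatible_def by auto
 have "ph' ` (U Int U') = ph' ` {x \<in> U'. x \<in> U}" by auto
 obtain s where s: "s > 0" "ball (ph' p) s \<subseteq> ph' ` U'" "(%w. inv_into U' ph' (ph' p + w)) ` ball 0 s \<subseteq> U"
  using chart_disc_exists[OF c' U'(2) chart_facts(1)[OF c] U(2)] by blast
 note pd' = chart_pdisc[OF c' U'(2) s(1,2) refl]
 let ?S = "ball (ph' p) s" let ?T = "ph \<circ> inv_into U' ph'"
 have SU: "inv_into U' ph' z \<in> U Int U' & ph' (inv_into U' ph' z) = z" if "z \<in> ?S" for z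
 proof -
  have w: "z - ph' p \<in> ball 0 s" using that by (simp add: dist_norm norm_minus_commute)
  have "inv_into U' ph' (ph' p + (z - ph' p)) \<in> U" using s(3) w by blast
  then show ?thesis using pd'(3)[OF w] by simp
 qed
 have "?S \<subseteq> ph' ` (U Int U')" using SU by (metis image_eqI subsetI)
 then have holS: "?T holomorphic_on ?S" using hol holomorphic_on_subset by blast
 have injT: "inj_on ?T ?S"
 proof (rule inj_onI)
  fix z z' assume z: "z \<in> ?S" "z' \<in> ?S" "?T z = ?T z'"
  then have "inv_into U' ph' z = inv_into U' ph' z'" using chart_facts(3)[OF c] SU by (auto simp: inj_on_def)
  then show "z = z'" using SU z by metis
 qed
 have p: "inv_into U' ph' (ph' p) = p" using chart_facts(3)[OF c'] U' by simp
 let ?D = "deriv ?T (ph' p)"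
 have D0: "?D ~= 0" by (rule holomorphic_injective_imp_regular[OF holS open_ball injT]) (use s in simp)
 have "(?T has_field_derivative ?D) (at (ph' p))"
  by (rule holomorphic_derivI[OF holS open_ball]) (use s in simp)
 then have "((%h. (?T (ph' p + h) - ?T (ph' p)) / h) \<longlongrightarrow> ?D) (at 0)" by (rule DERIV_D)
 then have Dl: "((%w. (ph (g' w) - ph p) / w) \<longlongrightarrow> ?D) (at 0)" unfolding U'(4) by (simp add: p)
 let ?t = "%w. ph (g' w) - ph p"
 have "((%w. (?t w / w) * w) \<longlongrightarrow> ?D * 0) (at 0)" by (intro tendsto_intros Dl)
 moreover have "\<forall>\<^sub>F w in at 0. (?t w / w) * w = ?t w" by (simp add: eventually_at_filter)
 ultimately have "(?t \<longlongrightarrow> ?D * 0) (at 0)" by (rule Lim_transform_eventually)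
 then have t0: "(?t \<longlongrightarrow> 0) (at 0)" by simp
 have ev: "\<forall>\<^sub>F w in at 0. w \<in> ball (0::complex) s & w ~= 0"
  using s by (auto simp: eventually_at intro!: exI[of _ s])
 have gt: "g (?t w) = g' w & ?t w ~= 0" if w: "w \<in> ball 0 s & w ~= 0" for w
 proof -
  have z: "ph' p + w \<in> ?S" using w by (simp add: dist_norm)
  have gU: "g' w \<in> U" unfolding U'(4) using SU[OF z] by blast
  have "g' w ~= p" using SU[OF z] w unfolding U'(4) by auto
  then have "ph (g' w) ~= ph p" using chart_facts(3)[OF c] gU U(2) by (auto simp: inj_on_def)
  moreover have "g (?t w) = g' w" unfolding U(4) using chart_facts(3)[OF c] gU by simp
  ultimately show ?thesis by simp
 qed
 have "filterlim ?t (at 0) (at 0)"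
  unfolding filterlim_at using t0 ev gt by (auto elim!: eventually_mono)
 from filterlim_compose[OF L(1) this]
 have "((%w. R (g (?t w)) / ?t w) \<longlongrightarrow> L) (at 0)" by simp
 then have "((%w. R (g (?t w)) / ?t w * (?t w / w)) \<longlongrightarrow> L * ?D) (at 0)" using Dl by (rule tendsto_mult)
 then have "((%w. R (g' w) / w) \<longlongrightarrow> L * ?D) (at 0)"
  by (rule Lim_transform_eventually) (use ev gt in \<open>auto elim!: eventually_mono\<close>)
 then show ?thesis using L(2) D0 by (intro exI[of _ "L * ?D"]) auto
qed

text \<open>A simple zero of a merely continuous function: it is asymptotic to a nonzero multiple of
  the coordinate.\<close>

definition zer :: "'a => ('a => complex) => bool" where
 "zer p R \<longleftrightarrow> (\<exists>r g L. hdisc A p r g & L ~= 0 & ((%w. R (g w) / w) \<longlongrightarrow> L) (at 0))"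

lemma zer_disc:
 assumes z: "zer p R" and g: "hdisc A p r g"
 obtains L where "L ~= 0" "((%w. R (g w) / w) \<longlongrightarrow> L) (at 0)"
proof -
 obtain r0 g0 L0 where h0: "hdisc A p r0 g0" and L0: "L0 ~= 0" "((%w. R (g0 w) / w) \<longlongrightarrow> L0) (at 0)"
  using z unfolding zer_def by blast
 from hdisc_change[OF h0 g L0(2,1)] show thesis using that by blast
qed

text \<open>A topological substitute for a meromorphic function with divisor p - q, which on a
  compact surface of positive genus does not exist for different p and q.\<close>

definition zprel :: "'a => 'a => bool" where
 "zprel p q \<longleftrightarrow> p = q | (\<exists>R. cs (subtopology X (topspace X - {p, q})) R & zer p R & zer q (%x. inverse (R x)))"

lemma zprel_sym: assumes "zprel p q" shows "zprel q p"
proof (cases "p = q")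
 case False
 then obtain R where R: "cs (subtopology X (topspace X - {p, q})) R" "zer p R" "zer q (%x. inverse (R x))"
  using assms unfolding zprel_def by blast
 have "{q, p} = {p, q}" by auto
 then have "cs (subtopology X (topspace X - {q, p})) (%x. inverse (R x))" using cs_inverse[OF R(1)] by simp
 moreover have "zer p (%x. inverse (inverse (R x)))" using R(2) by simp
 ultimately show ?thesis using R(3) unfolding zprel_def by blast
qed (simp add: zprel_def)

text \<open>The nowhere zero factor c contributes only its value at p to the limit.\<close>

lemma zer_cong:
 assumes z: "zer p R" and N: "openin X N" "p \<in> N" and eq: "!!x. x \<in> N ==> x ~= p ==> R x = R' x * c x"
  and c: "cs (subtopology X N) c"
 shows "zer p R'"
proof -
 obtain r g where g: "hdisc A p r g" "g ` ball 0 r \<subseteq> N" by (rule hdisc_exists[OF N])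
 obtain L where L: "L ~= 0" "((%w. R (g w) / w) \<longlongrightarrow> L) (at 0)" by (rule zer_disc[OF z g(1)])
 note pd = hdisc_pdisc[OF g(1)]
 have r: "r > 0" using g(1) unfolding hdisc_def by blast
 have "cs (subtopology X (g ` ball 0 r)) c" by (rule cs_sub[OF c g(2)])
 then have cc: "continuous_on (ball 0 r) (%w. c (g w))" "!!w. w \<in> ball 0 r ==> c (g w) ~= 0"
  using cs_on_disc_iff[OF pd(1) subset_refl] by auto
 have "isCont (%w. c (g w)) 0" using cc(1) r unfolding continuous_on_eq_continuous_at[OF open_ball] by auto
 then have "((%w. c (g w)) \<longlongrightarrow> c (g 0)) (at 0)" by (simp add: isCont_def)
 then have "((%w. (R (g w) / w) / c (g w)) \<longlongrightarrow> L / c (g 0)) (at 0)"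
  using cc(2)[of 0] r by (intro tendsto_divide L) auto
 moreover have "\<forall>\<^sub>F w in at 0. (R (g w) / w) / c (g w) = R' (g w) / w"
 proof -
  have "(R (g w) / w) / c (g w) = R' (g w) / w" if w: "w \<in> ball 0 r" "w ~= 0" for w
  proof -
   have "g w ~= p" using pd w r unfolding pdisc_def by (metis centre_in_ball inj_onD)
   moreover have "g w \<in> N" using g(2) w by blast
   ultimately show ?thesis using eq[of "g w"] cc(2)[OF w(1)] by simp
  qed
  then show ?thesis using r by (auto simp: eventually_at intro!: exI[of _ r])
 qed
 ultimately have "((%w. R' (g w) / w) \<longlongrightarrow> L / c (g 0)) (at 0)" by (rule Lim_transform_eventually)
 moreover have "L / c (g 0) ~= 0" using L(1) cc(2)[of 0] r by simp
 ultimately show ?thesis using g(1) unfolding zer_def by blast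
qed

lemma openin_minus_finite: "finite P ==> openin X (topspace X - P)"
proof -
 assume P: "finite P"
 have "Hausdorff_space X" using rs unfolding riemann_surface_def by blast
 then have "closedin X (P Int topspace X)"
  using P by (meson Hausdorff_imp_t1_space finite_Int inf_le2 t1_space_closedin_finite)
 then have "openin X (topspace X - P Int topspace X)" by blast
 then show ?thesis by (simp add: Diff_Int_distrib2 Diff_Int)
qed

text \<open>In the product of the two functions the pole of the first at q cancels the zero of the
  second.\<close>

lemma zprel_trans: assumes pq: "zprel p q" and qs: "zprel q s" and top: "p \<in> topspace X" "q \<in> topspace X" "s \<in> topspace X"
 shows "zprel p s"
proof (cases "p = q | q = s | p = s")
 case False
 then obtain R R' where R: "cs (subtopology X (topspace X - {p, q})) R" "zer p R" "zer q (%x. inverse (R x))"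
  and R': "cs (subtopology X (topspace X - {q, s})) R'" "zer q R'" "zer s (%x. inverse (R' x))"
  using assms(1,2) unfolding zprel_def by blast
 let ?W = "topspace X - {p, q, s}" let ?V = "topspace X - {p, s}"
 have RW: "cs (subtopology X ?W) R" "cs (subtopology X ?W) R'"
  using cs_sub[OF R(1), of ?W] cs_sub[OF R'(1), of ?W] by auto
 obtain r g where g: "hdisc A q r g" "g ` ball 0 r \<subseteq> ?V"
  by (rule hdisc_exists[of ?V q]) (use openin_minus_finite[of "{p,s}"] top False in auto)
 note pd = hdisc_pdisc[OF g(1)]
 have r: "r > 0" using g(1) unfolding hdisc_def by blast
 obtain L where L: "L ~= 0" "((%w. inverse (R (g w)) / w) \<longlongrightarrow> L) (at 0)"
  by (rule zer_disc[OF R(3) g(1)])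
 obtain L' where L': "L' ~= 0" "((%w. R' (g w) / w) \<longlongrightarrow> L') (at 0)"
  by (rule zer_disc[OF R'(2) g(1)])
 have lim: "((%w. R (g w) * R' (g w)) \<longlongrightarrow> L' / L) (at 0)"
 proof (rule Lim_transform_eventually)
  show "((%w. (R' (g w) / w) / (inverse (R (g w)) / w)) \<longlongrightarrow> L' / L) (at 0)"
   by (intro tendsto_divide L L')
  show "\<forall>\<^sub>F w in at 0. (R' (g w) / w) / (inverse (R (g w)) / w) = R (g w) * R' (g w)"
   by (auto simp: eventually_at_filter field_simps)
 qed
 \<comment> \<open>By the two asymptotics the product tends to L'/L at q, a nonzero number, which
   fills the gap.\<close>
 define F where "F x = (if x = q then L' / L else R x * R' x)" for x
 have g0: "g w = q \<longleftrightarrow> w = 0" if "w \<in> ball 0 r" for w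
  using pd that r unfolding pdisc_def by (metis centre_in_ball inj_onD)
 have gW: "g ` (ball 0 r - {0}) \<subseteq> ?W" using g(2) g0 by blast
 have prod: "cs (subtopology X (g ` (ball 0 r - {0}))) (%x. R x * R' x)"
  by (rule cs_sub[OF cs_mult[OF RW] gW])
 have prod': "continuous_on (ball 0 r - {0}) (%w. R (g w) * R' (g w))" "!!w. w \<in> ball 0 r - {0} ==> R (g w) * R' (g w) ~= 0"
  using prod unfolding cs_on_disc_iff[OF pd(1) Diff_subset] by auto
 have Fg: "F (g w) = (if w = 0 then L' / L else R (g w) * R' (g w))" if "w \<in> ball 0 r" for w
  using g0[OF that] unfolding F_def by auto
 have c1: "cs (subtopology X (g ` ball 0 r)) F"
  unfolding cs_on_disc_iff[OF pd(1) subset_refl]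
 proof
  show "continuous_on (ball 0 r) (%w. F (g w))"
   by (rule continuous_on_eq[OF continuous_on_disc_fill[OF prod'(1) lim]]) (use Fg in auto)
  show "\<forall>w\<in>ball 0 r. F (g w) ~= 0" using Fg prod'(2) L L' by auto
 qed
 have c2: "cs (subtopology X ?W) F"
  by (rule cs_cong[OF cs_mult[OF RW]]) (auto simp: F_def)
 have "cs (subtopology X ?V) F"
 proof (rule cs_local)
  fix x assume x: "x \<in> ?V"
  show "\<exists>N. openin X N & x \<in> N & N \<subseteq> ?V & cs (subtopology X N) F"
  proof (cases "x = q")
   case True
   have "openin X (g ` ball 0 r)" using pd(1) unfolding pdisc_def by blast
   moreover have "x \<in> g ` ball 0 r" by (rule image_eqI[of _ _ 0]) (use True pd(2) r in auto)
   ultimately show ?thesis using c1 g(2) by blast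
  next
   case False
   then have "x \<in> ?W" using x by blast
   moreover have "openin X ?W" by (rule openin_minus_finite) simp
   moreover have "?W \<subseteq> ?V" by blast
   ultimately show ?thesis using c2 by blast
  qed
 qed
 moreover have "zer p F"
 proof (rule zer_cong[OF R(2)])
  show "openin X (topspace X - {q, s})" by (rule openin_minus_finite) simp
  show "cs (subtopology X (topspace X - {q, s})) (%x. inverse (R' x))" by (rule cs_inverse[OF R'(1)])
  fix x assume x: "x \<in> topspace X - {q, s}"
  then have "R' x ~= 0" using R'(1) unfolding cs_def by auto
  then show "R x = F x * inverse (R' x)" using x unfolding F_def by auto
 qed (use top False in auto)
 moreover have "zer s (%x. inverse (F x))"
 proof (rule zer_cong[OF R'(3)])
  show "openin X (topspace X - {p, q})" by (rule openin_minus_finite) simp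
  show "cs (subtopology X (topspace X - {p, q})) R" by (rule R(1))
  fix x assume x: "x \<in> topspace X - {p, q}"
  then have "R x ~= 0" using R(1) unfolding cs_def by auto
  then show "inverse (R' x) = inverse (F x) * R x" using x unfolding F_def by auto
 qed (use top False in auto)
 ultimately show ?thesis unfolding zprel_def by blast
qed (use assms in \<open>auto simp: zprel_def\<close>)

text \<open>In the disc the quotient (w - a)/(w - b) has the right zero and pole. Written as 1 + (b
  - a)/(w - b) it can be cut off to the constant 1.\<close>

lemma zprel_local:
 assumes g: "hdisc A p r g" and ab: "a \<in> ball 0 (r/12)" "b \<in> ball 0 (r/12)"
 shows "zprel (g a) (g b)"
proof (cases "a = b")
 case False
 note pd = hdisc_pdisc[OF g]
 have X: "Hausdorff_space X" using rs unfolding riemann_surface_def by blast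
 have r: "r > 0" using g unfolding hdisc_def by blast
 have inj: "inj_on g (ball 0 r)" using pd unfolding pdisc_def by blast
 have abB: "a \<in> ball 0 r" "b \<in> ball 0 r" using ab r by auto
 define cut where "cut w = complex_of_real (max 0 (min 1 (2 - 3 * norm w / r)))" for w :: complex
 have cut1: "cut w = 1" if "norm w <= r/3" for w
 proof -
  have "3 * norm w / r <= 1" using that r by (simp add: field_simps)
  then show ?thesis by (simp add: cut_def)
 qed
 have cut0: "cut w = 0" if "norm w \<ge> 2*r/3" for w
 proof -
  have "3 * norm w / r \<ge> 2" using that r by (simp add: field_simps)
  then show ?thesis by (simp add: cut_def)
 qed
 have cutn: "norm (cut w) <= 1" for w unfolding cut_def norm_of_real by (simp add: max_def min_def)
 have ccut: "continuous_on S cut" for S unfolding cut_def using r by (intro continuous_intros) auto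
 let ?f = "%w. 1 + cut w * ((b - a) / (w - b))"
 have f_in: "?f w = (w - a) / (w - b)" if "norm w <= r/3" "w ~= b" for w
  using cut1[OF that(1)] that(2) by (simp add: field_simps)
 have f_ne: "?f w ~= 0" if "w ~= a" "w ~= b" for w
 proof (cases "norm w <= r/3")
  case True then show ?thesis using f_in that by simp
 next
  case False
  \<comment> \<open>Beyond radius r/3, where the cut-off acts, |w - b| > r/3 - r/12 = r/4 while |b -
    a| < r/6. So the correction is smaller than 1 and no new zero arises; this is the reason for the
    radius r/12.\<close>
  have "norm (b - a) < r/6" using norm_triangle_ineq4[of b a] ab by simp
  moreover have "norm (w - b) > r/4" using norm_triangle_ineq2[of w b] False ab by simp
  ultimately have "norm ((b - a) / (w - b)) < 1" using r by (simp add: norm_divide divide_less_eq)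
  then have "norm (cut w * ((b - a) / (w - b))) < 1"
   using mult_right_mono[OF cutn[of w] norm_ge_zero[of "(b - a) / (w - b)"]] unfolding norm_mult by linarith
  then show ?thesis by (metis add_eq_0_iff less_irrefl norm_minus_cancel norm_one)
 qed
 define R where "R x = (if x \<in> g ` ball 0 r then ?f (inv_into (ball 0 r) g x) else 1)" for x
 have Rg: "R (g w) = ?f w" if "w \<in> ball 0 r" for w using that inj by (simp add: R_def)
 have Rout: "R x = 1" if "x ~: g ` cball 0 (2*r/3)" for x
 proof (cases "x \<in> g ` ball 0 r")
  case True
  then obtain w where w: "w \<in> ball 0 r" "x = g w" by blast
  then have "norm w > 2*r/3" using that by (metis dist_0_norm imageI mem_cball not_le)
  then show ?thesis using Rg[OF w(1)] w(2) cut0[of w] by simp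
 qed (simp add: R_def)
 let ?V = "topspace X - {g a, g b}"
 let ?B = "ball 0 r - {a, b}"
 have gB: "g ` ?B \<subseteq> ?V" using pdisc_image_subset[OF pd(1), of "?B"] inj abB by (fastforce simp: inj_on_def)
 have "cs (subtopology X ?V) R"
 proof (rule cs_local)
  fix x assume x: "x \<in> ?V"
  show "\<exists>N. openin X N & x \<in> N & N \<subseteq> ?V & cs (subtopology X N) R"
  proof (cases "x \<in> g ` ball 0 r")
   case True
   then have "x \<in> g ` ?B" using x by blast
   moreover have "open ?B" by (simp add: open_Diff)
   then have "openin X (g ` ?B)" using pd(1) unfolding pdisc_def by blast
   moreover have "cs (subtopology X (g ` ?B)) R"
    unfolding cs_on_disc_iff[OF pd(1) Diff_subset]
   proof
    show "continuous_on ?B (%w. R (g w))"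
     by (rule continuous_on_eq[of _ ?f]) (use Rg in \<open>auto intro!: continuous_intros ccut\<close>)
    show "\<forall>w\<in>?B. R (g w) ~= 0" using Rg f_ne by auto
   qed
   ultimately show ?thesis using gB by blast
  next
   case False
   let ?N = "?V - g ` cball 0 (2*r/3)"
   have "openin X ?N" using openin_minus_finite[of "{g a, g b}"] pdisc_closed_cball[OF X pd(1)] r by (simp add: openin_diff)
   moreover have "x \<in> ?N"
   proof -
    have "cball 0 (2*r/3) \<subseteq> ball (0::complex) r" using r by auto
    then show ?thesis using False x by blast
   qed
   moreover have "cs (subtopology X ?N) R" by (rule cs_cong[OF cs_one]) (auto simp: Rout)
   ultimately show ?thesis by blast
  qed
 qed
 moreover have key: "zer (g c) S" if c: "c \<in> ball 0 (r/12)" "d \<in> ball 0 (r/12)" "c ~= d"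
  and S: "!!w. norm w <= r/3 ==> w ~= c ==> w ~= d ==> S (g w) = (w - c) / (w - d)" for c d S
 proof -
  obtain U ph where U: "(U, ph) \<in> A" "p \<in> U" "ball (ph p) r \<subseteq> ph ` U" "g = (%w. inv_into U ph (ph p + w))"
   using g unfolding hdisc_def by blast
  note pc = chart_pdisc[OF atlas_chart[OF U(1)] U(2) r U(3,4)]
  have cB: "c \<in> ball 0 r" using c r by auto
  have "hdisc A (g c) (r/2) (%w. g (c + w))"
   unfolding hdisc_def
  proof (intro conjI exI)
   show "ball (ph (g c)) (r/2) \<subseteq> ph ` U"
   proof
    fix z assume "z \<in> ball (ph (g c)) (r/2)"
    then have "norm (z - (ph p + c)) < r/2" using pc(3)[OF cB] by (simp add: dist_norm norm_minus_commute)
    then have "norm (z - ph p) < r" using norm_triangle_ineq[of "z - (ph p + c)" c] c r by (simp add: algebra_simps)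
    then show "z \<in> ph ` U" using U(3) by (auto simp: dist_norm norm_minus_commute)
   qed
   show "(%w. g (c + w)) = (%w. inv_into U ph (ph (g c) + w))" using pc(3)[OF cB] unfolding U(4) by (simp add: add.assoc)
  qed (use U r pc(3)[OF cB] in auto)
  moreover have "((%w. S (g (c + w)) / w) \<longlongrightarrow> 1 / (c - d)) (at 0)"
  proof (rule Lim_transform_eventually)
   show "((%w. 1 / (c + w - d)) \<longlongrightarrow> 1 / (c - d)) (at 0)"
    using c(3) by (auto intro!: tendsto_eq_intros)
   have "1 / (c + w - d) = S (g (c + w)) / w" if w: "norm w < min (r/12) (norm (d - c))" "w ~= 0" for w
   proof -
    have "norm (c + w) <= r/3" using norm_triangle_ineq[of c w] c w r by simp
    moreover have "c + w ~= d" using w by auto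
    ultimately show ?thesis using S[of "c + w"] w by simp
   qed
   then show "\<forall>\<^sub>F w in at 0. 1 / (c + w - d) = S (g (c + w)) / w"
    using r c(3) unfolding eventually_at by (intro exI[of _ "min (r/12) (norm (d - c))"]) auto
  qed
  moreover have "1 / (c - d) ~= 0" using c(3) by simp
  ultimately show ?thesis unfolding zer_def by blast
 qed
 have "zer (g a) R"
 proof (rule key[OF ab False])
  fix w assume w: "norm w <= r/3" "w ~= a" "w ~= b"
  then show "R (g w) = (w - a) / (w - b)" using Rg[of w] f_in[of w] r by simp
 qed
 moreover have "zer (g b) (%x. inverse (R x))"
 proof (rule key[OF ab(2,1) False[symmetric]])
  fix w assume w: "norm w <= r/3" "w ~= b" "w ~= a"
  then show "inverse (R (g w)) = (w - b) / (w - a)" using Rg[of w] f_in[of w] r by simp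
 qed
 ultimately show ?thesis unfolding zprel_def by blast
qed (simp add: zprel_def)

text \<open>By \<open>zprel_local\<close> the classes of this equivalence relation are open, so a
  connected surface has only one.\<close>

lemma zprel_all:
 assumes con: "connected_space X" and pq: "p \<in> topspace X" "q \<in> topspace X"
 shows "zprel p q"
proof -
 let ?S = "{x \<in> topspace X. zprel p x}"
 have nb: "\<exists>N. openin X N & x \<in> N & (\<forall>y\<in>N. zprel x y)" if x: "x \<in> topspace X" for x
 proof -
  obtain r g where g: "hdisc A x r g" and "g ` ball 0 r \<subseteq> topspace X"
   by (rule hdisc_exists[OF openin_topspace x])
  note pd = hdisc_pdisc[OF g]
  have r: "r > 0" using g unfolding hdisc_def by blast
  have "openin X (g ` ball 0 (r/12))"
   by (rule pdisc_open[OF pd(1) open_ball]) (use r in \<open>auto intro: subset_ball\<close>)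
  moreover have "x \<in> g ` ball 0 (r/12)" by (rule image_eqI[of _ _ 0]) (use pd(2) r in auto)
  moreover have "zprel x y" if y: "y \<in> g ` ball 0 (r/12)" for y
  proof -
   obtain b where "b \<in> ball 0 (r/12)" "y = g b" using y by blast
   then show ?thesis using zprel_local[OF g, of 0 b] pd(2) r by simp
  qed
  ultimately show ?thesis by blast
 qed
 have "openin X ?S"
 proof (subst openin_subopen, intro ballI)
  fix x assume x: "x \<in> ?S"
  then obtain N where N: "openin X N" "x \<in> N" "\<forall>y\<in>N. zprel x y" using nb by blast
  then have "N \<subseteq> topspace X" using openin_subset by blast
  then have "N \<subseteq> ?S" using zprel_trans[of p x] N x pq by blast
  then show "\<exists>T. openin X T & x \<in> T & T \<subseteq> ?S" using N by blast
 qed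
 moreover have "openin X (topspace X - ?S)"
 proof (subst openin_subopen, intro ballI)
  fix x assume x: "x \<in> topspace X - ?S"
  then obtain N where N: "openin X N" "x \<in> N" "\<forall>y\<in>N. zprel x y" using nb by blast
  then have "N \<subseteq> topspace X" using openin_subset by blast
  then have "N \<subseteq> topspace X - ?S" using zprel_trans[of p _ x] zprel_sym N x pq by blast
  then show "\<exists>T. openin X T & x \<in> T & T \<subseteq> topspace X - ?S" using N by blast
 qed
 then have "closedin X ?S" by (auto simp: closedin_def)
 moreover have "p \<in> ?S" using pq by (auto simp: zprel_def)
 ultimately have "?S = topspace X" using con unfolding connected_space_clopen_in by blast
 then show ?thesis using pq by blast
qed

text \<open>Filling one of several punctures halves the number of classes.\<close>

lemma fill_puncture:
 assumes con: "connected_space X" and P: "finite P" "P \<subseteq> topspace X" "q \<in> P" and p: "p \<in> topspace X" "p ~: P"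
 shows "sqcard (subtopology X (topspace X - insert p P)) k \<longleftrightarrow>
   (\<exists>l. sqcard (subtopology X (topspace X - P)) l & k = 2 * l)"
proof -
 have X: "Hausdorff_space X" using rs unfolding riemann_surface_def by blast
 have "p ~= q" using P p by blast
 then obtain R where R: "cs (subtopology X (topspace X - {p, q})) R" "zer p R"
  using zprel_all[OF con p(1), of q] P unfolding zprel_def by blast
 obtain r g where g: "hdisc A p r g" "g ` ball 0 r \<subseteq> topspace X - P"
  by (rule hdisc_exists[of "topspace X - P" p]) (use openin_minus_finite[OF P(1)] p in auto)
 note pd = hdisc_pdisc[OF g(1)]
 obtain L where L: "L ~= 0" "((%w. R (g w) / w) \<longlongrightarrow> L) (at 0)"
  by (rule zer_disc[OF R(2) g(1)])
 have "closedin X P" using X P by (meson Hausdorff_imp_t1_space t1_space_closedin_finite)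
 moreover have "cs (subtopology X (topspace X - insert (g 0) P)) R"
  by (rule cs_sub[OF R(1)]) (use P pd in auto)
 ultimately show ?thesis
  using punctured_filling[OF X pd(1) _ _ _ L(2,1), of P k] g(2) pd(2) by auto
qed

end

section \<open>Cellulations\<close>

text \<open>The maximum norm, whose unit ball is the square \<open>Sq\<close>. Squares serve as
  models of cells rather than round discs because affine maps cut them in halves.\<close>

definition supn :: "complex => real" where
 "supn z = max \<bar>Re z\<bar> \<bar>Im z\<bar>"

definition Sq :: "complex set" where
 "Sq = {z. supn z <= 1}"

lemma continuous_on_supn [continuous_intros]: "continuous_on S f ==> continuous_on S (%x. supn (f x))"
 unfolding supn_def by (intro continuous_intros)

lemma supn_ge_0 [simp]: "0 <= supn z"
 by (simp add: supn_def)

lemma supn_eq_0 [simp]: "supn z = 0 \<longleftrightarrow> z = 0"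
 by (auto simp: supn_def complex_eq_iff max_def split: if_splits)

lemma supn_zero [simp]: "supn 0 = 0"
 by (simp add: supn_def)

lemma supn_scale: "supn (of_real t * z) = \<bar>t\<bar> * supn z"
 by (simp add: supn_def abs_mult max_mult_distrib_left)

lemma supn_divide: "supn (z / of_real t) = supn z / \<bar>t\<bar>"
proof -
 have "z / of_real t = of_real (1 / t) * z" by simp
 then show ?thesis using supn_scale[of "1/t" z] by (simp add: field_simps)
qed

lemma supn_pos [simp]: "0 < supn z \<longleftrightarrow> z ~= 0"
 using supn_ge_0[of z] supn_eq_0[of z] by linarith

lemma compact_Sq: "compact Sq"
proof -
 have "Sq = cbox (Complex (-1) (-1)) (Complex 1 1)"
  unfolding Sq_def supn_def by (auto simp: in_cbox_complex_iff)
 then show ?thesis by (metis compact_cbox)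
qed

lemma zero_in_Sq [simp]: "0 \<in> Sq"
 by (simp add: Sq_def)

text \<open>The closed cell is embedded together with its boundary and meets G in the boundary only;
  how G was assembled from arcs along that boundary is left open.\<close>

definition cell :: "'a topology => 'a set => (complex => 'a) => bool" where
 "cell X G kp \<longleftrightarrow> continuous_map (top_of_set Sq) X kp & inj_on kp Sq & (\<forall>z\<in>Sq. kp z \<in> G \<longleftrightarrow> supn z = 1)"

text \<open>The Euler characteristic of the cellulated surface is \<open>e + card K\<close>.\<close>

definition cellulation :: "'a topology => 'a set => int => (complex => 'a) set => bool" where
 "cellulation X G e K \<longleftrightarrow> graph X G e & finite K & (\<forall>kp\<in>K. cell X G kp) &
   (\<forall>kp\<in>K. \<forall>kp'\<in>K. \<forall>z\<in>Sq. \<forall>z'\<in>Sq. kp z = kp' z' --> kp z ~: G --> kp = kp') &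
   topspace X = G Un (\<Union>kp\<in>K. kp ` Sq)"

section \<open>Square classes of a cellulated surface\<close>

text \<open>On the punctured square f and the function continued along rays from its boundary values
  have the same winding number, so they differ by an exponential. The normalisation h = 0 on the
  boundary allows roots to be pasted there.\<close>

lemma radial_log:
 assumes f: "continuous_on (Sq - {0}) f" "!!w. w \<in> Sq - {0} ==> f w ~= (0::complex)"
 obtains h where "continuous_on (Sq - {0}) h" "!!w. w \<in> Sq - {0} ==> f w = f (w / of_real (supn w)) * exp (h w)"
  "!!w. supn w = 1 ==> h w = 0"
proof -
 \<comment> \<open>Radial retraction onto the square extends f to a punctured round disc; radius 3
   suffices since points of \<open>Sq\<close> have norm at most 2.\<close>
 let ?rh = "%w. w / of_real (max 1 (supn w))"
 have rh: "?rh w \<in> Sq - {0}" if "w ~= 0" for w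
  using that by (auto simp: Sq_def supn_divide)
 define F where "F w = f (?rh w)" for w
 have "continuous_on (ball 0 3 - {0}) F"
  unfolding F_def
  by (rule continuous_on_compose2[OF f(1)]) (use rh in \<open>auto intro!: continuous_intros\<close>)
 moreover have "F w ~= 0" if "w \<in> ball 0 3 - {0}" for w using f(2)[OF rh] that unfolding F_def by auto
 ultimately obtain k h where h: "continuous_on (ball 0 3 - {0}) h" "!!w. w \<in> ball 0 3 - {0} ==> F w = w powi k * exp (h w)"
  using punctured_disc_log[of 3 F] by (metis zero_less_numeral)
 have b: "w \<in> ball 0 3 - {0}" if "w \<in> Sq - {0}" for w
 proof -
  have "norm w <= \<bar>Re w\<bar> + \<bar>Im w\<bar>" by (rule cmod_le)
  then show ?thesis using that by (auto simp: Sq_def supn_def)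
 qed
 have n: "w / of_real (supn w) \<in> Sq - {0}" if "w \<in> Sq - {0}" for w using that by (auto simp: Sq_def supn_divide)
 have Ff: "F w = f w" if "w \<in> Sq - {0}" for w
 proof -
  have "max 1 (supn w) = 1" using that by (simp add: Sq_def)
  then show ?thesis unfolding F_def by simp
 qed
 \<comment> \<open>The factor \<open>supn w\<close> between w and its projection to the boundary
   contributes k ln(\<open>supn w\<close>) to the logarithm.\<close>
 define H where "H w = of_real (ln (supn w)) * of_int k + h w - h (w / of_real (supn w))" for w
 show thesis
 proof
  show "continuous_on (Sq - {0}) H"
   unfolding H_def
  proof (intro continuous_intros)
   show "continuous_on (Sq - {0}) h" by (rule continuous_on_subset[OF h(1)]) (use b in blast)
   show "continuous_on (Sq - {0}) (%w. h (w / complex_of_real (supn w)))"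
    by (rule continuous_on_compose2[OF h(1)]) (use b[OF n] in \<open>auto intro!: continuous_intros\<close>)
  qed auto
  show "f w = f (w / of_real (supn w)) * exp (H w)" if w: "w \<in> Sq - {0}" for w
  proof -
   let ?s = "complex_of_real (supn w)"
   have s: "exp (of_real (ln (supn w))) = ?s" using w by (metis DiffE exp_ln exp_of_real insertCI supn_pos)
   have s0: "?s ~= 0" using w by simp
   have "f (w / ?s) * exp (H w) = (w / ?s) powi k * exp (h (w / ?s)) * (?s powi k * (exp (h w) / exp (h (w / ?s))))"
    using Ff[OF n[OF w]] h(2)[OF b[OF n[OF w]]] unfolding H_def exp_add exp_diff
    by (simp add: exp_power_int[symmetric] s mult.commute[of _ "of_int k"])
   also have "\<dots> = ((w / ?s) powi k * ?s powi k) * exp (h w)" by simp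
   also have "(w / ?s) powi k * ?s powi k = w powi k" using s0 by (simp add: power_int_mult_distrib[symmetric])
   finally show ?thesis using Ff[OF w] h(2)[OF b[OF w]] by simp
  qed
  show "H w = 0" if "supn w = 1" for w using that by (simp add: H_def)
 qed
qed

text \<open>The cell without its centre retracts radially onto its boundary, which lies in Z:
  functions are extended along rays, and \<open>radial_log\<close> shows that square roots extend as
  well.\<close>

lemma cell_fill:
 assumes X: "Hausdorff_space X" and kp: "continuous_map (top_of_set Sq) X kp" "inj_on kp Sq"
  and Z: "Z \<subseteq> topspace X" "!!z. z \<in> Sq ==> kp z \<in> Z \<longleftrightarrow> supn z = 1"
  and cl: "closedin (subtopology X (Z Un kp ` (Sq - {0}))) Z"
 shows "sqcard (subtopology X Z) k \<longleftrightarrow> sqcard (subtopology X (Z Un kp ` (Sq - {0}))) k"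
proof -
 let ?A = "kp ` (Sq - {0})" let ?Y = "Z Un kp ` (Sq - {0})" let ?C = "{z. supn z = 1}"
 have CS: "?C \<subseteq> Sq - {0}" by (auto simp: Sq_def)
 then have CS': "?C \<subseteq> Sq" by blast
 have As: "?A \<subseteq> topspace X" using kp(1) by (auto simp: continuous_map_def)
 have clS: "closedin X (kp ` Sq)" by (rule compact_inj_embedding(2)[OF X compact_Sq kp])
 have k0: "kp 0 ~: ?Y"
 proof
  assume "kp 0 \<in> ?Y"
  then consider "kp 0 \<in> Z" | z where "z \<in> Sq - {0}" "kp 0 = kp z" by auto
  then show False
  proof cases
   case 1 then show False using Z(2)[of 0] by simp
  next
   case 2 then show False using kp(2) by (auto simp: inj_on_def)
  qed
 qed
 have "?A = kp ` Sq Int ?Y"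
 proof
  show "kp ` Sq Int ?Y \<subseteq> ?A"
  proof
   fix x assume x: "x \<in> kp ` Sq Int ?Y"
   then obtain z where z: "z \<in> Sq" "x = kp z" by blast
   then have "z ~= 0" using x k0 by auto
   then show "x \<in> ?A" using z by blast
  qed
 qed blast
 then have clA: "closedin (subtopology X ?Y) ?A" using clS by (metis closedin_subtopology)
 have csA: "cs (subtopology X (kp ` D)) g \<longleftrightarrow> continuous_on D (g \<circ> kp) & (\<forall>d\<in>D. g (kp d) ~= 0)" if "D \<subseteq> Sq" for g D
  by (rule cs_on_image_iff[OF X compact_Sq kp that])
 define \<iota> where "\<iota> = inv_into Sq kp"
 have \<iota>: "\<iota> (kp z) = z" if "z \<in> Sq" for z using that kp(2) unfolding \<iota>_def by simp
 let ?n = "%w. w / of_real (supn w)"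
 have n: "supn (?n w) = 1" if "w \<in> Sq - {0}" for w using that by (simp add: supn_divide)
 have ZC: "kp ` ?C \<subseteq> Z" using Z(2) CS' by auto
 have bd: "cs (subtopology X ?A) (%x. F (kp (?n (\<iota> x))))" if F: "cs (subtopology X Z) F" for F
 proof -
  have c: "continuous_on ?C (F \<circ> kp)" "!!d. d \<in> ?C ==> F (kp d) ~= 0"
   using cs_sub[OF F ZC] unfolding csA[OF CS'] by auto
  have "continuous_on (Sq - {0}) (%w. (F \<circ> kp) (?n w))"
   by (rule continuous_on_compose2[OF c(1)]) (use n in \<open>auto intro!: continuous_intros\<close>)
  then have "continuous_on (Sq - {0}) ((%x. F (kp (?n (\<iota> x)))) \<circ> kp)"
   by (rule continuous_on_eq) (use \<iota> in auto)
  then show ?thesis unfolding csA[OF Diff_subset] using c(2) n \<iota> by auto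
 qed
 have on: "z \<in> Sq ==> kp z \<in> Z ==> ?n z = z" for z using Z(2) by simp
 show ?thesis
 proof (rule sqcard_restrict_bij)
  fix F assume F: "cs (subtopology X Z) F"
  have "cs (subtopology X ?Y) (%x. if x \<in> Z then F x else F (kp (?n (\<iota> x))))"
  proof (rule cs_paste2[OF Z(1) As cl clA F bd[OF F]])
   fix x assume "x \<in> Z" "x \<in> ?A"
   then obtain z where "z \<in> Sq" "x = kp z" "kp z \<in> Z" by blast
   then show "F x = F (kp (?n (\<iota> x)))" using \<iota> on by simp
  qed
  moreover have "sqeq (subtopology X Z) (%x. if x \<in> Z then F x else F (kp (?n (\<iota> x)))) F"
   by (rule sqeq_cong) auto
  ultimately show "\<exists>F'. cs (subtopology X ?Y) F' & sqeq (subtopology X Z) F' F" by blast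
 next
  fix F assume F: "cs (subtopology X ?Y) F" "sqeq (subtopology X Z) F (%x. 1)"
  obtain S where S: "cs (subtopology X Z) S" "!!x. x \<in> Z ==> F x = 1 * (S x)\<^sup>2"
   using sqeq_subE[OF F(2) Z(1)] by blast
  have "cs (subtopology X ?A) F" by (rule cs_sub[OF F(1)]) blast
  then have Fk: "continuous_on (Sq - {0}) (F \<circ> kp)" "!!d. d \<in> Sq - {0} ==> (F \<circ> kp) d ~= 0"
   unfolding csA[OF Diff_subset] by auto
  obtain h where h: "continuous_on (Sq - {0}) h" "!!w. w \<in> Sq - {0} ==> (F \<circ> kp) w = (F \<circ> kp) (?n w) * exp (h w)"
   "!!w. supn w = 1 ==> h w = 0" using radial_log[OF Fk] by blast
  have "continuous_on (Sq - {0}) ((%x. exp (h (\<iota> x) / 2)) \<circ> kp)"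
   by (rule continuous_on_eq[of _ "%w. exp (h w / 2)"]) (use \<iota> h(1) in \<open>auto intro!: continuous_intros\<close>)
  then have E: "cs (subtopology X ?A) (%x. exp (h (\<iota> x) / 2))" unfolding csA[OF Diff_subset] by auto
  show "sqeq (subtopology X ?Y) F (%x. 1)"
  proof (rule sqeq_paste2[OF Z(1) As cl clA S cs_mult[OF bd[OF S(1)] E]])
   fix x assume "x \<in> ?A"
   then obtain z where z: "z \<in> Sq - {0}" "x = kp z" by blast
   have nz: "kp (?n z) \<in> Z" using ZC n[OF z(1)] by blast
   have "F x = F (kp (?n z)) * exp (h z)" using h(2)[OF z(1)] z(2) by simp
   also have "\<dots> = (S (kp (?n z)) * exp (h z / 2))\<^sup>2" using S(2)[OF nz] by (simp add: power_mult_distrib exp_double[symmetric])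
   finally show "F x = 1 * (S (kp (?n (\<iota> x))) * exp (h (\<iota> x) / 2))\<^sup>2" using z \<iota> by simp
  next
   fix x assume "x \<in> Z" "x \<in> ?A"
   then obtain z where z: "z \<in> Sq" "x = kp z" "kp z \<in> Z" by blast
   then have "h z = 0" "?n z = z" using h(3) Z(2) on by auto
   then show "S x = S (kp (?n (\<iota> x))) * exp (h (\<iota> x) / 2)" using \<iota> z by simp
  qed
 qed blast
qed

lemma cellulation_punctured:
 assumes X: "Hausdorff_space X" and c: "cellulation X G e K"
 shows "sqcard (subtopology X G) k \<longleftrightarrow> sqcard (subtopology X (topspace X - (%kp. kp 0) ` K)) k"
proof -
 have gr: "graph X G e" and fin: "finite K" and ce: "!!kp. kp \<in> K ==> cell X G kp"
  and dis: "!!kp kp' z z'. kp \<in> K ==> kp' \<in> K ==> z \<in> Sq ==> z' \<in> Sq ==> kp z = kp' z' ==> kp z ~: G ==> kp = kp'"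
  and top: "topspace X = G Un (\<Union>kp\<in>K. kp ` Sq)"
  using c unfolding cellulation_def by blast+
 have G: "closedin X G" using graphext_closed[OF X gr] by simp
 have cl: "closedin X (kp ` Sq)" if "kp \<in> K" for kp
  using compact_inj_embedding(2)[OF X compact_Sq] ce[OF that] unfolding cell_def by blast
 have "sqcard (subtopology X G) k \<longleftrightarrow> sqcard (subtopology X (G Un (\<Union>kp\<in>L. kp ` (Sq - {0})))) k" if "finite L" "L \<subseteq> K" for L
  using that
 proof (induction L rule: finite_induct)
  case (insert kp L)
  let ?Z = "G Un (\<Union>kp\<in>L. kp ` (Sq - {0}))"
  have kpK: "kp \<in> K" and LK: "L \<subseteq> K" using insert by auto
  have ck: "continuous_map (top_of_set Sq) X kp" "inj_on kp Sq" "!!z. z \<in> Sq ==> kp z \<in> G \<longleftrightarrow> supn z = 1"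
   using ce[OF kpK] unfolding cell_def by auto
  have notL: "kp z ~: kp' ` Sq" if "z \<in> Sq" "kp z ~: G" "kp' \<in> L" for z kp'
  proof
   assume "kp z \<in> kp' ` Sq"
   then obtain z' where "z' \<in> Sq" "kp z = kp' z'" by blast
   then have "kp = kp'" using dis[OF kpK _ that(1)] that LK by blast
   then show False using that insert.hyps by blast
  qed
  have "sqcard (subtopology X ?Z) k \<longleftrightarrow> sqcard (subtopology X (?Z Un kp ` (Sq - {0}))) k"
  proof (rule cell_fill[OF X ck(1,2)])
   show "?Z \<subseteq> topspace X" using top LK by auto
   show "kp z \<in> ?Z \<longleftrightarrow> supn z = 1" if "z \<in> Sq" for z
    using ck(3)[OF that] notL[OF that] by blast
   \<comment> \<open>Z is closed in the larger set because it is the trace of the closed set in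
     which the earlier cells keep their centres.\<close>
   have "?Z = (G Un (\<Union>kp\<in>L. kp ` Sq)) Int (?Z Un kp ` (Sq - {0}))"
   proof (intro equalityI subsetI)
    fix x assume x: "x \<in> (G Un (\<Union>kp\<in>L. kp ` Sq)) Int (?Z Un kp ` (Sq - {0}))"
    show "x \<in> ?Z"
    proof (rule ccontr)
     assume nx: "x ~: ?Z"
     then obtain z where z: "z \<in> Sq" "x = kp z" using x by blast
     then show False using notL[of z] x nx by blast
    qed
   qed blast
   moreover have "closedin X (G Un (\<Union>kp\<in>L. kp ` Sq))"
   proof -
    have "closedin X (\<Union>kp\<in>L. kp ` Sq)"
     by (rule closedin_Union) (use insert.hyps cl LK in auto)
    then show ?thesis using G by (intro closedin_Un)
   qed
   ultimately show "closedin (subtopology X (?Z Un kp ` (Sq - {0}))) ?Z" by (metis closedin_subtopology)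
  qed
  moreover have "?Z Un kp ` (Sq - {0}) = G Un (\<Union>kp\<in>insert kp L. kp ` (Sq - {0}))" by auto
  ultimately show ?case using insert.IH LK by simp
 qed simp
 from this[OF fin subset_refl]
 have "sqcard (subtopology X G) k \<longleftrightarrow> sqcard (subtopology X (G Un (\<Union>kp\<in>K. kp ` (Sq - {0})))) k" .
 moreover have "G Un (\<Union>kp\<in>K. kp ` (Sq - {0})) = topspace X - (%kp. kp 0) ` K"
 proof (intro equalityI subsetI)
  fix x assume x: "x \<in> G Un (\<Union>kp\<in>K. kp ` (Sq - {0}))"
  have "x ~= kp 0" if k: "kp \<in> K" for kp
  proof
   assume xk: "x = kp 0"
   have "kp 0 ~: G" using ce[OF k] unfolding cell_def by auto
   then obtain kp' z where z: "kp' \<in> K" "z \<in> Sq - {0}" "x = kp' z" using x xk by blast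
   then have "kp = kp'" using dis[OF k z(1), of 0 z] xk \<open>kp 0 ~: G\<close> by auto
   then have "kp 0 = kp z" using z xk by simp
   then show False using ce[OF k] z unfolding cell_def by (auto simp: inj_on_def)
  qed
  then show "x \<in> topspace X - (%kp. kp 0) ` K" using x top by auto
 next
  fix x assume x: "x \<in> topspace X - (%kp. kp 0) ` K"
  then consider "x \<in> G" | kp z where "kp \<in> K" "z \<in> Sq" "x = kp z" using top by blast
  then show "x \<in> G Un (\<Union>kp\<in>K. kp ` (Sq - {0}))"
  proof cases
   case (2 kp z)
   then have "z ~= 0" using x by auto
   then show ?thesis using 2 by blast
  qed simp
 qed
 ultimately show ?thesis by simp
qed

lemma connected_supn_circle: "connected {z. supn z = 1}"
proof -
 have "{z. supn z = 1} = (%w. w / of_real (supn w)) ` (- {0})"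
 proof (intro equalityI subsetI)
  fix z assume "z \<in> {z. supn z = 1}"
  then show "z \<in> (%w. w / of_real (supn w)) ` (- {0})" by (intro image_eqI[of _ _ z]) auto
 qed (auto simp: supn_divide split: if_splits)
 moreover have "connected (- {0 :: complex})" by (rule connected_punctured_universe) simp
 moreover have "continuous_on (- {0 :: complex}) (%w. w / of_real (supn w))"
  by (intro continuous_intros) auto
 ultimately show ?thesis using connected_continuous_image by metis
qed

text \<open>A clopen subset of the graph contains the boundary of each cell wholly or not at all, as
  the boundary is connected. Together with the cells that it bounds it is a clopen subset of
  X.\<close>

lemma cellulation_connected:
 assumes X: "Hausdorff_space X" "connected_space X" and c: "cellulation X G e K" and ne: "K ~= {}"
 shows "card (clp (subtopology X G)) = 2"
proof -
 have gr: "graph X G e" and fin: "finite K" and ce: "!!kp. kp \<in> K ==> cell X G kp"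
  and top: "topspace X = G Un (\<Union>kp\<in>K. kp ` Sq)"
  using c unfolding cellulation_def by blast+
 have G: "closedin X G" using graphext_closed[OF X(1) gr] by simp
 have cl: "closedin X (kp ` Sq)" if "kp \<in> K" for kp
  using compact_inj_embedding(2)[OF X(1) compact_Sq] ce[OF that] unfolding cell_def by blast
 let ?C = "{z. supn z = 1}"
 have CS: "?C \<subseteq> Sq" by (auto simp: Sq_def)
 have triv: "U = {} | U = G" if U: "U \<in> clp (subtopology X G)" for U
 proof -
  have U': "U \<subseteq> G" "closedin X U" "closedin X (G - U)" using U unfolding clp_sub_iff[OF G] by auto
  have bd: "kp ` ?C \<subseteq> U | kp ` ?C \<subseteq> G - U" if k: "kp \<in> K" for kp
  proof -
   have kc: "continuous_map (top_of_set Sq) X kp" using ce[OF k] unfolding cell_def by blast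
   have "connectedin X (kp ` ?C)"
    by (rule connectedin_continuous_map_image[OF kc]) (use CS connected_supn_circle in \<open>simp add: connectedin_subtopology\<close>)
   then have "~ (closedin X U & closedin X (G - U) & kp ` ?C \<subseteq> U Un (G - U) & U Int (G - U) Int kp ` ?C = {} & U Int kp ` ?C ~= {} & (G - U) Int kp ` ?C ~= {})"
    unfolding connectedin_closedin by blast
   moreover have "kp ` ?C \<subseteq> G" using ce[OF k] CS unfolding cell_def by auto
   ultimately show ?thesis using U' by blast
  qed
  define E where "E V = V Un (\<Union>kp\<in>{kp\<in>K. kp ` ?C \<subseteq> V}. kp ` Sq)" for V
  have clE: "closedin X (E V)" if "closedin X V" for V
  proof -
   have "closedin X (\<Union>kp\<in>{kp\<in>K. kp ` ?C \<subseteq> V}. kp ` Sq)" by (rule closedin_Union) (use fin cl in auto)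
   then show ?thesis unfolding E_def using that by (intro closedin_Un)
  qed
  have un: "E U Un E (G - U) = topspace X" unfolding top
  proof (intro equalityI subsetI)
   fix x assume "x \<in> G Un (\<Union>kp\<in>K. kp ` Sq)"
   then consider "x \<in> G" | kp where "kp \<in> K" "x \<in> kp ` Sq" by blast
   then show "x \<in> E U Un E (G - U)"
   proof cases
    case (2 kp) then show ?thesis using bd[OF 2(1)] unfolding E_def by blast
   qed (auto simp: E_def)
  qed (use U' in \<open>auto simp: E_def\<close>)
  have c1: "1 \<in> ?C" by (simp add: supn_def)
  have EG: "E V Int G = V" if "V \<subseteq> G" for V
  proof (intro equalityI subsetI)
   fix x assume x: "x \<in> E V Int G"
   show "x \<in> V"
   proof (rule ccontr)
    assume "x ~: V"
    then obtain kp z where k: "kp \<in> K" "kp ` ?C \<subseteq> V" "z \<in> Sq" "x = kp z" using x unfolding E_def by blast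
    then have "supn z = 1" using x ce[OF k(1)] unfolding cell_def by auto
    then show False using k \<open>x ~: V\<close> by blast
   qed
  qed (use that in \<open>auto simp: E_def\<close>)
  have "E U Int E (G - U) = {}"
  proof (rule ccontr)
   assume "E U Int E (G - U) ~= {}"
   then obtain x where x: "x \<in> E U" "x \<in> E (G - U)" by blast
   show False
   proof (cases "x \<in> G")
    case True
    then show False using x EG[of U] EG[of "G - U"] U' by blast
   next
    case False
    then obtain kp z kp' z' where k: "kp \<in> K" "kp ` ?C \<subseteq> U" "z \<in> Sq" "x = kp z"
     "kp' \<in> K" "kp' ` ?C \<subseteq> G - U" "z' \<in> Sq" "x = kp' z'" using x U' unfolding E_def by blast
    then have "kp = kp'" using c False unfolding cellulation_def by metis
    then show False using k c1 by blast
   qed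
  qed
  then have "E U = topspace X - E (G - U)" using un by blast
  then have "openin X (E U)" using openin_diff[OF openin_topspace clE[OF U'(3)]] by argo
  then have "E U = {} | E U = topspace X" using clE[OF U'(2)] X(2) unfolding connected_space_clopen_in by blast
  then show ?thesis using EG[OF U'(1)] top by blast
 qed
 obtain kp where "kp \<in> K" using ne by blast
 then have "kp 1 \<in> G" using ce unfolding cell_def by (auto simp: Sq_def supn_def)
 then have "G ~= {}" by blast
 have "{} \<in> clp (subtopology X G)" "G \<in> clp (subtopology X G)" unfolding clp_sub_iff[OF G] using G by auto
 then have "clp (subtopology X G) = {{}, G}" using triv by blast
 then show ?thesis using \<open>G ~= {}\<close> by simp
qed

text \<open>The graph is connected, so it has 2^(1 - e) classes, and so has X without the centres of
  all cells. Filling all of these but one halves the count \<open>card K - 1\<close> times.\<close>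

theorem cellulation_sqcard:
 assumes rs: "riemann_surface X A" and con: "connected_space X" and c: "cellulation X G e K" and ne: "K ~= {}"
  and p: "p \<in> topspace X"
 shows "\<exists>b. sqcard (subtopology X (topspace X - {p})) (2 ^ b) & int b = 2 - e - int (card K)"
proof -
 have X: "Hausdorff_space X" using rs unfolding riemann_surface_def by blast
 have gr: "graph X G e" and fin: "finite K" and ce: "!!kp. kp \<in> K ==> cell X G kp"
  and dis: "!!kp kp' z z'. kp \<in> K ==> kp' \<in> K ==> z \<in> Sq ==> z' \<in> Sq ==> kp z = kp' z' ==> kp z ~: G ==> kp = kp'"
  and top: "topspace X = G Un (\<Union>kp\<in>K. kp ` Sq)"
  using c unfolding cellulation_def by blast+
 obtain m r where mr: "card (clp (subtopology X G)) = 2 ^ m" "sqcard (subtopology X G) (2 ^ r)" "e = int m - int r"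
  using graph_euler[OF X gr] unfolding euler_def by blast
 have "(2::nat) ^ m = 2 ^ 1" using cellulation_connected[OF X con c ne] mr(1) by simp
 then have m: "m = 1" by (simp only: power_inject_exp)
 let ?c = "%kp. kp (0 :: complex)"
 have inj: "inj_on ?c K"
 proof (rule inj_onI)
  fix kp kp' assume k: "kp \<in> K" "kp' \<in> K" "?c kp = ?c kp'"
  have "kp 0 ~: G" using ce[OF k(1)] unfolding cell_def by auto
  then show "kp = kp'" using dis[OF k(1,2), of 0 0] k(3) by simp
 qed
 let ?P = "?c ` K"
 have PT: "?P \<subseteq> topspace X" using top by auto
 have P: "sqcard (subtopology X (topspace X - ?P)) (2 ^ r)" using cellulation_punctured[OF X c] mr(2) by blast
 have fill: "\<exists>b. sqcard (subtopology X (topspace X - {q})) (2 ^ b) & b + card Q = s"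
  if "finite Q" "Q \<subseteq> topspace X" "q \<in> topspace X" "q ~: Q" "sqcard (subtopology X (topspace X - insert q Q)) (2 ^ s)" for q Q s
  using that
 proof (induction Q arbitrary: s rule: finite_induct)
  case (insert x Q)
  have "insert q (insert x Q) = insert x (insert q Q)" by auto
  then have "sqcard (subtopology X (topspace X - insert x (insert q Q))) (2 ^ s)" using insert.prems by simp
  then obtain l where l: "sqcard (subtopology X (topspace X - insert q Q)) l" "2 ^ s = 2 * l"
   using fill_puncture[OF rs con, of "insert q Q" q x "2 ^ s"] insert by auto
  then obtain s' where s': "s = Suc s'" by (cases s) auto
  then have "sqcard (subtopology X (topspace X - insert q Q)) (2 ^ s')" using l by simp
  then obtain b where "sqcard (subtopology X (topspace X - {q})) (2 ^ b)" "b + card Q = s'"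
   using insert.IH insert.prems by auto
  then show ?case using s' insert.hyps by auto
 qed auto
 obtain kp where k: "kp \<in> K" using ne by blast
 have eP: "insert (?c kp) (?P - {?c kp}) = ?P" using k by auto
 have kT: "?c kp \<in> topspace X" using PT k by blast
 have "\<exists>b. sqcard (subtopology X (topspace X - {?c kp})) (2 ^ b) & b + card (?P - {?c kp}) = r"
 proof (rule fill)
  show "sqcard (subtopology X (topspace X - insert (?c kp) (?P - {?c kp}))) (2 ^ r)" unfolding eP by (rule P)
 qed (use fin PT kT in auto)
 then obtain b where b: "sqcard (subtopology X (topspace X - {?c kp})) (2 ^ b)" "b + card (?P - {?c kp}) = r"
  by blast
 have "card ?P = card K" by (rule card_image[OF inj])
 moreover have "card ?P = Suc (card (?P - {?c kp}))" by (rule card.remove) (use fin k in auto)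
 ultimately have bK: "b + card K = Suc r" using b(2) by simp
 have "sqcard (subtopology X (topspace X - {p})) (2 ^ b)"
 proof (cases "p = ?c kp")
  case False
  \<comment> \<open>The remaining puncture is moved to p: removing p as well doubles the count, and
    filling the old puncture halves it again.\<close>
  have "sqcard (subtopology X (topspace X - insert p {?c kp})) (2 * 2 ^ b)"
   using fill_puncture[OF rs con, of "{?c kp}" "?c kp" p "2 * 2 ^ b"] b(1) p kT False by auto
  then have "sqcard (subtopology X (topspace X - insert (?c kp) {p})) (2 * 2 ^ b)" by (simp add: insert_commute)
  then show ?thesis using fill_puncture[OF rs con, of "{p}" p "?c kp" "2 * 2 ^ b"] p kT False by auto
 qed (use b in simp)
 moreover have "int b = 2 - e - int (card K)" using bK mr(3) m by simp
 ultimately show ?thesis by blast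
qed

corollary cellulation_euler_unique:
 assumes rs: "riemann_surface X A" and con: "connected_space X" and "cellulation X G e K" "K ~= {}"
  and "cellulation X G' e' K'" "K' ~= {}"
 shows "e + int (card K) = e' + int (card K')"
proof -
 obtain kp where "kp \<in> K" using assms by blast
 moreover have "topspace X = G Un (\<Union>kp\<in>K. kp ` Sq)" using assms(3) unfolding cellulation_def by blast
 ultimately have p: "kp 0 \<in> topspace X" using zero_in_Sq by blast
 obtain b where b: "sqcard (subtopology X (topspace X - {kp 0})) (2 ^ b)" "int b = 2 - e - int (card K)"
  using cellulation_sqcard[OF rs con assms(3,4) p] by blast
 obtain b' where b': "sqcard (subtopology X (topspace X - {kp 0})) (2 ^ b')" "int b' = 2 - e' - int (card K')"
  using cellulation_sqcard[OF rs con assms(5,6) p] by blast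
 have "(2::nat) ^ b = 2 ^ b'" by (rule sqcard_unique[OF b(1) b'(1)])
 then have "b = b'" by simp
 then show ?thesis using b b' by simp
qed

section \<open>Local form of holomorphic maps\<close>

lemma chart_intro:
 assumes "openin X U" "open V" "continuous_map (subtopology X U) euclidean ph" "ph ` U = V"
  "continuous_map (top_of_set V) X g" "!!x. x \<in> U ==> g (ph x) = x"
 shows "complex_chart X (U, ph)"
proof -
 have U: "U \<subseteq> topspace X" using assms(1) openin_subset by blast
 have ts: "topspace (subtopology X U) = U" using U by auto
 have "homeomorphic_maps (subtopology X U) (top_of_set V) ph g"
  unfolding homeomorphic_maps_def ts
 proof (intro conjI ballI)
  show "continuous_map (subtopology X U) (top_of_set V) ph"
   using assms(3,4) U by (auto simp: continuous_map_in_subtopology)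
  show "continuous_map (top_of_set V) (subtopology X U) g"
   unfolding continuous_map_in_subtopology using assms(4,5,6) by auto
  show "g (ph x) = x" if "x \<in> U" for x using assms(6) that .
  show "ph (g y) = y" if "y \<in> topspace (top_of_set V)" for y
  proof -
   from that assms(4) obtain x where "x \<in> U" "y = ph x" by auto
   then show ?thesis using assms(6) by simp
  qed
 qed
 then have "homeomorphic_map (subtopology X U) (top_of_set V) ph" using homeomorphic_map_maps by blast
 then show ?thesis using assms(1,2,4) unfolding complex_chart_def by auto
qed

text \<open>An injective holomorphic map has a holomorphic inverse, so composing a chart with it
  preserves compatibility with every chart of the atlas.\<close>

lemma max_atlas_intro:
 assumes rs: "riemann_surface X A" and U: "(U, ph) \<in> A" and W: "open W" "W \<subseteq> ph ` U"
  and et: "et holomorphic_on W" "inj_on et W"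
 shows "({x \<in> U. ph x \<in> W}, et \<circ> ph) \<in> max_atlas X A"
proof -
 let ?U = "{x \<in> U. ph x \<in> W}"
 have c: "complex_chart X (U, ph)" by (rule atlas_chart[OF rs U])
 have inj: "inj_on ph U" by (rule chart_facts(3)[OF c])
 have phU: "ph ` ?U = W" using W by auto
 obtain g where g: "g holomorphic_on et ` W" "!!z. z \<in> W ==> g (et z) = z"
  by (rule holomorphic_has_inverse[OF et(1) W(1) et(2)]) blast
 have chart: "complex_chart X (?U, et \<circ> ph)"
 proof (rule chart_intro)
  show "openin X ?U" by (rule chart_facts(6)[OF c W(1)])
  show "open (et ` W)" by (rule open_mapping_thm3[OF et(1) W(1) et(2)])
  have "continuous_map (subtopology X ?U) euclidean ph"
   by (rule continuous_map_from_subtopology_mono[OF chart_facts(4)[OF c]]) auto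
  then have "continuous_map (subtopology X ?U) euclidean (%x. et (ph x))"
   by (rule continuous_map_comp_cont[OF _ _ holomorphic_on_imp_continuous_on[OF et(1)]]) auto
  then show "continuous_map (subtopology X ?U) euclidean (et \<circ> ph)" by (simp add: o_def)
  show "(et \<circ> ph) ` ?U = et ` W" unfolding image_comp[symmetric] phU ..
  have "continuous_on (et ` W) g" by (rule holomorphic_on_imp_continuous_on[OF g(1)])
  moreover have "g ` et ` W \<subseteq> ph ` U" using g(2) W by auto
  ultimately have "continuous_map (top_of_set (et ` W)) (top_of_set (ph ` U)) g"
   by (auto simp: continuous_map_in_subtopology)
  from continuous_map_compose[OF this chart_facts(5)[OF c]]
  show "continuous_map (top_of_set (et ` W)) X (inv_into U ph \<circ> g)" .
  show "(inv_into U ph \<circ> g) ((et \<circ> ph) x) = x" if "x \<in> ?U" for x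
   using that g(2) inj by simp
 qed
 have inj': "inj_on (et \<circ> ph) ?U" by (rule chart_facts(3)[OF chart])
 have "holo_compatible (?U, et \<circ> ph) d" if d: "d \<in> A" for d
 proof -
  obtain V ps where dV: "d = (V, ps)" by (cases d)
  have "holo_compatible (U, ph) (V, ps)" using rs U d dV unfolding riemann_surface_def by blast
  then have h: "(ps \<circ> inv_into U ph) holomorphic_on ph ` (U Int V)" "(ph \<circ> inv_into V ps) holomorphic_on ps ` (U Int V)"
   unfolding holo_compatible_def by auto
  have injV: "inj_on ps V" using chart_facts(3)[OF atlas_chart[OF rs d[unfolded dV]]] .
  have "(ps \<circ> inv_into ?U (et \<circ> ph)) holomorphic_on (et \<circ> ph) ` (?U Int V)"
  proof (rule holomorphic_transform)
   show "((ps \<circ> inv_into U ph) \<circ> g) holomorphic_on (et \<circ> ph) ` (?U Int V)"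
   proof (rule holomorphic_on_compose_gen[OF _ h(1)])
    show "g holomorphic_on (et \<circ> ph) ` (?U Int V)" by (rule holomorphic_on_subset[OF g(1)]) auto
    show "g ` (et \<circ> ph) ` (?U Int V) \<subseteq> ph ` (U Int V)" using g(2) by auto
   qed
   fix z assume "z \<in> (et \<circ> ph) ` (?U Int V)"
   then obtain x where x: "x \<in> ?U" "x \<in> V" "z = (et \<circ> ph) x" by blast
   have "inv_into ?U (et \<circ> ph) z = x" unfolding x(3) by (rule inv_into_f_f[OF inj' x(1)])
   moreover have "inv_into U ph (g z) = x" using x g(2) inj by simp
   ultimately show "((ps \<circ> inv_into U ph) \<circ> g) z = (ps \<circ> inv_into ?U (et \<circ> ph)) z" by simp
  qed
  moreover have "((et \<circ> ph) \<circ> inv_into V ps) holomorphic_on ps ` (?U Int V)"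
  proof -
   have "(et \<circ> (ph \<circ> inv_into V ps)) holomorphic_on ps ` (?U Int V)"
   proof (rule holomorphic_on_compose_gen[OF _ et(1)])
    show "(ph \<circ> inv_into V ps) holomorphic_on ps ` (?U Int V)" by (rule holomorphic_on_subset[OF h(2)]) auto
    show "(ph \<circ> inv_into V ps) ` ps ` (?U Int V) \<subseteq> W" using injV by auto
   qed
   then show ?thesis by (simp add: o_assoc)
  qed
  ultimately show ?thesis unfolding holo_compatible_def dV by simp
 qed
 then show ?thesis using chart unfolding max_atlas_def by blast
qed

lemma max_atlas_chart: "c \<in> max_atlas X A ==> complex_chart X c"
 unfolding max_atlas_def by blast

lemma centered_chart_exists:
 assumes rs: "riemann_surface X A" and p: "p \<in> topspace X"
 obtains U ph where "(U, ph) \<in> max_atlas X A" "p \<in> U" "ph p = 0"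
proof -
 obtain U ph where U: "(U, ph) \<in> A" "p \<in> U"
  using rs p unfolding riemann_surface_def by fastforce
 have "({x \<in> U. ph x \<in> ph ` U}, (%w. w - ph p) \<circ> ph) \<in> max_atlas X A"
 proof (rule max_atlas_intro[OF rs U(1)])
  show "open (ph ` U)" by (rule chart_facts(2)[OF atlas_chart[OF rs U(1)]])
 qed (auto intro!: holomorphic_intros inj_onI)
 then show thesis using that U by simp
qed

lemma local_power_formE:
 assumes "local_power_form X A Y B f p n"
 obtains U ph V ps where "(U, ph) \<in> max_atlas X A" "(V, ps) \<in> max_atlas Y B" "p \<in> U" "ph p = 0" "f p \<in> V" "ps (f p) = 0"
  "f ` U \<subseteq> V" "!!x. x \<in> U ==> ps (f x) = ph x ^ n"
proof -
 obtain c where c: "c \<in> max_atlas X A" "case c of (U, ph) => \<exists>(V, ps)\<in>max_atlas Y B.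
    chart_centered_at p (U, ph) & chart_centered_at (f p) (V, ps) &
    f ` U \<subseteq> V & (\<forall>x\<in>U. ps (f x) = ph x ^ n)"
  using assms unfolding local_power_form_def by (rule bexE)
 obtain U ph where cU: "c = (U, ph)" by (cases c)
 obtain d where d: "d \<in> max_atlas Y B" "case d of (V, ps) =>
    chart_centered_at p (U, ph) & chart_centered_at (f p) (V, ps) &
    f ` U \<subseteq> V & (\<forall>x\<in>U. ps (f x) = ph x ^ n)"
  using c(2) unfolding cU split by (rule bexE)
 obtain V ps where dV: "d = (V, ps)" by (cases d)
 show thesis
  using that[of U ph V ps] c(1) d unfolding cU dV split chart_centered_at_def by blast
qed

definition locconst :: "'a topology => ('a => 'b) => 'a => bool" where
 "locconst X f p \<longleftrightarrow> (\<exists>N. openin X N & p \<in> N & (\<forall>x\<in>N. f x = f p))"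

text \<open>The roots of (ep/2)^n all have modulus ep/2. Complete sets of roots in small discs serve
  to detect the exponent of a power form by counting.\<close>

lemma nth_roots_in_disc:
 assumes "n \<ge> 1" "ep > 0"
 obtains Z :: "complex set" and c where "c ~= 0" "card Z = n" "finite Z" "Z \<subseteq> ball 0 ep" "\<forall>z\<in>Z. z ^ n = c"
proof -
 let ?c = "complex_of_real ((ep/2) ^ n)"
 let ?Z = "{z. z ^ n = ?c}"
 have c0: "?c ~= 0" using assms by simp
 have card: "card ?Z = n" by (rule card_nth_roots[OF c0]) (use assms in simp)
 have "finite ?Z" by (rule card_ge_0_finite) (use card assms in simp)
 moreover have "?Z \<subseteq> ball 0 ep"
 proof
  fix z assume "z \<in> ?Z"
  then have zc: "z ^ n = ?c" by blast
  have "norm z ^ n = norm ?c" unfolding zc[symmetric] norm_power ..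
  also have "\<dots> = (ep/2) ^ n" unfolding norm_of_real using assms by simp
  finally have "norm z = ep/2" by (rule power_eq_imp_eq_base) (use assms in auto)
  then show "z \<in> ball 0 ep" using assms by simp
 qed
 ultimately show thesis using that[OF c0 card] by blast
qed

lemma power_less_iff: "0 <= a ==> 0 <= b ==> 0 < n ==> a ^ n < b ^ n \<longleftrightarrow> a < (b::real)"
 by (auto intro: power_strict_mono power_less_imp_less_base)

text \<open>Near every fibre the map is a disjoint union of power maps between discs, the exponents being
 given by \<open>N\<close>.\<close>

definition branched :: "'a topology => 'b topology => ('a => 'b) => ('a => nat) => bool" where
 "branched X Y f N \<longleftrightarrow> continuous_map X Y f & (\<forall>p\<in>topspace X. N p \<ge> 1) &
   (\<forall>q\<in>topspace Y. finite {p \<in> topspace X. f p = q} &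
    (\<exists>r h rh g. pdisc Y r h & h 0 = q &
     (\<forall>p\<in>{p \<in> topspace X. f p = q}. pdisc X (rh p) (g p) & g p 0 = p & rh p ^ N p = r &
      (\<forall>w\<in>ball 0 (rh p). f (g p w) = h (w ^ N p))) &
     (\<forall>p\<in>{p \<in> topspace X. f p = q}. \<forall>p'\<in>{p \<in> topspace X. f p = q}. p ~= p' -->
      g p ` ball 0 (rh p) Int g p' ` ball 0 (rh p') = {}) &
     (\<forall>x\<in>topspace X. f x \<in> h ` ball 0 r --> (\<exists>p\<in>{p \<in> topspace X. f p = q}. x \<in> g p ` ball 0 (rh p))) &
     (\<forall>x\<in>topspace X. f x \<in> h ` ball 0 r --> f x ~= q --> N x = 1)))"

lemma disjoint_neighbourhoods:
 assumes X: "Hausdorff_space X" and F: "finite F" "F \<subseteq> topspace X"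
 obtains W where "!!p. p \<in> F ==> openin X (W p) & p \<in> W p" "!!p p'. p \<in> F ==> p' \<in> F ==> p ~= p' ==> W p Int W p' = {}"
proof -
 have "\<exists>U V. openin X U & openin X V & p \<in> U & q \<in> V & U Int V = {}"
  if "p \<in> F" "q \<in> F" "p ~= q" for p q
 proof -
  have "p \<in> topspace X" "q \<in> topspace X" using that F by auto
  then show ?thesis using X that(3) unfolding Hausdorff_space_def disjnt_def by blast
 qed
 then obtain U V where UV: "!!p q. p \<in> F ==> q \<in> F ==> p ~= q ==>
   openin X (U p q) & openin X (V p q) & p \<in> U p q & q \<in> V p q & U p q Int V p q = {}"
  by metis
 define W where "W p = topspace X Int (\<Inter>q\<in>F - {p}. U p q Int V q p)" for p
 show thesis
 proof (rule that)
  fix p assume p: "p \<in> F"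
  have "openin X (U p q Int V q p)" if "q \<in> F - {p}" for q using UV[of p q] UV[of q p] p that by (intro openin_Int) auto
  then have "openin X (W p)" unfolding W_def
  proof (cases "F - {p} = {}")
   case False
   then have "openin X (\<Inter>q\<in>F - {p}. U p q Int V q p)"
    using F \<open>!!q. q \<in> F - {p} ==> openin X (U p q Int V q p)\<close> by (intro openin_Inter) auto
   then show "openin X (topspace X Int (\<Inter>q\<in>F - {p}. U p q Int V q p))" by (intro openin_Int) auto
  next
   case True
   then show "openin X (topspace X Int (\<Inter>q\<in>F - {p}. U p q Int V q p))" unfolding True by simp
  qed
  moreover have "p \<in> W p" unfolding W_def using UV p F by blast
  ultimately show "openin X (W p) & p \<in> W p" by blast
 next
  fix p p' assume p: "p \<in> F" "p' \<in> F" "p ~= p'"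
  have "W p \<subseteq> U p p'" "W p' \<subseteq> V p p'" unfolding W_def using p by blast+
  then show "W p Int W p' = {}" using UV[OF p] by blast
 qed
qed

lemma min_positive:
 assumes "finite F" "!!p. p \<in> F ==> (s p :: real) > 0" "r0 > 0"
 obtains r where "r > 0" "r <= r0" "!!p. p \<in> F ==> r <= s p"
proof -
 let ?r = "Min (insert r0 (s ` F))"
 have "?r > 0" using assms by (subst Min_gr_iff) auto
 moreover have "?r <= r0" "!!p. p \<in> F ==> ?r <= s p" using assms(1) by auto
 ultimately show thesis using that by blast
qed

section \<open>The power form of the given map\<close>

context
 fixes X :: "'a topology" and A :: "'a chart set" and Y :: "'b topology" and B :: "'b chart set" and f :: "'a => 'b"
 assumes rsX: "riemann_surface X A" and cX: "compact_space X" and conX: "connected_space X"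
  and rsY: "riemann_surface Y B" and cY: "compact_space Y" and conY: "connected_space Y"
  and hol: "holomorphic_map X A Y B f"
  and nc: "\<exists>x\<in>topspace X. \<exists>y\<in>topspace X. f x ~= f y"
begin

lemma cont_f: "continuous_map X Y f"
 using hol unfolding holomorphic_map_def by blast

text \<open>In coordinates the map is (z - w)^n g(z) with g free of zeros. An n-th root of g,
  obtained from its logarithm, is absorbed into the coordinate of X. The chart of Y is prescribed so
  that all points of a fibre can share it.\<close>

lemma power_form_exists:
 assumes p: "p \<in> topspace X" and V: "(V, ps) \<in> max_atlas Y B" "f p \<in> V" "ps (f p) = 0"
  and nl: "~ locconst X f p"
 obtains n U ph where "n \<ge> 1" "(U, ph) \<in> max_atlas X A" "p \<in> U" "ph p = 0" "f ` U \<subseteq> V" "!!x. x \<in> U ==> ps (f x) = ph x ^ n"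
proof -
 obtain U ph where U: "(U, ph) \<in> A" "p \<in> U"
  using rsX p unfolding riemann_surface_def by fastforce
 note c = atlas_chart[OF rsX U(1)]
 have "f p \<in> topspace Y" using cont_f p by (auto simp: continuous_map_def)
 then obtain V0 ps0 where V0: "(V0, ps0) \<in> B" "f p \<in> V0"
  using rsY unfolding riemann_surface_def by fastforce
 note c0 = atlas_chart[OF rsY V0(1)] and cV = max_atlas_chart[OF V(1)]
 let ?w = "ph p" let ?i = "inv_into U ph"
 have oN: "openin X {x \<in> topspace X. f x \<in> V0 Int V}"
  by (rule openin_continuous_map_preimage[OF cont_f]) (use chart_facts(1)[OF c0] chart_facts(1)[OF cV] in blast)
 obtain r where r: "r > 0" "ball ?w r \<subseteq> ph ` U" "(%w. ?i (?w + w)) ` ball 0 r \<subseteq> {x \<in> topspace X. f x \<in> V0 Int V}"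
  by (rule chart_disc_exists[OF c U(2) oN]) (use V(2) V0(2) p in auto)
 let ?S = "ball ?w r"
 have S: "?i z \<in> U & ph (?i z) = z & f (?i z) \<in> V0 Int V" if z: "z \<in> ?S" for z
 proof -
  have zU: "z \<in> ph ` U" using r(2) z by blast
  have "z - ?w \<in> ball 0 r" using z by (simp add: dist_norm norm_minus_commute)
  then have "?i (?w + (z - ?w)) \<in> {x \<in> topspace X. f x \<in> V0 Int V}" using r(3) by blast
  then show ?thesis using inv_into_into[OF zU] f_inv_into_f[OF zU] by simp
 qed
 have h1: "(ps0 \<circ> f \<circ> ?i) holomorphic_on ph ` {x \<in> U. f x \<in> V0}"
  using hol U V0 unfolding holomorphic_map_def by fastforce
 have "holo_compatible (V, ps) (V0, ps0)" using V(1) V0(1) unfolding max_atlas_def by blast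
 then have h2: "(ps \<circ> inv_into V0 ps0) holomorphic_on ps0 ` (V Int V0)" unfolding holo_compatible_def by auto
 let ?F = "%z. ps (f (?i z))"
 have hF: "?F holomorphic_on ?S"
 proof (rule holomorphic_transform)
  show "((ps \<circ> inv_into V0 ps0) \<circ> (ps0 \<circ> f \<circ> ?i)) holomorphic_on ?S"
  proof (rule holomorphic_on_compose_gen[OF _ h2])
   have "?S \<subseteq> ph ` {x \<in> U. f x \<in> V0}"
   proof
    fix z assume "z \<in> ?S"
    from S[OF this] show "z \<in> ph ` {x \<in> U. f x \<in> V0}" by (intro image_eqI[of _ _ "?i z"]) auto
   qed
   then show "(ps0 \<circ> f \<circ> ?i) holomorphic_on ?S" by (rule holomorphic_on_subset[OF h1])
   show "(ps0 \<circ> f \<circ> ?i) ` ?S \<subseteq> ps0 ` (V Int V0)" using S by auto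
  qed
  fix z assume z: "z \<in> ?S"
  then have "inv_into V0 ps0 (ps0 (f (?i z))) = f (?i z)" using S[OF z] chart_facts(3)[OF c0] by simp
  then show "((ps \<circ> inv_into V0 ps0) \<circ> (ps0 \<circ> f \<circ> ?i)) z = ?F z" by simp
 qed
 have ip: "?i ?w = p" using chart_facts(3)[OF c] U by simp
 have F0: "?F ?w = 0" using ip V(3) by simp
 have "~ ?F constant_on ?S"
 proof
  assume "?F constant_on ?S"
  then have F: "?F z = 0" if "z \<in> ?S" for z using F0 that r(1) unfolding constant_on_def by (metis centre_in_ball)
  have "locconst X f p"
   unfolding locconst_def
  proof (intro exI conjI ballI)
   show "openin X {x \<in> U. ph x \<in> ?S}" by (rule chart_facts(6)[OF c open_ball])
   show "p \<in> {x \<in> U. ph x \<in> ?S}" using U r by simp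
   fix x assume x: "x \<in> {x \<in> U. ph x \<in> ?S}"
   then have ix: "?i (ph x) = x" using chart_facts(3)[OF c] by simp
   have "ps (f x) = ps (f p)" using F[of "ph x"] x ix V(3) by simp
   moreover have "f x \<in> V" using S[of "ph x"] x ix by simp
   ultimately show "f x = f p" using chart_facts(3)[OF cV] V(2) by (simp add: inj_on_eq_iff)
  qed
  then show False using nl by blast
 qed
 moreover have "connected ?S" by simp
 ultimately have nconst: "~ ?F constant_on ?S" "connected ?S" by blast+
 have wS: "?w \<in> ?S" using r(1) by simp
 obtain g s n where n: "0 < n" and s: "0 < s" "ball ?w s \<subseteq> ?S" and g: "g holomorphic_on ball ?w s"
  "!!z. z \<in> ball ?w s ==> ?F z = (z - ?w) ^ n * g z" "!!z. z \<in> ball ?w s ==> g z ~= 0"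
  by (rule holomorphic_factor_zero_nonconstant[OF hF open_ball nconst(2) wS F0 nconst(1)]) blast
 obtain l where l: "l holomorphic_on ball ?w s" "!!z. z \<in> ball ?w s ==> g z = exp (l z)"
  using contractible_imp_holomorphic_log[OF g(1) convex_imp_contractible[OF convex_ball] g(3)] by metis
 \<comment> \<open>A holomorphic n-th root of the coordinate expression; its derivative at the
   centre is nonzero, so it is a coordinate nearby.\<close>
 define et where "et z = (z - ?w) * exp (l z / of_nat n)" for z
 have het: "et holomorphic_on ball ?w s" unfolding et_def using n by (intro holomorphic_intros l) auto
 have etn: "et z ^ n = ?F z" if "z \<in> ball ?w s" for z
 proof -
  have "exp (l z / of_nat n) ^ n = exp (l z)" using n by (simp add: exp_of_nat_mult[symmetric])
  then show ?thesis unfolding et_def power_mult_distrib using g(2) l(2) that by simp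
 qed
 have ws: "?w \<in> ball ?w s" using s by simp
 have "(l has_field_derivative deriv l ?w) (at ?w)" by (rule holomorphic_derivI[OF l(1) open_ball ws])
 then have "(et has_field_derivative exp (l ?w / of_nat n)) (at ?w)"
  unfolding et_def using n by (auto intro!: derivative_eq_intros)
 then have "deriv et ?w ~= 0" by (simp add: DERIV_imp_deriv)
 then obtain t where t: "t > 0" "ball ?w t \<subseteq> ball ?w s" "inj_on et (ball ?w t)"
  by (rule has_complex_derivative_locally_injective[OF het ws open_ball]) blast
 have tS: "ball ?w t \<subseteq> ?S" using t(2) s(2) by blast
 have "({x \<in> U. ph x \<in> ball ?w t}, et \<circ> ph) \<in> max_atlas X A"
  by (rule max_atlas_intro[OF rsX U(1) open_ball _ holomorphic_on_subset[OF het t(2)] t(3)]) (use tS r(2) in blast)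
 moreover have "p \<in> {x \<in> U. ph x \<in> ball ?w t}" using U t by simp
 moreover have "(et \<circ> ph) p = 0" by (simp add: et_def)
 moreover have "f x \<in> V & ps (f x) = (et \<circ> ph) x ^ n" if x: "x \<in> {x \<in> U. ph x \<in> ball ?w t}" for x
 proof -
  have ix: "?i (ph x) = x" using x chart_facts(3)[OF c] by simp
  have "ph x \<in> ?S" "ph x \<in> ball ?w s" using x tS t(2) by blast+
  then show ?thesis using S[of "ph x"] etn[of "ph x"] ix by simp
 qed
 moreover have "n \<ge> 1" using n by simp
 ultimately show thesis using that by blast
qed

text \<open>Level sets of the power map are finite, whereas a disc is infinite.\<close>

lemma power_form_not_locconst:
 assumes U: "complex_chart X (U, ph)" and n: "n \<ge> 1" and V: "inj_on ps V" "f ` U \<subseteq> V" "!!x. x \<in> U ==> ps (f x) = ph x ^ n"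
  and x: "x \<in> U"
 shows "~ locconst X f x"
proof
 assume "locconst X f x"
 then obtain N where N: "openin X N" "x \<in> N" "\<forall>y\<in>N. f y = f x" unfolding locconst_def by blast
 obtain r where r: "r > 0" "ball (ph x) r \<subseteq> ph ` U" "(%w. inv_into U ph (ph x + w)) ` ball 0 r \<subseteq> N"
  by (rule chart_disc_exists[OF U x N(1,2)])
 have "ball (ph x) r \<subseteq> {z. z ^ n = ph x ^ n}"
 proof
  fix z assume z: "z \<in> ball (ph x) r"
  then have zU: "z \<in> ph ` U" using r(2) by blast
  have "z - ph x \<in> ball 0 r" using z by (simp add: dist_norm norm_minus_commute)
  then have "inv_into U ph (ph x + (z - ph x)) \<in> N" using r(3) by blast
  then have "f (inv_into U ph z) = f x" using N(3) by simp
  then show "z \<in> {z. z ^ n = ph x ^ n}" using V(3)[OF inv_into_into[OF zU]] V(3)[OF x] f_inv_into_f[OF zU] by simp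
 qed
 moreover have "finite {z. z ^ n = ph x ^ n}" using finite_nth_roots[of n "ph x ^ n"] n by simp
 ultimately have "finite (ball (ph x) r)" by (rule finite_subset)
 moreover have "infinite (ball (ph x) r)" using uncountable_infinite[OF uncountable_ball[OF r(1)]] by blast
 ultimately show False by blast
qed

text \<open>The identity theorem: the points of local constancy form an open set, and by the power
  form so do the others. If the first set had a point, f would be constant on the connected
  X.\<close>

lemma never_locconst: assumes p: "p \<in> topspace X" shows "~ locconst X f p"
proof
 assume lp: "locconst X f p"
 let ?L = "{x \<in> topspace X. locconst X f x}"
 have "openin X ?L"
 proof (subst openin_subopen, intro ballI)
  fix x assume "x \<in> ?L"
  then obtain N where N: "openin X N" "x \<in> N" "\<forall>y\<in>N. f y = f x" unfolding locconst_def by blast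
  have "locconst X f y" if y: "y \<in> N" for y
  proof -
   have "\<forall>x\<in>N. f x = f y" using N(3) bspec[OF N(3) y] by simp
   then show ?thesis unfolding locconst_def using N(1) y by blast
  qed
  then have "N \<subseteq> ?L" using openin_subset[OF N(1)] by blast
  then show "\<exists>T. openin X T & x \<in> T & T \<subseteq> ?L" using N by blast
 qed
 moreover have "openin X (topspace X - ?L)"
 proof (subst openin_subopen, intro ballI)
  fix x assume x: "x \<in> topspace X - ?L"
  then have xt: "x \<in> topspace X" and nx: "~ locconst X f x" by auto
  have "f x \<in> topspace Y" using cont_f xt by (auto simp: continuous_map_def)
  from centered_chart_exists[OF rsY this] obtain V ps where V: "(V, ps) \<in> max_atlas Y B" "f x \<in> V" "ps (f x) = 0" .
  obtain n U ph where U: "n \<ge> 1" "(U, ph) \<in> max_atlas X A" "x \<in> U" "ph x = 0" "f ` U \<subseteq> V" "!!y. y \<in> U ==> ps (f y) = ph y ^ n"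
   by (rule power_form_exists[OF xt V nx]) blast
  note cU = max_atlas_chart[OF U(2)] and cV = max_atlas_chart[OF V(1)]
  have "~ locconst X f y" if "y \<in> U" for y
   by (rule power_form_not_locconst[OF cU U(1) chart_facts(3)[OF cV] U(5,6) that])
  then have "U \<subseteq> topspace X - ?L" using chart_facts(7)[OF cU] by blast
  then show "\<exists>T. openin X T & x \<in> T & T \<subseteq> topspace X - ?L" using chart_facts(1)[OF cU] U(3) by blast
 qed
 then have "closedin X ?L" by (auto simp: closedin_def)
 ultimately have "?L = topspace X" using conX lp p unfolding connected_space_clopen_in by blast
 then have lc: "locconst X f x" if "x \<in> topspace X" for x using that by blast
 let ?E = "{x \<in> topspace X. f x = f p}"
 have "openin X ?E"
 proof (subst openin_subopen, intro ballI)
  fix x assume x: "x \<in> ?E"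
  then obtain N where N: "openin X N" "x \<in> N" "\<forall>y\<in>N. f y = f x" using lc unfolding locconst_def by blast
  then have "N \<subseteq> ?E" using openin_subset[OF N(1)] x by fastforce
  then show "\<exists>T. openin X T & x \<in> T & T \<subseteq> ?E" using N(1,2) by blast
 qed
 moreover have "openin X (topspace X - ?E)"
 proof (subst openin_subopen, intro ballI)
  fix x assume x: "x \<in> topspace X - ?E"
  then obtain N where N: "openin X N" "x \<in> N" "\<forall>y\<in>N. f y = f x" using lc unfolding locconst_def by blast
  then have "N \<subseteq> topspace X - ?E" using openin_subset[OF N(1)] x by fastforce
  then show "\<exists>T. openin X T & x \<in> T & T \<subseteq> topspace X - ?E" using N(1,2) by blast
 qed
 then have "closedin X ?E" by (auto simp: closedin_def)
 ultimately have "?E = topspace X" using conX p unfolding connected_space_clopen_in by blast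
 then have "f x = f p" if "x \<in> topspace X" for x using that by blast
 then show False using nc by auto
qed

text \<open>The n' points near p where one form takes a suitable nonzero value lie in a single fibre
  of f, and the other form sends them to different n-th roots of one number. This makes the exponent
  unique, as the \<open>THE\<close> in \<open>ramification_index\<close> requires.\<close>

lemma power_form_le:
 assumes n: "n \<ge> 1" "n' \<ge> 1" and "local_power_form X A Y B f p n" "local_power_form X A Y B f p n'"
 shows "n' <= n"
proof -
 obtain U ph V ps where U: "(U, ph) \<in> max_atlas X A" "(V, ps) \<in> max_atlas Y B" "p \<in> U" "ph p = 0" "f p \<in> V" "ps (f p) = 0"
  "f ` U \<subseteq> V" "!!x. x \<in> U ==> ps (f x) = ph x ^ n"
  by (rule local_power_formE[OF assms(3)]) blast
 obtain U' ph' V' ps' where U': "(U', ph') \<in> max_atlas X A" "(V', ps') \<in> max_atlas Y B" "p \<in> U'" "ph' p = 0" "f p \<in> V'" "ps' (f p) = 0"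
  "f ` U' \<subseteq> V'" "!!x. x \<in> U' ==> ps' (f x) = ph' x ^ n'"
  by (rule local_power_formE[OF assms(4)]) blast
 note c = max_atlas_chart[OF U(1)] and c' = max_atlas_chart[OF U'(1)]
 have iV: "inj_on ps' V'" by (rule chart_facts(3)[OF max_atlas_chart[OF U'(2)]])
 obtain r where r: "r > 0" "ball (ph' p) r \<subseteq> ph' ` U'" "(%w. inv_into U' ph' (ph' p + w)) ` ball 0 r \<subseteq> U"
  by (rule chart_disc_exists[OF c' U'(3) chart_facts(1)[OF c] U(3)])
 note pd = chart_pdisc[OF c' U'(3) r(1,2) refl]
 let ?g = "%w. inv_into U' ph' (ph' p + w)"
 obtain Z :: "complex set" and c0 where Z: "c0 ~= 0" "card Z = n'" "finite Z" "Z \<subseteq> ball 0 r" and Zc: "\<forall>z\<in>Z. z ^ n' = c0"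
  by (rule nth_roots_in_disc[OF n(2) r(1)])
 have gz: "?g z \<in> U' & ?g z \<in> U & ps' (f (?g z)) = c0" if "z \<in> Z" for z
 proof -
  have zb: "z \<in> ball 0 r" using Z(4) that by blast
  have "?g z \<in> U" using r(3) zb by blast
  then show ?thesis using pd(3)[OF zb] U'(8)[of "?g z"] U'(4) bspec[OF Zc that] by simp
 qed
 have "Z ~= {}" using Z(2) n(2) by auto
 then obtain z0 where z0: "z0 \<in> Z" by blast
 have same: "f (?g z) = f (?g z0)" if "z \<in> Z" for z
  using gz[OF that] gz[OF z0] U'(7) inj_onD[OF iV, of "f (?g z)" "f (?g z0)"] by auto
 let ?d = "ps (f (?g z0))"
 have "?d ~= 0"
 proof
  assume "?d = 0"
  then have "ps (f (?g z0)) = ps (f p)" using U(6) by simp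
  moreover have "f (?g z0) \<in> V" using gz[OF z0] U(7) by blast
  ultimately have "f (?g z0) = f p" using inj_onD[OF chart_facts(3)[OF max_atlas_chart[OF U(2)]]] U(5) by blast
  then show False using gz[OF z0] U'(6) Z(1) by simp
 qed
 then have "card {w. w ^ n = ?d} = n" by (rule card_nth_roots) (use n in simp)
 moreover have "(%z. ph (?g z)) ` Z \<subseteq> {w. w ^ n = ?d}"
 proof
  fix w assume "w \<in> (%z. ph (?g z)) ` Z"
  then obtain z where z: "z \<in> Z" "w = ph (?g z)" by blast
  then show "w \<in> {w. w ^ n = ?d}" using U(8)[of "?g z"] gz[OF z(1)] same[OF z(1)] by simp
 qed
 moreover have "inj_on (%z. ph (?g z)) Z"
 proof (rule inj_onI)
  fix z z' assume z: "z \<in> Z" "z' \<in> Z" "ph (?g z) = ph (?g z')"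
  have "?g z = ?g z'" by (rule inj_onD[OF chart_facts(3)[OF c] z(3)]) (use gz z in auto)
  then show "z = z'" using pd(1) z(1,2) Z(4) unfolding pdisc_def by (auto dest: inj_onD)
 qed
 moreover have "finite {w. w ^ n = ?d}" using finite_nth_roots[of n ?d] n by simp
 ultimately show ?thesis using Z(2) card_inj_on_le[of "%z. ph (?g z)" Z "{w. w ^ n = ?d}"] by simp
qed

text \<open>The local degree of f at p, which is the exponent of its power form.\<close>

definition mult_at :: "'a => nat" where
 "mult_at p = ramification_index X A Y B f p + 1"

lemma mult_at_eq:
 assumes "local_power_form X A Y B f p n" "n \<ge> 1"
 shows "mult_at p = n"
proof -
 have "(THE n. n \<ge> 1 & local_power_form X A Y B f p n) = n"
  by (rule the_equality) (use assms power_form_le in \<open>auto intro!: antisym\<close>)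
 then show ?thesis unfolding mult_at_def ramification_index_def using assms(2) by simp
qed

lemma power_form_mult:
 assumes p: "p \<in> topspace X" and V: "(V, ps) \<in> max_atlas Y B" "f p \<in> V" "ps (f p) = 0"
 obtains U ph where "(U, ph) \<in> max_atlas X A" "p \<in> U" "ph p = 0" "f ` U \<subseteq> V" "!!x. x \<in> U ==> ps (f x) = ph x ^ mult_at p"
  "mult_at p \<ge> 1"
proof -
 obtain n U ph where U: "n \<ge> 1" "(U, ph) \<in> max_atlas X A" "p \<in> U" "ph p = 0" "f ` U \<subseteq> V" "!!x. x \<in> U ==> ps (f x) = ph x ^ n"
  by (rule power_form_exists[OF p V never_locconst[OF p]]) blast
 have "local_power_form X A Y B f p n"
  unfolding local_power_form_def chart_centered_at_def
  using U V by (auto intro!: bexI[of _ "(U, ph)"] bexI[of _ "(V, ps)"])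
 then have "mult_at p = n" by (rule mult_at_eq[OF _ U(1)])
 then show thesis using that[OF U(2-5)] U by simp
qed

text \<open>A power form with exponent n has n different points with a common image arbitrarily near
  p.\<close>

lemma mult_at_injective:
 assumes p: "p \<in> topspace X" and N: "openin X N" "p \<in> N" "inj_on f N"
 shows "mult_at p = 1"
proof (rule ccontr)
 assume ne: "mult_at p ~= 1"
 have "f p \<in> topspace Y" using cont_f p by (auto simp: continuous_map_def)
 from centered_chart_exists[OF rsY this] obtain V ps where V: "(V, ps) \<in> max_atlas Y B" "f p \<in> V" "ps (f p) = 0" .
 obtain U ph where U: "(U, ph) \<in> max_atlas X A" "p \<in> U" "ph p = 0" "f ` U \<subseteq> V" "!!x. x \<in> U ==> ps (f x) = ph x ^ mult_at p"
  "mult_at p \<ge> 1" by (rule power_form_mult[OF p V]) blast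
 note c = max_atlas_chart[OF U(1)]
 obtain r where r: "r > 0" "ball (ph p) r \<subseteq> ph ` U" "(%w. inv_into U ph (ph p + w)) ` ball 0 r \<subseteq> N"
  by (rule chart_disc_exists[OF c U(2) N(1,2)])
 note pd = chart_pdisc[OF c U(2) r(1,2) refl]
 let ?g = "%w. inv_into U ph (ph p + w)"
 obtain Z :: "complex set" and c0 where Z: "c0 ~= 0" "card Z = mult_at p" "finite Z" "Z \<subseteq> ball 0 r" and Zc: "\<forall>z\<in>Z. z ^ mult_at p = c0"
  by (rule nth_roots_in_disc[OF U(6) r(1)])
 have "inj_on (%z. f (?g z)) Z"
 proof (rule inj_onI)
  fix z z' assume z: "z \<in> Z" "z' \<in> Z" "f (?g z) = f (?g z')"
  have zb: "z \<in> ball 0 r" "z' \<in> ball 0 r" using z Z(4) by blast+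
  have "?g z = ?g z'" by (rule inj_onD[OF N(3) z(3)]) (use zb r(3) in blast)+
  then show "z = z'" using pd(1) zb unfolding pdisc_def by (auto dest: inj_onD)
 qed
 moreover have "f (?g z) = f (?g z')" if z: "z \<in> Z" "z' \<in> Z" for z z'
 proof -
  have zb: "z \<in> ball 0 r" "z' \<in> ball 0 r" using z Z(4) by blast+
  have "ps (f (?g z)) = ps (f (?g z'))" using U(5)[of "?g z"] U(5)[of "?g z'"] pd(3)[OF zb(1)] pd(3)[OF zb(2)] U(3) bspec[OF Zc z(1)] bspec[OF Zc z(2)] by simp
  then show ?thesis
   by (rule inj_onD[OF chart_facts(3)[OF max_atlas_chart[OF V(1)]]]) (use pd(3)[OF zb(1)] pd(3)[OF zb(2)] U(4) in auto)
 qed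
 ultimately have "z = z'" if "z \<in> Z" "z' \<in> Z" for z z' using that by (auto dest: inj_onD)
 then have "card Z <= Suc 0" using card_le_Suc0_iff_eq[OF Z(3)] by blast
 then show False using Z(2) ne U(6) by simp
qed


lemma mult_at_pos: "1 <= mult_at p"
 by (simp add: mult_at_def)

lemma XH: "Hausdorff_space X" and YH: "Hausdorff_space Y"
 using rsX rsY unfolding riemann_surface_def by blast+

text \<open>At all points of the fibre over q the power forms are taken with respect to one chart at
  q. Compactness confines the preimage of a small disc about q to the discs around these points, and
  radii r^(1/n) make each of them cover exactly that disc.\<close>

lemma branched_mult: "branched X Y f mult_at"
 unfolding branched_def
proof (intro conjI ballI)
 show "continuous_map X Y f" by (rule cont_f)
 show "1 <= mult_at p" for p by (rule mult_at_pos)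
 fix q assume q: "q \<in> topspace Y"
 let ?F = "{p \<in> topspace X. f p = q}"
 obtain V ps where V: "(V, ps) \<in> max_atlas Y B" "q \<in> V" "ps q = 0"
  by (rule centered_chart_exists[OF rsY q])
 note cV = max_atlas_chart[OF V(1)]
 note iV = chart_facts(3)[OF cV]
 have disc: "\<exists>s g. pdisc X s g & g 0 = p & g ` ball 0 s \<subseteq> M & (\<forall>w\<in>ball 0 s. f (g w) \<in> V & ps (f (g w)) = w ^ mult_at p)"
  if p: "p \<in> ?F" and M: "openin X M" "p \<in> M" for p M
 proof -
  have pt: "p \<in> topspace X" "f p = q" using p by auto
  obtain U ph where U: "(U, ph) \<in> max_atlas X A" "p \<in> U" "ph p = 0" "f ` U \<subseteq> V" "!!x. x \<in> U ==> ps (f x) = ph x ^ mult_at p"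
   by (rule power_form_mult[OF pt(1), of V ps]) (use V pt in auto)
  note cU = max_atlas_chart[OF U(1)]
  obtain s where s: "s > 0" "ball (ph p) s \<subseteq> ph ` U" "(%w. inv_into U ph (ph p + w)) ` ball 0 s \<subseteq> M"
   by (rule chart_disc_exists[OF cU U(2) M])
  note pd = chart_pdisc[OF cU U(2) s(1,2) refl]
  let ?g = "%w. inv_into U ph (ph p + w)"
  have "f (?g w) \<in> V & ps (f (?g w)) = w ^ mult_at p" if "w \<in> ball 0 s" for w
   using pd(3)[OF that] U(3,4) U(5)[of "?g w"] by auto
  then show ?thesis using pd(1,2) s(3) by blast
 qed
 \<comment> \<open>By the power form the points of a fibre are isolated, and compactness leaves
   finitely many.\<close>
 have fin: "finite ?F"
 proof -
  have "\<exists>M. openin X M & x \<in> M & M Int ?F \<subseteq> {x}" if x: "x \<in> topspace X" for x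
  proof (cases "x \<in> ?F")
   case True
   then obtain s g where g: "pdisc X s g" "g 0 = x" "\<forall>w\<in>ball 0 s. f (g w) \<in> V & ps (f (g w)) = w ^ mult_at x"
    using disc[OF True openin_topspace x] by blast
   have "y = x" if y: "y \<in> g ` ball 0 s" "y \<in> ?F" for y
   proof -
    obtain w where w: "w \<in> ball 0 s" "y = g w" using y(1) by blast
    then have "w ^ mult_at x = 0" using g(3) y(2) V(3) by auto
    then show ?thesis using w g(2) by simp
   qed
   moreover have "x \<in> g ` ball 0 s" using g unfolding pdisc_def by (intro image_eqI[of _ _ 0]) auto
   ultimately show ?thesis using pdisc_open[OF g(1) open_ball subset_refl] by blast
  next
   case False
   have "openin X (topspace X - ?F)"
   proof -
    have "closedin Y {q}" using closedin_Hausdorff_singleton[OF YH q] .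
    then have "closedin X {x \<in> topspace X. f x \<in> {q}}" by (rule closedin_continuous_map_preimage[OF cont_f])
    then show ?thesis by (simp add: openin_diff)
   qed
   then show ?thesis using False x by (intro exI[of _ "topspace X - ?F"]) auto
  qed
  then obtain M where M: "!!x. x \<in> topspace X ==> openin X (M x) & x \<in> M x & M x Int ?F \<subseteq> {x}" by metis
  have "\<exists>\<F>. finite \<F> & \<F> \<subseteq> M ` topspace X & topspace X \<subseteq> \<Union>\<F>"
   using cX unfolding compact_space_alt by (rule allE[of _ "M ` topspace X"]) (use M in blast)
  then obtain \<F> where \<F>: "finite \<F>" "\<F> \<subseteq> M ` topspace X" "topspace X \<subseteq> \<Union>\<F>" by blast
  then obtain T where T: "finite T" "T \<subseteq> topspace X" "\<F> = M ` T" by (meson finite_subset_image)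
  have "?F \<subseteq> T"
  proof
   fix p assume p: "p \<in> ?F"
   then obtain x where "x \<in> T" "p \<in> M x" using \<F>(3) T(3) by blast
   then show "p \<in> T" using M[of x] T(2) p by blast
  qed
  then show ?thesis using T(1) finite_subset by blast
 qed
 then show "finite ?F" .
 obtain M where M: "!!p. p \<in> ?F ==> openin X (M p) & p \<in> M p" "!!p p'. p \<in> ?F ==> p' \<in> ?F ==> p ~= p' ==> M p Int M p' = {}"
  by (rule disjoint_neighbourhoods[OF XH fin]) blast+
 define D where "D p s g \<longleftrightarrow> pdisc X s g & g 0 = p & g ` ball 0 s \<subseteq> M p &
   (\<forall>w\<in>ball 0 s. f (g w) \<in> V & ps (f (g w)) = w ^ mult_at p)" for p s g
 have "\<exists>sg. D p (fst sg) (snd sg)" if pF: "p \<in> ?F" for p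
 proof -
  obtain s g where "D p s g"
   using disc[OF pF conjunct1[OF M(1)[OF pF]] conjunct2[OF M(1)[OF pF]]] unfolding D_def by (elim exE)
  then show ?thesis by (intro exI[of _ "(s, g)"]) simp
 qed
 \<comment> \<open>Radius and parametrization are chosen as one pair, so that they fit
   together.\<close>
 then have sgD: "D p (fst (SOME sg. D p (fst sg) (snd sg))) (snd (SOME sg. D p (fst sg) (snd sg)))" if "p \<in> ?F" for p
  using someI_ex[of "%sg. D p (fst sg) (snd sg)"] that by blast
 define s where "s p = fst (SOME sg. D p (fst sg) (snd sg))" for p
 define g where "g p = snd (SOME sg. D p (fst sg) (snd sg))" for p
 have g: "pdisc X (s p) (g p) & g p 0 = p & g p ` ball 0 (s p) \<subseteq> M p &
   (\<forall>w\<in>ball 0 (s p). f (g p w) \<in> V & ps (f (g p w)) = w ^ mult_at p)" if "p \<in> ?F" for p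
 proof -
  have "D p (s p) (g p)" unfolding s_def g_def by (rule sgD[OF that])
  then show ?thesis unfolding D_def .
 qed
 \<comment> \<open>The image of this compact set is closed and misses q, so a small disc about q has
   its preimage inside the discs.\<close>
 let ?C = "topspace X - (\<Union>p\<in>?F. g p ` ball 0 (s p))"
 have "openin X (g p ` ball 0 (s p))" if "p \<in> ?F" for p
  by (rule pdisc_open[OF _ open_ball subset_refl]) (use g[OF that] in blast)
 then have "openin X (\<Union>p\<in>?F. g p ` ball 0 (s p))" by blast
 then have "closedin X ?C" by blast
 then have "compactin X ?C" by (rule closedin_compact_space[OF cX])
 then have "compactin Y (f ` ?C)" by (rule image_compactin[OF _ cont_f])
 then have "closedin Y (f ` ?C)" by (rule compactin_imp_closedin[OF YH])
 then have oC: "openin Y (topspace Y - f ` ?C)" by blast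
 have sp: "s p > 0" if "p \<in> ?F" for p using g[OF that] unfolding pdisc_def by blast
 have qC: "q \<in> topspace Y - f ` ?C"
 proof -
  have "p \<in> g p ` ball 0 (s p)" if "p \<in> ?F" for p
   by (rule image_eqI[of _ _ 0]) (use g[OF that] sp[OF that] in auto)
  then show ?thesis using q by blast
 qed
 obtain r0 where r0: "r0 > 0" "ball (ps q) r0 \<subseteq> ps ` V" "(%w. inv_into V ps (ps q + w)) ` ball 0 r0 \<subseteq> topspace Y - f ` ?C"
  by (rule chart_disc_exists[OF cV V(2) oC qC])
 let ?h = "%w. inv_into V ps (ps q + w)"
 note pdh = chart_pdisc[OF cV V(2) r0(1,2) refl]
 obtain r where r: "r > 0" "r <= r0" "!!p. p \<in> ?F ==> r <= s p ^ mult_at p"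
  by (rule min_positive[OF fin, of "%p. s p ^ mult_at p" r0]) (use sp r0 in auto)
 \<comment> \<open>With radius r^(1/n) the n-th power maps onto the disc of radius r, the same for
   every point of the fibre.\<close>
 define rh where "rh p = root (mult_at p) r" for p
 have mp: "0 < mult_at p" for p using mult_at_pos[of p] by simp
 have rhn: "rh p ^ mult_at p = r" for p unfolding rh_def using r(1) mp[of p] by (simp add: real_root_pow_pos2)
 have rhpos: "rh p > 0" for p unfolding rh_def using r(1) mp[of p] by simp
 have rhs: "rh p <= s p" if "p \<in> ?F" for p
 proof (rule power_le_imp_le_base)
  show "rh p ^ Suc (mult_at p - 1) <= s p ^ Suc (mult_at p - 1)" using r(3)[OF that] rhn[of p] mp[of p] by simp
  show "0 <= s p" using sp[OF that] by simp
 qed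
 have hr: "pdisc Y r ?h" by (rule pdisc_shrink[OF pdh(1) r(1,2)])
 have rhiff: "norm (w ^ mult_at p) < r \<longleftrightarrow> norm w < rh p" for w :: complex and p
 proof -
  have "norm w ^ mult_at p < rh p ^ mult_at p \<longleftrightarrow> norm w < rh p"
   using power_less_iff[of "norm w" "rh p" "mult_at p"] rhpos[of p] mp[of p] by simp
  then show ?thesis unfolding norm_power rhn .
 qed
 have fg: "f (g p w) = ?h (w ^ mult_at p)" if p: "p \<in> ?F" and w: "w \<in> ball 0 (s p)" and wr: "norm (w ^ mult_at p) < r0" for p w
 proof -
  have 1: "f (g p w) \<in> V" "ps (f (g p w)) = w ^ mult_at p" using g[OF p] w by blast+
  have "w ^ mult_at p \<in> ball 0 r0" using wr by simp
  from pdh(3)[OF this] have "?h (w ^ mult_at p) \<in> V" "ps (?h (w ^ mult_at p)) = w ^ mult_at p" using V(3) by simp_all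
  then show ?thesis using inj_onD[OF iV _ 1(1)] 1(2) by simp
 qed
 have cover: "\<exists>p\<in>?F. x \<in> g p ` ball 0 (rh p)" if x: "x \<in> topspace X" "f x \<in> ?h ` ball 0 r" for x
 proof -
  have "ball 0 r \<subseteq> ball (0::complex) r0" using r(2) by auto
  then have "?h ` ball 0 r \<subseteq> topspace Y - f ` ?C" using r0(3) by (meson image_mono order_trans)
  then have "f x ~: f ` ?C" using x(2) by (meson DiffD2 subsetD)
  then have "x ~: ?C" by blast
  then have "x \<in> (\<Union>p\<in>?F. g p ` ball 0 (s p))" using x(1) by blast
  then obtain p w where p: "p \<in> ?F" "w \<in> ball 0 (s p)" "x = g p w" by blast
  obtain v where v: "v \<in> ball 0 r" "f x = ?h v" using x(2) by blast
  have "v \<in> ball 0 r0" using v(1) r(2) by simp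
  then have "ps (f x) = v" using pdh(3)[of v] v(2) V(3) by simp
  then have "w ^ mult_at p = v" using g[OF p(1)] p(2,3) by auto
  then have "w \<in> ball 0 (rh p)" using v(1) rhiff[where p=p and w=w] by simp
  then show ?thesis using p by blast
 qed
 show "\<exists>r h rh g. pdisc Y r h & h 0 = q &
     (\<forall>p\<in>?F. pdisc X (rh p) (g p) & g p 0 = p & rh p ^ mult_at p = r &
      (\<forall>w\<in>ball 0 (rh p). f (g p w) = h (w ^ mult_at p))) &
     (\<forall>p\<in>?F. \<forall>p'\<in>?F. p ~= p' --> g p ` ball 0 (rh p) Int g p' ` ball 0 (rh p') = {}) &
     (\<forall>x\<in>topspace X. f x \<in> h ` ball 0 r --> (\<exists>p\<in>?F. x \<in> g p ` ball 0 (rh p))) &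
     (\<forall>x\<in>topspace X. f x \<in> h ` ball 0 r --> f x ~= q --> mult_at x = 1)"
 proof (intro exI conjI ballI impI)
  show "pdisc Y r ?h" by (rule hr)
  show "?h 0 = q" by (rule pdh(2))
  fix p assume p: "p \<in> ?F"
  show "pdisc X (rh p) (g p)" by (rule pdisc_shrink[OF _ rhpos rhs[OF p]]) (use g[OF p] in blast)
  show "g p 0 = p" using g[OF p] by blast
  show "rh p ^ mult_at p = r" by (rule rhn)
  show "f (g p w) = ?h (w ^ mult_at p)" if w: "w \<in> ball 0 (rh p)" for w
  proof (rule fg[OF p])
   show "w \<in> ball 0 (s p)" using w rhs[OF p] by simp
   show "norm (w ^ mult_at p) < r0" using rhiff[where p=p and w=w] w r(2) by simp
  qed
 next
  fix p p' assume p: "p \<in> ?F" "p' \<in> ?F" "p ~= p'"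
  have "g p ` ball 0 (rh p) \<subseteq> M p" "g p' ` ball 0 (rh p') \<subseteq> M p'"
   using g[OF p(1)] g[OF p(2)] subset_ball[OF rhs[OF p(1)], of 0] subset_ball[OF rhs[OF p(2)], of 0] by blast+
  then show "g p ` ball 0 (rh p) Int g p' ` ball 0 (rh p') = {}" using M(2)[OF p] by blast
 next
  fix x assume x: "x \<in> topspace X" "f x \<in> ?h ` ball 0 r"
  show "\<exists>p\<in>?F. x \<in> g p ` ball 0 (rh p)" by (rule cover[OF x])
 next
  fix x assume x: "x \<in> topspace X" "f x \<in> ?h ` ball 0 r" "f x ~= q"
  obtain p w where p: "p \<in> ?F" "w \<in> ball 0 (rh p)" "x = g p w" using cover[OF x(1,2)] by blast
  let ?n = "mult_at p"
  have w0: "w ~= 0" using p g[OF p(1)] x(3) by auto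
  \<comment> \<open>Away from the centre the power map is locally injective, so the multiplicity
    there is 1.\<close>
  have "deriv (%z. z ^ ?n) w ~= 0"
  proof -
   have "((%z. z ^ ?n) has_field_derivative of_nat ?n * w ^ (?n - 1)) (at w)" by (auto intro!: derivative_eq_intros)
   then show ?thesis using w0 mp[of p] by (simp add: DERIV_imp_deriv)
  qed
  moreover have "(%z. z ^ ?n) holomorphic_on ball 0 (rh p)" by (intro holomorphic_intros)
  ultimately obtain t where t: "t > 0" "ball w t \<subseteq> ball 0 (rh p)" "inj_on (%z. z ^ ?n) (ball w t)"
   using has_complex_derivative_locally_injective[of "%z. z ^ ?n" "ball 0 (rh p)" w] p(2) open_ball by metis
  have pdp: "pdisc X (rh p) (g p)" by (rule pdisc_shrink[OF _ rhpos rhs[OF p(1)]]) (use g[OF p(1)] in blast)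
  show "mult_at x = 1"
  proof (rule mult_at_injective[OF x(1)])
   show "openin X (g p ` ball w t)" by (rule pdisc_open[OF pdp open_ball t(2)])
   show "x \<in> g p ` ball w t" unfolding p(3) using t(1) by simp
   show "inj_on f (g p ` ball w t)"
   proof (rule inj_onI)
    fix a b assume ab: "a \<in> g p ` ball w t" "b \<in> g p ` ball w t" "f a = f b"
    then obtain u v where u: "u \<in> ball w t" "a = g p u" and v: "v \<in> ball w t" "b = g p v" by blast
    have us: "u \<in> ball 0 (s p)" "v \<in> ball 0 (s p)" using u v t(2) rhs[OF p(1)] by (meson subset_ball subset_iff)+
    have "u ^ ?n = v ^ ?n" using g[OF p(1)] us ab(3) u v by metis
    then show "a = b" using inj_onD[OF t(3)] u v by blast
   qed
  qed
 qed
qed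

end

section \<open>Lifting cellulations through branched coverings\<close>

text \<open>Where u is nonzero the roots come from a logarithm, which exists on a contractible set;
  at a zero of u they all meet in 0. For n = 1 the root is u itself, hence the alternative in
  \<open>c\<close>.\<close>

lemma roots_family:
 fixes u :: "'d::real_normed_vector => complex"
 assumes u: "continuous_on D u" and n: "n \<ge> 1" and c: "n = 1 | contractible {d \<in> D. u d ~= 0}"
 obtains w where "\<forall>k<n. continuous_on D (w k) & (\<forall>d\<in>D. w k d ^ n = u d)"
  "\<forall>d\<in>D. \<forall>z. z ^ n = u d --> (\<exists>k<n. z = w k d)"
  "\<forall>d\<in>D. u d ~= 0 --> inj_on (%k. w k d) {..<n}"
proof (cases "n = 1")
 case True
 show thesis by (rule that[of "%k. u"]) (use u True in \<open>auto simp: inj_on_def\<close>)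
next
 case False
 let ?D = "{d \<in> D. u d ~= 0}"
 have uc: "continuous_on ?D u" by (rule continuous_on_subset[OF u]) auto
 obtain l where l: "continuous_on ?D l" "!!d. d \<in> ?D ==> u d = exp (l d)"
  using continuous_logarithm_on_contractible[OF uc] c False by (metis (mono_tags, lifting) mem_Collect_eq)
 define w where "w k d = (if u d = 0 then 0 else exp (l d / of_nat n) * exp (2 * of_real pi * \<i> * of_nat k / of_nat n))" for k d
 have n0: "n ~= 0" using n by simp
 have wn: "w k d ^ n = u d" if "d \<in> D" for k d
 proof (cases "u d = 0")
  case True then show ?thesis using n0 by (simp add: w_def)
 next
  case False
  have "exp (l d / of_nat n) ^ n = exp (l d)" using n0 by (simp add: exp_of_nat_mult[symmetric])
  moreover have "exp (2 * of_real pi * \<i> * of_nat k / of_nat n) ^ n = 1"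
   by (rule complex_root_unity[OF n0])
  ultimately show ?thesis using False l(2)[of d] that by (simp add: w_def power_mult_distrib)
 qed
 show thesis
 proof (rule that[of w])
  have "continuous_on D (w k)" for k
  proof (rule continuous_on_eq_continuous_within[THEN iffD2], rule ballI)
   fix d assume d: "d \<in> D"
   show "continuous (at d within D) (w k)"
   proof (cases "u d = 0")
    \<comment> \<open>At a zero of u continuity follows from |w| = |u|^(1/n).\<close>
    case True
    have "(u \<longlongrightarrow> u d) (at d within D)" using u d by (simp add: continuous_on)
    then have "((%x. norm (u x)) \<longlongrightarrow> 0) (at d within D)" using True tendsto_norm_zero by fastforce
    then have "((%x. root n (norm (u x))) \<longlongrightarrow> root n 0) (at d within D)" by (rule tendsto_real_root)
    moreover have "\<forall>\<^sub>F x in at d within D. root n (norm (u x)) = norm (w k x)"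
    proof -
     have "root n (norm (u x)) = norm (w k x)" if "x \<in> D" for x
      using wn[OF that, of k, symmetric] n0 by (simp add: norm_power real_root_power_cancel)
     then show ?thesis by (auto simp: eventually_at_filter)
    qed
    ultimately have "((%x. norm (w k x)) \<longlongrightarrow> root n 0) (at d within D)" by (rule Lim_transform_eventually)
    then have "(w k \<longlongrightarrow> 0) (at d within D)" using tendsto_norm_zero_cancel by fastforce
    then show ?thesis using True by (simp add: continuous_within w_def)
   next
    case False
    have "continuous_on ?D (w k)"
     by (rule continuous_on_eq[of _ "%d. exp (l d / of_nat n) * exp (2 * of_real pi * \<i> * of_nat k / of_nat n)"])
      (use n0 in \<open>auto intro!: continuous_intros l(1) simp: w_def\<close>)
    then have "(w k \<longlongrightarrow> w k d) (at d within ?D)" using d False by (simp add: continuous_on)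
    moreover have "openin (top_of_set D) ?D"
    proof -
     have "openin (top_of_set D) (D Int u -` (- {0}))" by (rule continuous_openin_preimage_gen[OF u]) (rule open_Compl[OF closed_singleton])
     moreover have "D Int u -` (- {0}) = ?D" by auto
     ultimately show ?thesis by simp
    qed
    then obtain T where T: "open T" "?D = D Int T" unfolding openin_open by blast
    then have "d \<in> T" using d False by blast
    then have "at d within D = at d within ?D"
     by (rule at_within_nhd[OF _ T(1)]) (use T(2) in blast)
    ultimately show ?thesis by (simp add: continuous_within)
   qed
  qed
  then show "\<forall>k<n. continuous_on D (w k) & (\<forall>d\<in>D. w k d ^ n = u d)" using wn by blast
  have inj: "inj_on (%k. w k d) {..<n}" if "d \<in> D" "u d ~= 0" for d
  proof (rule inj_onI)
   fix j k assume jk: "j \<in> {..<n}" "k \<in> {..<n}" "w j d = w k d"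
   then have "exp (2 * of_real pi * \<i> * of_nat j / of_nat n) = exp (2 * of_real pi * \<i> * of_nat k / of_nat n)"
    using that by (simp add: w_def)
   then show "j = k" using complex_root_unity_eq[of n j k] jk n0 by simp
  qed
  then show "\<forall>d\<in>D. u d ~= 0 --> inj_on (%k. w k d) {..<n}" by blast
  show "\<forall>d\<in>D. \<forall>z. z ^ n = u d --> (\<exists>k<n. z = w k d)"
  proof (intro ballI allI impI)
   fix d z assume d: "d \<in> D" and z: "z ^ n = u d"
   show "\<exists>k<n. z = w k d"
   proof (cases "u d = 0")
    case True
    then have "z = w 0 d" using z n0 by (simp add: w_def)
    then show ?thesis using n by (intro exI[of _ 0]) simp
   next
    case False
    have "card {z. z ^ n = u d} = n" by (rule card_nth_roots[OF False]) (use n in simp)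
    moreover have "card ((%k. w k d) ` {..<n}) = n" using inj[OF d False] by (simp add: card_image)
    moreover have "(%k. w k d) ` {..<n} \<subseteq> {z. z ^ n = u d}" using wn[OF d] by auto
    moreover have "finite {z. z ^ n = u d}" by (rule finite_nth_roots) (use n in simp)
    ultimately have "(%k. w k d) ` {..<n} = {z. z ^ n = u d}" using card_subset_eq by metis
    then show ?thesis using z by blast
   qed
  qed
 qed
qed

section \<open>Subdividing arcs and enlarging graphs\<close>

text \<open>If P holds for all sufficiently short arcs in the sense of
  \<open>graphP_subdivide\<close>, a graph can be rebuilt in this form with the same Euler
  characteristic.\<close>

inductive graphP :: "'a topology => ((real => 'a) => bool) => 'a set => int => bool" for X P where
 base: "graphP X P {} 0"
| point: "graphP X P T e ==> x \<in> topspace X ==> x ~: T ==> graphP X P (insert x T) (e + 1)"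
| arc: "graphP X P T e ==> continuous_map (top_of_set {0..1}) X ga ==> inj_on ga {0..1} ==> P ga ==>
  T Int ga ` {0..1} = {ga 0, ga 1} ==> graphP X P (T Un ga ` {0..1}) (e - 1)"

definition aff :: "real => real => real => real" where
 "aff a b t = a + t * (b - a)"

lemma aff_image: "a < b ==> aff a b ` {0..1} = {a..b}"
proof (intro equalityI subsetI)
 fix x assume ab: "a < b" and x: "x \<in> {a..b}"
 then show "x \<in> aff a b ` {0..1}"
  by (intro image_eqI[of _ _ "(x - a) / (b - a)"]) (auto simp: aff_def field_simps)
next
 fix x assume ab: "a < b" and "x \<in> aff a b ` {0..1}"
 then obtain t where t: "0 <= t" "t <= 1" "x = a + t * (b - a)" unfolding aff_def by auto
 have "t * (b - a) <= b - a" "0 <= t * (b - a)" using t ab by (auto simp: mult_left_le_one_le)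
 then show "x \<in> {a..b}" using t by auto
qed

lemma aff_inj: "a < b ==> aff a b s = aff a b t \<longleftrightarrow> s = t"
 by (simp add: aff_def)

text \<open>Compactness of the interval in the form of bisection. The hypothesis \<open>loc\<close>
  speaks only of intervals without t in their interior, because \<open>ga t\<close> may be a branch
  point and must then become an end of the pieces.\<close>

lemma graphP_subdivide:
 assumes g: "graphP X P T e" and ga: "continuous_map (top_of_set {0..1}) X ga" "inj_on ga {0..1}"
  and int: "T Int ga ` {0..1} = {ga 0, ga 1}"
  and loc: "!!t. t \<in> {0..1} ==> \<exists>dl>0. \<forall>a b. 0 <= a --> a < b --> b <= 1 --> t - dl < a --> b < t + dl -->
    t ~: {a<..<b} --> P (ga \<circ> aff a b)"
 shows "graphP X P (T Un ga ` {0..1}) (e - 1)"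
proof -
 \<comment> \<open>T is quantified, so that the second half of an arc can be attached to a graph
   that already contains the first.\<close>
 define S where "S a b \<longleftrightarrow> (\<forall>T e. graphP X P T e --> T Int ga ` {a..b} = {ga a, ga b} --> graphP X P (T Un ga ` {a..b}) (e - 1))" for a b
 have SP: "S a b" if ab: "0 <= a" "a < b" "b <= 1" and P: "P (ga \<circ> aff a b)" for a b
  unfolding S_def
 proof (intro allI impI)
  fix T e assume T: "graphP X P T e" "T Int ga ` {a..b} = {ga a, ga b}"
  have im: "(ga \<circ> aff a b) ` {0..1} = ga ` {a..b}" unfolding image_comp[symmetric] aff_image[OF ab(2)] ..
  have sub: "{a..b} \<subseteq> {0..1}" using ab by auto
  have "continuous_on {0..1} (aff a b)" unfolding aff_def by (intro continuous_intros)
  then have "continuous_map (top_of_set {0..1}) (top_of_set {0..1}) (aff a b)"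
   using aff_image[OF ab(2)] sub by (simp add: continuous_map_in_subtopology image_subset_iff_funcset[symmetric])
  then have 1: "continuous_map (top_of_set {0..1}) X (ga \<circ> aff a b)" using ga(1) by (rule continuous_map_compose)
  have "inj_on (aff a b) {0..1}" using aff_inj[OF ab(2)] by (auto simp: inj_on_def)
  moreover have "inj_on ga (aff a b ` {0..1})" using inj_on_subset[OF ga(2) sub] aff_image[OF ab(2)] by simp
  ultimately have 2: "inj_on (ga \<circ> aff a b) {0..1}" by (rule comp_inj_on)
  have "T Int (ga \<circ> aff a b) ` {0..1} = {(ga \<circ> aff a b) 0, (ga \<circ> aff a b) 1}" unfolding im T(2) by (simp add: aff_def)
  from graphP.arc[OF T(1) 1 2 P this] show "graphP X P (T Un ga ` {a..b}) (e - 1)" unfolding im .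
 qed
 \<comment> \<open>The middle point adds 1 and the two halves take away 2, the same total as for the
   undivided arc.\<close>
 have join: "S a b" if ab: "0 <= a" "a < c" "c < b" "b <= 1" and S: "S a c" "S c b" for a b c
  unfolding S_def
 proof (intro allI impI)
  fix T e assume T: "graphP X P T e" "T Int ga ` {a..b} = {ga a, ga b}"
  have in01: "{a..b} \<subseteq> {0..1}" "{a..c} \<subseteq> {a..b}" "{c..b} \<subseteq> {a..b}" using ab by auto
  have inj: "ga s = ga t \<longleftrightarrow> s = t" if "s \<in> {a..b}" "t \<in> {a..b}" for s t
   using ga(2) in01 that by (meson inj_on_eq_iff subsetD)
  have Tt: "ga t \<in> T \<longleftrightarrow> t = a | t = b" if t: "t \<in> {a..b}" for t
  proof -
   have "ga t \<in> T \<longleftrightarrow> ga t \<in> {ga a, ga b}" using T(2) t by blast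
   then show ?thesis using inj[OF t, of a] inj[OF t, of b] ab by auto
  qed
  have c: "ga c \<in> topspace X" "ga c ~: T"
   using ga(1) ab Tt[of c] by (auto simp: continuous_map_def)
  have 1: "graphP X P (insert (ga c) T) (e + 1)" by (rule graphP.point[OF T(1) c])
  have "insert (ga c) T Int ga ` {a..c} = {ga a, ga c}"
  proof (intro equalityI subsetI)
   fix x assume x: "x \<in> insert (ga c) T Int ga ` {a..c}"
   then obtain t where t: "t \<in> {a..c}" "x = ga t" by blast
   then have "ga t = ga c | t = a | t = b" using x Tt[of t] ab by auto
   then have "ga t = ga c | t = a" using t(1) ab by auto
   then show "x \<in> {ga a, ga c}" using t(2) by blast
  next
   fix x assume x: "x \<in> {ga a, ga c}"
   have "ga a \<in> T" "ga a \<in> ga ` {a..c}" "ga c \<in> ga ` {a..c}" using Tt[of a] ab by simp_all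
   then show "x \<in> insert (ga c) T Int ga ` {a..c}" using x by blast
  qed
  then have 2: "graphP X P (insert (ga c) T Un ga ` {a..c}) (e + 1 - 1)" using S(1) 1 unfolding S_def by blast
  have "(insert (ga c) T Un ga ` {a..c}) Int ga ` {c..b} = {ga c, ga b}"
  proof (intro equalityI subsetI)
   fix x assume x: "x \<in> (insert (ga c) T Un ga ` {a..c}) Int ga ` {c..b}"
   then obtain t where t: "t \<in> {c..b}" "x = ga t" by blast
   then consider "ga t = ga c" | "ga t \<in> T" | s where "s \<in> {a..c}" "ga t = ga s" using x by blast
   then show "x \<in> {ga c, ga b}"
   proof cases
    case 1 then show ?thesis using t(2) by simp
   next
    case 2
    then have "t = b" using Tt[of t] t(1) ab by simp
    then show ?thesis using t(2) by simp
   next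
    case 3
    have "s \<in> {a..b}" "t \<in> {a..b}" using 3(1) t(1) ab by auto
    then have "t = s" using inj 3(2) by blast
    then have "t = c" using 3(1) t(1) by simp
    then show ?thesis using t(2) by simp
   qed
  next
   fix x assume x: "x \<in> {ga c, ga b}"
   have "ga b \<in> T" "ga b \<in> ga ` {c..b}" "ga c \<in> ga ` {c..b}" using Tt[of b] ab by simp_all
   then show "x \<in> (insert (ga c) T Un ga ` {a..c}) Int ga ` {c..b}" using x by blast
  qed
  then have 3: "graphP X P (insert (ga c) T Un ga ` {a..c} Un ga ` {c..b}) (e + 1 - 1 - 1)" using S(2) 2 unfolding S_def by blast
  have "{a..b} = {a..c} Un {c..b}" "c \<in> {a..c}" using ab by auto
  then have "insert (ga c) T Un ga ` {a..c} Un ga ` {c..b} = T Un ga ` {a..b}" by blast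
  then show "graphP X P (T Un ga ` {a..b}) (e - 1)" using 3 by simp
 qed
 have "0 <= (0::real) --> 0 < (1::real) --> (1::real) <= 1 --> S 0 1"
 proof (rule Bolzano[of 0 1 "%a b. 0 <= a --> a < b --> b <= 1 --> S a b"])
  fix a b c :: real
  assume "0 <= a --> a < b --> b <= 1 --> S a b" "0 <= b --> b < c --> c <= 1 --> S b c" "a <= b" "b <= c"
  then show "0 <= a --> a < c --> c <= 1 --> S a c"
   using join[of a b c] by (cases "a = b"; cases "b = c") auto
 next
  fix t :: real assume t: "0 <= t" "t <= 1"
  then obtain dl where dl: "dl > 0" "!!a b. 0 <= a ==> a < b ==> b <= 1 ==> t - dl < a ==> b < t + dl ==>
    t ~: {a<..<b} ==> P (ga \<circ> aff a b)" using loc[of t] by (metis atLeastAtMost_iff)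
  show "\<exists>d>0. \<forall>a b. a <= t & t <= b & b - a < d --> (0 <= a --> a < b --> b <= 1 --> S a b)"
  proof (intro exI[of _ dl] conjI allI impI)
   fix a b assume ab: "a <= t & t <= b & b - a < dl" "0 <= a" "a < b" "b <= 1"
   show "S a b"
   proof (cases "t = a | t = b")
    case True
    show ?thesis by (rule SP[OF ab(2-4)], rule dl(2)) (use ab True in auto)
   next
    \<comment> \<open>An interval with t in its interior is split at t.\<close>
    case False
    then have "a < t" "t < b" using ab by auto
    moreover have "S a t" by (rule SP, use ab \<open>a < t\<close> t in simp_all, rule dl(2)) (use ab \<open>a < t\<close> t in auto)
    moreover have "S t b" by (rule SP, use ab \<open>t < b\<close> t in simp_all, rule dl(2)) (use ab \<open>t < b\<close> t in auto)
    ultimately show ?thesis using join ab by blast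
   qed
  qed (use dl in simp)
 qed simp
 then have "S 0 1" by simp
 then show ?thesis using g int unfolding S_def by blast
qed

lemma graph_add_points:
 assumes "graph X S e" "finite F" "F \<subseteq> topspace X" "F Int S = {}"
 shows "graph X (S Un F) (e + int (card F))"
 using assms(2-4)
proof (induction F rule: finite_induct)
 case empty then show ?case using assms(1) by simp
next
 case (insert x F)
 have "graph X (insert x (S Un F)) (e + int (card F) + 1)"
  by (rule graphext.point) (use insert in auto)
 moreover have "e + int (card F) + 1 = e + int (card (insert x F))" using insert.hyps by simp
 ultimately show ?case by simp
qed

lemma Un_UNION_Int: "(!!x. x \<in> L ==> F x Int A \<subseteq> S) ==> (S Un (\<Union>x\<in>L. F x)) Int A = S Int A"
 by blast

text \<open>The arcs meet one another only in S, so each of them still has just its ends in common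
  with the union built before it.\<close>

lemma graph_add_arcs:
 assumes "graph X S e" "finite L"
  and arc: "!!La. La \<in> L ==> continuous_map (top_of_set {0..1::real}) X La & inj_on La {0..1} & S Int La ` {0..1} = {La 0, La 1}"
  and dis: "!!La La'. La \<in> L ==> La' \<in> L ==> La ~= La' ==> La ` {0..1} Int La' ` {0..1} \<subseteq> S"
 shows "graph X (S Un (\<Union>La\<in>L. La ` {0..1})) (e - int (card L))"
 using assms(2) arc dis
proof (induction L rule: finite_induct)
 case empty show ?case using assms(1) by simp
next
 case (insert La L)
 let ?S = "S Un (\<Union>La\<in>L. La ` {0..1})"
 have IH: "graph X ?S (e - int (card L))"
 proof (rule insert.IH)
  show "continuous_map (top_of_set {0..1}) X La' & inj_on La' {0..1} & S Int La' ` {0..1} = {La' 0, La' 1}" if "La' \<in> L" for La'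
   by (rule insert.prems(1)[OF insertI2[OF that]])
  show "La' ` {0..1} Int La'' ` {0..1} \<subseteq> S" if "La' \<in> L" "La'' \<in> L" "La' ~= La''" for La' La''
   by (rule insert.prems(2)[OF insertI2[OF that(1)] insertI2[OF that(2)] that(3)])
 qed
 note a' = insert.prems(1)[OF insertI1]
 note a = conjunct1[OF a'] conjunct1[OF conjunct2[OF a']] conjunct2[OF conjunct2[OF a']]
 have "La' ` {0..1} Int La ` {0..1} \<subseteq> S" if "La' \<in> L" for La'
  by (rule insert.prems(2)[OF insertI2[OF that] insertI1]) (use that insert.hyps in blast)
 then have "?S Int La ` {0..1} = S Int La ` {0..1}" by (rule Un_UNION_Int)
 then have "?S Int La ` {0..1} = {La 0, La 1}" using a(3) by simp
 from graphext.arc[OF IH a(1,2) this]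
 have "graph X (?S Un La ` {0..1}) (e - int (card L) - 1)" .
 moreover have "?S Un La ` {0..1} = S Un (\<Union>La\<in>insert La L. La ` {0..1})" unfolding UN_insert by (simp only: Un_ac)
 moreover have "e - int (card L) - 1 = e - int (card (insert La L))" using insert.hyps by simp
 ultimately show ?case by simp
qed

section \<open>Cutting a cell in two\<close>

text \<open>The cutting arc costs 1 in e and the cell set gains one member, so the Euler
  characteristic is preserved. The maps \<open>al\<close> and \<open>\<beta>\<close> parametrize the
  closed halves. That the new cells differ from each other and from the remaining ones is recorded
  for nested cuts.\<close>

lemma cell_cut:
 assumes c: "cellulation Y G e K" and k: "kp \<in> K"
  and al: "continuous_on Sq al" "al ` Sq \<subseteq> Sq" "inj_on al Sq"
  and \<beta>: "continuous_on Sq \<beta>" "\<beta> ` Sq \<subseteq> Sq" "inj_on \<beta> Sq"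
  and cov: "Sq \<subseteq> al ` Sq Un \<beta> ` Sq"
  and sgm: "continuous_on {0..1::real} sgm" "inj_on sgm {0..1}" "sgm ` {0..1} \<subseteq> Sq"
  and int: "al ` Sq Int \<beta> ` Sq \<subseteq> sgm ` {0..1}"
  and sal: "!!z. z \<in> Sq ==> supn (al z) = 1 | al z \<in> sgm ` {0..1} \<longleftrightarrow> supn z = 1"
  and s\<beta>: "!!z. z \<in> Sq ==> supn (\<beta> z) = 1 | \<beta> z \<in> sgm ` {0..1} \<longleftrightarrow> supn z = 1"
  and ssgm: "!!t. t \<in> {0..1} ==> supn (sgm t) = 1 \<longleftrightarrow> t = 0 | t = 1"
 shows "cellulation Y (G Un kp ` sgm ` {0..1}) (e - 1) ((K - {kp}) Un {kp \<circ> al, kp \<circ> \<beta>})"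
  "kp \<circ> al ~= kp \<circ> \<beta>" "kp \<circ> al ~: K - {kp}" "kp \<circ> \<beta> ~: K - {kp}"
proof -
 have gr: "graph Y G e" and fin: "finite K" and ce: "!!kp. kp \<in> K ==> cell Y G kp"
  and dis: "!!kp kp' z z'. kp \<in> K ==> kp' \<in> K ==> z \<in> Sq ==> z' \<in> Sq ==> kp z = kp' z' ==> kp z ~: G ==> kp = kp'"
  and top: "topspace Y = G Un (\<Union>kp\<in>K. kp ` Sq)"
  using c unfolding cellulation_def by blast+
 have kc: "continuous_map (top_of_set Sq) Y kp" and ki: "inj_on kp Sq" and kG: "!!z. z \<in> Sq ==> kp z \<in> G \<longleftrightarrow> supn z = 1"
  using ce[OF k] unfolding cell_def by auto
 let ?I = "{0..1::real}" let ?G = "G Un kp ` sgm ` {0..1}"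
 have kS: "kp z \<in> kp ` sgm ` ?I \<longleftrightarrow> z \<in> sgm ` ?I" if "z \<in> Sq" for z
  using inj_on_image_mem_iff[OF ki that sgm(3)] .
 have gr': "graph Y ?G (e - 1)"
 proof -
  have "continuous_map (top_of_set ?I) (top_of_set Sq) sgm" using sgm by (auto simp: continuous_map_in_subtopology)
  then have 1: "continuous_map (top_of_set ?I) Y (kp \<circ> sgm)" using kc by (rule continuous_map_compose)
  have 2: "inj_on (kp \<circ> sgm) ?I" by (rule comp_inj_on[OF sgm(2) inj_on_subset[OF ki sgm(3)]])
  have "G Int (kp \<circ> sgm) ` ?I = {(kp \<circ> sgm) 0, (kp \<circ> sgm) 1}"
  proof -
   have "kp (sgm t) \<in> G \<longleftrightarrow> t = 0 | t = 1" if "t \<in> ?I" for t using kG[of "sgm t"] ssgm[OF that] sgm(3) that by blast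
   then show ?thesis by auto
  qed
  from graphext.arc[OF gr 1 2 this] show ?thesis unfolding image_comp .
 qed
 have cell2: "cell Y ?G (kp \<circ> et)" if et: "continuous_on Sq et" "et ` Sq \<subseteq> Sq" "inj_on et Sq"
  "!!z. z \<in> Sq ==> supn (et z) = 1 | et z \<in> sgm ` ?I \<longleftrightarrow> supn z = 1" for et
  unfolding cell_def
 proof (intro conjI ballI)
  have "continuous_map (top_of_set Sq) (top_of_set Sq) et" using et by (auto simp: continuous_map_in_subtopology)
  then show "continuous_map (top_of_set Sq) Y (kp \<circ> et)" using kc by (rule continuous_map_compose)
  show "inj_on (kp \<circ> et) Sq" by (rule comp_inj_on[OF et(3) inj_on_subset[OF ki et(2)]])
  fix z assume z: "z \<in> Sq"
  then have ez: "et z \<in> Sq" using et(2) by blast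
  have "(kp \<circ> et) z \<in> ?G \<longleftrightarrow> supn (et z) = 1 | et z \<in> sgm ` ?I" using kG[OF ez] kS[OF ez] by simp
  then show "(kp \<circ> et) z \<in> ?G \<longleftrightarrow> supn z = 1" using et(4)[OF z] by simp
 qed
 have cal: "cell Y ?G (kp \<circ> al)" by (rule cell2[OF al sal])
 have c\<beta>: "cell Y ?G (kp \<circ> \<beta>)" by (rule cell2[OF \<beta> s\<beta>])
 have oth: "kp' z ~: kp ` Sq" if "kp' \<in> K - {kp}" "z \<in> Sq" "kp' z ~: G" for kp' z
  using dis[of kp' kp z] that k by blast
 have cO: "cell Y ?G kp'" if k': "kp' \<in> K - {kp}" for kp'
 proof -
  have "cell Y G kp'" using ce k' by blast
  moreover have "kp' z \<in> ?G \<longleftrightarrow> kp' z \<in> G" if "z \<in> Sq" for z using oth[OF k' that] sgm(3) by blast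
  ultimately show ?thesis unfolding cell_def by simp
 qed
 have a0: "al 0 \<in> Sq" "\<beta> 0 \<in> Sq" using al(2) \<beta>(2) by auto
 have n0: "(kp \<circ> al) 0 ~: ?G" "(kp \<circ> \<beta>) 0 ~: ?G" using cal c\<beta> unfolding cell_def by auto
 have ab: "al z ~= \<beta> z'" if "z \<in> Sq" "z' \<in> Sq" "kp (al z) ~: ?G" for z z'
  using int that kS[of "al z"] al(2) by (metis IntI UnCI imageI image_subset_iff subsetD)
 show ne: "kp \<circ> al ~= kp \<circ> \<beta>"
 proof
  assume "kp \<circ> al = kp \<circ> \<beta>"
  then have "kp (al 0) = kp (\<beta> 0)" by (metis comp_apply)
  then have "al 0 = \<beta> 0" using ki a0 by (auto dest: inj_onD)
  then show False using ab[of 0 0] n0 by simp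
 qed
 show na: "kp \<circ> al ~: K - {kp}"
 proof
  assume a: "kp \<circ> al \<in> K - {kp}"
  have "(kp \<circ> al) 0 ~: kp ` Sq" by (rule oth[OF a]) (use n0 in auto)
  then show False using a0 by auto
 qed
 show nb: "kp \<circ> \<beta> ~: K - {kp}"
 proof
  assume a: "kp \<circ> \<beta> \<in> K - {kp}"
  have "(kp \<circ> \<beta>) 0 ~: kp ` Sq" by (rule oth[OF a]) (use n0 in auto)
  then show False using a0 by auto
 qed
 show "cellulation Y ?G (e - 1) ((K - {kp}) Un {kp \<circ> al, kp \<circ> \<beta>})"
  unfolding cellulation_def
 proof (intro conjI)
  show "\<forall>kp'\<in>(K - {kp}) Un {kp \<circ> al, kp \<circ> \<beta>}. cell Y ?G kp'" using cal c\<beta> cO by blast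
  have inkp: "(kp \<circ> al) z \<in> kp ` Sq" "(kp \<circ> \<beta>) z \<in> kp ` Sq" if "z \<in> Sq" for z using al(2) \<beta>(2) that by auto
  have d1: False if "kp1 \<in> K - {kp}" "kp2 \<in> {kp \<circ> al, kp \<circ> \<beta>}" "z \<in> Sq" "z' \<in> Sq" "kp1 z = kp2 z'" "kp1 z ~: ?G" for kp1 kp2 z z'
  proof -
   have "kp1 z ~: kp ` Sq" using oth[OF that(1,3)] that(6) by blast
   moreover have "kp2 z' \<in> kp ` Sq" using that(2) inkp[OF that(4)] by blast
   ultimately show False using that(5) by simp
  qed
  have d2: False if "z \<in> Sq" "z' \<in> Sq" "(kp \<circ> al) z = (kp \<circ> \<beta>) z'" "(kp \<circ> al) z ~: ?G" for z z'
  proof -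
   have "al z = \<beta> z'" using that(1-3) ki al(2) \<beta>(2) by (auto dest!: inj_onD)
   then show False using ab[OF that(1,2)] that(4) by simp
  qed
  show "\<forall>kp1\<in>(K - {kp}) Un {kp \<circ> al, kp \<circ> \<beta>}. \<forall>kp2\<in>(K - {kp}) Un {kp \<circ> al, kp \<circ> \<beta>}. \<forall>z\<in>Sq. \<forall>z'\<in>Sq.
    kp1 z = kp2 z' --> kp1 z ~: ?G --> kp1 = kp2"
  proof (intro ballI impI)
   fix kp1 kp2 z z'
   assume a: "kp1 \<in> (K - {kp}) Un {kp \<circ> al, kp \<circ> \<beta>}" "kp2 \<in> (K - {kp}) Un {kp \<circ> al, kp \<circ> \<beta>}" "z \<in> Sq" "z' \<in> Sq" "kp1 z = kp2 z'" "kp1 z ~: ?G"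
   have a': "kp2 z' = kp1 z" "kp2 z' ~: ?G" using a by simp_all
   consider "kp1 \<in> K - {kp}" "kp2 \<in> K - {kp}" | "kp1 \<in> K - {kp}" "kp2 \<in> {kp \<circ> al, kp \<circ> \<beta>}" | "kp2 \<in> K - {kp}" "kp1 \<in> {kp \<circ> al, kp \<circ> \<beta>}"
    | "kp1 = kp \<circ> al" "kp2 = kp \<circ> \<beta>" | "kp1 = kp \<circ> \<beta>" "kp2 = kp \<circ> al" | "kp1 = kp2" using a(1,2) by (auto simp del: o_apply)
   then show "kp1 = kp2"
   proof cases
    case 1 then show ?thesis using dis[of kp1 kp2 z z'] a by blast
   next
    case 2 then show ?thesis using d1[OF 2 a(3,4,5,6)] by blast
   next
    case 3 then show ?thesis using d1[OF 3 a(4,3) a'] by blast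
   next
    case 4 then show ?thesis using d2[OF a(3,4)] a(5,6) by blast
   next
    case 5 then show ?thesis using d2[OF a(4,3)] a' by blast
   qed
  qed
  show "topspace Y = ?G Un (\<Union>kp'\<in>(K - {kp}) Un {kp \<circ> al, kp \<circ> \<beta>}. kp' ` Sq)"
  proof (intro equalityI subsetI)
   fix x assume "x \<in> topspace Y"
   then consider "x \<in> G" | kp' where "kp' \<in> K - {kp}" "x \<in> kp' ` Sq" | "x \<in> kp ` Sq" using top by blast
   then show "x \<in> ?G Un (\<Union>kp'\<in>(K - {kp}) Un {kp \<circ> al, kp \<circ> \<beta>}. kp' ` Sq)"
   proof cases
    case 3
    then have "x \<in> kp ` al ` Sq Un kp ` \<beta> ` Sq" using cov by blast
    then show ?thesis unfolding image_comp by blast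
   qed blast+
  next
   fix x assume "x \<in> ?G Un (\<Union>kp'\<in>(K - {kp}) Un {kp \<circ> al, kp \<circ> \<beta>}. kp' ` Sq)"
   then consider "x \<in> G" | "x \<in> kp ` Sq" | kp' where "kp' \<in> K" "x \<in> kp' ` Sq" using sgm(3) inkp by blast
   then show "x \<in> topspace Y" using top k by cases blast+
  qed
 qed (use gr' fin in auto)
qed

lemma supn_Complex: "supn (Complex x y) = max \<bar>x\<bar> \<bar>y\<bar>"
 by (simp add: supn_def)

lemma Sq_iff: "z \<in> Sq \<longleftrightarrow> \<bar>Re z\<bar> <= 1 & \<bar>Im z\<bar> <= 1"
 by (simp add: Sq_def supn_def)

lemma supn_1_iff: "z \<in> Sq ==> supn z = 1 \<longleftrightarrow> \<bar>Re z\<bar> = 1 | \<bar>Im z\<bar> = 1"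
 by (auto simp: Sq_iff supn_def)

text \<open>The affine map of the standard square onto the rectangle \<open>[a, b] \<times> [c, d]\<close>.\<close>

definition rect :: "real => real => real => real => complex => complex" where
 "rect a b c d z = Complex (a + (Re z + 1) / 2 * (b - a)) (c + (Im z + 1) / 2 * (d - c))"

lemma interp: "a < b ==> \<bar>s\<bar> <= 1 ==> a <= a + (s + 1) / 2 * (b - a) & a + (s + 1) / 2 * (b - a) <= (b::real)"
proof -
 assume a: "a < b" "\<bar>s\<bar> <= 1"
 have "0 <= (s + 1) / 2 * (b - a)" using a by (intro mult_nonneg_nonneg) auto
 moreover have "(s + 1) / 2 * (b - a) <= 1 * (b - a)" using a by (intro mult_right_mono) auto
 ultimately show ?thesis by simp
qed

lemma interp_ends:
 fixes a b s :: real
 assumes ab: "a < b"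
 shows "a + (s + 1) / 2 * (b - a) = a \<longleftrightarrow> s = - 1" "a + (s + 1) / 2 * (b - a) = b \<longleftrightarrow> s = (1::real)"
proof -
 have 1: "a + x * (b - a) = a \<longleftrightarrow> x = 0" for x using ab by simp
 have "a + x * (b - a) = b \<longleftrightarrow> (x - 1) * (b - a) = 0" for x by (simp add: algebra_simps)
 then have 2: "a + x * (b - a) = b \<longleftrightarrow> x = 1" for x using ab by simp
 show "a + (s + 1) / 2 * (b - a) = a \<longleftrightarrow> s = - 1" unfolding 1 by auto
 show "a + (s + 1) / 2 * (b - a) = b \<longleftrightarrow> s = 1" unfolding 2 by auto
qed

lemma rect_in: assumes "a < b" "c < d" "z \<in> Sq"
 shows "a <= Re (rect a b c d z)" "Re (rect a b c d z) <= b" "c <= Im (rect a b c d z)" "Im (rect a b c d z) <= d"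
proof -
 have "\<bar>Re z\<bar> <= 1" "\<bar>Im z\<bar> <= 1" using assms(3) by (simp_all add: Sq_iff)
 from interp[OF assms(1) this(1)] interp[OF assms(2) this(2)]
 show "a <= Re (rect a b c d z)" "Re (rect a b c d z) <= b" "c <= Im (rect a b c d z)" "Im (rect a b c d z) <= d"
  unfolding rect_def complex.sel by blast+
qed

lemma rect_image: assumes "a < b" "c < d"
 shows "rect a b c d ` Sq = {w. a <= Re w & Re w <= b & c <= Im w & Im w <= d}"
proof (intro equalityI subsetI)
 fix w assume w: "w \<in> {w. a <= Re w & Re w <= b & c <= Im w & Im w <= d}"
 show "w \<in> rect a b c d ` Sq"
 proof (rule image_eqI)
  show "w = rect a b c d (Complex (2 * ((Re w - a) / (b - a)) - 1) (2 * ((Im w - c) / (d - c)) - 1))"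
  proof -
   have *: "x = a + (2 * ((x - a) / (b - a)) - 1 + 1) / 2 * (b - a)" if "a < b" for x a b :: real
   proof -
    have "(2 * y - 1 + 1) / 2 = y" for y :: real by simp
    then show ?thesis using that by (simp only:) simp
   qed
   show ?thesis using *[OF assms(1)] *[OF assms(2)] unfolding rect_def by (intro complex_eqI) (simp only: complex.sel)+
  qed
  have "0 <= (Re w - a) / (b - a)" "(Re w - a) / (b - a) <= 1" "0 <= (Im w - c) / (d - c)" "(Im w - c) / (d - c) <= 1"
   using w assms by auto
  moreover have "\<bar>2 * y - 1\<bar> <= 1" if "0 <= y" "y <= 1" for y :: real using that by linarith
  ultimately show "Complex (2 * ((Re w - a) / (b - a)) - 1) (2 * ((Im w - c) / (d - c)) - 1) \<in> Sq"
   unfolding Sq_iff complex.sel by blast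
 qed
qed (use rect_in[OF assms] in auto)

lemma rect_inj: "a < b ==> c < d ==> rect a b c d z = rect a b c d w \<longleftrightarrow> z = w"
 by (auto simp: rect_def complex_eq_iff)

lemma rect_cont: "continuous_on S (rect a b c d)"
 unfolding rect_def by (auto intro!: continuous_intros simp: Complex_eq)

lemma rect_id: "Re (rect (- 1) 1 c d z) = Re z" "Im (rect a b (- 1) 1 z) = Im z"
 by (simp_all add: rect_def add_divide_distrib)

lemma rect_vcut: "- 1 < t ==> t < 1 ==> rect a b c d \<circ> rect (- 1) t (- 1) 1 = rect a (a + (t + 1) / 2 * (b - a)) c d"
 "- 1 < t ==> t < 1 ==> rect a b c d \<circ> rect t 1 (- 1) 1 = rect (a + (t + 1) / 2 * (b - a)) b c d"
 by (auto simp: rect_def fun_eq_iff field_simps)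

lemma rect_hcut: "- 1 < t ==> t < 1 ==> rect a b c d \<circ> rect (- 1) 1 (- 1) t = rect a b c (c + (t + 1) / 2 * (d - c))"
 "- 1 < t ==> t < 1 ==> rect a b c d \<circ> rect (- 1) 1 t 1 = rect a b (c + (t + 1) / 2 * (d - c)) d"
 by (auto simp: rect_def fun_eq_iff field_simps)

lemma vcut:
 assumes c: "cellulation Y G e K" and k: "kp \<in> K" and t: "- 1 < t" "t < 1"
 shows "cellulation Y (G Un kp ` (%s. Complex t (2 * s - 1)) ` {0..1}) (e - 1) ((K - {kp}) Un {kp \<circ> rect (- 1) t (- 1) 1, kp \<circ> rect t 1 (- 1) 1})"
  "kp \<circ> rect (- 1) t (- 1) 1 ~= kp \<circ> rect t 1 (- 1) 1"
  "kp \<circ> rect (- 1) t (- 1) 1 ~: K - {kp}" "kp \<circ> rect t 1 (- 1) 1 ~: K - {kp}"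
proof -
 have sgm: "(%s. Complex t (2 * s - 1)) ` {0..1} = {w. Re w = t & \<bar>Im w\<bar> <= 1}"
 proof (intro equalityI subsetI)
  fix w assume "w \<in> {w. Re w = t & \<bar>Im w\<bar> <= 1}"
  then show "w \<in> (%s. Complex t (2 * s - 1)) ` {0..1}"
   by (intro image_eqI[of _ _ "(Im w + 1) / 2"]) (auto simp: complex_eq_iff abs_le_iff field_simps)
 qed auto
 have im: "rect (- 1) t (- 1) 1 ` Sq = {w. - 1 <= Re w & Re w <= t & - 1 <= Im w & Im w <= 1}"
  "rect t 1 (- 1) 1 ` Sq = {w. t <= Re w & Re w <= 1 & - 1 <= Im w & Im w <= 1}"
  using rect_image t by auto
 note A = cell_cut[OF c k, of "rect (- 1) t (- 1) 1" "rect t 1 (- 1) 1" "%s. Complex t (2 * s - 1)"]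
 have 1: "rect (- 1) t (- 1) 1 ` Sq \<subseteq> Sq" "rect t 1 (- 1) 1 ` Sq \<subseteq> Sq" "Sq \<subseteq> rect (- 1) t (- 1) 1 ` Sq Un rect t 1 (- 1) 1 ` Sq"
  "rect (- 1) t (- 1) 1 ` Sq Int rect t 1 (- 1) 1 ` Sq \<subseteq> (%s. Complex t (2 * s - 1)) ` {0..1}"
  unfolding im sgm using t by (auto simp: Sq_iff)
 have 2: "inj_on (rect (- 1) t (- 1) 1) Sq" "inj_on (rect t 1 (- 1) 1) Sq" using rect_inj t by (auto simp: inj_on_def)
 have 3: "(%s. Complex t (2 * s - 1)) ` {0..1} \<subseteq> Sq" "inj_on (%s. Complex t (2 * s - 1)) {0..1}"
  "continuous_on {0..1} (%s. Complex t (2 * s - 1))"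
  unfolding sgm using t by (auto simp: Sq_iff inj_on_def intro!: continuous_intros)
 \<comment> \<open>The right side of the square goes to the cut and the left side stays in place, so
   the boundary of the half lies in the old boundary or in the cut.\<close>
 have 4: "supn (rect (- 1) t (- 1) 1 z) = 1 | rect (- 1) t (- 1) 1 z \<in> (%s. Complex t (2 * s - 1)) ` {0..1} \<longleftrightarrow> supn z = 1" if z: "z \<in> Sq" for z
 proof -
  let ?w = "rect (- 1) t (- 1) 1 z"
  have w: "?w \<in> Sq" "Re ?w <= t" using 1(1) rect_in(2)[of "-1" t "-1" 1 z] z t by auto
  have "Re ?w = - 1 \<longleftrightarrow> Re z = - 1" "Re ?w = t \<longleftrightarrow> Re z = 1"
   using interp_ends[of "-1" t "Re z"] t by (auto simp: rect_def)
  moreover have "Im ?w = Im z" by (rule rect_id)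
  moreover have "\<bar>Re ?w\<bar> = 1 \<longleftrightarrow> Re ?w = - 1" using w t by auto
  ultimately show ?thesis unfolding sgm supn_1_iff[OF w(1)] supn_1_iff[OF z] using z w by (auto simp: Sq_iff)
 qed
 have 5: "supn (rect t 1 (- 1) 1 z) = 1 | rect t 1 (- 1) 1 z \<in> (%s. Complex t (2 * s - 1)) ` {0..1} \<longleftrightarrow> supn z = 1" if z: "z \<in> Sq" for z
 proof -
  let ?w = "rect t 1 (- 1) 1 z"
  have w: "?w \<in> Sq" "t <= Re ?w" using 1(2) rect_in(1)[of t 1 "-1" 1 z] z t by auto
  have "Re ?w = 1 \<longleftrightarrow> Re z = 1" "Re ?w = t \<longleftrightarrow> Re z = - 1"
   using interp_ends[of t 1 "Re z"] t by (auto simp: rect_def)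
  moreover have "Im ?w = Im z" by (rule rect_id)
  moreover have "\<bar>Re ?w\<bar> = 1 \<longleftrightarrow> Re ?w = 1" using w t by auto
  ultimately show ?thesis unfolding sgm supn_1_iff[OF w(1)] supn_1_iff[OF z] using z w by (auto simp: Sq_iff)
 qed
 have 6: "supn (Complex t (2 * s - 1)) = 1 \<longleftrightarrow> s = 0 | s = 1" if "s \<in> {0..1}" for s
  using t that by (auto simp: supn_Complex max_def abs_if split: if_splits)
 note B = A[OF rect_cont 1(1) 2(1) rect_cont 1(2) 2(2) 1(3) 3(3,2,1) 1(4) 4 5 6]
 show "cellulation Y (G Un kp ` (%s. Complex t (2 * s - 1)) ` {0..1}) (e - 1) ((K - {kp}) Un {kp \<circ> rect (- 1) t (- 1) 1, kp \<circ> rect t 1 (- 1) 1})"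
  by (rule B(1))
 show "kp \<circ> rect (- 1) t (- 1) 1 ~= kp \<circ> rect t 1 (- 1) 1" by (rule B(2))
 show "kp \<circ> rect (- 1) t (- 1) 1 ~: K - {kp}" by (rule B(3))
 show "kp \<circ> rect t 1 (- 1) 1 ~: K - {kp}" by (rule B(4))
qed

lemma hcut:
 assumes c: "cellulation Y G e K" and k: "kp \<in> K" and t: "- 1 < t" "t < 1"
 shows "cellulation Y (G Un kp ` (%s. Complex (2 * s - 1) t) ` {0..1}) (e - 1) ((K - {kp}) Un {kp \<circ> rect (- 1) 1 (- 1) t, kp \<circ> rect (- 1) 1 t 1})"
  "kp \<circ> rect (- 1) 1 (- 1) t ~= kp \<circ> rect (- 1) 1 t 1"
  "kp \<circ> rect (- 1) 1 (- 1) t ~: K - {kp}" "kp \<circ> rect (- 1) 1 t 1 ~: K - {kp}"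
proof -
 have sgm: "(%s. Complex (2 * s - 1) t) ` {0..1} = {w. Im w = t & \<bar>Re w\<bar> <= 1}"
 proof (intro equalityI subsetI)
  fix w assume "w \<in> {w. Im w = t & \<bar>Re w\<bar> <= 1}"
  then show "w \<in> (%s. Complex (2 * s - 1) t) ` {0..1}"
   by (intro image_eqI[of _ _ "(Re w + 1) / 2"]) (auto simp: complex_eq_iff abs_le_iff field_simps)
 qed auto
 have im: "rect (- 1) 1 (- 1) t ` Sq = {w. - 1 <= Re w & Re w <= 1 & - 1 <= Im w & Im w <= t}"
  "rect (- 1) 1 t 1 ` Sq = {w. - 1 <= Re w & Re w <= 1 & t <= Im w & Im w <= 1}"
  using rect_image t by auto
 note A = cell_cut[OF c k, of "rect (- 1) 1 (- 1) t" "rect (- 1) 1 t 1" "%s. Complex (2 * s - 1) t"]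
 have 1: "rect (- 1) 1 (- 1) t ` Sq \<subseteq> Sq" "rect (- 1) 1 t 1 ` Sq \<subseteq> Sq" "Sq \<subseteq> rect (- 1) 1 (- 1) t ` Sq Un rect (- 1) 1 t 1 ` Sq"
  "rect (- 1) 1 (- 1) t ` Sq Int rect (- 1) 1 t 1 ` Sq \<subseteq> (%s. Complex (2 * s - 1) t) ` {0..1}"
  unfolding im sgm using t by (auto simp: Sq_iff)
 have 2: "inj_on (rect (- 1) 1 (- 1) t) Sq" "inj_on (rect (- 1) 1 t 1) Sq" using rect_inj t by (auto simp: inj_on_def)
 have 3: "(%s. Complex (2 * s - 1) t) ` {0..1} \<subseteq> Sq" "inj_on (%s. Complex (2 * s - 1) t) {0..1}"
  "continuous_on {0..1} (%s. Complex (2 * s - 1) t)"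
  unfolding sgm using t by (auto simp: Sq_iff inj_on_def intro!: continuous_intros)
 have 4: "supn (rect (- 1) 1 (- 1) t z) = 1 | rect (- 1) 1 (- 1) t z \<in> (%s. Complex (2 * s - 1) t) ` {0..1} \<longleftrightarrow> supn z = 1" if z: "z \<in> Sq" for z
 proof -
  let ?w = "rect (- 1) 1 (- 1) t z"
  have w: "?w \<in> Sq" "Im ?w <= t" using 1(1) rect_in(4)[of "-1" 1 "-1" t z] z t by auto
  have "Im ?w = - 1 \<longleftrightarrow> Im z = - 1" "Im ?w = t \<longleftrightarrow> Im z = 1"
   using interp_ends[of "-1" t "Im z"] t by (auto simp: rect_def)
  moreover have "Re ?w = Re z" by (rule rect_id)
  moreover have "\<bar>Im ?w\<bar> = 1 \<longleftrightarrow> Im ?w = - 1" using w t by auto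
  ultimately show ?thesis unfolding sgm supn_1_iff[OF w(1)] supn_1_iff[OF z] using z w by (auto simp: Sq_iff)
 qed
 have 5: "supn (rect (- 1) 1 t 1 z) = 1 | rect (- 1) 1 t 1 z \<in> (%s. Complex (2 * s - 1) t) ` {0..1} \<longleftrightarrow> supn z = 1" if z: "z \<in> Sq" for z
 proof -
  let ?w = "rect (- 1) 1 t 1 z"
  have w: "?w \<in> Sq" "t <= Im ?w" using 1(2) rect_in(3)[of "-1" 1 t 1 z] z t by auto
  have "Im ?w = 1 \<longleftrightarrow> Im z = 1" "Im ?w = t \<longleftrightarrow> Im z = - 1"
   using interp_ends[of t 1 "Im z"] t by (auto simp: rect_def)
  moreover have "Re ?w = Re z" by (rule rect_id)
  moreover have "\<bar>Im ?w\<bar> = 1 \<longleftrightarrow> Im ?w = 1" using w t by auto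
  ultimately show ?thesis unfolding sgm supn_1_iff[OF w(1)] supn_1_iff[OF z] using z w by (auto simp: Sq_iff)
 qed
 have 6: "supn (Complex (2 * s - 1) t) = 1 \<longleftrightarrow> s = 0 | s = 1" if "s \<in> {0..1}" for s
  using t that by (auto simp: supn_Complex max_def abs_if split: if_splits)
 note B = A[OF rect_cont 1(1) 2(1) rect_cont 1(2) 2(2) 1(3) 3(3,2,1) 1(4) 4 5 6]
 show "cellulation Y (G Un kp ` (%s. Complex (2 * s - 1) t) ` {0..1}) (e - 1) ((K - {kp}) Un {kp \<circ> rect (- 1) 1 (- 1) t, kp \<circ> rect (- 1) 1 t 1})"
  by (rule B(1))
 show "kp \<circ> rect (- 1) 1 (- 1) t ~= kp \<circ> rect (- 1) 1 t 1" by (rule B(2))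
 show "kp \<circ> rect (- 1) 1 (- 1) t ~: K - {kp}" by (rule B(3))
 show "kp \<circ> rect (- 1) 1 t 1 ~: K - {kp}" by (rule B(4))
qed

section \<open>Fibres and degree of a branched covering\<close>

text \<open>Lifting uses the topological description \<open>branched\<close> alone, without
  charts.\<close>

locale branched_covering =
 fixes X :: "'a topology" and Y :: "'b topology" and f :: "'a => 'b" and N :: "'a => nat"
 assumes br: "branched X Y f N"
begin

definition fib :: "'b => 'a set" where
 "fib q = {p \<in> topspace X. f p = q}"

definition brs :: "'b set" where
 "brs = {q \<in> topspace Y. \<exists>p\<in>fib q. N p ~= 1}"

definition nbh :: "'b => real => (complex => 'b) => ('a => real) => ('a => complex => 'a) => bool" where
 "nbh q r h rh g \<longleftrightarrow> pdisc Y r h & h 0 = q &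
     (\<forall>p\<in>fib q. pdisc X (rh p) (g p) & g p 0 = p & rh p ^ N p = r &
      (\<forall>w\<in>ball 0 (rh p). f (g p w) = h (w ^ N p))) &
     (\<forall>p\<in>fib q. \<forall>p'\<in>fib q. p ~= p' --> g p ` ball 0 (rh p) Int g p' ` ball 0 (rh p') = {}) &
     (\<forall>x\<in>topspace X. f x \<in> h ` ball 0 r --> (\<exists>p\<in>fib q. x \<in> g p ` ball 0 (rh p))) &
     (\<forall>x\<in>topspace X. f x \<in> h ` ball 0 r --> f x ~= q --> N x = 1)"

lemma nbh_exists: "q \<in> topspace Y ==> \<exists>r h rh g. nbh q r h rh g"
 using br unfolding branched_def nbh_def fib_def by simp

lemma finite_fib: "q \<in> topspace Y ==> finite (fib q)"
 using br unfolding branched_def fib_def by simp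

lemma cont_br: "continuous_map X Y f" and N_pos: "p \<in> topspace X ==> N p \<ge> 1"
 using br unfolding branched_def by simp_all

text \<open>Evenly covered up to branching: over the disc that contains U the map is a disjoint
  union of power maps, and only the centre of the disc can be a branch point.\<close>

definition evenly :: "'b set => bool" where
 "evenly U \<longleftrightarrow> (\<exists>q\<in>topspace Y. \<exists>r h rh g. nbh q r h rh g & U \<subseteq> h ` ball 0 r)"

lemma nbhD:
 assumes "nbh q r h rh g"
 shows "pdisc Y r h" "h 0 = q"
  "p \<in> fib q ==> pdisc X (rh p) (g p)"
  "p \<in> fib q ==> rh p ^ N p = r"
  "p \<in> fib q ==> w \<in> ball 0 (rh p) ==> f (g p w) = h (w ^ N p)"
  "p \<in> fib q ==> p' \<in> fib q ==> p ~= p' ==> g p ` ball 0 (rh p) Int g p' ` ball 0 (rh p') = {}"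
  "x \<in> topspace X ==> f x \<in> h ` ball 0 r ==> \<exists>p\<in>fib q. x \<in> g p ` ball 0 (rh p)"
  "x \<in> topspace X ==> f x \<in> h ` ball 0 r ==> f x ~= q ==> N x = 1"
 using assms unfolding nbh_def by simp_all

lemma nbh_power_in:
 fixes w :: complex
 assumes nb: "nbh q r h rh g" and p: "p \<in> fib q"
 shows "w ^ N p \<in> ball 0 r \<longleftrightarrow> w \<in> ball 0 (rh p)"
proof -
 have pt: "p \<in> topspace X" using p unfolding fib_def by blast
 have rh: "rh p ^ N p = r" "rh p > 0" using nbhD(3,4)[OF nb p] unfolding pdisc_def by blast+
 have "norm w ^ N p < rh p ^ N p \<longleftrightarrow> norm w < rh p"
  using power_less_iff[of "norm w" "rh p" "N p"] rh(2) N_pos[OF pt] by simp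
 then show ?thesis using rh(1) by (simp add: norm_power)
qed

lemma nbh_fibre:
 assumes nb: "nbh q r h rh g" and v: "v \<in> ball 0 r"
 shows "fib (h v) = (\<Union>p\<in>fib q. g p ` {w. w ^ N p = v})"
proof (intro equalityI subsetI)
 fix x assume x: "x \<in> fib (h v)"
 then have xt: "x \<in> topspace X" "f x = h v" unfolding fib_def by auto
 have "f x \<in> h ` ball 0 r" unfolding xt(2) by (rule imageI[OF v])
 from nbhD(7)[OF nb xt(1) this] obtain p w where p: "p \<in> fib q" "w \<in> ball 0 (rh p)" "x = g p w" by blast
 have "h (w ^ N p) = h v" using nbhD(5)[OF nb p(1,2)] xt(2) p(3) by simp
 moreover have "w ^ N p \<in> ball 0 r" using nbh_power_in[OF nb p(1)] p(2) by blast
 moreover have "inj_on h (ball 0 r)" using nbhD(1)[OF nb] unfolding pdisc_def by blast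
 ultimately have "w ^ N p = v" using v by (meson inj_onD)
 then show "x \<in> (\<Union>p\<in>fib q. g p ` {w. w ^ N p = v})" using p by blast
next
 fix x assume "x \<in> (\<Union>p\<in>fib q. g p ` {w. w ^ N p = v})"
 then obtain p w where p: "p \<in> fib q" "w ^ N p = v" "x = g p w" by blast
 have w: "w \<in> ball 0 (rh p)" using nbh_power_in[OF nb p(1)] p(2) v by blast
 have pd: "pdisc X (rh p) (g p)" "f (g p w) = h (w ^ N p)" using nbhD(3,5)[OF nb p(1)] w by blast+
 have "g p w \<in> topspace X" using pdisc_image_subset[OF pd(1) subset_refl] w by blast
 then show "x \<in> fib (h v)" unfolding fib_def using p pd(2) by simp
qed

lemma nbh_inj:
 assumes nb: "nbh q r h rh g" and p: "p \<in> fib q" "p' \<in> fib q" and w: "w \<in> ball 0 (rh p)" "w' \<in> ball 0 (rh p')"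
  and eq: "g p w = g p' w'"
 shows "p = p' & w = w'"
proof -
 have pp: "p = p'"
 proof (rule ccontr)
  assume "p ~= p'"
  then have "g p ` ball 0 (rh p) Int g p' ` ball 0 (rh p') = {}" by (rule nbhD(6)[OF nb p])
  moreover have "g p w \<in> g p ` ball 0 (rh p)" by (rule imageI[OF w(1)])
  moreover have "g p w \<in> g p' ` ball 0 (rh p')" unfolding eq by (rule imageI[OF w(2)])
  ultimately show False by blast
 qed
 have "inj_on (g p) (ball 0 (rh p))" using nbhD(3)[OF nb p(1)] unfolding pdisc_def by blast
 then show ?thesis using pp w eq by (auto dest: inj_onD)
qed

text \<open>Each point p of the central fibre contributes \<open>N p\<close> simple points to a
  neighbouring fibre, one for each root of the coordinate v.\<close>

lemma nbh_degree:
 assumes nb: "nbh q r h rh g" and q: "q \<in> topspace Y" and y: "y \<in> h ` ball 0 r"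
 shows "(\<Sum>x\<in>fib y. N x) = (\<Sum>p\<in>fib q. N p)"
proof (cases "y = q")
 case False
 obtain v where v: "v \<in> ball 0 r" "y = h v" using y by blast
 have h0: "h 0 = q" by (rule nbhD(2)[OF nb])
 then have v0: "v ~= 0" using v False by auto
 have N1: "N x = 1" if "x \<in> fib y" for x
  using nbhD(8)[OF nb, of x] that y False unfolding fib_def by simp
 have "(\<Sum>x\<in>fib y. N x) = card (fib y)" using N1 by simp
 also have "\<dots> = (\<Sum>p\<in>fib q. card (g p ` {w. w ^ N p = v}))"
  unfolding v(2) nbh_fibre[OF nb v(1)]
 proof (rule card_UN_disjoint[OF finite_fib[OF q]])
  show "\<forall>p\<in>fib q. finite (g p ` {w. w ^ N p = v})"
  proof
   fix p assume "p \<in> fib q"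
   then have "N p > 0" using N_pos[of p] unfolding fib_def by simp
   then show "finite (g p ` {w. w ^ N p = v})" by (intro finite_imageI finite_nth_roots)
  qed
  show "\<forall>p\<in>fib q. \<forall>p'\<in>fib q. p ~= p' --> g p ` {w. w ^ N p = v} Int g p' ` {w. w ^ N p' = v} = {}"
  proof (intro ballI impI equals0I)
   fix p p' x assume p: "p \<in> fib q" "p' \<in> fib q" "p ~= p'" "x \<in> g p ` {w. w ^ N p = v} Int g p' ` {w. w ^ N p' = v}"
   then obtain w w' where "w ^ N p = v" "x = g p w" "w' ^ N p' = v" "x = g p' w'" by blast
   then show False using nbh_inj[OF nb p(1,2), of w w'] nbh_power_in[OF nb p(1), of w] nbh_power_in[OF nb p(2), of w'] v(1) p(3) by simp
  qed
 qed
 also have "\<dots> = (\<Sum>p\<in>fib q. N p)"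
 proof (rule sum.cong[OF refl])
  fix p assume p: "p \<in> fib q"
  then have np: "N p > 0" using N_pos[of p] unfolding fib_def by simp
  have "inj_on (g p) {w. w ^ N p = v}"
  proof (rule inj_onI)
   fix a b assume ab: "a \<in> {w. w ^ N p = v}" "b \<in> {w. w ^ N p = v}" "g p a = g p b"
   then have "a \<in> ball 0 (rh p)" "b \<in> ball 0 (rh p)"
    using nbh_power_in[OF nb p, of a] nbh_power_in[OF nb p, of b] v(1) by simp_all
   then show "a = b" using nbh_inj[OF nb p p _ _ ab(3)] by blast
  qed
  then show "card (g p ` {w. w ^ N p = v}) = N p" using card_nth_roots[OF v0 np] by (simp add: card_image)
 qed
 finally show ?thesis .
qed simp

lemma nbh_open: "nbh q r h rh g ==> openin Y (h ` ball 0 r) & q \<in> h ` ball 0 r"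
proof -
 assume nb: "nbh q r h rh g"
 note pd = nbhD(1,2)[OF nb]
 then have "r > 0" unfolding pdisc_def by blast
 then have "q \<in> h ` ball 0 r" using pd(2) by (intro image_eqI[of _ _ 0]) auto
 then show ?thesis using pdisc_open[OF pd(1) open_ball subset_refl] by blast
qed

lemma degree_const:
 assumes con: "connected_space Y" and q: "q \<in> topspace Y" "q' \<in> topspace Y"
 shows "(\<Sum>x\<in>fib q'. N x) = (\<Sum>p\<in>fib q. N p)"
proof -
 let ?d = "%y. \<Sum>x\<in>fib y. N x"
 have loc: "\<exists>T. openin Y T & y \<in> T & (\<forall>z\<in>T. ?d z = ?d y)" if y: "y \<in> topspace Y" for y
 proof -
  obtain r h rh g where nb: "nbh y r h rh g" using nbh_exists[OF y] by blast
  have "\<forall>z\<in>h ` ball 0 r. ?d z = ?d y" using nbh_degree[OF nb y] by blast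
  then show ?thesis using nbh_open[OF nb] by blast
 qed
 let ?S = "{y \<in> topspace Y. ?d y = ?d q}"
 have "openin Y ?S"
 proof (subst openin_subopen, intro ballI)
  fix y assume y: "y \<in> ?S"
  then have "y \<in> topspace Y" by blast
  from loc[OF this] obtain T where T: "openin Y T" "y \<in> T" "\<forall>z\<in>T. ?d z = ?d y" by blast
  have "T \<subseteq> ?S"
  proof
   fix z assume z: "z \<in> T"
   then have "z \<in> topspace Y" "?d z = ?d y" using openin_subset[OF T(1)] T(3) by blast+
   then show "z \<in> ?S" using y by simp
  qed
  then show "\<exists>T. openin Y T & y \<in> T & T \<subseteq> ?S" using T by blast
 qed
 moreover have "openin Y (topspace Y - ?S)"
 proof (subst openin_subopen, intro ballI)
  fix y assume y: "y \<in> topspace Y - ?S"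
  then have "y \<in> topspace Y" by blast
  from loc[OF this] obtain T where T: "openin Y T" "y \<in> T" "\<forall>z\<in>T. ?d z = ?d y" by blast
  have "T \<subseteq> topspace Y - ?S"
  proof
   fix z assume z: "z \<in> T"
   then have "z \<in> topspace Y" "?d z = ?d y" using openin_subset[OF T(1)] T(3) by blast+
   then show "z \<in> topspace Y - ?S" using y by simp
  qed
  then show "\<exists>T. openin Y T & y \<in> T & T \<subseteq> topspace Y - ?S" using T by blast
 qed
 then have "closedin Y ?S" unfolding closedin_def by blast
 ultimately have "?S = {} | ?S = topspace Y"
  by (intro con[unfolded connected_space_clopen_in, rule_format] conjI)
 moreover have "q \<in> ?S" using q(1) by simp
 ultimately have "?S = topspace Y" by (elim disjE) (simp only: empty_iff, assumption)
 then have "q' \<in> ?S" using q(2) by simp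
 then show ?thesis by simp
qed

lemma nbh_brs: "nbh q r h rh g ==> y \<in> h ` ball 0 r ==> y \<in> brs ==> y = q"
proof (rule ccontr)
 assume nb: "nbh q r h rh g" and y: "y \<in> h ` ball 0 r" "y \<in> brs" "y ~= q"
 then obtain p where "p \<in> topspace X" "f p = y" "N p ~= 1" unfolding brs_def fib_def by blast
 then show False using nbhD(8)[OF nb, of p] y by blast
qed

text \<open>By \<open>nbh_brs\<close> every point has a neighbourhood in which no other point is a
  branch point; finitely many of these cover Y.\<close>

lemma finite_brs:
 assumes c: "compact_space Y"
 shows "finite brs"
proof -
 have "\<forall>y\<in>topspace Y. \<exists>T. openin Y T & y \<in> T & T Int brs \<subseteq> {y}"
 proof
  fix y assume y: "y \<in> topspace Y"
  obtain r h rh g where nb: "nbh y r h rh g" using nbh_exists[OF y] by blast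
  have "h ` ball 0 r Int brs \<subseteq> {y}" using nbh_brs[OF nb] by blast
  then show "\<exists>T. openin Y T & y \<in> T & T Int brs \<subseteq> {y}" using nbh_open[OF nb] by blast
 qed
 from bchoice[OF this] obtain M where "\<forall>y\<in>topspace Y. openin Y (M y) & y \<in> M y & M y Int brs \<subseteq> {y}" ..
 then have M: "!!y. y \<in> topspace Y ==> openin Y (M y) & y \<in> M y & M y Int brs \<subseteq> {y}" by (rule bspec)
 have "\<exists>\<F>. finite \<F> & \<F> \<subseteq> M ` topspace Y & topspace Y \<subseteq> \<Union>\<F>"
  using c unfolding compact_space_alt by (rule allE[of _ "M ` topspace Y"]) (use M in blast)
 then obtain \<F> where \<F>: "finite \<F>" "\<F> \<subseteq> M ` topspace Y" "topspace Y \<subseteq> \<Union>\<F>" by blast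
 then obtain T where T: "finite T" "T \<subseteq> topspace Y" "\<F> = M ` T" by (meson finite_subset_image)
 have "brs \<subseteq> T"
 proof
  fix p assume p: "p \<in> brs"
  then have "p \<in> topspace Y" unfolding brs_def by blast
  then obtain x where "x \<in> T" "p \<in> M x" using \<F>(3) T(3) by blast
  then show "p \<in> T" using M[of x] T(2) p by blast
 qed
 then show ?thesis using T(1) finite_subset by blast
qed

end

lemma rect_halves:
 assumes "2 * m = a + b"
 shows "rect a b c d \<circ> rect (- 1) 0 (- 1) 1 = rect a m c d" "rect a b c d \<circ> rect 0 1 (- 1) 1 = rect m b c d"
  "rect c d a b \<circ> rect (- 1) 1 (- 1) 0 = rect c d a m" "rect c d a b \<circ> rect (- 1) 1 0 1 = rect c d m b"
proof -
 have m: "a + (0 + 1) / 2 * (b - a) = m" using assms by (simp add: field_simps)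
 have t: "- 1 < (0::real)" "(0::real) < 1" by simp_all
 show "rect a b c d \<circ> rect (- 1) 0 (- 1) 1 = rect a m c d" "rect a b c d \<circ> rect 0 1 (- 1) 1 = rect m b c d"
  "rect c d a b \<circ> rect (- 1) 1 (- 1) 0 = rect c d a m" "rect c d a b \<circ> rect (- 1) 1 0 1 = rect c d m b"
  unfolding rect_vcut[OF t] rect_hcut[OF t] m by (rule refl)+
qed

section \<open>Lifting arcs and cells\<close>

context branched_covering
begin

text \<open>Over one disc a lift is a point p of the central fibre together with a choice of an
  \<open>N p\<close>-th root of the coordinate, which gives m lifts in total. The roots exist
  because D without the branch points is contractible. The lifts are told apart at an unbranched
  point, which exists by \<open>con\<close>; over branch points they may coincide.\<close>

lemma lifts_exist:
 fixes D :: "'d::real_normed_vector set"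
 assumes ev: "evenly (kp ` D)" and kp: "continuous_map (top_of_set D) Y kp"
  and con: "contractible {d \<in> D. kp d ~: brs}" "{d \<in> D. kp d ~: brs} ~= {}"
  and m: "!!q. q \<in> topspace Y ==> (\<Sum>x\<in>fib q. N x) = m"
 obtains L where "finite L" "card L = m"
  "\<forall>La\<in>L. continuous_map (top_of_set D) X La & (\<forall>d\<in>D. f (La d) = kp d)"
  "\<forall>d\<in>D. \<forall>x\<in>topspace X. f x = kp d --> (\<exists>La\<in>L. x = La d)"
  "\<forall>La\<in>L. \<forall>La'\<in>L. \<forall>d\<in>D. La d = La' d --> kp d ~: brs --> La = La'"
proof -
 obtain q r h rh g where q: "q \<in> topspace Y" and nb: "nbh q r h rh g" and sub: "kp ` D \<subseteq> h ` ball 0 r"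
  using ev unfolding evenly_def by blast
 note pd = nbhD(1,2)[OF nb]
 have injh: "inj_on h (ball 0 r)" using pd unfolding pdisc_def by blast
 let ?i = "inv_into (ball 0 r) h"
 define u where "u d = ?i (kp d)" for d
 have "continuous_map (subtopology Y (h ` ball 0 r)) euclidean ?i"
  unfolding continuous_map_on_disc_iff[OF pd(1) subset_refl]
  by (rule continuous_map_eq[of _ _ "%x. x"]) (auto simp: inv_into_f_f[OF injh])
 moreover have "continuous_map (top_of_set D) (subtopology Y (h ` ball 0 r)) kp"
  using kp sub by (auto simp: continuous_map_in_subtopology)
 ultimately have "continuous_map (top_of_set D) euclidean (?i \<circ> kp)" by (rule continuous_map_compose[rotated])
 then have cu: "continuous_on D u" unfolding u_def by (simp add: o_def)
 have u: "u d \<in> ball 0 r & h (u d) = kp d" if "d \<in> D" for d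
 proof -
  have "kp d \<in> h ` ball 0 r" using sub that by blast
  from inv_into_into[OF this] f_inv_into_f[OF this] show ?thesis unfolding u_def by blast
 qed
 have u0: "u d = 0 \<longleftrightarrow> kp d = q" if "d \<in> D" for d
 proof -
  have "0 \<in> ball (0::complex) r" using pd(1) unfolding pdisc_def by simp
  with u[OF that] have "h (u d) = h 0 \<longleftrightarrow> u d = 0" using inj_on_eq_iff[OF injh] by blast
  then show ?thesis using u[OF that] pd(2) by simp
 qed
 have brq: "kp d \<in> brs \<longleftrightarrow> q \<in> brs & u d = 0" if "d \<in> D" for d
  using nbh_brs[OF nb, of "kp d"] u0[OF that] sub that by blast
 have ct: "N p = 1 | contractible {d \<in> D. u d ~= 0}" if p: "p \<in> fib q" for p
 proof (cases "N p = 1")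
  case False
  then have "q \<in> brs" unfolding brs_def using p q by blast
  then have "{d \<in> D. kp d ~: brs} = {d \<in> D. u d ~= 0}" using brq by blast
  then show ?thesis using con(1) by simp
 qed simp
 have pt: "p \<in> topspace X" if "p \<in> fib q" for p using that unfolding fib_def by blast
 have "\<forall>p. \<exists>w. p \<in> fib q --> (\<forall>k<N p. continuous_on D (w k) & (\<forall>d\<in>D. w k d ^ N p = u d)) &
  (\<forall>d\<in>D. \<forall>z. z ^ N p = u d --> (\<exists>k<N p. z = w k d)) &
  (\<forall>d\<in>D. u d ~= 0 --> inj_on (%k. w k d) {..<N p})"
 proof
  fix p
  show "\<exists>w. p \<in> fib q --> (\<forall>k<N p. continuous_on D (w k) & (\<forall>d\<in>D. w k d ^ N p = u d)) &
  (\<forall>d\<in>D. \<forall>z. z ^ N p = u d --> (\<exists>k<N p. z = w k d)) &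
  (\<forall>d\<in>D. u d ~= 0 --> inj_on (%k. w k d) {..<N p})"
  proof (cases "p \<in> fib q")
   case True
   show ?thesis by (rule roots_family[OF cu N_pos[OF pt[OF True]] ct[OF True]]) blast
  qed blast
 qed
 from choice[OF this] obtain w where w: "\<forall>p. p \<in> fib q --> (\<forall>k<N p. continuous_on D (w p k) & (\<forall>d\<in>D. w p k d ^ N p = u d)) &
  (\<forall>d\<in>D. \<forall>z. z ^ N p = u d --> (\<exists>k<N p. z = w p k d)) &
  (\<forall>d\<in>D. u d ~= 0 --> inj_on (%k. w p k d) {..<N p})" ..
 let ?S = "Sigma (fib q) (%p. {..<N p})"
 define F where "F = (%(p, k) d. g p (w p k d))"
 have wb: "w p k d \<in> ball 0 (rh p) & w p k d ^ N p = u d" if "p \<in> fib q" "k < N p" "d \<in> D" for p k d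
 proof -
  have e: "w p k d ^ N p = u d" using w that by blast
  then have "w p k d ^ N p \<in> ball 0 r" using u[OF that(3)] by simp
  then show ?thesis using nbh_power_in[OF nb that(1)] e by blast
 qed
 have inj: "(p, k) = (p', k')" if pk: "(p, k) \<in> ?S" "(p', k') \<in> ?S" and d: "d \<in> D" "kp d ~: brs"
  and eq: "F (p, k) d = F (p', k') d" for p k p' k' d
 proof -
  have p: "p \<in> fib q" "k < N p" "p' \<in> fib q" "k' < N p'" using pk by auto
  have "p = p' & w p k d = w p' k' d"
   by (rule nbh_inj[OF nb p(1,3)]) (use wb[OF p(1,2) d(1)] wb[OF p(3,4) d(1)] eq in \<open>auto simp: F_def\<close>)
  then have pp: "p = p'" "w p k d = w p k' d" by auto
  \<comment> \<open>A zero of u at an unbranched point means that the centre q is no branch point,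
    so there is only one root to choose.\<close>
  have "k = k'"
  proof (cases "u d = 0")
   case True
   then have "q ~: brs" using brq[OF d(1)] d(2) by blast
   then have "N p = 1" unfolding brs_def using p(1) q by blast
   then show ?thesis using p pp(1) by simp
  next
   case False
   then have "inj_on (%k. w p k d) {..<N p}" using w p(1) d(1) by blast
   then show ?thesis using pp p by (auto dest: inj_onD)
  qed
  then show ?thesis using pp by simp
 qed
 obtain d1 where d1: "d1 \<in> D" "kp d1 ~: brs" using con(2) by blast
 have injF: "inj_on F ?S"
 proof (rule inj_onI)
  fix a b assume ab: "a \<in> ?S" "b \<in> ?S" "F a = F b"
  obtain p k p' k' where "a = (p, k)" "b = (p', k')" by (cases a, cases b)
  then show "a = b" using inj[of p k p' k' d1] ab d1 by simp
 qed
 have finS: "finite ?S" using finite_fib[OF q] by auto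
 show thesis
 proof (rule that[of "F ` ?S"])
  show "finite (F ` ?S)" using finS by simp
  have "card (F ` ?S) = card ?S" by (rule card_image[OF injF])
  also have "\<dots> = (\<Sum>p\<in>fib q. N p)" using finite_fib[OF q] by (simp add: card_SigmaI)
  finally show "card (F ` ?S) = m" using m[OF q] by simp
  show "\<forall>La\<in>F ` ?S. continuous_map (top_of_set D) X La & (\<forall>d\<in>D. f (La d) = kp d)"
  proof
   fix La assume "La \<in> F ` ?S"
   then obtain p k where p: "p \<in> fib q" "k < N p" "La = (%d. g p (w p k d))" by (auto simp: F_def)
   have pdp: "pdisc X (rh p) (g p)" and fg: "\<forall>w\<in>ball 0 (rh p). f (g p w) = h (w ^ N p)"
    using nbhD(3,5)[OF nb p(1)] by blast+
   have "continuous_map (top_of_set D) (top_of_set (ball 0 (rh p))) (w p k)"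
    using w p(1,2) wb[OF p(1,2)] by (auto simp: continuous_map_in_subtopology)
   moreover have "continuous_map (top_of_set (ball 0 (rh p))) X (g p)" using pdp unfolding pdisc_def by blast
   ultimately have "continuous_map (top_of_set D) X (g p \<circ> w p k)" by (rule continuous_map_compose)
   then have "continuous_map (top_of_set D) X La" unfolding p(3) comp_def .
   moreover have "f (La d) = kp d" if "d \<in> D" for d
    unfolding p(3) using fg wb[OF p(1,2) that] u[OF that] by simp
   ultimately show "continuous_map (top_of_set D) X La & (\<forall>d\<in>D. f (La d) = kp d)" by blast
  qed
  show "\<forall>d\<in>D. \<forall>x\<in>topspace X. f x = kp d --> (\<exists>La\<in>F ` ?S. x = La d)"
  proof (intro ballI impI)
   fix d x assume d: "d \<in> D" and x: "x \<in> topspace X" "f x = kp d"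
   have "x \<in> fib (h (u d))" unfolding fib_def using x u[OF d] by simp
   then obtain p z where p: "p \<in> fib q" "z ^ N p = u d" "x = g p z" using nbh_fibre[OF nb, of "u d"] u[OF d] by blast
   then obtain k where "k < N p" "z = w p k d" using w d by blast
   then have "(p, k) \<in> ?S" "x = F (p, k) d" using p by (auto simp: F_def)
   then show "\<exists>La\<in>F ` ?S. x = La d" by blast
  qed
  show "\<forall>La\<in>F ` ?S. \<forall>La'\<in>F ` ?S. \<forall>d\<in>D. La d = La' d --> kp d ~: brs --> La = La'"
  proof (intro ballI impI)
   fix La La' d assume a: "La \<in> F ` ?S" "La' \<in> F ` ?S" "d \<in> D" "La d = La' d" "kp d ~: brs"
   then obtain s s' where s: "s \<in> ?S" "La = F s" "s' \<in> ?S" "La' = F s'" by blast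
   obtain p k p' k' where "s = (p, k)" "s' = (p', k')" by (cases s, cases s')
   then show "La = La'" using inj[of p k p' k' d] s a by simp
  qed
 qed
qed

text \<open>The hypotheses of \<open>lifts_exist\<close> for an arc, with the further demand that
  branch points occur only at its ends, where different lifts may meet.\<close>

definition good :: "(real => 'b) => bool" where
 "good ga \<longleftrightarrow> evenly (ga ` {0..1}) & contractible {t \<in> {0..1}. ga t ~: brs} &
   {t \<in> {0..1}. ga t ~: brs} ~= {} & (\<forall>t\<in>{0<..<1}. ga t ~: brs)"

lemma evenly_local:
 fixes D :: "'d::metric_space set"
 assumes ga: "continuous_map (top_of_set D) Y ga" and t: "t \<in> D"
 obtains r h rh g V where "nbh (ga t) r h rh g" "open V" "t \<in> V" "ga ` (D Int V) \<subseteq> h ` ball 0 r"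
proof -
 have "ga t \<in> topspace Y" using ga t by (auto simp: continuous_map_def)
 then obtain r h rh g where nb: "nbh (ga t) r h rh g" using nbh_exists by blast
 have o: "openin Y (h ` ball 0 r)" "ga t \<in> h ` ball 0 r" using nbh_open[OF nb] by blast+
 have "openin (top_of_set D) {s \<in> D. ga s \<in> h ` ball 0 r}"
  using openin_continuous_map_preimage[OF ga o(1)] by simp
 then obtain V where V: "open V" "{s \<in> D. ga s \<in> h ` ball 0 r} = D Int V" unfolding openin_open by blast
 show thesis
 proof (rule that[OF nb V(1)])
  show "t \<in> V" using V(2) t o(2) by blast
  show "ga ` (D Int V) \<subseteq> h ` ball 0 r" using V(2) by blast
 qed
qed

lemma interval_minus_end:
 assumes "B \<subseteq> {0::real} | B \<subseteq> {1}"
 shows "contractible ({0..1} - B)" "1 / 2 \<in> {0..1} - B" "{0<..<1} Int B = {}"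
proof -
 have "B = {} | B = {0} | B = {1}" using assms by blast
 then have "{0..1} - B = {0..1} | {0..1} - B = {0<..1} | {0..1} - B = {0..<1}" by (elim disjE) auto
 then have "convex ({0..1} - B)" by (elim disjE) simp_all
 then show "contractible ({0..1} - B)" by (rule convex_imp_contractible)
qed (use assms in auto)

text \<open>A suitable disc about \<open>ga t\<close> has no branch point except possibly its
  centre, so a short subarc can meet a branch point only at t, which is outside its
  interior.\<close>

lemma good_local:
 assumes ga: "continuous_map (top_of_set {0..1::real}) Y ga" and inj: "inj_on ga {0..1}" and t: "t \<in> {0..1}"
 shows "\<exists>dl>0. \<forall>a b. 0 <= a --> a < b --> b <= 1 --> t - dl < a --> b < t + dl --> t ~: {a<..<b} --> good (ga \<circ> aff a b)"
proof -
 obtain r h rh g V where nb: "nbh (ga t) r h rh g" and V: "open V" "t \<in> V" "ga ` ({0..1} Int V) \<subseteq> h ` ball 0 r"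
  using evenly_local[OF ga t] by blast
 obtain dl where dl: "dl > 0" "ball t dl \<subseteq> V" using V(1,2) by (meson openE)
 have gt: "ga t \<in> topspace Y" using ga t by (auto simp: continuous_map_def)
 have "good (ga \<circ> aff a b)" if ab: "0 <= a" "a < b" "b <= 1" "t - dl < a" "b < t + dl" "t ~: {a<..<b}" for a b
 proof -
  let ?g = "ga \<circ> aff a b"
  have s: "aff a b s \<in> {0..1} Int V & aff a b s \<in> {a..b}" if "s \<in> {0..1}" for s
  proof -
   have 1: "aff a b s \<in> {a..b}" using aff_image[OF ab(2)] that by blast
   then have "aff a b s \<in> ball t dl" using ab by (auto simp: dist_real_def)
   then show ?thesis using 1 dl(2) ab by auto
  qed
  have im: "?g ` {0..1} \<subseteq> h ` ball 0 r" using s V(3) by fastforce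
  then have ev: "evenly (?g ` {0..1})" unfolding evenly_def using nb gt by blast
  define B where "B = {s \<in> {0..1}. ?g s \<in> brs}"
  have Bt: "aff a b s = t" if "s \<in> B" for s
  proof -
   have s01: "s \<in> {0..1}" "?g s \<in> brs" using that unfolding B_def by auto
   then have "?g s = ga t" using nbh_brs[OF nb] im by blast
   then show ?thesis using inj_onD[OF inj _ _ t] s[OF s01(1)] by simp
  qed
  have "B \<subseteq> {0} | B \<subseteq> {1}"
  proof (cases "t = a")
   case True
   have "s = 0" if "s \<in> B" for s using Bt[OF that] True aff_inj[OF ab(2), of s 0] by (simp add: aff_def)
   then show ?thesis by blast
  next
   case False
   have "s = 1" if "s \<in> B" for s
   proof -
    have "t \<in> {a..b}" using Bt[OF that] s[of s] that unfolding B_def by auto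
    then have "t = b" using False ab(6) by auto
    then show ?thesis using Bt[OF that] aff_inj[OF ab(2), of s 1] by (simp add: aff_def)
   qed
   then show ?thesis by blast
  qed
  note B = interval_minus_end[OF this]
  have e: "{s \<in> {0..1}. ?g s ~: brs} = {0..1} - B" unfolding B_def by blast
  have "\<forall>s\<in>{0<..<1}. ?g s ~: brs"
  proof
   fix s :: real assume s: "s \<in> {0<..<1}"
   then have "s ~: B" "s \<in> {0..1}" using B(3) by (blast, auto)
   then show "?g s ~: brs" unfolding B_def by blast
  qed
  then show ?thesis unfolding good_def e using ev B(1,2) by blast
 qed
 then show ?thesis using dl(1) by blast
qed

lemma graph_imp_graphP: "graph Y T e ==> graphP Y good T e"
proof (induction rule: graphext.induct)
 case base then show ?case by (rule graphP.base)
next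
 case (point T e x) then show ?case by (intro graphP.point)
next
 case (arc T e ga)
 show ?case by (rule graphP_subdivide[OF arc.IH arc.hyps(2,3,4) good_local[OF arc.hyps(2,3)]])
qed

definition pre :: "'b set => 'a set" where
 "pre T = {x \<in> topspace X. f x \<in> T}"

text \<open>Points and arcs have m lifts each, except that a branch point q has only
  \<open>card (fib q)\<close> preimages; the sum collects these deficits.\<close>

lemma lift_graph:
 assumes "graphP Y good T e" and fin: "finite brs" and m: "!!q. q \<in> topspace Y ==> (\<Sum>x\<in>fib q. N x) = m"
 shows "graph X (pre T) (int m * e - (\<Sum>q\<in>brs Int T. int m - int (card (fib q))))"
 using assms(1)
proof (induction rule: graphP.induct)
 case base
 have "pre {} = {}" by (simp add: pre_def)
 then show ?case using graphext.base[of X "{}"] by simp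
next
 case (point T e q)
 have "graph X (pre T Un fib q) (int m * e - (\<Sum>q\<in>brs Int T. int m - int (card (fib q))) + int (card (fib q)))"
  by (rule graph_add_points[OF point.IH finite_fib[OF point.hyps(2)]]) (use point.hyps(3) in \<open>auto simp: pre_def fib_def\<close>)
 moreover have "pre T Un fib q = pre (insert q T)" by (auto simp: pre_def fib_def)
 moreover have "int m * e - (\<Sum>q\<in>brs Int T. int m - int (card (fib q))) + int (card (fib q)) =
  int m * (e + 1) - (\<Sum>q\<in>brs Int insert q T. int m - int (card (fib q)))"
 proof (cases "q \<in> brs")
  case True
  then have "brs Int insert q T = insert q (brs Int T)" by blast
  then show ?thesis using fin point.hyps(3) by (simp add: distrib_left)
 next
  case False
  have "(\<Sum>x\<in>fib q. N x) = (\<Sum>x\<in>fib q. 1)"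
   by (rule sum.cong[OF refl]) (use False point.hyps(2) in \<open>auto simp: brs_def\<close>)
  then have "card (fib q) = m" using m[OF point.hyps(2)] by simp
  moreover have "brs Int insert q T = brs Int T" using False by blast
  ultimately show ?thesis by (simp add: distrib_left)
 qed
 ultimately show ?case by simp
next
 case (arc T e ga)
 have gd: "evenly (ga ` {0..1})" "contractible {t \<in> {0..1}. ga t ~: brs}" "{t \<in> {0..1}. ga t ~: brs} ~= {}"
  and inn: "!!t. t \<in> {0<..<1} ==> ga t ~: brs"
  using arc.hyps(4) unfolding good_def by blast+
 have gaT: "ga t \<in> T \<longleftrightarrow> t = 0 | t = 1" if t: "t \<in> {0..1}" for t
 proof -
  have "ga t \<in> T \<longleftrightarrow> ga t \<in> {ga 0, ga 1}" using arc.hyps(5) t by blast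
  moreover have "ga t = ga 0 \<longleftrightarrow> t = 0" "ga t = ga 1 \<longleftrightarrow> t = 1"
   by (rule inj_on_eq_iff[OF arc.hyps(3)], use t in simp_all)+
  ultimately show ?thesis by blast
 qed
 \<comment> \<open>An arc brings no new branch points, since its ends lie in T already; the
   correction term is therefore unchanged.\<close>
 have brT: "ga t \<in> T" if "t \<in> {0..1}" "ga t \<in> brs" for t
 proof -
  have "~ t \<in> {0<..<1}" using inn that(2) by blast
  then have "t = 0 | t = 1" using that(1) by auto
  then show ?thesis using gaT[OF that(1)] by blast
 qed
 obtain L where L: "finite L" "card L = m"
  "\<forall>La\<in>L. continuous_map (top_of_set {0..1}) X La & (\<forall>d\<in>{0..1}. f (La d) = ga d)"
  "\<forall>d\<in>{0..1}. \<forall>x\<in>topspace X. f x = ga d --> (\<exists>La\<in>L. x = La d)"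
  "\<forall>La\<in>L. \<forall>La'\<in>L. \<forall>d\<in>{0..1}. La d = La' d --> ga d ~: brs --> La = La'"
  by (rule lifts_exist[OF gd(1) arc.hyps(2) gd(2,3) m])
 have Lt: "La d \<in> topspace X" "f (La d) = ga d" if "La \<in> L" "d \<in> {0..1}" for La d
 proof -
  have c: "continuous_map (top_of_set {0..1}) X La" using L(3) that(1) by blast
  show "La d \<in> topspace X" using continuous_map_image_subset_topspace[OF c] that(2) by auto
  show "f (La d) = ga d" using L(3) that by blast
 qed
 have same: "s = t" if "La \<in> L" "La' \<in> L" "s \<in> {0..1}" "t \<in> {0..1}" "La s = La' t" for La La' s t
 proof -
  have "ga s = ga t" using Lt(2)[OF that(1,3)] Lt(2)[OF that(2,4)] that(5) by simp
  then show ?thesis using inj_onD[OF arc.hyps(3)] that(3,4) by blast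
 qed
 have S: "La t \<in> pre T \<longleftrightarrow> t = 0 | t = 1" if "La \<in> L" "t \<in> {0..1}" for La t
  unfolding pre_def using Lt[OF that] gaT[OF that(2)] by simp
 have "graph X (pre T Un (\<Union>La\<in>L. La ` {0..1})) (int m * e - (\<Sum>q\<in>brs Int T. int m - int (card (fib q))) - int (card L))"
 proof (rule graph_add_arcs[OF arc.IH L(1)])
  fix La assume La: "La \<in> L"
  have "inj_on La {0..1}" using same[OF La La] by (rule inj_onI)
  moreover have "pre T Int La ` {0..1} = {La 0, La 1}"
  proof (intro equalityI subsetI)
   fix x assume "x \<in> pre T Int La ` {0..1}"
   then obtain t where t: "t \<in> {0..1}" "x = La t" "La t \<in> pre T" by blast
   then show "x \<in> {La 0, La 1}" using S[OF La t(1)] by blast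
  next
   fix x assume x: "x \<in> {La 0, La 1}"
   have "(0::real) \<in> {0..1}" "(1::real) \<in> {0..1}" by simp_all
   then show "x \<in> pre T Int La ` {0..1}" using x S[OF La] by blast
  qed
  ultimately show "continuous_map (top_of_set {0..1}) X La & inj_on La {0..1} & pre T Int La ` {0..1} = {La 0, La 1}"
   using L(3) La by blast
 next
  fix La La' assume La: "La \<in> L" "La' \<in> L" "La ~= La'"
  \<comment> \<open>Different lifts can meet only over a branch point, and on this arc such a point
    lies in T.\<close>
  show "La ` {0..1} Int La' ` {0..1} \<subseteq> pre T"
  proof
   fix x assume "x \<in> La ` {0..1} Int La' ` {0..1}"
   then obtain s t where st: "s \<in> {0..1}" "t \<in> {0..1}" "x = La s" "x = La' t" by blast
   have "s = t" by (rule same[OF La(1,2) st(1,2)]) (use st in simp)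
   then have "ga s \<in> brs" using L(5) La st by blast
   then have "ga s \<in> T" using brT st(1) by blast
   then show "x \<in> pre T" unfolding pre_def using Lt[OF La(1) st(1)] st(3) by simp
  qed
 qed
 moreover have "pre T Un (\<Union>La\<in>L. La ` {0..1}) = pre (T Un ga ` {0..1})"
 proof (intro equalityI subsetI)
  fix x assume "x \<in> pre T Un (\<Union>La\<in>L. La ` {0..1})"
  then consider "x \<in> pre T" | La t where "La \<in> L" "t \<in> {0..1}" "x = La t" by blast
  then show "x \<in> pre (T Un ga ` {0..1})"
  proof cases
   case 1 then show ?thesis unfolding pre_def by blast
  next
   case 2 then show ?thesis unfolding pre_def using Lt[OF 2(1,2)] by simp
  qed
 next
  fix x assume "x \<in> pre (T Un ga ` {0..1})"
  then consider "x \<in> pre T" | t where "x \<in> topspace X" "t \<in> {0..1}" "f x = ga t" unfolding pre_def by blast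
  then show "x \<in> pre T Un (\<Union>La\<in>L. La ` {0..1})"
  proof cases
   case 2 then show ?thesis using L(4) by blast
  qed blast
 qed
 moreover have "brs Int (T Un ga ` {0..1}) = brs Int T" using brT by blast
 moreover have "int m * e - (\<Sum>q\<in>brs Int T. int m - int (card (fib q))) - int (card L) =
  int m * (e - 1) - (\<Sum>q\<in>brs Int T. int m - int (card (fib q)))"
  using L(2) by (simp add: right_diff_distrib)
 ultimately show ?case by (simp only:)
qed

text \<open>The set is star-shaped about 0: shortening a vector moves it off the boundary of the
  square.\<close>

lemma Sq_minus_contractible:
 assumes "!!z. z \<in> B ==> supn z = 1"
 shows "contractible (Sq - B)"
proof (rule starlike_imp_contractible)
 show "starlike (Sq - B)" unfolding starlike_def
 proof (intro bexI[of _ 0] ballI subsetI)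
  have "(0::complex) ~: B" using assms[of 0] by auto
  then show "0 \<in> Sq - B" by simp
  fix z x assume z: "z \<in> Sq - B" and "x \<in> closed_segment 0 z"
  then obtain u where u: "0 <= u" "u <= 1" "x = of_real u * z" by (auto simp: closed_segment_def scaleR_conv_of_real)
  have s: "supn x = u * supn z" "supn z <= 1" using u z by (auto simp: supn_scale Sq_def)
  then have le: "supn x <= 1" using u(1,2) by (simp add: mult_le_one)
  have "x ~: B"
  proof
   assume x: "x \<in> B"
   then have "u * supn z = 1" using assms s by simp
   moreover have "u * supn z <= u" using s(2) u by (simp add: mult_left_le)
   ultimately have "u = 1" using u by simp
   then show False using x u z by simp
  qed
  then show "x \<in> Sq - B" using le by (simp add: Sq_def)
 qed
qed

text \<open>With the branch points on the graph, a cell without them is a square without some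
  boundary points, so \<open>lifts_exist\<close> applies. Outside \<open>pre G\<close> different
  lifts are disjoint because they could meet only over branch points.\<close>

lemma lift_cells:
 assumes c: "cellulation Y G e K" and fin: "finite brs" and m: "!!q. q \<in> topspace Y ==> (\<Sum>x\<in>fib q. N x) = m"
  and bG: "brs \<subseteq> G" and ev: "!!kp. kp \<in> K ==> evenly (kp ` Sq)"
 shows "\<exists>L. cellulation X (pre G) (int m * e - (\<Sum>q\<in>brs. int m - int (card (fib q)))) L & card L = m * card K"
proof -
 have gr: "graph Y G e" and finK: "finite K" and ce: "!!kp. kp \<in> K ==> cell Y G kp"
  and dis: "!!kp kp' z z'. kp \<in> K ==> kp' \<in> K ==> z \<in> Sq ==> z' \<in> Sq ==> kp z = kp' z' ==> kp z ~: G ==> kp = kp'"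
  and top: "topspace Y = G Un (\<Union>kp\<in>K. kp ` Sq)"
  using c unfolding cellulation_def by blast+
 have kc: "continuous_map (top_of_set Sq) Y kp" and ki: "inj_on kp Sq" and kG: "!!z. z \<in> Sq ==> kp z \<in> G \<longleftrightarrow> supn z = 1"
  if "kp \<in> K" for kp using ce[OF that] unfolding cell_def by auto
 let ?P = "%kp L. finite L & card L = m &
  (\<forall>La\<in>L. continuous_map (top_of_set Sq) X La & (\<forall>d\<in>Sq. f (La d) = kp d)) &
  (\<forall>d\<in>Sq. \<forall>x\<in>topspace X. f x = kp d --> (\<exists>La\<in>L. x = La d)) &
  (\<forall>La\<in>L. \<forall>La'\<in>L. \<forall>d\<in>Sq. La d = La' d --> kp d ~: brs --> La = La')"
 have "\<forall>kp\<in>K. \<exists>L. ?P kp L"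
 proof
  fix kp assume k: "kp \<in> K"
  have "{z \<in> Sq. kp z ~: brs} = Sq - {z \<in> Sq. kp z \<in> brs}" by blast
  moreover have "contractible (Sq - {z \<in> Sq. kp z \<in> brs})"
   by (rule Sq_minus_contractible) (use kG[OF k] bG in blast)
  ultimately have 1: "contractible {z \<in> Sq. kp z ~: brs}" by simp
  have "kp 0 ~: brs" using kG[OF k, of 0] bG by auto
  then have 2: "{z \<in> Sq. kp z ~: brs} ~= {}" using zero_in_Sq by blast
  show "\<exists>L. ?P kp L"
  proof (rule lifts_exist[OF ev[OF k] kc[OF k] 1 2 m])
   fix L
   assume "finite L" "card L = m"
    "\<forall>La\<in>L. continuous_map (top_of_set Sq) X La & (\<forall>d\<in>Sq. f (La d) = kp d)"
    "\<forall>d\<in>Sq. \<forall>x\<in>topspace X. f x = kp d --> (\<exists>La\<in>L. x = La d)"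
    "\<forall>La\<in>L. \<forall>La'\<in>L. \<forall>d\<in>Sq. La d = La' d --> kp d ~: brs --> La = La'"
   then show ?thesis by (intro exI[of _ L] conjI)
  qed
 qed
 from bchoice[OF this] obtain L where L: "\<forall>kp\<in>K. ?P kp (L kp)" ..
 have Lc: "continuous_map (top_of_set Sq) X La" "!!z. z \<in> Sq ==> f (La z) = kp z" if "kp \<in> K" "La \<in> L kp" for kp La
  using L that by blast+
 have Lt: "La z \<in> topspace X" if "kp \<in> K" "La \<in> L kp" "z \<in> Sq" for kp La z
  using Lc(1)[OF that(1,2)] that(3) by (auto simp: continuous_map_def)
 have Lpre: "La z \<in> pre G \<longleftrightarrow> supn z = 1" if "kp \<in> K" "La \<in> L kp" "z \<in> Sq" for kp La z
  unfolding pre_def using Lt[OF that] Lc(2)[OF that] kG[OF that(1,3)] by simp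
 have Lfin: "finite (L kp)" "card (L kp) = m" if "kp \<in> K" for kp using L that by blast+
 have cellX: "cell X (pre G) La" if k: "kp \<in> K" "La \<in> L kp" for kp La
  unfolding cell_def
 proof (intro conjI ballI Lc(1)[OF k] Lpre[OF k])
  show "inj_on La Sq"
  proof (rule inj_onI)
   fix z z' assume z: "z \<in> Sq" "z' \<in> Sq" "La z = La z'"
   then have "kp z = kp z'" using Lc(2)[OF k z(1)] Lc(2)[OF k z(2)] by simp
   then show "z = z'" using inj_onD[OF ki[OF k(1)]] z by blast
  qed
 qed
 have disX: "kp = kp' & La = La'" if k: "kp \<in> K" "kp' \<in> K" "La \<in> L kp" "La' \<in> L kp'" and z: "z \<in> Sq" "z' \<in> Sq" "La z = La' z'" "La z ~: pre G"
  for kp kp' La La' z z'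
 proof -
  have eq: "kp z = kp' z'" using Lc(2)[OF k(1,3) z(1)] Lc(2)[OF k(2,4) z(2)] z(3) by simp
  have "supn z ~= 1" using Lpre[OF k(1,3) z(1)] z(4) by blast
  then have nG: "kp z ~: G" using kG[OF k(1) z(1)] by blast
  have kk: "kp = kp'" by (rule dis[OF k(1,2) z(1,2) eq nG])
  then have "z = z'" using inj_onD[OF ki[OF k(1)] _ z(1,2)] eq by blast
  moreover have "kp z ~: brs" using nG bG by blast
  ultimately have "La = La'" using L k z kk by blast
  then show ?thesis using kk by blast
 qed
 let ?L = "\<Union>kp\<in>K. L kp"
 have card: "card ?L = m * card K"
 proof -
  have "card ?L = (\<Sum>kp\<in>K. card (L kp))"
  proof (rule card_UN_disjoint[OF finK])
   show "\<forall>kp\<in>K. finite (L kp)" using Lfin by blast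
   show "\<forall>kp\<in>K. \<forall>kp'\<in>K. kp ~= kp' --> L kp Int L kp' = {}"
   proof (intro ballI impI equals0I)
    fix kp kp' La assume a: "kp \<in> K" "kp' \<in> K" "kp ~= kp'" "La \<in> L kp Int L kp'"
    have "La 0 ~: pre G" using Lpre[of kp La 0] a by simp
    then show False using disX[of kp kp' La La 0 0] a by simp
   qed
  qed
  also have "\<dots> = m * card K" using Lfin(2) by simp
  finally show ?thesis .
 qed
 have "brs Int G = brs" using bG by blast
 then have grX: "graph X (pre G) (int m * e - (\<Sum>q\<in>brs. int m - int (card (fib q))))"
  using lift_graph[OF graph_imp_graphP[OF gr] fin m] by simp
 have "cellulation X (pre G) (int m * e - (\<Sum>q\<in>brs. int m - int (card (fib q)))) ?L"
  unfolding cellulation_def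
 proof (intro conjI grX)
  show "finite ?L" using finK Lfin(1) by blast
  show "\<forall>La\<in>?L. cell X (pre G) La" using cellX by blast
  show "\<forall>La\<in>?L. \<forall>La'\<in>?L. \<forall>z\<in>Sq. \<forall>z'\<in>Sq. La z = La' z' --> La z ~: pre G --> La = La'"
  proof (intro ballI impI)
   fix La La' z z' assume a: "La \<in> ?L" "La' \<in> ?L" "z \<in> Sq" "z' \<in> Sq" "La z = La' z'" "La z ~: pre G"
   then obtain kp kp' where "kp \<in> K" "kp' \<in> K" "La \<in> L kp" "La' \<in> L kp'" by blast
   from disX[OF this a(3-6)] show "La = La'" by blast
  qed
  show "topspace X = pre G Un (\<Union>La\<in>?L. La ` Sq)"
  proof (intro equalityI subsetI)
   fix x assume x: "x \<in> topspace X"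
   then have "f x \<in> topspace Y" using cont_br by (auto simp: continuous_map_def)
   then consider "f x \<in> G" | kp z where "kp \<in> K" "z \<in> Sq" "f x = kp z" using top by blast
   then show "x \<in> pre G Un (\<Union>La\<in>?L. La ` Sq)"
   proof cases
    case 1 then show ?thesis using x unfolding pre_def by blast
   next
    case 2
    then obtain La where "La \<in> L kp" "x = La z" using L x by blast
    then show ?thesis using 2 by blast
   qed
  next
   fix x assume "x \<in> pre G Un (\<Union>La\<in>?L. La ` Sq)"
   then consider "x \<in> pre G" | kp La z where "kp \<in> K" "La \<in> L kp" "z \<in> Sq" "x = La z" by blast
   then show "x \<in> topspace X"
   proof cases
    case 2 then show ?thesis using Lt by simp
   qed (simp add: pre_def)
  qed
 qed
 then show ?thesis using card by blast
qed

section \<open>Refining a cellulation\<close>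

text \<open>A point inside a cell is brought onto the graph by cutting that cell along the vertical
  line through it.\<close>

lemma cellulation_through_points:
 assumes "finite B" "B \<subseteq> topspace Y" "cellulation Y G e K" "K ~= {}"
 shows "\<exists>G' e' K'. cellulation Y G' e' K' & K' ~= {} & B \<subseteq> G'"
 using assms(1,2)
proof (induction B rule: finite_induct)
 case empty then show ?case using assms(3,4) by blast
next
 case (insert q B)
 from insert.IH insert.prems obtain G e K where c: "cellulation Y G e K" "K ~= {}" "B \<subseteq> G" by blast
 show ?case
 proof (cases "q \<in> G")
  case True then show ?thesis using c by blast
 next
  case False
  have "q \<in> topspace Y" using insert.prems by blast
  then obtain kp z where k: "kp \<in> K" "z \<in> Sq" "q = kp z" using c(1) False unfolding cellulation_def by blast
  have "cell Y G kp" using c(1) k(1) unfolding cellulation_def by blast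
  then have "supn z ~= 1" using k False unfolding cell_def by blast
  then have z: "- 1 < Re z" "Re z < 1" "\<bar>Im z\<bar> <= 1" using k(2) supn_1_iff[OF k(2)] by (auto simp: Sq_iff)
  have "z = Complex (Re z) (2 * ((Im z + 1) / 2) - 1)" "(Im z + 1) / 2 \<in> {0..1}" using z(3) by (auto simp: complex_eq_iff field_simps)
  then have "q \<in> kp ` (%s. Complex (Re z) (2 * s - 1)) ` {0..1}" unfolding k(3) by (metis image_eqI)
  then have "insert q B \<subseteq> G Un kp ` (%s. Complex (Re z) (2 * s - 1)) ` {0..1}" using c(3) by blast
  then show ?thesis using vcut(1)[OF c(1) k(1) z(1,2)] by blast
 qed
qed

lemma evenly_mono: "evenly U ==> V \<subseteq> U ==> evenly V"
 unfolding evenly_def by (meson subset_trans)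

text \<open>Quantified over all cellulations that contain the cell, so that it can be applied to one
  half after the other half has been refined.\<close>

definition refinable :: "(complex => 'b) => bool" where
 "refinable kp \<longleftrightarrow> (\<forall>G e K. cellulation Y G e K --> kp \<in> K -->
   (\<exists>G' e' K''. cellulation Y G' e' ((K - {kp}) Un K'') & G \<subseteq> G' & K'' ~= {} & (\<forall>kp'\<in>K''. evenly (kp' ` Sq))))"

lemma refinable_evenly: "evenly (kp ` Sq) ==> refinable kp"
 unfolding refinable_def
proof (intro allI impI)
 fix G e K assume "evenly (kp ` Sq)" "cellulation Y G e K" "kp \<in> K"
 moreover from this(3) have "(K - {kp}) Un {kp} = K" by blast
 ultimately show "\<exists>G' e' K''. cellulation Y G' e' ((K - {kp}) Un K'') & G \<subseteq> G' & K'' ~= {} & (\<forall>kp'\<in>K''. evenly (kp' ` Sq))"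
  by (intro exI[of _ G] exI[of _ e] exI[of _ "{kp}"]) simp
qed

lemma refinable_cut:
 assumes cut: "!!G e K. cellulation Y G e K ==> kp \<in> K ==> \<exists>G' e'. cellulation Y G' e' ((K - {kp}) Un {kp1, kp2}) & G \<subseteq> G' &
   kp1 ~= kp2 & kp1 ~: K - {kp} & kp2 ~: K - {kp}"
  and r: "refinable kp1" "refinable kp2"
 shows "refinable kp"
 unfolding refinable_def
proof (intro allI impI)
 fix G e K assume c: "cellulation Y G e K" "kp \<in> K"
 from cut[OF c] obtain G1 e1 where 1: "cellulation Y G1 e1 ((K - {kp}) Un {kp1, kp2})" "G \<subseteq> G1"
   "kp1 ~= kp2" "kp1 ~: K - {kp}" "kp2 ~: K - {kp}" by (elim exE conjE)
 obtain G2 e2 K2 where 2: "cellulation Y G2 e2 ((((K - {kp}) Un {kp1, kp2}) - {kp1}) Un K2)" "G1 \<subseteq> G2" "\<forall>kp'\<in>K2. evenly (kp' ` Sq)"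
  using r(1) 1(1) unfolding refinable_def by (meson UnI2 insertI1)
 \<comment> \<open>The second half survives the refinement of the first.\<close>
 have k2: "kp2 \<in> (((K - {kp}) Un {kp1, kp2}) - {kp1}) Un K2" using 1(3) by blast
 obtain G3 e3 K3 where 3: "cellulation Y G3 e3 ((((((K - {kp}) Un {kp1, kp2}) - {kp1}) Un K2) - {kp2}) Un K3)" "G2 \<subseteq> G3" "K3 ~= {}" "\<forall>kp'\<in>K3. evenly (kp' ` Sq)"
  using r(2) 2(1) k2 unfolding refinable_def by meson
 have eq: "(((((K - {kp}) Un {kp1, kp2}) - {kp1}) Un K2) - {kp2}) Un K3 = (K - {kp}) Un ((K2 - {kp2}) Un K3)"
  using 1(4,5) by blast
 show "\<exists>G' e' K''. cellulation Y G' e' ((K - {kp}) Un K'') & G \<subseteq> G' & K'' ~= {} & (\<forall>kp'\<in>K''. evenly (kp' ` Sq))"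
 proof (intro exI conjI)
  show "cellulation Y G3 e3 ((K - {kp}) Un ((K2 - {kp2}) Un K3))" using 3(1) unfolding eq .
  show "G \<subseteq> G3" using 1(2) 2(2) 3(2) by blast
  show "(K2 - {kp2}) Un K3 ~= {}" using 3(3) by blast
  show "\<forall>kp'\<in>(K2 - {kp2}) Un K3. evenly (kp' ` Sq)" using 2(3) 3(4) by blast
 qed
qed

lemma refinable_vcut:
 assumes "refinable (kp \<circ> rect (- 1) 0 (- 1) 1)" "refinable (kp \<circ> rect 0 1 (- 1) 1)"
 shows "refinable kp"
proof (rule refinable_cut[OF _ assms])
 fix G e K assume "cellulation Y G e K" "kp \<in> K"
 from vcut[OF this, of 0] show "\<exists>G' e'. cellulation Y G' e' ((K - {kp}) Un {kp \<circ> rect (- 1) 0 (- 1) 1, kp \<circ> rect 0 1 (- 1) 1}) & G \<subseteq> G' &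
   kp \<circ> rect (- 1) 0 (- 1) 1 ~= kp \<circ> rect 0 1 (- 1) 1 & kp \<circ> rect (- 1) 0 (- 1) 1 ~: K - {kp} & kp \<circ> rect 0 1 (- 1) 1 ~: K - {kp}"
  by (intro exI conjI) (assumption | simp)+
qed

lemma refinable_hcut:
 assumes "refinable (kp \<circ> rect (- 1) 1 (- 1) 0)" "refinable (kp \<circ> rect (- 1) 1 0 1)"
 shows "refinable kp"
proof (rule refinable_cut[OF _ assms])
 fix G e K assume "cellulation Y G e K" "kp \<in> K"
 from hcut[OF this, of 0] show "\<exists>G' e'. cellulation Y G' e' ((K - {kp}) Un {kp \<circ> rect (- 1) 1 (- 1) 0, kp \<circ> rect (- 1) 1 0 1}) & G \<subseteq> G' &
   kp \<circ> rect (- 1) 1 (- 1) 0 ~= kp \<circ> rect (- 1) 1 0 1 & kp \<circ> rect (- 1) 1 (- 1) 0 ~: K - {kp} & kp \<circ> rect (- 1) 1 0 1 ~: K - {kp}"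
  by (intro exI conjI) (assumption | simp)+
qed

text \<open>By the Lebesgue number lemma all sufficiently small rectangles have images inside one
  disc of \<open>nbh\<close>, and repeated halving reaches such rectangles.\<close>

lemma refinable_cell:
 assumes kp: "continuous_map (top_of_set Sq) Y kp"
 shows "refinable kp"
proof -
 let ?C = "{V. open V & evenly (kp ` (Sq Int V))}"
 have loc: "\<exists>V\<in>?C. z \<in> V" if z: "z \<in> Sq" for z
 proof -
  obtain r h rh g V where nb: "nbh (kp z) r h rh g" and V: "open V" "z \<in> V" "kp ` (Sq Int V) \<subseteq> h ` ball 0 r"
   using evenly_local[OF kp z] by blast
  have "kp z \<in> topspace Y" using kp z by (auto simp: continuous_map_def)
  then have "evenly (kp ` (Sq Int V))" unfolding evenly_def using nb V(3) by blast
  then show ?thesis using V by blast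
 qed
 have "Sq \<subseteq> \<Union>?C" using loc by blast
 moreover have "?C ~= {}" using loc[OF zero_in_Sq] by blast
 ultimately obtain dl where dl: "0 < dl" "!!T. T \<subseteq> Sq ==> diameter T < dl ==> \<exists>B\<in>?C. T \<subseteq> B"
  using Lebesgue_number_lemma[OF compact_Sq, of ?C] by blast
 \<comment> \<open>Sides of at most dl/4 keep the diameter at most dl/2, strictly below the Lebesgue
   number.\<close>
 have small: "evenly ((kp \<circ> rect a b c d) ` Sq)" if ab: "- 1 <= a" "a < b" "b <= 1" "- 1 <= c" "c < d" "d <= 1"
  and s: "b - a <= dl / 4" "d - c <= dl / 4" for a b c d
 proof -
  let ?T = "rect a b c d ` Sq"
  have T: "?T = {w. a <= Re w & Re w <= b & c <= Im w & Im w <= d}" by (rule rect_image[OF ab(2,5)])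
  have TS: "?T \<subseteq> Sq" unfolding T using ab by (auto simp: Sq_iff)
  have "diameter ?T <= dl / 2"
  proof (rule diameter_le)
   show "?T ~= {} | 0 <= dl / 2" using dl(1) by simp
   fix x y assume "x \<in> ?T" "y \<in> ?T"
   then have "\<bar>Re (x - y)\<bar> <= b - a" "\<bar>Im (x - y)\<bar> <= d - c" unfolding T by (auto simp: abs_le_iff)
   then have "\<bar>Re (x - y)\<bar> + \<bar>Im (x - y)\<bar> <= dl / 4 + dl / 4" using s by linarith
   also have "\<dots> = dl / 2" by simp
   finally show "cmod (x - y) <= dl / 2" using cmod_le[of "x - y"] by simp
  qed
  then have "diameter ?T < dl" using dl(1) by simp
  from dl(2)[OF TS this] obtain B where B: "evenly (kp ` (Sq Int B))" "?T \<subseteq> B" by blast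
  have "(kp \<circ> rect a b c d) ` Sq \<subseteq> kp ` (Sq Int B)"
   unfolding image_comp[symmetric] by (rule image_mono[OF Int_greatest[OF TS B(2)]])
  then show ?thesis by (rule evenly_mono[OF B(1)])
 qed
 \<comment> \<open>Induction on the number of rounds, each of which halves both sides.\<close>
 have *: "refinable (kp \<circ> rect a b c d)" if "- 1 <= a" "a < b" "b <= 1" "- 1 <= c" "c < d" "d <= 1"
  "b - a <= 2 ^ n * (dl / 4)" "d - c <= 2 ^ n * (dl / 4)" for n a b c d
  using that
 proof (induction n arbitrary: a b c d)
  case 0 then show ?case by (intro refinable_evenly small) simp_all
 next
  case (Suc n)
  define m k where "m = (a + b) / 2" and "k = (c + d) / 2"
  then have mk: "2 * m = a + b" "2 * k = c + d" by simp_all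
  have m: "a < m" "m < b" "c < k" "k < d" using Suc.prems mk by linarith+
  have "2 ^ Suc n * (dl / 4) = 2 * (2 ^ n * (dl / 4))" by simp
  then have half: "m - a <= 2 ^ n * (dl / 4)" "b - m <= 2 ^ n * (dl / 4)" "k - c <= 2 ^ n * (dl / 4)" "d - k <= 2 ^ n * (dl / 4)"
   using Suc.prems(7,8) mk by linarith+
  have V: "refinable (kp \<circ> rect a' b' c d)" if "- 1 <= a'" "a' < b'" "b' <= 1" "b' - a' <= 2 ^ n * (dl / 4)" for a' b'
  proof (rule refinable_hcut)
   have "refinable (kp \<circ> rect a' b' c k)" by (rule Suc.IH) (use that Suc.prems(1-6) m half in linarith)+
   then show "refinable (kp \<circ> rect a' b' c d \<circ> rect (- 1) 1 (- 1) 0)" unfolding comp_assoc rect_halves(3)[OF mk(2)] .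
   have "refinable (kp \<circ> rect a' b' k d)" by (rule Suc.IH) (use that Suc.prems(1-6) m half in linarith)+
   then show "refinable (kp \<circ> rect a' b' c d \<circ> rect (- 1) 1 0 1)" unfolding comp_assoc rect_halves(4)[OF mk(2)] .
  qed
  show ?case
  proof (rule refinable_vcut)
   have "refinable (kp \<circ> rect a m c d)" by (rule V) (use Suc.prems(1-6) m half in linarith)+
   then show "refinable (kp \<circ> rect a b c d \<circ> rect (- 1) 0 (- 1) 1)" unfolding comp_assoc rect_halves(1)[OF mk(1)] .
   have "refinable (kp \<circ> rect m b c d)" by (rule V) (use Suc.prems(1-6) m half in linarith)+
   then show "refinable (kp \<circ> rect a b c d \<circ> rect 0 1 (- 1) 1)" unfolding comp_assoc rect_halves(2)[OF mk(1)] .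
  qed
 qed
 \<comment> \<open>The full square has sides of length 2, so n rounds are enough once 2 <= 2^n
   dl/4.\<close>
 obtain n where "8 / dl < 2 ^ n" using real_arch_pow[of 2 "8 / dl"] by auto
 then have "2 <= 2 ^ n * (dl / 4)" using dl(1) by (simp add: field_simps)
 then have "refinable (kp \<circ> rect (- 1) 1 (- 1) 1)" by (intro *[of _ _ _ _ n]) simp_all
 moreover have "rect (- 1) 1 (- 1) 1 = id" by (rule ext, rule complex_eqI) (simp_all add: rect_id)
 ultimately show ?thesis by simp
qed

text \<open>Each use of \<open>refinable\<close> removes an unsuitable cell and adds only suitable
  ones.\<close>

lemma cellulation_evenly:
 assumes "cellulation Y G e K" "K ~= {}"
 shows "\<exists>G' e' K'. cellulation Y G' e' K' & G \<subseteq> G' & K' ~= {} & (\<forall>kp\<in>K'. evenly (kp ` Sq))"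
 using assms
proof (induction "card {kp \<in> K. ~ evenly (kp ` Sq)}" arbitrary: G e K rule: less_induct)
 case less
 note c = less.prems(1)
 show ?case
 proof (cases "\<exists>kp\<in>K. ~ evenly (kp ` Sq)")
  case False then show ?thesis using less.prems by blast
 next
  case True
  then obtain kp where k: "kp \<in> K" "~ evenly (kp ` Sq)" by blast
  have "cell Y G kp" and finK: "finite K" using c k(1) unfolding cellulation_def by blast+
  then have "refinable kp" unfolding cell_def using refinable_cell by blast
  then obtain G1 e1 K1 where 1: "cellulation Y G1 e1 ((K - {kp}) Un K1)" "G \<subseteq> G1" "K1 ~= {}" "\<forall>kp'\<in>K1. evenly (kp' ` Sq)"
   using c k(1) unfolding refinable_def by meson
  have "{kp' \<in> (K - {kp}) Un K1. ~ evenly (kp' ` Sq)} \<subset> {kp \<in> K. ~ evenly (kp ` Sq)}" using 1(4) k by blast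
  then have "card {kp' \<in> (K - {kp}) Un K1. ~ evenly (kp' ` Sq)} < card {kp \<in> K. ~ evenly (kp ` Sq)}"
   by (rule psubset_card_mono[rotated]) (use finK in simp)
  from less.hyps[OF this 1(1)] 1(3) obtain G' e' K' where "cellulation Y G' e' K'" "G1 \<subseteq> G'" "K' ~= {}" "\<forall>kp\<in>K'. evenly (kp ` Sq)" by blast
  then show ?thesis using 1(2) by blast
 qed
qed

theorem lift_cellulation:
 assumes "compact_space Y" and ne: "topspace X ~= {}"
  and m: "!!q. q \<in> topspace Y ==> (\<Sum>x\<in>fib q. N x) = m"
  and c: "cellulation Y G e K" "K ~= {}"
 shows "\<exists>G' e' K' H L. cellulation Y G' e' K' & K' ~= {} &
  cellulation X H (int m * e' - (\<Sum>q\<in>brs. int m - int (card (fib q)))) L & L ~= {} & card L = m * card K'"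
proof -
 have fin: "finite brs" by (rule finite_brs[OF assms(1)])
 have "brs \<subseteq> topspace Y" unfolding brs_def by blast
 from cellulation_through_points[OF fin this c] obtain G1 e1 K1 where 1: "cellulation Y G1 e1 K1" "K1 ~= {}" "brs \<subseteq> G1" by (elim exE conjE)
 from cellulation_evenly[OF 1(1,2)] obtain G2 e2 K2 where 2: "cellulation Y G2 e2 K2" "G1 \<subseteq> G2" "K2 ~= {}" "\<forall>kp\<in>K2. evenly (kp ` Sq)" by (elim exE conjE)
 have b2: "brs \<subseteq> G2" using 1(3) 2(2) by (rule subset_trans)
 from lift_cells[OF 2(1) fin m b2] 2(4) obtain L where
  L: "cellulation X (pre G2) (int m * e2 - (\<Sum>q\<in>brs. int m - int (card (fib q)))) L" "card L = m * card K2" by blast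
 obtain x where x: "x \<in> topspace X" using ne by blast
 have fx: "f x \<in> topspace Y" using x cont_br by (auto simp: continuous_map_def)
 \<comment> \<open>The fibre through an actual point shows m > 0, so the lifted cellulation has
   cells.\<close>
 have "0 < N x" using N_pos[OF x] by simp
 also have "N x <= (\<Sum>x\<in>fib (f x). N x)"
  by (rule member_le_sum[OF _ _ finite_fib[OF fx]]) (use x in \<open>auto simp: fib_def\<close>)
 also have "\<dots> = m" by (rule m[OF fx])
 finally have m0: "0 < m" .
 have "finite K2" using 2(1) unfolding cellulation_def by blast
 then have "0 < card K2" using 2(3) by (simp add: card_gt_0_iff)
 then have "0 < card L" using L(2) m0 by simp
 then have "L ~= {}" by auto
 then show ?thesis using 2(1,3) L by (intro exI conjI)
qed

end

section \<open>Relative cellulations\<close>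

text \<open>A relative cellulation: \<open>R\<close> is the union of a graph \<open>T\<close>, built on the closed set \<open>B\<close>, and of cells;
 \<open>v\<close> is the Euler characteristic of \<open>R\<close> relative to \<open>B\<close>.\<close>

definition rc :: "'a topology => 'a set => 'a set => 'a set => int => bool" where
 "rc X B R T v \<longleftrightarrow> (\<exists>e K. graphext X B T e & finite K & (\<forall>kp\<in>K. cell X T kp) &
   (\<forall>kp\<in>K. \<forall>kp'\<in>K. \<forall>z\<in>Sq. \<forall>z'\<in>Sq. kp z = kp' z' --> kp z ~: T --> kp = kp') &
   R = T Un (\<Union>kp\<in>K. kp ` Sq) & v = e + int (card K))"

lemma graphext_sub: "graphext X B T e ==> B \<subseteq> T"
 by (induction rule: graphext.induct) auto

lemma graphext_glue:
 assumes "graphext X B' T' e'" and T: "graphext X B T e" "B' \<subseteq> T" and "T Int T' \<subseteq> B'"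
 shows "graphext X B (T Un T') (e + e')"
 using assms(1,4)
proof (induction rule: graphext.induct)
 case base
 have "T Un B' = T" using T(2) by blast
 then show ?case using T(1) by simp
next
 case (point T1 e1 x)
 have IH: "graphext X B (T Un T1) (e + e1)" by (rule point.IH) (use point.prems in blast)
 have "x ~: T"
 proof
  assume "x \<in> T"
  then have "x \<in> B'" using point.prems by blast
  then show False using graphext_sub[OF point.hyps(1)] point.hyps(3) by blast
 qed
 then have "x ~: T Un T1" using point.hyps(3) by blast
 from graphext.point[OF IH point.hyps(2) this] show ?case by (simp add: add.assoc)
next
 case (arc T1 e1 ga)
 have IH: "graphext X B (T Un T1) (e + e1)" by (rule arc.IH) (use arc.prems in blast)
 have "T Int ga ` {0..1} \<subseteq> T1" using arc.prems graphext_sub[OF arc.hyps(1)] by blast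
 then have "(T Un T1) Int ga ` {0..1} = T1 Int ga ` {0..1}" by blast
 then have "(T Un T1) Int ga ` {0..1} = {ga 0, ga 1}" using arc.hyps(4) by simp
 from graphext.arc[OF IH arc.hyps(2,3) this] show ?case by (simp add: Un_assoc add_diff_eq)
qed

lemma rc_sub: "rc X B R T v ==> B \<subseteq> T" "rc X B R T v ==> T \<subseteq> R"
proof -
 assume r: "rc X B R T v"
 then obtain e where "graphext X B T e" unfolding rc_def by (elim exE conjE)
 then show "B \<subseteq> T" by (rule graphext_sub)
 show "T \<subseteq> R" using r unfolding rc_def by (elim exE conjE) simp
qed

lemma rcE:
 assumes "rc X B R T v"
 obtains e K where "graphext X B T e" "finite K" "\<forall>kp\<in>K. cell X T kp"
   "\<forall>kp\<in>K. \<forall>kp'\<in>K. \<forall>z\<in>Sq. \<forall>z'\<in>Sq. kp z = kp' z' --> kp z ~: T --> kp = kp'"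
   "R = T Un (\<Union>kp\<in>K. kp ` Sq)" "v = e + int (card K)"
 using assms[unfolded rc_def] by (elim exE conjE) (rule that; assumption)

text \<open>Relative Euler characteristics add because the two parts share nothing outside B', which
  is the base of the second part and is counted in the first.\<close>

lemma rc_glue:
 assumes a: "rc X B R T v" and b: "rc X B' R' T' v'" and sub: "B' \<subseteq> T" and int: "R Int R' \<subseteq> B'"
 shows "rc X B (R Un R') (T Un T') (v + v')"
proof -
 from rcE[OF a] obtain e K where a'0: "graphext X B T e" "finite K" "\<forall>kp\<in>K. cell X T kp"
   "\<forall>kp\<in>K. \<forall>kp'\<in>K. \<forall>z\<in>Sq. \<forall>z'\<in>Sq. kp z = kp' z' --> kp z ~: T --> kp = kp'"
   "R = T Un (\<Union>kp\<in>K. kp ` Sq)" "v = e + int (card K)" .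
 have a'3: "!!kp. kp \<in> K ==> cell X T kp" by (rule bspec[OF a'0(3)])
 have a'4: "!!kp kp' z z'. kp \<in> K ==> kp' \<in> K ==> z \<in> Sq ==> z' \<in> Sq ==> kp z = kp' z' ==> kp z ~: T ==> kp = kp'"
  by (rule a'0(4)[rule_format])
 note a' = a'0(1,2) a'3 a'4 a'0(5,6)
 from rcE[OF b] obtain e' K' where b'0: "graphext X B' T' e'" "finite K'" "\<forall>kp\<in>K'. cell X T' kp"
   "\<forall>kp\<in>K'. \<forall>kp'\<in>K'. \<forall>z\<in>Sq. \<forall>z'\<in>Sq. kp z = kp' z' --> kp z ~: T' --> kp = kp'"
   "R' = T' Un (\<Union>kp\<in>K'. kp ` Sq)" "v' = e' + int (card K')" .
 have b'3: "!!kp. kp \<in> K' ==> cell X T' kp" by (rule bspec[OF b'0(3)])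
 have b'4: "!!kp kp' z z'. kp \<in> K' ==> kp' \<in> K' ==> z \<in> Sq ==> z' \<in> Sq ==> kp z = kp' z' ==> kp z ~: T' ==> kp = kp'"
  by (rule b'0(4)[rule_format])
 note b' = b'0(1,2) b'3 b'4 b'0(5,6)
 have TR: "T \<subseteq> R" "T' \<subseteq> R'" "B' \<subseteq> T'" using rc_sub[OF a] rc_sub[OF b] by blast+
 have inR: "kp z \<in> R" if "kp \<in> K" "z \<in> Sq" for kp z using a'(5) that by blast
 have inR': "kp z \<in> R'" if "kp \<in> K'" "z \<in> Sq" for kp z using b'(5) that by blast
 have c1: "kp z \<in> T Un T' \<longleftrightarrow> kp z \<in> T" if "kp \<in> K" "z \<in> Sq" for kp z
  using inR[OF that] TR sub int by blast
 have c2: "kp z \<in> T Un T' \<longleftrightarrow> kp z \<in> T'" if "kp \<in> K'" "z \<in> Sq" for kp z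
  using inR'[OF that] TR sub int by blast
 have x: False if "kp \<in> K" "kp' \<in> K'" "z \<in> Sq" "z' \<in> Sq" "kp z = kp' z'" "kp z ~: T Un T'" for kp kp' z z'
 proof -
  have "kp z \<in> R Int R'" using inR[OF that(1,3)] inR'[OF that(2,4)] that(5) by simp
  then show False using int sub that(6) by blast
 qed
 have "K Int K' = {}"
 proof (rule equals0I)
  fix kp assume k: "kp \<in> K Int K'"
  then have k1: "kp \<in> K" and k2: "kp \<in> K'" by blast+
  have "kp 0 ~: T" using a'(3)[OF k1] zero_in_Sq unfolding cell_def by fastforce
  moreover have "kp 0 \<in> T" using inR[OF k1 zero_in_Sq] inR'[OF k2 zero_in_Sq] int sub by blast
  ultimately show False by blast
 qed
 then have card: "card (K Un K') = card K + card K'" using a'(2) b'(2) by (rule card_Un_disjoint[rotated 2])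
 show ?thesis unfolding rc_def
 proof (intro exI[of _ "e + e'"] exI[of _ "K Un K'"] conjI)
  show "graphext X B (T Un T') (e + e')" by (rule graphext_glue[OF b'(1) a'(1) sub]) (use int TR in blast)
  show "finite (K Un K')" using a'(2) b'(2) by simp
  show "\<forall>kp\<in>K Un K'. cell X (T Un T') kp"
  proof
   fix kp assume "kp \<in> K Un K'"
   then consider "kp \<in> K" | "kp \<in> K'" by blast
   then show "cell X (T Un T') kp"
   proof cases
    case 1 then show ?thesis using a'(3)[OF 1] c1[OF 1] unfolding cell_def by simp
   next
    case 2 then show ?thesis using b'(3)[OF 2] c2[OF 2] unfolding cell_def by simp
   qed
  qed
  show "\<forall>kp\<in>K Un K'. \<forall>kp'\<in>K Un K'. \<forall>z\<in>Sq. \<forall>z'\<in>Sq. kp z = kp' z' --> kp z ~: T Un T' --> kp = kp'"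
  proof (intro ballI impI)
   fix kp kp' z z' assume h: "kp \<in> K Un K'" "kp' \<in> K Un K'" "z \<in> Sq" "z' \<in> Sq" "kp z = kp' z'" "kp z ~: T Un T'"
   have h': "kp' z' ~: T Un T'" using h(5,6) by simp
   consider "kp \<in> K" "kp' \<in> K" | "kp \<in> K" "kp' \<in> K'" | "kp \<in> K'" "kp' \<in> K" | "kp \<in> K'" "kp' \<in> K'" using h(1,2) by blast
   then show "kp = kp'"
   proof cases
    case 1 show ?thesis by (rule a'(4)[OF 1 h(3-5)]) (use h(6) in blast)
   next
    case 2 then show ?thesis using x[OF 2 h(3-6)] by blast
   next
    case 3 then show ?thesis using x[OF 3(2,1) h(4,3) h(5)[symmetric] h'] by blast
   next
    case 4 show ?thesis by (rule b'(4)[OF 4 h(3-5)]) (use h(6) in blast)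
   qed
  qed
  show "R Un R' = T Un T' Un (\<Union>kp\<in>K Un K'. kp ` Sq)" unfolding a'(5) b'(5) by blast
  show "v + v' = e + e' + int (card (K Un K'))" unfolding a'(6) b'(6) card by simp
 qed
qed

lemma rc_refl: "rc X B B B 0"
 unfolding rc_def by (intro exI[of _ 0] exI[of _ "{}"]) (simp add: graphext.base)

lemma rc_insert:
 assumes "rc X B R T v" "x \<in> topspace X" "x ~: R"
 shows "rc X B (insert x R) (insert x T) (v + 1)"
proof -
 have "graphext X {} (insert x {}) (0 + 1)" by (rule graphext.point[OF graphext.base assms(2)]) simp
 then have "rc X {} {x} {x} 1" unfolding rc_def by (intro exI[of _ 1] exI[of _ "{}"]) simp
 from rc_glue[OF assms(1) this] show ?thesis using assms(3) by simp
qed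

lemma rc_arc:
 fixes a b :: real
 assumes r: "rc X B R T v" and ab: "a < b" and h: "continuous_map (top_of_set {a..b}) X h" "inj_on h {a..b}"
  and ends: "h a \<in> T" "h b \<in> T" and int: "!!t. a < t ==> t < b ==> h t ~: R"
 shows "rc X B (R Un h ` {a..b}) (T Un h ` {a..b}) (v - 1)"
proof -
 let ?ga = "h \<circ> aff a b"
 have im: "?ga ` {0..1} = h ` {a..b}" unfolding image_comp[symmetric] aff_image[OF ab] ..
 have "continuous_on {0..1} (aff a b)" unfolding aff_def by (intro continuous_intros)
 then have "continuous_map (top_of_set {0..1}) (top_of_set {a..b}) (aff a b)"
  using aff_image[OF ab] by (simp add: continuous_map_in_subtopology image_subset_iff_funcset[symmetric])
 then have 1: "continuous_map (top_of_set {0..1}) X ?ga" using h(1) by (rule continuous_map_compose)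
 have "inj_on (aff a b) {0..1}" using aff_inj[OF ab] by (simp add: inj_on_def)
 then have 2: "inj_on ?ga {0..1}" using h(2) unfolding aff_image[OF ab, symmetric] by (rule comp_inj_on)
 have e: "?ga 0 = h a" "?ga 1 = h b" by (simp_all add: aff_def)
 have s: "{h a, h b} \<subseteq> h ` {a..b}" using ab by simp
 have "{h a, h b} Int ?ga ` {0..1} = {?ga 0, ?ga 1}" unfolding im e using s by blast
 from graphext.arc[OF graphext.base 1 2 this] have "graphext X {h a, h b} ({h a, h b} Un h ` {a..b}) (0 - 1)" unfolding im .
 moreover have "{h a, h b} Un h ` {a..b} = h ` {a..b}" using s by blast
 ultimately have g: "graphext X {h a, h b} (h ` {a..b}) (- 1)" by simp
 have "rc X {h a, h b} (h ` {a..b}) (h ` {a..b}) (- 1)" unfolding rc_def by (intro exI[of _ "- 1"] exI[of _ "{}"]) (simp add: g)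
 moreover have "R Int h ` {a..b} \<subseteq> {h a, h b}"
 proof
  fix x assume "x \<in> R Int h ` {a..b}"
  then obtain t where t: "t \<in> {a..b}" "x = h t" "h t \<in> R" by blast
  then have "~ (a < t & t < b)" using int by blast
  then have "t = a | t = b" using t(1) by auto
  then show "x \<in> {h a, h b}" using t(2) by blast
 qed
 moreover have "{h a, h b} \<subseteq> T" using ends by blast
 ultimately have "rc X B (R Un h ` {a..b}) (T Un h ` {a..b}) (v + - 1)" by (intro rc_glue[OF r])
 then show ?thesis by simp
qed

lemma rc_cell:
 assumes r: "rc X B R T v" and kp: "continuous_map (top_of_set Sq) X kp" "inj_on kp Sq"
  and bd: "!!z. z \<in> Sq ==> supn z = 1 ==> kp z \<in> T" and int: "!!z. z \<in> Sq ==> supn z ~= 1 ==> kp z ~: R"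
 shows "rc X B (R Un kp ` Sq) T (v + 1)"
proof -
 let ?B = "kp ` {z \<in> Sq. supn z = 1}"
 have mem: "kp z \<in> ?B \<longleftrightarrow> supn z = 1" if "z \<in> Sq" for z
  using inj_on_image_mem_iff[OF kp(2) that, of "{z \<in> Sq. supn z = 1}"] that by auto
 have c: "cell X ?B kp" unfolding cell_def using kp mem by blast
 have "rc X ?B (kp ` Sq) ?B 1" unfolding rc_def
  by (intro exI[of _ 0] exI[of _ "{kp}"] conjI graphext.base) (use c in auto)
 moreover have "?B \<subseteq> T" using bd by blast
 moreover have "R Int kp ` Sq \<subseteq> ?B" using int by blast
 ultimately have "rc X B (R Un kp ` Sq) (T Un ?B) (v + 1)" by (intro rc_glue[OF r])
 moreover have "T Un ?B = T" using bd by blast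
 ultimately show ?thesis by simp
qed

lemma graphext_push:
 assumes "graphext euclidean B T e" and "T \<subseteq> D" and xi: "continuous_map (top_of_set D) X xi" "inj_on xi D"
 shows "graphext X (xi ` B) (xi ` T) e"
 using assms(1,2)
proof (induction rule: graphext.induct)
 case base show ?case by (rule graphext.base)
next
 case (point T e x)
 have "xi x \<in> topspace X" using continuous_map_image_subset_topspace[OF xi(1)] point.prems by auto
 moreover have "xi x ~: xi ` T" using inj_on_image_mem_iff[OF xi(2), of x T] point.prems point.hyps by blast
 ultimately have "graphext X (xi ` B) (insert (xi x) (xi ` T)) (e + 1)" using point by (intro graphext.point) auto
 then show ?case by simp
next
 case (arc T e ga)
 have T: "T \<subseteq> D" "ga ` {0..1} \<subseteq> D" using arc.prems by auto
 have "continuous_map (top_of_set {0..1}) (top_of_set D) ga" using arc.hyps(2) T(2) by (simp add: continuous_map_in_subtopology image_subset_iff_funcset[symmetric])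
 then have 1: "continuous_map (top_of_set {0..1}) X (xi \<circ> ga)" using xi(1) by (rule continuous_map_compose)
 have 2: "inj_on (xi \<circ> ga) {0..1}" by (rule comp_inj_on[OF arc.hyps(3) inj_on_subset[OF xi(2) T(2)]])
 have "xi ` T Int (xi \<circ> ga) ` {0..1} = xi ` (T Int ga ` {0..1})"
  unfolding image_comp[symmetric] by (rule inj_on_image_Int[OF xi(2) T, symmetric])
 also have "\<dots> = {(xi \<circ> ga) 0, (xi \<circ> ga) 1}" unfolding arc.hyps(4) by simp
 finally have 3: "xi ` T Int (xi \<circ> ga) ` {0..1} = {(xi \<circ> ga) 0, (xi \<circ> ga) 1}" .
 from graphext.arc[OF arc.IH[OF T(1)] 1 2 3] show ?case unfolding image_Un image_comp .
qed

text \<open>The models of a holed square and of a handle are built in Euclidean space and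
  transported to X by this lemma.\<close>

lemma rc_push:
 assumes r: "rc euclidean B R T v" and D: "R \<subseteq> D" and xi: "continuous_map (top_of_set D) X xi" "inj_on xi D"
 shows "rc X (xi ` B) (xi ` R) (xi ` T) v"
proof -
 from rcE[OF r] obtain e K where a0: "graphext euclidean B T e" "finite K" "\<forall>kp\<in>K. cell euclidean T kp"
   "\<forall>kp\<in>K. \<forall>kp'\<in>K. \<forall>z\<in>Sq. \<forall>z'\<in>Sq. kp z = kp' z' --> kp z ~: T --> kp = kp'"
   "R = T Un (\<Union>kp\<in>K. kp ` Sq)" "v = e + int (card K)" .
 have a3: "!!kp. kp \<in> K ==> cell euclidean T kp" by (rule bspec[OF a0(3)])
 have a4: "!!kp kp' z z'. kp \<in> K ==> kp' \<in> K ==> z \<in> Sq ==> z' \<in> Sq ==> kp z = kp' z' ==> kp z ~: T ==> kp = kp'"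
  by (rule a0(4)[rule_format])
 note a = a0(1,2) a3 a4 a0(5,6)
 have TD: "T \<subseteq> D" using rc_sub(2)[OF r] D by blast
 have kD: "kp z \<in> D" if "kp \<in> K" "z \<in> Sq" for kp z using a(5) D that by blast
 have mem: "xi (kp z) \<in> xi ` T \<longleftrightarrow> kp z \<in> T" if "kp \<in> K" "z \<in> Sq" for kp z
  by (rule inj_on_image_mem_iff[OF xi(2) kD[OF that] TD])
 have dis: "kp = kp'" if "kp \<in> K" "kp' \<in> K" "z \<in> Sq" "z' \<in> Sq" "xi (kp z) = xi (kp' z')" "kp z ~: T" for kp kp' z z'
  by (rule a(4)[OF that(1-4) inj_onD[OF xi(2) that(5) kD[OF that(1,3)] kD[OF that(2,4)]] that(6)])
 have "inj_on (%kp. xi \<circ> kp) K"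
 proof (rule inj_onI)
  fix kp kp' assume k: "kp \<in> K" "kp' \<in> K" "xi \<circ> kp = xi \<circ> kp'"
  have "xi (kp 0) = xi (kp' 0)" using fun_cong[OF k(3), of 0] by simp
  moreover have "kp 0 ~: T" using a(3)[OF k(1)] zero_in_Sq unfolding cell_def by fastforce
  ultimately show "kp = kp'" by (rule dis[OF k(1,2) zero_in_Sq zero_in_Sq])
 qed
 then have card: "card ((%kp. xi \<circ> kp) ` K) = card K" by (rule card_image)
 show ?thesis unfolding rc_def
 proof (intro exI[of _ e] exI[of _ "(%kp. xi \<circ> kp) ` K"] conjI)
  show "graphext X (xi ` B) (xi ` T) e" by (rule graphext_push[OF a(1) TD xi])
  show "finite ((%kp. xi \<circ> kp) ` K)" using a(2) by simp
  show "\<forall>kp\<in>(%kp. xi \<circ> kp) ` K. cell X (xi ` T) kp"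
  proof
   fix et assume "et \<in> (%kp. xi \<circ> kp) ` K"
   then obtain kp where k: "kp \<in> K" "et = xi \<circ> kp" by blast
   have c: "continuous_map (top_of_set Sq) euclidean kp" "inj_on kp Sq" "\<forall>z\<in>Sq. kp z \<in> T \<longleftrightarrow> supn z = 1"
    using a(3)[OF k(1)] unfolding cell_def by blast+
   have s: "kp ` Sq \<subseteq> D" using kD[OF k(1)] by blast
   then have "continuous_map (top_of_set Sq) (top_of_set D) kp" using c(1) by (simp add: continuous_map_in_subtopology image_subset_iff_funcset[symmetric])
   then have 1: "continuous_map (top_of_set Sq) X et" unfolding k(2) using xi(1) by (rule continuous_map_compose)
   have 2: "inj_on et Sq" unfolding k(2) by (rule comp_inj_on[OF c(2) inj_on_subset[OF xi(2) s]])
   have 3: "\<forall>z\<in>Sq. et z \<in> xi ` T \<longleftrightarrow> supn z = 1" unfolding k(2) comp_def using mem[OF k(1)] c(3) by blast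
   show "cell X (xi ` T) et" unfolding cell_def using 1 2 3 by blast
  qed
  show "\<forall>kp\<in>(%kp. xi \<circ> kp) ` K. \<forall>kp'\<in>(%kp. xi \<circ> kp) ` K. \<forall>z\<in>Sq. \<forall>z'\<in>Sq. kp z = kp' z' --> kp z ~: xi ` T --> kp = kp'"
  proof (intro ballI impI)
   fix et et' z z' assume h: "et \<in> (%kp. xi \<circ> kp) ` K" "et' \<in> (%kp. xi \<circ> kp) ` K" "z \<in> Sq" "z' \<in> Sq" "et z = et' z'" "et z ~: xi ` T"
   then obtain kp kp' where k: "kp \<in> K" "kp' \<in> K" "et = xi \<circ> kp" "et' = xi \<circ> kp'" by blast
   have "kp z ~: T"
   proof
    assume "kp z \<in> T"
    then have "xi (kp z) \<in> xi ` T" by (rule imageI)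
    then show False using h(6) k(3) by simp
   qed
   moreover have "xi (kp z) = xi (kp' z')" using h(5) k(3,4) by simp
   ultimately have "kp = kp'" by (intro dis[OF k(1,2) h(3,4)])
   then show "et = et'" using k(3,4) by simp
  qed
  show "xi ` R = xi ` T Un (\<Union>kp\<in>(%kp. xi \<circ> kp) ` K. kp ` Sq)" unfolding a(5) by (simp add: image_Un image_UN image_comp)
  show "v = e + int (card ((%kp. xi \<circ> kp) ` K))" unfolding card by (rule a(6))
 qed
qed

section \<open>Curved quadrilaterals and squares with round holes\<close>

definition trap :: "real => real => (real => real) => (real => real) => complex set" where
 "trap a b u v = {z. a <= Re z & Re z <= b & u (Re z) <= Im z & Im z <= v (Re z)}"

definition ipol :: "real => real => real => real" where
 "ipol a b s = a + (s + 1) / 2 * (b - a)"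

lemma ipol_facts:
 assumes "a < b" "\<bar>s\<bar> <= 1"
 shows "a <= ipol a b s" "ipol a b s <= b" "ipol a b s = a \<longleftrightarrow> s = - 1" "ipol a b s = b \<longleftrightarrow> s = 1"
  "ipol a b s = ipol a b s' \<longleftrightarrow> s = s'"
 using interp[OF assms] interp_ends[OF assms(1), of s] assms(1) unfolding ipol_def by auto

lemma ipol_surj:
 assumes "a < b" "a <= x" "x <= b"
 obtains s where "\<bar>s\<bar> <= 1" "ipol a b s = x"
proof
 let ?y = "(x - a) / (b - a)"
 have y: "0 <= ?y" "?y <= 1" using assms by auto
 then show "\<bar>2 * ?y - 1\<bar> <= 1" by (simp add: abs_le_iff del: times_divide_eq_right)
 have "(2 * y - 1 + 1) / 2 = y" for y :: real by simp
 then show "ipol a b (2 * ?y - 1) = x" unfolding ipol_def using assms(1) by (simp only:) simp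
qed

text \<open>Affine along every vertical segment, this map carries \<open>Sq\<close> onto
  \<open>trap a b u v\<close> and sides to sides.\<close>

definition tmap :: "real => real => (real => real) => (real => real) => complex => complex" where
 "tmap a b u v z = Complex (ipol a b (Re z)) (ipol (u (ipol a b (Re z))) (v (ipol a b (Re z))) (Im z))"

text \<open>Cells of the models arise as regions between two graphs; the strict inequality of u and
  v keeps \<open>tmap\<close> injective up to the vertical sides.\<close>

lemma rc_trap:
 assumes r: "rc X B R T n" and ab: "a < b" and u: "continuous_on {a..b} u" "continuous_on {a..b} v"
  and uv: "!!x. a <= x ==> x <= b ==> u x < v x"
  and xi: "continuous_map (top_of_set (trap a b u v)) X xi" "inj_on xi (trap a b u v)"
  and bd: "!!z. z \<in> trap a b u v ==> Re z = a | Re z = b | Im z = u (Re z) | Im z = v (Re z) ==> xi z \<in> T"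
  and int: "!!z. a < Re z ==> Re z < b ==> u (Re z) < Im z ==> Im z < v (Re z) ==> xi z ~: R"
 shows "rc X B (R Un xi ` trap a b u v) T (n + 1)"
proof -
 let ?t = "tmap a b u v"
 have sq: "\<bar>Re z\<bar> <= 1" "\<bar>Im z\<bar> <= 1" if "z \<in> Sq" for z using that by (simp_all add: Sq_iff)
 have x: "a <= ipol a b (Re z)" "ipol a b (Re z) <= b" "u (ipol a b (Re z)) < v (ipol a b (Re z))" if "z \<in> Sq" for z
  using ipol_facts(1,2)[OF ab sq(1)[OF that]] uv by simp_all
 have im: "?t ` Sq = trap a b u v"
 proof (intro equalityI subsetI)
  fix w assume "w \<in> ?t ` Sq"
  then obtain z where z: "z \<in> Sq" "w = ?t z" by blast
  show "w \<in> trap a b u v" unfolding z(2) trap_def tmap_def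
   using x[OF z(1)] ipol_facts(1,2)[OF x(3)[OF z(1)] sq(2)[OF z(1)]] by simp
 next
  fix w assume w: "w \<in> trap a b u v"
  then have w': "a <= Re w" "Re w <= b" "u (Re w) <= Im w" "Im w <= v (Re w)" unfolding trap_def by simp_all
  obtain s where s: "\<bar>s\<bar> <= 1" "ipol a b s = Re w" using ipol_surj[OF ab w'(1,2)] .
  obtain s' where s': "\<bar>s'\<bar> <= 1" "ipol (u (Re w)) (v (Re w)) s' = Im w" using ipol_surj[OF uv[OF w'(1,2)] w'(3,4)] .
  have "w = ?t (Complex s s')" unfolding tmap_def by (simp add: s(2) s'(2))
  moreover have "Complex s s' \<in> Sq" using s s' by (simp add: Sq_iff)
  ultimately show "w \<in> ?t ` Sq" by blast
 qed
 have ct: "continuous_on Sq ?t"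
 proof -
  have 1: "continuous_on Sq (%z. ipol a b (Re z))" unfolding ipol_def by (intro continuous_intros) auto
  have 2: "continuous_on Sq (%z. u (ipol a b (Re z)))" "continuous_on Sq (%z. v (ipol a b (Re z)))"
   using x by (auto intro!: continuous_on_compose2[OF u(1) 1] continuous_on_compose2[OF u(2) 1])
  have 3: "continuous_on Sq (%z. ipol (u (ipol a b (Re z))) (v (ipol a b (Re z))) (Im z))"
   unfolding ipol_def[of "u _"] by (intro continuous_intros 2) auto
  show ?thesis unfolding tmap_def Complex_eq by (intro continuous_intros 1 3)
 qed
 have it: "inj_on ?t Sq"
 proof (rule inj_onI)
  fix z w assume zw: "z \<in> Sq" "w \<in> Sq" "?t z = ?t w"
  then have "ipol a b (Re z) = ipol a b (Re w)" unfolding tmap_def by simp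
  then have re: "Re z = Re w" using ipol_facts(5)[OF ab sq(1)[OF zw(1)]] by blast
  then have "ipol (u (ipol a b (Re z))) (v (ipol a b (Re z))) (Im z) = ipol (u (ipol a b (Re z))) (v (ipol a b (Re z))) (Im w)"
   using zw(3) unfolding tmap_def by simp
  then have "Im z = Im w" using ipol_facts(5)[OF x(3)[OF zw(1)] sq(2)[OF zw(1)]] by blast
  then show "z = w" using re by (rule complex_eqI[rotated])
 qed
 have bt: "supn z = 1 \<longleftrightarrow> Re (?t z) = a | Re (?t z) = b | Im (?t z) = u (Re (?t z)) | Im (?t z) = v (Re (?t z))" if z: "z \<in> Sq" for z
  unfolding supn_1_iff[OF z] tmap_def complex.sel
  using ipol_facts(3,4)[OF ab sq(1)[OF z]] ipol_facts(3,4)[OF x(3)[OF z] sq(2)[OF z]] by (auto simp: abs_if)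
 have "continuous_map (top_of_set Sq) (top_of_set (trap a b u v)) ?t"
  using ct im by (simp add: continuous_map_in_subtopology image_subset_iff_funcset[symmetric])
 then have 1: "continuous_map (top_of_set Sq) X (xi \<circ> ?t)" using xi(1) by (rule continuous_map_compose)
 have 2: "inj_on (xi \<circ> ?t) Sq" using it xi(2) unfolding im[symmetric] by (rule comp_inj_on)
 have "rc X B (R Un (xi \<circ> ?t) ` Sq) T (n + 1)"
 proof (rule rc_cell[OF r 1 2])
  fix z assume z: "z \<in> Sq"
  have tz: "?t z \<in> trap a b u v" using im z by blast
  show "(xi \<circ> ?t) z \<in> T" if "supn z = 1" using bd[OF tz] bt[OF z] that by simp
  show "(xi \<circ> ?t) z ~: R" if "supn z ~= 1"
   unfolding comp_def by (rule int) (use tz bt[OF z] that in \<open>auto simp: trap_def\<close>)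
 qed
 then show ?thesis unfolding image_comp[symmetric] im .
qed

definition rbox :: "real => real => real => real => complex set" where
 "rbox a b c d = {z. a <= Re z & Re z <= b & c <= Im z & Im z <= d}"

definition rim :: "real => real => real => real => complex set" where
 "rim a b c d = {z \<in> rbox a b c d. Re z = a | Re z = b | Im z = c | Im z = d}"

text \<open>A box relative to its rim has characteristic 1, and each hole lowers it by one. The hole
  circles are kept in the graph because handles will be attached along them.\<close>

definition holed :: "real => real => real => real => complex set => real => bool" where
 "holed a b c d P dl \<longleftrightarrow> (\<exists>T. rc euclidean (rim a b c d) (rbox a b c d - (\<Union>p\<in>P. ball p dl)) T (1 - int (card P)) &
   (\<forall>p\<in>P. sphere p dl \<subseteq> T))"

lemma near_Re: "w \<in> ball p dl ==> \<bar>Re p - Re w\<bar> < dl"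
 using abs_Re_le_cmod[of "p - w"] by (simp add: dist_norm)

lemma holed_empty: "a < b ==> c < d ==> holed a b c d {} dl"
proof -
 assume ab: "a < b" "c < d"
 let ?t = "trap a b (%_. c) (%_. d)"
 have tb: "?t = rbox a b c d" unfolding trap_def rbox_def ..
 have "rc euclidean (rim a b c d) (rim a b c d Un id ` ?t) (rim a b c d) (0 + 1)"
  by (rule rc_trap[OF rc_refl ab(1)]) (use ab in \<open>auto simp: rim_def tb\<close>)
 moreover have "rim a b c d Un id ` ?t = rbox a b c d" unfolding tb rim_def by auto
 ultimately show ?thesis unfolding holed_def by auto
qed

text \<open>Two arcs, namely a horizontal line through the centre with a detour along the upper half
  circle, and the lower half circle, leave two cells: -2 + 2 = 0.\<close>

lemma holed_single:
 assumes p: "a < Re p - dl" "Re p + dl < b" "c < Im p - dl" "Im p + dl < d" and dl: "0 < dl"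
 shows "holed a b c d {p} dl"
proof -
 \<comment> \<open>Half the length of the chord of the disc above x; \<open>max\<close> makes it 0
   outside the disc, so that one formula describes the whole line with its detour.\<close>
 define q where "q x = sqrt (max 0 (dl\<^sup>2 - (x - Re p)\<^sup>2))" for x
 define u l where "u x = Im p + q x" and "l x = Im p - q x" for x
 have q: "0 <= q x" "q x <= dl" for x
 proof -
  show "0 <= q x" by (simp add: q_def)
  have "max 0 (dl\<^sup>2 - (x - Re p)\<^sup>2) <= dl\<^sup>2" by simp
  then have "q x <= sqrt (dl\<^sup>2)" unfolding q_def by (rule real_sqrt_le_mono)
  then show "q x <= dl" using dl by simp
 qed
 have q0: "q x = 0 \<longleftrightarrow> dl <= \<bar>x - Re p\<bar>" for x
 proof -
  have "q x = 0 \<longleftrightarrow> dl\<^sup>2 <= (x - Re p)\<^sup>2" unfolding q_def by (auto simp: max_def)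
  also have "\<dots> \<longleftrightarrow> dl <= \<bar>x - Re p\<bar>" using abs_le_square_iff[of dl "x - Re p"] dl by simp
  finally show ?thesis .
 qed
 have norm2: "(norm (p - z))\<^sup>2 = (Re z - Re p)\<^sup>2 + (Im z - Im p)\<^sup>2" for z
  by (simp add: cmod_power2 power2_commute)
 have far: "z ~: ball p dl \<longleftrightarrow> q (Re z) <= \<bar>Im z - Im p\<bar>" for z
 proof -
  have "z ~: ball p dl \<longleftrightarrow> dl\<^sup>2 <= (norm (p - z))\<^sup>2"
   using abs_le_square_iff[of dl "norm (p - z)"] dl by (simp add: dist_norm not_less)
  also have "\<dots> \<longleftrightarrow> max 0 (dl\<^sup>2 - (Re z - Re p)\<^sup>2) <= (Im z - Im p)\<^sup>2" unfolding norm2 by auto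
  also have "\<dots> \<longleftrightarrow> sqrt (max 0 (dl\<^sup>2 - (Re z - Re p)\<^sup>2)) <= sqrt ((Im z - Im p)\<^sup>2)" by (rule real_sqrt_le_iff[symmetric])
  finally show ?thesis by (simp add: q_def)
 qed
 have on: "\<bar>Im z - Im p\<bar> = q (Re z)" if "z \<in> sphere p dl" for z
 proof -
  have "(norm (p - z))\<^sup>2 = dl\<^sup>2" using that by (simp add: dist_norm)
  then have "(Im z - Im p)\<^sup>2 = dl\<^sup>2 - (Re z - Re p)\<^sup>2" unfolding norm2 by simp
  then have "max 0 (dl\<^sup>2 - (Re z - Re p)\<^sup>2) = (Im z - Im p)\<^sup>2" by (metis max_def zero_le_power2)
  then show ?thesis unfolding q_def by simp
 qed
 have cq: "continuous_on S q" for S unfolding q_def by (intro continuous_intros)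
 have cu: "continuous_on S u" "continuous_on S l" for S unfolding u_def l_def by (intro continuous_intros cq)+
 have cont: "continuous_map (top_of_set S) euclidean (%x. Complex x (u x))" "continuous_map (top_of_set S) euclidean (%x. Complex x (l x))" for S
  unfolding Complex_eq using cu by (auto intro!: continuous_intros)
 let ?R0 = "rim a b c d"
 have ends: "u a = Im p" "u b = Im p" using q0[of a] q0[of b] p dl by (auto simp: u_def)
 have ab: "a < b" using p dl by linarith
 define U where "U = (%x. Complex x (u x)) ` {a..b}"
 define W where "W = (%x. Complex x (l x)) ` {Re p - dl..Re p + dl}"
 have uin: "c < u x" "u x < d" "c < l x" "l x < d" for x using q[of x] p unfolding u_def l_def by linarith+
 have 1: "rc euclidean ?R0 (?R0 Un U) (?R0 Un U) (0 - 1)" unfolding U_def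
 proof (rule rc_arc[OF rc_refl ab cont(1)])
  show "inj_on (%x. Complex x (u x)) {a..b}" by (rule inj_onI) simp
  show "Complex a (u a) \<in> ?R0" "Complex b (u b) \<in> ?R0" using uin[of a] uin[of b] ab by (auto simp: rim_def rbox_def)
  show "Complex t (u t) ~: ?R0" if "a < t" "t < b" for t using uin[of t] that by (auto simp: rim_def)
 qed
 have Um: "z \<in> U \<longleftrightarrow> a <= Re z & Re z <= b & Im z = u (Re z)" for z
  unfolding U_def by (auto simp: image_iff complex_eq_iff)
 have Wm: "z \<in> W \<longleftrightarrow> Re p - dl <= Re z & Re z <= Re p + dl & Im z = l (Re z)" for z
  unfolding W_def by (auto simp: image_iff complex_eq_iff)
 have 2: "rc euclidean ?R0 ((?R0 Un U) Un W) ((?R0 Un U) Un W) (0 - 1 - 1)" unfolding W_def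
 proof (rule rc_arc[OF 1 _ cont(2)])
  show "Re p - dl < Re p + dl" using dl by simp
  show "inj_on (%x. Complex x (l x)) {Re p - dl..Re p + dl}" by (rule inj_onI) simp
  have "q (Re p - dl) = 0" "q (Re p + dl) = 0" unfolding q0 by simp_all
  then show "Complex (Re p - dl) (l (Re p - dl)) \<in> ?R0 Un U" "Complex (Re p + dl) (l (Re p + dl)) \<in> ?R0 Un U"
   using p dl unfolding Un_iff Um by (simp_all add: u_def l_def)
  fix t assume t: "Re p - dl < t" "t < Re p + dl"
  then have "q t ~= 0" unfolding q0 by (simp add: abs_le_iff not_le)
  then have "l t ~= u t" unfolding u_def l_def by linarith
  then show "Complex t (l t) ~: ?R0 Un U" using uin[of t] t p dl unfolding Un_iff Um rim_def by auto
 qed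
 let ?T = "(?R0 Un U) Un W"
 let ?A = "trap a b u (%_. d)" and ?C = "trap a b (%_. c) l"
 have 3: "rc euclidean ?R0 (?T Un id ` ?A) ?T (0 - 1 - 1 + 1)"
 proof (rule rc_trap[OF 2 ab cu(1)])
  show "id z \<in> ?T" if "z \<in> ?A" "Re z = a | Re z = b | Im z = u (Re z) | Im z = d" for z
   using that uin[of "Re z"] unfolding Un_iff Um id_apply by (auto simp: trap_def rim_def rbox_def)
  show "id z ~: ?T" if "a < Re z" "Re z < b" "u (Re z) < Im z" "Im z < d" for z
   using that uin[of "Re z"] q[of "Re z"] unfolding Un_iff Um Wm id_apply by (auto simp: rim_def u_def l_def)
 qed (use uin in auto)
 have 4: "rc euclidean ?R0 ((?T Un id ` ?A) Un id ` ?C) ?T (0 - 1 - 1 + 1 + 1)"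
 proof (rule rc_trap[OF 3 ab _ cu(2)])
  show "id z \<in> ?T" if z: "z \<in> ?C" "Re z = a | Re z = b | Im z = c | Im z = l (Re z)" for z
  proof (cases "Im z = l (Re z)")
   case True
   show ?thesis
   proof (cases "\<bar>Re z - Re p\<bar> <= dl")
    case True
    then show ?thesis using \<open>Im z = l (Re z)\<close> unfolding Un_iff Wm id_apply by (simp add: abs_le_iff)
   next
    case False
    then have "q (Re z) = 0" unfolding q0 by simp
    then show ?thesis using \<open>Im z = l (Re z)\<close> z(1) unfolding Un_iff Um id_apply by (simp add: trap_def u_def l_def)
   qed
  next
   case False
   then show ?thesis using z uin(4)[of "Re z"] by (auto simp: trap_def rim_def rbox_def)
  qed
  show "id z ~: ?T Un id ` ?A" if "a < Re z" "Re z < b" "c < Im z" "Im z < l (Re z)" for z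
   using that uin[of "Re z"] q[of "Re z"] unfolding Un_iff Um Wm id_apply image_id by (auto simp: rim_def u_def l_def trap_def)
 qed (use uin in auto)
 have R: "(?T Un id ` ?A) Un id ` ?C = rbox a b c d - (\<Union>p\<in>{p}. ball p dl)"
 proof -
  have "z \<in> (?T Un ?A) Un ?C \<longleftrightarrow> z \<in> rbox a b c d & z ~: ball p dl" for z
  proof
   assume "z \<in> rbox a b c d & z ~: ball p dl"
   then have "q (Re z) <= \<bar>Im z - Im p\<bar>" "z \<in> rbox a b c d" unfolding far by blast+
   then show "z \<in> (?T Un ?A) Un ?C" unfolding Un_iff trap_def u_def l_def rbox_def by auto
  next
   assume z: "z \<in> (?T Un ?A) Un ?C"
   then consider "z \<in> ?R0" | "z \<in> ?A" | "z \<in> ?C" | "z \<in> U" | "z \<in> W" by blast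
   then show "z \<in> rbox a b c d & z ~: ball p dl" unfolding far
   proof cases
    case 1
    have "q (Re z) <= \<bar>Im z - Im p\<bar>"
    proof (cases "Re z = a | Re z = b")
     case True
     then have "q (Re z) = 0" using q0[of a] q0[of b] p dl by auto
     then show ?thesis by simp
    next
     case False
     then have "Im z = c | Im z = d" using 1 by (auto simp: rim_def)
     then show ?thesis using q(2)[of "Re z"] p by auto
    qed
    then show "z \<in> rbox a b c d & q (Re z) <= \<bar>Im z - Im p\<bar>" using 1 by (simp add: rim_def)
   next
    case 2 then show "z \<in> rbox a b c d & q (Re z) <= \<bar>Im z - Im p\<bar>" using uin[of "Re z"] by (auto simp: trap_def rbox_def u_def)
   next
    case 3 then show "z \<in> rbox a b c d & q (Re z) <= \<bar>Im z - Im p\<bar>" using uin[of "Re z"] by (auto simp: trap_def rbox_def l_def)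
   next
    case 4 then show "z \<in> rbox a b c d & q (Re z) <= \<bar>Im z - Im p\<bar>" using uin[of "Re z"] unfolding Um by (auto simp: rbox_def u_def)
   next
    case 5 then show "z \<in> rbox a b c d & q (Re z) <= \<bar>Im z - Im p\<bar>" using uin[of "Re z"] p unfolding Wm by (auto simp: rbox_def l_def)
   qed
  qed
  then have "(?T Un ?A) Un ?C = rbox a b c d - ball p dl" unfolding set_eq_iff Diff_iff by (rule allI)
  then show ?thesis by (simp only: image_id id_apply UN_insert UN_empty Un_empty_right)
 qed
 have "sphere p dl \<subseteq> ?T"
 proof
  fix z assume z: "z \<in> sphere p dl"
  have "\<bar>Re (p - z)\<bar> <= dl" using abs_Re_le_cmod[of "p - z"] z by (simp add: dist_norm)
  then have re: "Re p - dl <= Re z" "Re z <= Re p + dl" by (simp_all add: abs_le_iff)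
  have "Im z = u (Re z) | Im z = l (Re z)" using on[OF z] unfolding u_def l_def by (auto simp: abs_if split: if_splits)
  then show "z \<in> ?T" unfolding Un_iff Um Wm using re p by auto
 qed
 then show ?thesis unfolding holed_def by (intro exI[of _ ?T] conjI) (use 4[unfolded R] in simp_all)
qed

text \<open>The cut adds one arc, so the characteristics combine to -1 + (1 - n1) + (1 - n2) = 1 -
  n; \<open>far\<close> keeps the open holes off the cut.\<close>

lemma holed_cut:
 assumes t: "a < t" "t < b" and cd: "c < d" and fin: "finite P"
  and far: "!!p. p \<in> P ==> dl <= \<bar>Re p - t\<bar>"
  and l: "holed a t c d {p \<in> P. Re p < t} dl" and r: "holed t b c d {p \<in> P. t < Re p} dl" and dl: "0 < dl"
 shows "holed a b c d P dl"
proof -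
 let ?P1 = "{p \<in> P. Re p < t}" and ?P2 = "{p \<in> P. t < Re p}"
 define A1 where "A1 = rbox a t c d - (\<Union>p\<in>?P1. ball p dl)"
 define A2 where "A2 = rbox t b c d - (\<Union>p\<in>?P2. ball p dl)"
 obtain T1 where T1: "rc euclidean (rim a t c d) A1 T1 (1 - int (card ?P1))" "\<forall>p\<in>?P1. sphere p dl \<subseteq> T1"
  using l unfolding holed_def A1_def by blast
 obtain T2 where T2: "rc euclidean (rim t b c d) A2 T2 (1 - int (card ?P2))" "\<forall>p\<in>?P2. sphere p dl \<subseteq> T2"
  using r unfolding holed_def A2_def by blast
 define V where "V = (%y. Complex t y) ` {c..d}"
 have Vm: "z \<in> V \<longleftrightarrow> Re z = t & c <= Im z & Im z <= d" for z
  unfolding V_def by (auto simp: image_iff complex_eq_iff)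
 let ?R0 = "rim a b c d"
 have 1: "rc euclidean ?R0 (?R0 Un V) (?R0 Un V) (0 - 1)" unfolding V_def
 proof (rule rc_arc[OF rc_refl cd])
  show "continuous_map (top_of_set {c..d}) euclidean (Complex t)" unfolding Complex_eq by (auto intro!: continuous_intros)
  show "inj_on (Complex t) {c..d}" by (rule inj_onI) simp
 qed (use t cd in \<open>auto simp: rim_def rbox_def\<close>)
 have 2: "rc euclidean ?R0 ((?R0 Un V) Un A1) ((?R0 Un V) Un T1) (0 - 1 + (1 - int (card ?P1)))"
 proof (rule rc_glue[OF 1 T1(1)])
  show "rim a t c d \<subseteq> ?R0 Un V" using t unfolding rim_def rbox_def by (auto simp: Vm)
  show "(?R0 Un V) Int A1 \<subseteq> rim a t c d" using t unfolding A1_def rim_def rbox_def by (auto simp: Vm)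
 qed
 have 3: "rc euclidean ?R0 (((?R0 Un V) Un A1) Un A2) (((?R0 Un V) Un T1) Un T2) (0 - 1 + (1 - int (card ?P1)) + (1 - int (card ?P2)))"
 proof (rule rc_glue[OF 2 T2(1)])
  show "rim t b c d \<subseteq> (?R0 Un V) Un T1" using t unfolding rim_def rbox_def by (auto simp: Vm)
  show "((?R0 Un V) Un A1) Int A2 \<subseteq> rim t b c d" using t unfolding A1_def A2_def rim_def rbox_def by (auto simp: Vm)
 qed
 have P: "P = ?P1 Un ?P2"
 proof -
  have "Re p ~= t" if "p \<in> P" for p using far[OF that] dl by auto
  then show ?thesis by force
 qed
 have "card P = card ?P1 + card ?P2" by (subst P, rule card_Un_disjoint) (use fin in auto)
 then have v: "0 - 1 + (1 - int (card ?P1)) + (1 - int (card ?P2)) = 1 - int (card P)" by simp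
 have n1: "z ~: ball p dl" if "p \<in> ?P1" "t <= Re z" for p z using near_Re[of z p dl] far[of p] that by auto
 have n2: "z ~: ball p dl" if "p \<in> ?P2" "Re z <= t" for p z using near_Re[of z p dl] far[of p] that by auto
 have sub: "rim a t c d \<subseteq> A1" "rim t b c d \<subseteq> A2" using rc_sub[OF T1(1)] rc_sub[OF T2(1)] by blast+
 have R: "((?R0 Un V) Un A1) Un A2 = rbox a b c d - (\<Union>p\<in>P. ball p dl)"
 proof (intro equalityI subsetI)
  fix z assume z: "z \<in> ((?R0 Un V) Un A1) Un A2"
  have "?R0 Un V \<subseteq> rim a t c d Un rim t b c d" using t unfolding rim_def rbox_def by (auto simp: Vm)
  then have "z \<in> A1 | z \<in> A2" using z sub by blast
  then show "z \<in> rbox a b c d - (\<Union>p\<in>P. ball p dl)"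
  proof
   assume "z \<in> A1"
   then have z1: "z \<in> rbox a t c d" "!!p. p \<in> ?P1 ==> z ~: ball p dl" unfolding A1_def by blast+
   then have "!!p. p \<in> ?P2 ==> z ~: ball p dl" by (intro n2) (auto simp: rbox_def)
   then have "z ~: (\<Union>p\<in>P. ball p dl)" using z1(2) P by blast
   then show ?thesis using z1(1) t by (simp add: rbox_def)
  next
   assume "z \<in> A2"
   then have z1: "z \<in> rbox t b c d" "!!p. p \<in> ?P2 ==> z ~: ball p dl" unfolding A2_def by blast+
   then have "!!p. p \<in> ?P1 ==> z ~: ball p dl" by (intro n1) (auto simp: rbox_def)
   then have "z ~: (\<Union>p\<in>P. ball p dl)" using z1(2) P by blast
   then show ?thesis using z1(1) t by (simp add: rbox_def)
  qed
 next
  fix z assume z: "z \<in> rbox a b c d - (\<Union>p\<in>P. ball p dl)"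
  then have "z \<in> rbox a t c d | z \<in> rbox t b c d" by (auto simp: rbox_def)
  then have "z \<in> A1 | z \<in> A2" using z unfolding A1_def A2_def by blast
  then show "z \<in> ((?R0 Un V) Un A1) Un A2" by blast
 qed
 have "\<forall>p\<in>P. sphere p dl \<subseteq> ((?R0 Un V) Un T1) Un T2" using T1(2) T2(2) P by blast
 then show ?thesis unfolding holed_def using 3 unfolding R v by blast
qed

text \<open>Reflection in the diagonal, which gives different real parts to centres that lie on one
  vertical line.\<close>

definition swp :: "complex => complex" where
 "swp z = Complex (Im z) (Re z)"

lemma swp_swp [simp]: "swp (swp z) = z"
 by (simp add: swp_def)

lemma swp_dist: "dist (swp z) (swp w) = dist z w"
 by (simp add: dist_norm cmod_def swp_def add.commute)

lemma swp_image: "swp ` A = {z. swp z \<in> A}"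
 by (auto simp: image_iff intro: swp_swp[symmetric])

lemma holed_swp:
 assumes "holed a b c d P dl"
 shows "holed c d a b (swp ` P) dl"
proof -
 obtain T where T: "rc euclidean (rim a b c d) (rbox a b c d - (\<Union>p\<in>P. ball p dl)) T (1 - int (card P))"
  "\<forall>p\<in>P. sphere p dl \<subseteq> T" using assms unfolding holed_def by blast
 have inj: "inj_on swp S" for S by (rule inj_on_inverseI[of _ swp]) simp
 have "continuous_map (top_of_set UNIV) euclidean swp"
  unfolding swp_def Complex_eq by (auto intro!: continuous_intros)
 from rc_push[OF T(1) subset_UNIV this inj]
 have r: "rc euclidean (swp ` rim a b c d) (swp ` (rbox a b c d - (\<Union>p\<in>P. ball p dl))) (swp ` T) (1 - int (card P))" .
 have 1: "swp ` rim a b c d = rim c d a b" unfolding swp_image by (auto simp: swp_def rim_def rbox_def)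
 have b: "swp z \<in> ball p dl \<longleftrightarrow> z \<in> ball (swp p) dl" "swp z \<in> sphere p dl \<longleftrightarrow> z \<in> sphere (swp p) dl" for z p
  using swp_dist[of p "swp z"] by simp_all
 have "swp z \<in> rbox a b c d \<longleftrightarrow> z \<in> rbox c d a b" for z by (auto simp: swp_def rbox_def)
 then have 2: "swp ` (rbox a b c d - (\<Union>p\<in>P. ball p dl)) = rbox c d a b - (\<Union>p\<in>swp ` P. ball p dl)"
  unfolding swp_image using b(1) by (simp add: set_eq_iff) (metis swp_swp)
 have 3: "sphere (swp p) dl \<subseteq> swp ` T" if "p \<in> P" for p
  unfolding swp_image using T(2) that b(2)[of _ p] by blast
 have "card (swp ` P) = card P" using inj by (rule card_image)
 then show ?thesis unfolding holed_def using r 3 unfolding 1 2 by auto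
qed

text \<open>Induction on the number of holes: two centres with different real parts are separated by
  a vertical line through no centre, and otherwise the picture is reflected. The bound
  \<open>ep\<close> has to keep the holes clear of every cut.\<close>

lemma holed_exists:
 assumes "finite P" "a < b" "c < d" "!!p. p \<in> P ==> a < Re p & Re p < b & c < Im p & Im p < d"
 shows "\<exists>ep>0. \<forall>dl. 0 < dl --> dl < ep --> holed a b c d P dl"
 using assms
proof (induction "card P" arbitrary: P a b c d rule: less_induct)
 case less
 \<comment> \<open>Stated for every set of the same size and every box, so that it also applies to
   the reflected picture.\<close>
 have cut: "\<exists>ep>0. \<forall>dl. 0 < dl --> dl < ep --> holed a b c d P' dl"
  if P': "finite P'" "card P' = card P" "!!p. p \<in> P' ==> a < Re p & Re p < b & c < Im p & Im p < d"
   and ab: "a < b" "c < d" and pq: "p \<in> P'" "p' \<in> P'" "Re p < Re p'" for P' a b c d p p'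
 proof -
  \<comment> \<open>The interval is infinite, so it contains a t that avoids the finitely many real
    parts.\<close>
  have "infinite {Re p<..<Re p'}" using pq(3) by simp
  then have "{Re p<..<Re p'} - Re ` P' ~= {}"
   using P'(1) Diff_infinite_finite[of "Re ` P'" "{Re p<..<Re p'}"] by (metis finite.emptyI finite_imageI)
  then obtain t where "t \<in> {Re p<..<Re p'} - Re ` P'" by blast
  then have t: "Re p < t" "t < Re p'" "t ~: Re ` P'" by simp_all
  let ?P1 = "{p \<in> P'. Re p < t}" and ?P2 = "{p \<in> P'. t < Re p}"
  have tab: "a < t" "t < b" using t(1,2) P'(3)[OF pq(1)] P'(3)[OF pq(2)] by linarith+
  have "?P1 \<subset> P'" "?P2 \<subset> P'" using pq t by force+
  then have card: "card ?P1 < card P" "card ?P2 < card P" using P'(1,2) psubset_card_mono[OF P'(1)] by simp_all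
  have "\<exists>ep>0. \<forall>dl. 0 < dl --> dl < ep --> holed a t c d ?P1 dl"
   by (rule less.hyps[OF card(1)]) (use P'(1,3) tab ab in auto)
  then obtain e1 where e1: "e1 > 0" "\<forall>dl. 0 < dl --> dl < e1 --> holed a t c d ?P1 dl" by (elim exE conjE)
  have "\<exists>ep>0. \<forall>dl. 0 < dl --> dl < ep --> holed t b c d ?P2 dl"
   by (rule less.hyps[OF card(2)]) (use P'(1,3) tab ab in auto)
  then obtain e2 where e2: "e2 > 0" "\<forall>dl. 0 < dl --> dl < e2 --> holed t b c d ?P2 dl" by (elim exE conjE)
  define et where "et = Min ((%p. \<bar>Re p - t\<bar>) ` P')"
  have ne: "(%p. \<bar>Re p - t\<bar>) ` P' ~= {}" "finite ((%p. \<bar>Re p - t\<bar>) ` P')" using pq P'(1) by auto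
  have "0 < et" unfolding et_def Min_gr_iff[OF ne(2,1)] using t(3) by auto
  have et: "et <= \<bar>Re p - t\<bar>" if "p \<in> P'" for p unfolding et_def using ne that by (intro Min_le) auto
  show ?thesis
  proof (intro exI[of _ "min et (min e1 e2)"] conjI allI impI)
   show "0 < min et (min e1 e2)" using \<open>0 < et\<close> e1(1) e2(1) by simp
   fix dl assume d: "0 < dl" "dl < min et (min e1 e2)"
   show "holed a b c d P' dl"
   proof (rule holed_cut[OF tab ab(2) P'(1)])
    show "dl <= \<bar>Re p - t\<bar>" if "p \<in> P'" for p using et[OF that] d by linarith
   qed (use e1 e2 d in auto)
  qed
 qed
 consider "P = {}" | p where "P = {p}" | p p' where "p \<in> P" "p' \<in> P" "p ~= p'"
  by (metis all_not_in_conv insertI1 is_singletonI' is_singleton_the_elem)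
 then show ?case
 proof cases
  case 1 then show ?thesis using holed_empty[OF less.prems(2,3)] by (intro exI[of _ 1]) simp
 next
  case (2 p)
  let ?e = "min (min (Re p - a) (b - Re p)) (min (Im p - c) (d - Im p))"
  have "0 < ?e" using less.prems(4)[of p] 2 by simp
  moreover have "holed a b c d P dl" if "0 < dl" "dl < ?e" for dl unfolding 2 by (rule holed_single) (use that in auto)
  ultimately show ?thesis by blast
 next
  case (3 p p')
  show ?thesis
  proof (cases "Re p = Re p'")
   case False
   then consider "Re p < Re p'" | "Re p' < Re p" by linarith
   then show ?thesis
   proof cases
    case 1 show ?thesis by (rule cut[OF less.prems(1) refl less.prems(4,2,3) 3(1,2) 1])
   next
    case 2 show ?thesis by (rule cut[OF less.prems(1) refl less.prems(4,2,3) 3(2,1) 2])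
   qed
  next
   case True
   then have im: "Im p ~= Im p'" using 3(3) by (simp add: complex_eq_iff)
   have card: "card (swp ` P) = card P" by (rule card_image, rule inj_on_inverseI[of _ swp]) simp
   have mem: "c < Re q & Re q < d & a < Im q & Im q < b" if "q \<in> swp ` P" for q
    using less.prems(4) that by (auto simp: swp_def)
   have s: "swp p \<in> swp ` P" "swp p' \<in> swp ` P" using 3 by blast+
   have "\<exists>ep>0. \<forall>dl. 0 < dl --> dl < ep --> holed c d a b (swp ` P) dl"
   proof (cases "Im p < Im p'")
    case True
    then have "Re (swp p) < Re (swp p')" by (simp add: swp_def)
    from cut[OF _ card mem less.prems(3,2) s this] less.prems(1) show ?thesis by simp
   next
    case False
    then have "Re (swp p') < Re (swp p)" using im by (simp add: swp_def)
    from cut[OF _ card mem less.prems(3,2) s(2,1) this] less.prems(1) show ?thesis by simp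
   qed
   moreover have "swp ` swp ` P = P" by (simp add: image_comp comp_def)
   ultimately show ?thesis using holed_swp[of c d a b "swp ` P"] by auto
  qed
 qed
qed

section \<open>The handle\<close>

text \<open>Parametrizes the upper (\<open>s = 1\<close>) or lower (\<open>s = -1\<close>) unit half circle by the distance from 1.\<close>

definition Zc :: "real => real => complex" where
 "Zc s x = Complex (1 - x\<^sup>2 / 2) (s * (x * sqrt (1 - x\<^sup>2 / 4)))"

lemma norm_eq_iff_square: "0 <= c ==> norm z = c \<longleftrightarrow> (norm z)\<^sup>2 = (c::real)\<^sup>2"
 by (simp add: power2_eq_iff_nonneg)

lemma Zc_props:
 assumes s: "s = 1 | s = - 1" and x: "0 <= x" "x <= 2"
 shows "norm (Zc s x) = 1" "norm (Zc s x - 1) = x" "0 <= s * Im (Zc s x)"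
proof -
 have "x\<^sup>2 <= 2\<^sup>2" using x by (intro power_mono) auto
 then have q: "(sqrt (1 - x\<^sup>2 / 4))\<^sup>2 = 1 - x\<^sup>2 / 4" "0 <= sqrt (1 - x\<^sup>2 / 4)" by simp_all
 have im: "(Im (Zc s x))\<^sup>2 = x\<^sup>2 * (1 - x\<^sup>2 / 4)"
  using s q(1) by (auto simp: Zc_def power_mult_distrib)
 have "(norm (Zc s x))\<^sup>2 = (1 - x\<^sup>2 / 2)\<^sup>2 + x\<^sup>2 * (1 - x\<^sup>2 / 4)" unfolding cmod_power2 im by (simp add: Zc_def)
 also have "\<dots> = 1" by (simp add: power2_eq_square field_simps)
 finally show "norm (Zc s x) = 1" by (simp add: norm_eq_iff_square)
 have "(norm (Zc s x - 1))\<^sup>2 = (x\<^sup>2 / 2)\<^sup>2 + x\<^sup>2 * (1 - x\<^sup>2 / 4)"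
  unfolding cmod_power2 minus_complex.sel one_complex.sel diff_zero im by (simp add: Zc_def)
 also have "\<dots> = x\<^sup>2" by (simp add: power2_eq_square field_simps)
 finally show "norm (Zc s x - 1) = x" using norm_eq_iff_square[OF x(1)] by blast
 have "s * Im (Zc s x) = (s * s) * (x * sqrt (1 - x\<^sup>2 / 4))" by (simp add: Zc_def)
 then show "0 <= s * Im (Zc s x)" using s x(1) q(2) by auto
qed

lemma Zc_pos: "s = 1 | s = - 1 ==> 0 < x ==> x < 2 ==> 0 < s * Im (Zc s x)"
proof -
 assume s: "s = 1 | s = - 1" and x: "0 < x" "x < 2"
 have "x\<^sup>2 < 2\<^sup>2" using x by (intro power_strict_mono) auto
 then have "0 < sqrt (1 - x\<^sup>2 / 4)" by simp
 moreover have "s * Im (Zc s x) = (s * s) * (x * sqrt (1 - x\<^sup>2 / 4))" by (simp add: Zc_def)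
 ultimately show "0 < s * Im (Zc s x)" using s x by auto
qed

lemma Zc_ends [simp]: "Zc s 0 = 1" "Zc s 2 = - 1"
 by (simp_all add: Zc_def complex_eq_iff)

text \<open>On the unit circle the distance from 1 determines the real part, and the sign condition
  then fixes the imaginary part.\<close>

lemma Zc_onto:
 assumes s: "s = 1 | s = - 1" and z: "norm z = 1" "0 <= s * Im z"
 shows "Zc s (norm (z - 1)) = z" "norm (z - 1) <= 2"
proof -
 show x2: "norm (z - 1) <= 2" using norm_triangle_ineq4[of z 1] z(1) by simp
 let ?w = "Zc s (norm (z - 1))"
 have w: "norm ?w = 1" "0 <= s * Im ?w" using Zc_props[OF s _ x2] by simp_all
 have "(Re z)\<^sup>2 + (Im z)\<^sup>2 = 1" using z(1) cmod_power2[of z] by simp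
 moreover have "(norm (z - 1))\<^sup>2 = (Re z - 1)\<^sup>2 + (Im z)\<^sup>2" by (simp add: cmod_power2)
 ultimately have "(norm (z - 1))\<^sup>2 = 2 - 2 * Re z" by (simp add: power2_eq_square algebra_simps)
 then have re: "Re ?w = Re z" unfolding Zc_def by (simp add: diff_divide_distrib)
 have "(Im ?w)\<^sup>2 = (Im z)\<^sup>2" using w(1) z(1) cmod_power2[of z] cmod_power2[of ?w] re by simp
 then have "Im ?w = Im z | Im ?w = - Im z" by (simp add: power2_eq_iff)
 then have "Im ?w = Im z"
 proof
  assume m: "Im ?w = - Im z"
  have "Im z = 0" using s w(2) z(2) unfolding m by (elim disjE) simp_all
  then show ?thesis using m by simp
 qed
 then show "?w = z" using re by (rule complex_eqI[rotated])
qed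

lemma Zc_cont: "continuous_on S u ==> continuous_on S (%x. Zc s (u x))"
 unfolding Zc_def Complex_eq by (intro continuous_intros) auto

lemma handle_iff: "(z, w) \<in> handle \<longleftrightarrow> norm z = 1 & norm w = 1 & 1 <= (norm (z - 1))\<^sup>2 + (norm (w - 1))\<^sup>2"
 and handle_rim_iff: "(z, w) \<in> handle_rim \<longleftrightarrow> norm z = 1 & norm w = 1 & (norm (z - 1))\<^sup>2 + (norm (w - 1))\<^sup>2 = 1"
proof -
 have d: "dist (1, 1) (z, w) = sqrt ((norm (z - 1))\<^sup>2 + (norm (w - 1))\<^sup>2)"
  unfolding dist_Pair_Pair by (simp add: dist_norm norm_minus_commute)
 show "(z, w) \<in> handle \<longleftrightarrow> norm z = 1 & norm w = 1 & 1 <= (norm (z - 1))\<^sup>2 + (norm (w - 1))\<^sup>2"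
  unfolding handle_def Diff_iff mem_ball d by (auto simp: not_less)
 show "(z, w) \<in> handle_rim \<longleftrightarrow> norm z = 1 & norm w = 1 & (norm (z - 1))\<^sup>2 + (norm (w - 1))\<^sup>2 = 1"
  unfolding handle_rim_def Int_iff mem_sphere d by auto
qed

text \<open>For m = 1 this is the part of a coordinate circle through (1, 1) that remains in the
  handle; for m = 0 it is a whole circle.\<close>

definition arcs :: "real => complex set" where
 "arcs m = {z. norm z = 1 & m <= norm (z - 1)}"

lemma norm_minus_two [simp]: "norm (- 1 - 1 :: complex) = 2"
 by (simp add: norm_eq_iff_square cmod_power2)

text \<open>The upper and the lower half of \<open>arcs m\<close> run from distance m to the point
  -1, so they are two arcs whose ends are already in the graph.\<close>

lemma rc_two_arcs:
 fixes h :: "complex => complex \<times> complex"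
 assumes r: "rc euclidean B R T v" and m: "0 <= m" "m < 2" and h: "continuous_on UNIV h" "inj h"
  and ends: "h (- 1) \<in> T" "!!z. norm z = 1 ==> norm (z - 1) = m ==> h z \<in> T"
  and int: "!!z. norm z = 1 ==> m < norm (z - 1) ==> z ~= - 1 ==> h z ~: R"
 shows "rc euclidean B (R Un h ` arcs m) (T Un h ` arcs m) (v - 2)"
proof -
 have c: "continuous_map (top_of_set {m..2}) euclidean (h \<circ> Zc s)" for s
  using continuous_on_compose2[OF h(1) Zc_cont[OF continuous_on_id, of "{m..2}" s]] by (simp add: comp_def)
 have i: "inj_on (h \<circ> Zc s) {m..2}" if s: "s = 1 | s = - 1" for s
 proof (rule inj_onI)
  fix x y assume xy: "x \<in> {m..2}" "y \<in> {m..2}" "(h \<circ> Zc s) x = (h \<circ> Zc s) y"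
  then have e: "Zc s x = Zc s y" unfolding comp_def by (intro injD[OF h(2)])
  have "norm (Zc s x - 1) = x" "norm (Zc s y - 1) = y" using Zc_props(2)[OF s] xy(1,2) m by simp_all
  then show "x = y" unfolding e by (rule trans[OF sym])
 qed
 have z: "norm (Zc s t) = 1" "norm (Zc s t - 1) = t" if "s = 1 | s = - 1" "t \<in> {m..2}" for s t
  using Zc_props(1,2)[OF that(1), of t] that(2) m by simp_all
 have mi: "m \<in> {m..2}" using m by simp
 have e: "(h \<circ> Zc s) m \<in> T" "(h \<circ> Zc s) 2 \<in> T" if s: "s = 1 | s = - 1" for s
  unfolding comp_def using ends(1) ends(2)[OF z[OF s mi]] by simp_all
 have n: "(h \<circ> Zc s) t ~: R" if s: "s = 1 | s = - 1" and t: "m < t" "t < 2" for s t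
 proof -
  have "Zc s t ~= - 1"
  proof
   assume "Zc s t = - 1"
   then show False using z(2)[OF s, of t] t by simp
  qed
  moreover have "norm (Zc s t) = 1" "m < norm (Zc s t - 1)" using z[OF s, of t] t by simp_all
  ultimately show ?thesis unfolding comp_def by (intro int)
 qed
 have s: "(1::real) = 1 | (1::real) = - 1" "- 1 = (1::real) | - 1 = - (1::real)" by simp_all
 let ?A = "(h \<circ> Zc 1) ` {m..2}" and ?B = "(h \<circ> Zc (- 1)) ` {m..2}"
 have 1: "rc euclidean B (R Un ?A) (T Un ?A) (v - 1)"
  by (rule rc_arc[OF r m(2) c i[OF s(1)] e[OF s(1)] n[OF s(1)]])
 have 2: "rc euclidean B ((R Un ?A) Un ?B) ((T Un ?A) Un ?B) (v - 1 - 1)"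
 proof (rule rc_arc[OF 1 m(2) c i[OF s(2)]])
  show "(h \<circ> Zc (- 1)) m \<in> T Un ?A" "(h \<circ> Zc (- 1)) 2 \<in> T Un ?A" using e[OF s(2)] by blast+
  fix t assume t: "m < t" "t < 2"
  have "(h \<circ> Zc (- 1)) t ~: ?A"
  proof
   assume "(h \<circ> Zc (- 1)) t \<in> ?A"
   then obtain y where y: "y \<in> {m..2}" "h (Zc (- 1) t) = h (Zc 1 y)" unfolding comp_def by blast
   have eq: "Zc (- 1) t = Zc 1 y" by (rule injD[OF h(2) y(2)])
   have "0 < - 1 * Im (Zc (- 1) t)" by (rule Zc_pos[OF s(2)]) (use t m in simp_all)
   moreover have "0 <= 1 * Im (Zc 1 y)" by (rule Zc_props(3)[OF s(1)]) (use y m in simp_all)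
   ultimately show False using eq by simp
  qed
  then show "(h \<circ> Zc (- 1)) t ~: R Un ?A" using n[OF s(2) t] by blast
 qed
 have "?A Un ?B = h ` arcs m"
 proof (intro equalityI subsetI)
  fix p assume "p \<in> ?A Un ?B"
  then obtain s t where st: "s = 1 | s = - 1" "t \<in> {m..2}" "p = h (Zc s t)" unfolding comp_def by blast
  then have "Zc s t \<in> arcs m" using z[OF st(1,2)] unfolding arcs_def by simp
  then show "p \<in> h ` arcs m" using st(3) by blast
 next
  fix p assume "p \<in> h ` arcs m"
  then obtain w where w: "norm w = 1" "m <= norm (w - 1)" "p = h w" unfolding arcs_def by blast
  show "p \<in> ?A Un ?B"
  proof (cases "0 <= Im w")
   case True
   have o: "Zc 1 (norm (w - 1)) = w" "norm (w - 1) <= 2" using Zc_onto[OF s(1) w(1)] True by simp_all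
   have "p = (h \<circ> Zc 1) (norm (w - 1))" using o(1) w(3) by simp
   moreover have "norm (w - 1) \<in> {m..2}" using o(2) w(2) by simp
   ultimately show ?thesis by blast
  next
   case False
   have o: "Zc (- 1) (norm (w - 1)) = w" "norm (w - 1) <= 2" using Zc_onto[OF s(2) w(1)] False by simp_all
   have "p = (h \<circ> Zc (- 1)) (norm (w - 1))" using o(1) w(3) by simp
   moreover have "norm (w - 1) \<in> {m..2}" using o(2) w(2) by simp
   ultimately show ?thesis by blast
  qed
 qed
 then have "(R Un ?A) Un ?B = R Un h ` arcs m" "(T Un ?A) Un ?B = T Un h ` arcs m" by (simp_all only: Un_assoc)
 moreover have "v - 1 - 1 = v - 2" by simp
 ultimately show ?thesis using 2 by (simp only:)
qed

definition Qd :: "real => real => (complex \<times> complex) set" where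
 "Qd s s' = {(z, w). (z, w) \<in> handle & 0 <= s * Im z & 0 <= s' * Im w}"

text \<open>The coordinate circles z = 1, z = -1, w = 1 and w = -1 within the handle, together with
  its rim; they cut the handle into the four quadrants \<open>Qd\<close>.\<close>

definition hgraph :: "(complex \<times> complex) set" where
 "hgraph = {(z, w). (z, w) \<in> handle &
   (z = 1 | z = - 1 | w = 1 | w = - 1 | (norm (z - 1))\<^sup>2 + (norm (w - 1))\<^sup>2 = 1)}"

text \<open>In terms of the distances x and y of the two coordinates from 1, a quadrant of the
  handle is the part of the square [0, 2] x [0, 2] outside the open unit disc, which has the form of
  a \<open>trap\<close>.\<close>

lemma rc_quadrant:
 assumes r: "rc euclidean B R hgraph v" and s: "s = 1 | s = - 1" "s' = 1 | s' = - 1"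
  and R: "!!z w. (z, w) \<in> R ==> 0 < s * Im z ==> 0 < s' * Im w ==> (z, w) \<in> hgraph"
 shows "rc euclidean B (R Un Qd s s') hgraph (v + 1)"
proof -
 \<comment> \<open>The lower edge follows the unit circle, which is the rim, up to x = 1; from there
   on \<open>max\<close> makes it y = 0, that is w = 1.\<close>
 define u where "u x = sqrt (max 0 (1 - x\<^sup>2))" for x :: real
 let ?t = "trap 0 2 u (%_. 2)"
 let ?xi = "%z. (Zc s (Re z), Zc s' (Im z))"
 have u: "0 <= u x" "u x <= 1" for x
 proof -
  have "u x <= sqrt 1" unfolding u_def by (rule real_sqrt_le_mono) simp
  then show "u x <= 1" by simp
 qed (simp add: u_def)
 have u2: "1 <= x\<^sup>2 + (u x)\<^sup>2" for x unfolding u_def by simp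
 have ule: "u x <= y \<longleftrightarrow> 1 <= x\<^sup>2 + y\<^sup>2" if "0 <= y" for x y
 proof
  assume "u x <= y"
  then have "(u x)\<^sup>2 <= y\<^sup>2" using u(1) by (intro power_mono)
  then show "1 <= x\<^sup>2 + y\<^sup>2" using u2[of x] by linarith
 next
  assume "1 <= x\<^sup>2 + y\<^sup>2"
  then show "u x <= y" unfolding u_def using that by (intro real_le_lsqrt) auto
 qed
 have t: "0 <= Re z" "Re z <= 2" "0 <= Im z" "Im z <= 2" "1 <= (Re z)\<^sup>2 + (Im z)\<^sup>2" if "z \<in> ?t" for z
 proof -
  have *: "0 <= Re z" "Re z <= 2" "u (Re z) <= Im z" "Im z <= 2" using that unfolding trap_def by simp_all
  show "0 <= Im z" using *(3) u(1)[of "Re z"] by linarith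
  then show "1 <= (Re z)\<^sup>2 + (Im z)\<^sup>2" using ule *(3) by blast
 qed (use that in \<open>simp_all add: trap_def\<close>)
 have im: "?xi ` ?t = Qd s s'"
 proof (intro equalityI subsetI)
  fix p assume "p \<in> ?xi ` ?t"
  then obtain z where z: "z \<in> ?t" "p = ?xi z" by blast
  show "p \<in> Qd s s'" unfolding z(2) Qd_def mem_Collect_eq case_prod_conv handle_iff
   using Zc_props[OF s(1) t(1,2)[OF z(1)]] Zc_props[OF s(2) t(3,4)[OF z(1)]] t(5)[OF z(1)] by simp
 next
  fix p assume p: "p \<in> Qd s s'"
  obtain z w where zw: "p = (z, w)" by (cases p)
  have h: "norm z = 1" "norm w = 1" "1 <= (norm (z - 1))\<^sup>2 + (norm (w - 1))\<^sup>2" "0 <= s * Im z" "0 <= s' * Im w"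
   using p unfolding zw Qd_def mem_Collect_eq case_prod_conv handle_iff by blast+
  let ?c = "Complex (norm (z - 1)) (norm (w - 1))"
  have "p = ?xi ?c" unfolding zw using Zc_onto(1)[OF s(1) h(1,4)] Zc_onto(1)[OF s(2) h(2,5)] by simp
  moreover have "?c \<in> ?t" unfolding trap_def
   using Zc_onto(2)[OF s(1) h(1,4)] Zc_onto(2)[OF s(2) h(2,5)] ule[of "norm (w - 1)" "norm (z - 1)"] h(3) by simp
  ultimately show "p \<in> ?xi ` ?t" by blast
 qed
 have "rc euclidean B (R Un ?xi ` ?t) hgraph (v + 1)"
 proof (rule rc_trap[OF r])
  show "continuous_on {0..2} u" unfolding u_def by (intro continuous_intros)
  show "u x < 2" for x using u(2)[of x] by linarith
  show "continuous_map (top_of_set ?t) euclidean ?xi"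
   by (auto intro!: continuous_on_Pair Zc_cont continuous_intros)
  show "inj_on ?xi ?t"
  proof (rule inj_onI)
   fix z w assume z: "z \<in> ?t" "w \<in> ?t" "?xi z = ?xi w"
   have eq: "Zc s (Re z) = Zc s (Re w)" "Zc s' (Im z) = Zc s' (Im w)" using z(3) unfolding prod.inject by blast+
   have "Re z = Re w"
    using Zc_props(2)[OF s(1) t(1,2)[OF z(1)]] Zc_props(2)[OF s(1) t(1,2)[OF z(2)]] unfolding eq by (rule trans[OF sym])
   moreover have "Im z = Im w"
    using Zc_props(2)[OF s(2) t(3,4)[OF z(1)]] Zc_props(2)[OF s(2) t(3,4)[OF z(2)]] unfolding eq by (rule trans[OF sym])
   ultimately show "z = w" by (rule complex_eqI)
  qed
  show "?xi z \<in> hgraph" if z: "z \<in> ?t" "Re z = 0 | Re z = 2 | Im z = u (Re z) | Im z = 2" for z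
  proof -
   have H: "?xi z \<in> handle" using im z(1) unfolding Qd_def by blast
   have n: "norm (Zc s (Re z) - 1) = Re z" "norm (Zc s' (Im z) - 1) = Im z"
    using Zc_props(2)[OF s(1) t(1,2)[OF z(1)]] Zc_props(2)[OF s(2) t(3,4)[OF z(1)]] by simp_all
   have "Zc s (Re z) = 1 | Zc s (Re z) = - 1 | Zc s' (Im z) = 1 | Zc s' (Im z) = - 1 | (Re z)\<^sup>2 + (Im z)\<^sup>2 = 1"
   proof (cases "Im z = u (Re z)")
    case True
    have "(Re z)\<^sup>2 + (u (Re z))\<^sup>2 = 1 | u (Re z) = 0" unfolding u_def by (auto simp: max_def)
    then show ?thesis using True by auto
   next
    case False then show ?thesis using z(2) by auto
   qed
   then show ?thesis using H n unfolding hgraph_def by simp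
  qed
  show "?xi z ~: R" if z: "0 < Re z" "Re z < 2" "u (Re z) < Im z" "Im z < 2" for z
  proof
   assume "?xi z \<in> R"
   have i: "0 < Im z" using z(3) u(1)[of "Re z"] by linarith
   have "?xi z \<in> hgraph" using R[OF \<open>?xi z \<in> R\<close>] Zc_pos[OF s(1) z(1,2)] Zc_pos[OF s(2) i z(4)] by simp
   have n: "norm (Zc s (Re z) - 1) = Re z" "norm (Zc s' (Im z) - 1) = Im z"
    using Zc_props(2)[OF s(1)] Zc_props(2)[OF s(2)] z i by simp_all
   have q: "Zc s (Re z) ~= 1" "Zc s (Re z) ~= - 1" "Zc s' (Im z) ~= 1" "Zc s' (Im z) ~= - 1" using n z i by auto
   have "(u (Re z))\<^sup>2 < (Im z)\<^sup>2" using z(3) u(1) by (intro power_strict_mono) auto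
   then have "1 < (Re z)\<^sup>2 + (Im z)\<^sup>2" using u2[of "Re z"] by linarith
   then show False using \<open>?xi z \<in> hgraph\<close> q n unfolding hgraph_def by simp
  qed
 qed (rule continuous_on_const | simp)+
 then show ?thesis unfolding im .
qed

text \<open>Three crossing points of the coordinate circles, as (1, 1) is cut out, minus eight arcs,
  plus four quadrants: 3 - 8 + 4 = -1.\<close>

theorem rc_handle: "rc euclidean handle_rim handle hgraph (- 1)"
proof -
 let ?r = handle_rim
 let ?P = "insert (- 1, - 1) (insert (1, - 1) (insert (- 1, 1) ?r))"
 have 0: "rc euclidean ?r ?P ?P (0 + 1 + 1 + 1)"
  by (intro rc_insert rc_refl) (simp_all add: handle_rim_iff)
 let ?A1 = "(%z. (z, 1)) ` arcs 1" and ?A2 = "(%w. (1, w)) ` arcs 1"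
 let ?A3 = "(%z. (z, - 1)) ` arcs 0" and ?A4 = "(%w. (- 1, w)) ` arcs 0"
 have c: "continuous_on UNIV (%z::complex. (z, k::complex))" "continuous_on UNIV (%w::complex. (k::complex, w))"
  "inj (%z::complex. (z, k))" "inj (%w::complex. (k, w))" for k
  by (auto intro!: continuous_intros simp: inj_def)
 have one: "(1::complex) ~= - 1" "- 1 ~= (1::complex)" by (simp_all add: complex_eq_iff)
 have g1: "(norm (z - 1))\<^sup>2 ~= 1" if "1 < norm (z - 1)" for z :: complex
  using that by (simp add: power2_eq_1_iff)
 have g0: "3 + (norm (z - 1))\<^sup>2 ~= 0" "(norm (z - 1))\<^sup>2 + 3 ~= 0" "(norm (z - 1))\<^sup>2 ~= - 3" for z :: complex
  using zero_le_power2[of "norm (z - 1)"] by linarith+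
 have 1: "rc euclidean ?r (?P Un ?A1) (?P Un ?A1) (3 - 2)"
  by (rule rc_two_arcs) (use 0 c one g1 in \<open>auto simp: handle_rim_iff\<close>)
 have 2: "rc euclidean ?r ((?P Un ?A1) Un ?A2) ((?P Un ?A1) Un ?A2) (3 - 2 - 2)"
  by (rule rc_two_arcs[OF 1]) (use c one g1 in \<open>auto simp: handle_rim_iff\<close>)
 have 3: "rc euclidean ?r (((?P Un ?A1) Un ?A2) Un ?A3) (((?P Un ?A1) Un ?A2) Un ?A3) (3 - 2 - 2 - 2)"
  by (rule rc_two_arcs[OF 2]) (use c one in \<open>auto simp: handle_rim_iff g0\<close>)
 have 4: "rc euclidean ?r ((((?P Un ?A1) Un ?A2) Un ?A3) Un ?A4) ((((?P Un ?A1) Un ?A2) Un ?A3) Un ?A4) (3 - 2 - 2 - 2 - 2)"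
  by (rule rc_two_arcs[OF 3]) (use c one in \<open>auto simp: handle_rim_iff g0\<close>)
 have sq: "1 <= x\<^sup>2 \<longleftrightarrow> 1 <= x" if "0 <= x" for x :: real
  using abs_le_square_iff[of 1 x] that by simp
 have T: "(((?P Un ?A1) Un ?A2) Un ?A3) Un ?A4 = hgraph"
 proof (intro set_eqI)
  fix p :: "complex \<times> complex"
  obtain z w where p: "p = (z, w)" by (cases p)
  have "p \<in> (((?P Un ?A1) Un ?A2) Un ?A3) Un ?A4 \<longleftrightarrow>
   (z, w) \<in> ?r | (z = - 1 & w = - 1) | (z = 1 & w = - 1) | (z = - 1 & w = 1) | (w = 1 & z \<in> arcs 1) | (z = 1 & w \<in> arcs 1) |
   (w = - 1 & z \<in> arcs 0) | (z = - 1 & w \<in> arcs 0)"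
   unfolding p by auto
  also have "\<dots> \<longleftrightarrow> (z, w) \<in> hgraph"
   unfolding hgraph_def mem_Collect_eq case_prod_conv handle_iff handle_rim_iff arcs_def
   by (cases "z = 1"; cases "z = - 1"; cases "w = 1"; cases "w = - 1")
    (use sq[of "norm (z - 1)"] sq[of "norm (w - 1)"] one g0[of z] g0[of w] in auto)
  finally show "p \<in> (((?P Un ?A1) Un ?A2) Un ?A3) Un ?A4 \<longleftrightarrow> p \<in> hgraph" unfolding p .
 qed
 have s: "(1::real) = 1 | (1::real) = - 1" "- 1 = (1::real) | - 1 = - (1::real)" by simp_all
 have q1: "rc euclidean ?r (hgraph Un Qd 1 1) hgraph (3 - 2 - 2 - 2 - 2 + 1)"
  by (rule rc_quadrant[OF 4[unfolded T] s(1) s(1)])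
 have q2: "rc euclidean ?r ((hgraph Un Qd 1 1) Un Qd 1 (- 1)) hgraph (3 - 2 - 2 - 2 - 2 + 1 + 1)"
  by (rule rc_quadrant[OF q1 s(1) s(2)]) (auto simp: Qd_def)
 have q3: "rc euclidean ?r (((hgraph Un Qd 1 1) Un Qd 1 (- 1)) Un Qd (- 1) 1) hgraph (3 - 2 - 2 - 2 - 2 + 1 + 1 + 1)"
  by (rule rc_quadrant[OF q2 s(2) s(1)]) (auto simp: Qd_def)
 have q4: "rc euclidean ?r ((((hgraph Un Qd 1 1) Un Qd 1 (- 1)) Un Qd (- 1) 1) Un Qd (- 1) (- 1)) hgraph (3 - 2 - 2 - 2 - 2 + 1 + 1 + 1 + 1)"
  by (rule rc_quadrant[OF q3 s(2) s(2)]) (auto simp: Qd_def)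
 have "(((hgraph Un Qd 1 1) Un Qd 1 (- 1)) Un Qd (- 1) 1) Un Qd (- 1) (- 1) = handle"
 proof (intro set_eqI)
  fix p :: "complex \<times> complex"
  obtain z w where p: "p = (z, w)" by (cases p)
  show "p \<in> (((hgraph Un Qd 1 1) Un Qd 1 (- 1)) Un Qd (- 1) 1) Un Qd (- 1) (- 1) \<longleftrightarrow> p \<in> handle"
   unfolding p by (cases "0 <= Im z"; cases "0 <= Im w") (auto simp: Qd_def hgraph_def)
 qed
 then show ?thesis using q4 by simp
qed

section \<open>Spheres with holes\<close>

text \<open>If the discs covered the sphere, connectedness would force the first one to cover it
  alone, but the antipode of its centre has distance 2.\<close>

lemma pole_exists:
 fixes c :: "nat => real ^ 3"
 assumes c: "!!i. i < g ==> c i \<in> sphere 0 1 & 0 < r i & r i < 2"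
  and dis: "!!i j. i < g ==> j < g ==> i ~= j ==> sphere 0 1 Int cball (c i) (r i) Int cball (c j) (r j) = {}"
 obtains e where "e \<in> sphere 0 1" "!!i. i < g ==> e ~: cball (c i) (r i)"
proof -
 let ?S = "sphere (0::real^3) 1"
 have "axis 1 1 \<in> ?S" by (simp add: norm_axis_1)
 have "\<exists>e\<in>?S. \<forall>i<g. e ~: cball (c i) (r i)"
 proof (rule ccontr)
  assume "~ ?thesis"
  then have cov: "!!x. x \<in> ?S ==> \<exists>i<g. x \<in> cball (c i) (r i)" by blast
  from cov[OF \<open>axis 1 1 \<in> ?S\<close>] have g: "0 < g" by auto
  let ?A = "cball (c 0) (r 0)" and ?B = "\<Union>i\<in>{1..<g}. cball (c i) (r i)"
  have "connected ?S" by (rule connected_sphere) simp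
  moreover have "?A Int ?B Int ?S = {}"
  proof (rule equals0I)
   fix x assume x: "x \<in> ?A Int ?B Int ?S"
   then obtain i where "i \<in> {1..<g}" "x \<in> cball (c i) (r i)" by blast
   then show False using dis[of 0 i] g x by auto
  qed
  moreover have "?S \<subseteq> ?A Un ?B"
  proof
   fix x assume "x \<in> ?S"
   then obtain i where i: "i < g" "x \<in> cball (c i) (r i)" using cov by blast
   then show "x \<in> ?A Un ?B" by (cases "i = 0") auto
  qed
  moreover have "closed ?A" "closed ?B" by (auto intro!: closed_UN)
  ultimately have "?A Int ?S = {} | ?B Int ?S = {}" by (rule connected_closedD)
  moreover have "c 0 \<in> ?A Int ?S" using c[OF g] by simp
  ultimately have B: "?B Int ?S = {}" by blast
  have "- c 0 \<in> ?S" using c[OF g] by simp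
  then have "- c 0 \<in> ?A" using \<open>?S \<subseteq> ?A Un ?B\<close> B by blast
  moreover have "dist (c 0) (- c 0) = 2"
  proof -
   have "c 0 - - c 0 = 2 *\<^sub>R c 0" by (simp add: scaleR_2)
   then show ?thesis using c[OF g] by (simp add: dist_norm)
  qed
  ultimately show False using c[OF g] by simp
 qed
 then show thesis using that by blast
qed

lemma frame_exists:
 fixes e :: "real ^ 3"
 assumes "norm e = 1"
 obtains u v where "u \<bullet> u = 1" "v \<bullet> v = 1" "e \<bullet> e = 1" "u \<bullet> v = 0" "u \<bullet> e = 0" "v \<bullet> e = 0"
  "!!x. x = (x \<bullet> u) *\<^sub>R u + (x \<bullet> v) *\<^sub>R v + (x \<bullet> e) *\<^sub>R e"
proof -
 let ?a = "%i. axis i (1::real) :: real^3"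
 have "norm (?a 3) = 1" by (simp add: norm_axis_1)
 from orthogonal_transformation_exists_1[OF this assms] obtain f where f: "orthogonal_transformation f" "f (?a 3) = e" .
 have ip: "f x \<bullet> f y = x \<bullet> y" and lin: "linear f" for x y using f(1) unfolding orthogonal_transformation_def by blast+
 have "surj f" by (rule orthogonal_transformation_surj[OF f(1)])
 have n: "(1::3) ~= 2" "(1::3) ~= 3" "(2::3) ~= 3" by simp_all
 show thesis
 proof (rule that[of "f (?a 1)" "f (?a 2)"])
  show "x = (x \<bullet> f (?a 1)) *\<^sub>R f (?a 1) + (x \<bullet> f (?a 2)) *\<^sub>R f (?a 2) + (x \<bullet> e) *\<^sub>R e" for x
  proof -
   obtain y where y: "x = f y" using \<open>surj f\<close> by (metis surjD)
   have "y = (y \<bullet> ?a 1) *\<^sub>R ?a 1 + (y \<bullet> ?a 2) *\<^sub>R ?a 2 + (y \<bullet> ?a 3) *\<^sub>R ?a 3"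
    by (simp add: vec_eq_iff forall_3 inner_vec_def sum_3 axis_def)
   then have "f y = f ((y \<bullet> ?a 1) *\<^sub>R ?a 1 + (y \<bullet> ?a 2) *\<^sub>R ?a 2 + (y \<bullet> ?a 3) *\<^sub>R ?a 3)" by (rule arg_cong)
   also have "\<dots> = (y \<bullet> ?a 1) *\<^sub>R f (?a 1) + (y \<bullet> ?a 2) *\<^sub>R f (?a 2) + (y \<bullet> ?a 3) *\<^sub>R f (?a 3)"
    by (simp add: linear_add[OF lin] linear_scale[OF lin])
   finally show ?thesis unfolding y f(2)[symmetric] ip .
  qed
 qed (use n in \<open>simp_all add: f(2)[symmetric] ip inner_axis_axis\<close>)
qed

text \<open>Inverse stereographic projection from e. The distance formula controls the behaviour
  near the pole, and the last property is the correspondence of circles that leave the pole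
  outside.\<close>

lemma stereographic:
 fixes e :: "real ^ 3"
 assumes e: "norm e = 1"
 obtains sgm :: "complex => real ^ 3" where "continuous_on UNIV sgm" "inj sgm" "range sgm = sphere 0 1 - {e}"
  "!!z. (norm (sgm z - e))\<^sup>2 = 4 / ((norm z)\<^sup>2 + 1)"
  "!!c r. norm c = 1 ==> 0 < r ==> r < 2 ==> e ~: cball c r ==>
    \<exists>a rh. 0 < rh & (\<forall>z. (dist c (sgm z) < r \<longleftrightarrow> dist a z < rh) & (dist c (sgm z) <= r \<longleftrightarrow> dist a z <= rh))"
proof -
 obtain u v where f: "u \<bullet> u = 1" "v \<bullet> v = 1" "e \<bullet> e = 1" "u \<bullet> v = 0" "u \<bullet> e = 0" "v \<bullet> e = 0"
  and ex: "!!x. x = (x \<bullet> u) *\<^sub>R u + (x \<bullet> v) *\<^sub>R v + (x \<bullet> e) *\<^sub>R e" using frame_exists[OF e] by metis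
 have f': "v \<bullet> u = 0" "e \<bullet> u = 0" "e \<bullet> v = 0" using f(4-6) by (simp_all add: inner_commute)
 have ip: "x \<bullet> y = (x \<bullet> u) * (y \<bullet> u) + (x \<bullet> v) * (y \<bullet> v) + (x \<bullet> e) * (y \<bullet> e)" for x y
 proof -
  have "x \<bullet> y = x \<bullet> ((y \<bullet> u) *\<^sub>R u + (y \<bullet> v) *\<^sub>R v + (y \<bullet> e) *\<^sub>R e)" using ex[of y] by simp
  then show ?thesis by (simp add: inner_add_right mult.commute)
 qed
 have n1: "x \<bullet> x = (x \<bullet> u)\<^sup>2 + (x \<bullet> v)\<^sup>2 + (x \<bullet> e)\<^sup>2" for x using ip[of x x] by (simp add: power2_eq_square)
 define N where "N z = (norm z)\<^sup>2 + 1" for z :: complex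
 have N: "0 < N z" "N z ~= 0" for z using zero_le_power2[of "norm z"] unfolding N_def by linarith+
 have Nd: "N z = (Re z)\<^sup>2 + (Im z)\<^sup>2 + 1" for z unfolding N_def cmod_power2 ..
 \<comment> \<open>In the frame u, v, e this is the familiar (2 Re z, 2 Im z, |z|^2 - 1)/(|z|^2 +
   1), with N z = |z|^2 + 1.\<close>
 define sgm where "sgm z = (2 * Re z / N z) *\<^sub>R u + (2 * Im z / N z) *\<^sub>R v + ((N z - 2) / N z) *\<^sub>R e" for z
 have co: "sgm z \<bullet> u = 2 * Re z / N z" "sgm z \<bullet> v = 2 * Im z / N z" "sgm z \<bullet> e = (N z - 2) / N z" for z
  unfolding sgm_def by (simp_all add: inner_add_left f f')
 have sq: "sgm z \<bullet> sgm z = 1" for z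
 proof -
  have "sgm z \<bullet> sgm z = ((2 * Re z)\<^sup>2 + (2 * Im z)\<^sup>2 + (N z - 2)\<^sup>2) / (N z)\<^sup>2"
   unfolding n1[of "sgm z"] co by (simp add: power_divide add_divide_distrib)
  also have "(2 * Re z)\<^sup>2 + (2 * Im z)\<^sup>2 + (N z - 2)\<^sup>2 = (N z)\<^sup>2"
   unfolding Nd by (simp add: power2_eq_square algebra_simps)
  finally show ?thesis using N(2)[of z] by simp
 qed
 define ta where "ta x = Complex ((x \<bullet> u) / (1 - x \<bullet> e)) ((x \<bullet> v) / (1 - x \<bullet> e))" for x
 have ts: "ta (sgm z) = z" for z
 proof -
  have "1 - sgm z \<bullet> e = 2 / N z" unfolding co using N(2)[of z] by (simp add: field_simps)
  then show ?thesis unfolding ta_def co using N(2)[of z] by (simp add: complex_eq_iff)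
 qed
 have st: "sgm (ta x) = x" if x: "x \<bullet> x = 1" "x ~= e" for x
 proof -
  let ?p = "x \<bullet> u" and ?q = "x \<bullet> v" and ?t = "x \<bullet> e"
  have s: "?p\<^sup>2 + ?q\<^sup>2 + ?t\<^sup>2 = 1" using n1[of x] x(1) by simp
  have t1: "?t ~= 1"
  proof
   assume t: "?t = 1"
   then have "?p\<^sup>2 + ?q\<^sup>2 = 0" using s by simp
   then have "?p = 0" "?q = 0" by (simp_all add: sum_power2_eq_zero_iff)
   then show False using ex[of x] t x(2) by simp
  qed
  then have d: "1 - ?t ~= 0" by simp
  have "N (ta x) = (?p\<^sup>2 + ?q\<^sup>2) / (1 - ?t)\<^sup>2 + 1"
   unfolding Nd ta_def by (simp add: power_divide add_divide_distrib)
  also have "?p\<^sup>2 + ?q\<^sup>2 = (1 - ?t) * (1 + ?t)" using s by (simp add: power2_eq_square algebra_simps)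
  also have "(1 - ?t) * (1 + ?t) / (1 - ?t)\<^sup>2 + 1 = 2 / (1 - ?t)"
   using d by (simp add: power2_eq_square divide_simps)
  finally have Nt: "N (ta x) = 2 / (1 - ?t)" .
  have "2 * Re (ta x) / N (ta x) = ?p" "2 * Im (ta x) / N (ta x) = ?q" unfolding Nt unfolding ta_def using d by simp_all
  moreover have "(N (ta x) - 2) / N (ta x) = ?t" unfolding Nt using d by (simp add: divide_simps)
  ultimately have "sgm (ta x) = ?p *\<^sub>R u + ?q *\<^sub>R v + ?t *\<^sub>R e" unfolding sgm_def by simp
  then show ?thesis using ex[of x] by simp
 qed
 have n2: "(norm (x - y))\<^sup>2 = 2 - 2 * (x \<bullet> y)" if "x \<bullet> x = 1" "y \<bullet> y = 1" for x y :: "real^3"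
  using that by (simp add: power2_norm_eq_inner inner_diff_left inner_diff_right inner_commute)
 show thesis
 proof (rule that[of sgm])
  show "continuous_on UNIV sgm" unfolding sgm_def using N(2) unfolding N_def by (intro continuous_intros) auto
  show "inj sgm" by (rule inj_on_inverseI[of _ ta]) (rule ts)
  have "sgm z ~= e" for z
  proof
   assume "sgm z = e"
   then have "(N z - 2) / N z = 1" using co(3)[of z] f(3) by simp
   then show False using N(2)[of z] by simp
  qed
  then show "range sgm = sphere 0 1 - {e}"
  proof (intro equalityI subsetI)
   fix x assume "x \<in> sphere 0 1 - {e}"
   then have "x \<bullet> x = 1" "x ~= e" by (simp_all add: dot_square_norm)
   from st[OF this] show "x \<in> range sgm" by (metis rangeI)
  next
   fix x assume "!!z. sgm z ~= e" "x \<in> range sgm"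
   then show "x \<in> sphere 0 1 - {e}" using sq by (auto simp: norm_eq_sqrt_inner)
  qed
  show "(norm (sgm z - e))\<^sup>2 = 4 / ((norm z)\<^sup>2 + 1)" for z
   unfolding n2[OF sq f(3)] co N_def[symmetric] using N(2)[of z] by (simp add: field_simps)
  fix c :: "real^3" and r :: real assume c: "norm c = 1" and r: "0 < r" "r < 2" and ec: "e ~: cball c r"
  have cc: "c \<bullet> c = 1" using c by (simp add: dot_square_norm)
  let ?p = "c \<bullet> u" and ?q = "c \<bullet> v" and ?t = "c \<bullet> e"
  \<comment> \<open>On the unit sphere |c - x|^2 = 2 - 2 c.x, so x is closer to c than r exactly if
    c.x exceeds k.\<close>
  define k where "k = 1 - r\<^sup>2 / 2"
  have "r\<^sup>2 < 2\<^sup>2" using r by (intro power_strict_mono) auto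
  then have k: "- 1 < k" "k < 1" using r by (simp_all add: k_def)
  have "r < norm (c - e)" using ec by (simp add: dist_norm not_le)
  then have "r\<^sup>2 < (norm (c - e))\<^sup>2" using r by (intro power_strict_mono) auto
  then have kt: "0 < k - ?t" unfolding n2[OF cc f(3)] by (simp add: k_def)
  \<comment> \<open>Centre and radius come from completing the square in c.sgm(z) = k after
    multiplication by N z. The denominator is positive because e lies outside the disc.\<close>
  define a where "a = Complex (?p / (k - ?t)) (?q / (k - ?t))"
  define rh where "rh = sqrt (1 - k\<^sup>2) / (k - ?t)"
  have k2: "0 < 1 - k\<^sup>2" using k by (simp add: power2_less_1_iff abs_less_iff)
  have rho: "0 < rh" "rh\<^sup>2 = (1 - k\<^sup>2) / (k - ?t)\<^sup>2" using k2 kt unfolding rh_def by (simp_all add: power_divide)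
  have s: "?p\<^sup>2 + ?q\<^sup>2 = 1 - ?t\<^sup>2" using n1[of c] cc by simp
  have key: "(dist c (sgm z))\<^sup>2 - r\<^sup>2 = (2 * (k - ?t) / N z) * ((dist a z)\<^sup>2 - rh\<^sup>2)" for z
  proof -
   have cs: "c \<bullet> sgm z = (2 * Re z * ?p + 2 * Im z * ?q + (N z - 2) * ?t) / N z"
    unfolding ip[of c "sgm z"] co by (simp add: add_divide_distrib mult.commute)
   have "(dist c (sgm z))\<^sup>2 - r\<^sup>2 = 2 * (k - c \<bullet> sgm z)" unfolding dist_norm n2[OF cc sq] k_def by simp
   also have "\<dots> = 2 * (k * N z - (2 * Re z * ?p + 2 * Im z * ?q + (N z - 2) * ?t)) / N z"
    unfolding cs using N(2)[of z] by (simp add: field_simps)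
   finally have 1: "(dist c (sgm z))\<^sup>2 - r\<^sup>2 = 2 * (k * N z - (2 * Re z * ?p + 2 * Im z * ?q + (N z - 2) * ?t)) / N z" .
   let ?d = "k - ?t"
   have d0: "?d ~= 0" using kt by simp
   have "(dist a z)\<^sup>2 = (?p / ?d - Re z)\<^sup>2 + (?q / ?d - Im z)\<^sup>2" unfolding dist_norm cmod_power2 a_def by simp
   also have "\<dots> = (?p\<^sup>2 + ?q\<^sup>2) / ?d\<^sup>2 - 2 * (?p * Re z + ?q * Im z) / ?d + ((Re z)\<^sup>2 + (Im z)\<^sup>2)"
    using d0 by (simp add: power2_diff power_divide add_divide_distrib algebra_simps)
   finally have "(dist a z)\<^sup>2 - rh\<^sup>2 = (1 - ?t\<^sup>2 - (1 - k\<^sup>2)) / ?d\<^sup>2 - 2 * (?p * Re z + ?q * Im z) / ?d + (N z - 1)"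
    unfolding s rho(2) Nd by (simp add: diff_divide_distrib)
   also have "(1 - ?t\<^sup>2 - (1 - k\<^sup>2)) / ?d\<^sup>2 = (k + ?t) / ?d"
   proof -
    have "1 - ?t\<^sup>2 - (1 - k\<^sup>2) = (k + ?t) * ?d" by (simp add: power2_eq_square algebra_simps)
    then show ?thesis using d0 by (simp add: power2_eq_square)
   qed
   finally have E: "(dist a z)\<^sup>2 - rh\<^sup>2 = (k + ?t) / ?d - 2 * (?p * Re z + ?q * Im z) / ?d + (N z - 1)" .
   have "d * (x / d - y / d + w) = x - y + d * w" if "d ~= 0" for d x y w :: real
    using that by (simp add: distrib_left right_diff_distrib)
   from this[OF d0] have "?d * ((dist a z)\<^sup>2 - rh\<^sup>2) = (k + ?t) - 2 * (?p * Re z + ?q * Im z) + ?d * (N z - 1)"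
    unfolding E .
   also have "\<dots> = k * N z - (2 * Re z * ?p + 2 * Im z * ?q + (N z - 2) * ?t)" by (simp add: algebra_simps)
   finally show ?thesis unfolding 1 by (simp only: times_divide_eq_left mult.assoc)
  qed
  have pos: "0 < 2 * (k - ?t) / N z" for z using kt N(1)[of z] by simp
  have lt: "x < y \<longleftrightarrow> x\<^sup>2 - y\<^sup>2 < 0" "x <= y \<longleftrightarrow> x\<^sup>2 - y\<^sup>2 <= 0" if "0 <= x" "0 < y" for x y :: real
  proof -
   have 1: "y <= x \<longleftrightarrow> y\<^sup>2 <= x\<^sup>2" using abs_le_square_iff[of y x] that by simp
   have 2: "x <= y \<longleftrightarrow> x\<^sup>2 <= y\<^sup>2" using abs_le_square_iff[of x y] that by simp
   show "x < y \<longleftrightarrow> x\<^sup>2 - y\<^sup>2 < 0" using 1 by (cases "y <= x") simp_all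
   show "x <= y \<longleftrightarrow> x\<^sup>2 - y\<^sup>2 <= 0" using 2 by simp
  qed
  have "(dist c (sgm z) < r \<longleftrightarrow> dist a z < rh) & (dist c (sgm z) <= r \<longleftrightarrow> dist a z <= rh)" for z
   unfolding lt[OF zero_le_dist r(1)] lt[OF zero_le_dist rho(1)] key using pos[of z]
   by (simp add: mult_less_0_iff mult_le_0_iff del: times_divide_eq_left)
  then show "\<exists>a rh. 0 < rh & (\<forall>z. (dist c (sgm z) < r \<longleftrightarrow> dist a z < rh) & (dist c (sgm z) <= r \<longleftrightarrow> dist a z <= rh))"
   using rho(1) by blast
 qed
qed

text \<open>Shrinks the disjoint discs of radii \<open>rh i\<close> radially to discs of the same small radius \<open>dl\<close>.\<close>

lemma shrink_discs:
 fixes a :: "nat => complex" and rh :: "nat => real"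
 assumes rh: "!!i. i < g ==> 0 < rh i"
  and dis: "!!i j. i < g ==> j < g ==> i ~= j ==> cball (a i) (rh i) Int cball (a j) (rh j) = {}"
 obtains ep M where "0 < ep" "0 < M" "!!i. i < g ==> norm (a i) < M"
  "!!dl. 0 < dl ==> dl < ep ==> (\<forall>i<g. \<forall>j<g. i ~= j --> sphere (a i) dl Int ball (a j) dl = {}) & (\<exists>Th. continuous_on (- (\<Union>i<g. ball (a i) dl)) Th & inj_on Th (- (\<Union>i<g. ball (a i) dl)) &
   Th ` (- (\<Union>i<g. ball (a i) dl)) = - (\<Union>i<g. ball (a i) (rh i)) &
   (\<forall>w\<in>- (\<Union>i<g. ball (a i) dl). \<forall>i<g. dist (a i) (Th w) = rh i \<longleftrightarrow> dist (a i) w = dl) &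
   (\<forall>w. M <= norm w --> Th w = w & w \<in> - (\<Union>i<g. ball (a i) dl)))"
proof -
 have gap: "rh i + rh j < dist (a i) (a j)" if ij: "i < g" "j < g" "i ~= j" for i j
 proof (rule ccontr)
  assume "~ ?thesis"
  then have le: "dist (a i) (a j) <= rh i + rh j" by simp
  let ?s = "rh i + rh j"
  have s: "0 < ?s" "0 < rh i" "0 < rh j" using rh ij by (simp_all add: add_pos_pos)
  \<comment> \<open>The point that divides the segment between the centres in the ratio of the radii
    would lie in both discs.\<close>
  let ?p = "a i + of_real (rh i / ?s) * (a j - a i)"
  have "dist (a i) ?p = norm (of_real (rh i / ?s) * (a j - a i))" by (simp add: dist_norm)
  also have "\<dots> = \<bar>rh i / ?s\<bar> * norm (a j - a i)" by (simp only: norm_mult norm_of_real)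
  also have "\<dots> = rh i / ?s * dist (a i) (a j)" using s by (simp add: dist_norm norm_minus_commute)
  also have "rh i / ?s * dist (a i) (a j) <= rh i / ?s * ?s" using le s by (intro mult_left_mono) auto
  finally have 1: "?p \<in> cball (a i) (rh i)" using s by simp
  have "rh i / ?s = 1 - rh j / ?s" using s by (simp add: field_simps)
  then have "of_real (rh i / ?s) = 1 - complex_of_real (rh j / ?s)" by (simp only: of_real_diff of_real_1)
  moreover have "aj - (ai + x * (aj - ai)) = y * (aj - ai)" if "x = 1 - y" for x y ai aj :: complex
   unfolding that by (simp add: algebra_simps)
  ultimately have "a j - ?p = of_real (rh j / ?s) * (a j - a i)" by blast
  then have "dist (a j) ?p = norm (of_real (rh j / ?s) * (a j - a i))" by (simp only: dist_norm)
  also have "\<dots> = \<bar>rh j / ?s\<bar> * norm (a j - a i)" by (simp only: norm_mult norm_of_real)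
  also have "\<dots> = rh j / ?s * dist (a i) (a j)" using s by (simp add: dist_norm norm_minus_commute)
  also have "rh j / ?s * dist (a i) (a j) <= rh j / ?s * ?s" using le s by (intro mult_left_mono) auto
  finally have 2: "?p \<in> cball (a j) (rh j)" using s by simp
  show False using dis[OF ij] 1 2 by blast
 qed
 \<comment> \<open>With a third of the smallest gap, discs enlarged by \<open>et\<close> stay apart
   with room to spare.\<close>
 obtain et where et: "0 < et" "!!i j. i < g ==> j < g ==> i ~= j ==> 3 * et <= dist (a i) (a j) - rh i - rh j"
 proof -
  let ?s = "%(i, j). if i = j then 1 else dist (a i) (a j) - rh i - rh j"
  obtain r where r: "r > 0" "!!p. p \<in> {..<g} \<times> {..<g} ==> r <= ?s p"
   by (rule min_positive[of "{..<g} \<times> {..<g}" ?s 1]) (use gap in \<open>force+\<close>)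
  show thesis
  proof (rule that[of "r / 3"])
   show "3 * (r / 3) <= dist (a i) (a j) - rh i - rh j" if "i < g" "j < g" "i ~= j" for i j
    using r(2)[of "(i, j)"] that by simp
  qed (use r in simp)
 qed
 obtain ep where ep: "0 < ep" "!!i. i < g ==> ep <= rh i"
  by (rule min_positive[of "{..<g}" rh 1]) (use rh in auto)
 define R where "R i = rh i + et" for i
 have far: "R j < dist (a j) w" if ij: "i < g" "j < g" "i ~= j" and w: "dist (a i) w <= R i" for i j w
 proof -
  have "dist (a i) (a j) <= dist (a i) w + dist (a j) w" by (rule dist_triangle2)
  then show ?thesis using et(2)[OF ij] et(1) w unfolding R_def by linarith
 qed
 have R: "rh i < R i" for i using et(1) by (simp add: R_def)
 have R0: "0 < R i" if "i < g" for i using rh[OF that] R[of i] by linarith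
 have R1: "0 <= norm (a i) + R i" if "i < g" for i using R0[OF that] norm_ge_zero[of "a i"] by linarith
 \<comment> \<open>Exceeds |a i| + R i for every i, so the map constructed below is the identity
   from norm M on.\<close>
 define M where "M = 1 + (\<Sum>i<g. norm (a i) + R i)"
 have M: "norm (a i) + R i < M" if "i < g" for i
 proof -
  have "norm (a i) + R i <= (\<Sum>i<g. norm (a i) + R i)"
   by (rule member_le_sum) (use that R1 in simp_all)
  then show ?thesis unfolding M_def by linarith
 qed
 have "0 <= (\<Sum>i<g. norm (a i) + R i)" by (rule sum_nonneg) (use R1 in simp)
 then have M0: "0 < M" unfolding M_def by linarith
 show thesis
 proof (rule that[OF ep(1) M0])
  show "norm (a i) < M" if "i < g" for i using M[OF that] R0[OF that] by linarith
  fix dl assume dl: "0 < dl" "dl < ep"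
  have dlrh: "dl < rh i" "dl < R i" if "i < g" for i using ep(2)[OF that] dl(2) R[of i] by linarith+
  \<comment> \<open>Affine, with dl going to rh i and R i fixed. The slope is at most 1, so the
    maximum with t is \<open>lin\<close> up to R i and the identity beyond.\<close>
  define lin where "lin i t = rh i + (t - dl) * (et / (R i - dl))" for i t
  define ta where "ta i t = max t (lin i t)" for i t
  have sl: "0 < et / (R i - dl)" "et / (R i - dl) <= 1" if "i < g" for i
   using dlrh[OF that] et(1) by (simp_all add: R_def)
  have mono: "ta i s < ta i t" if i: "i < g" and st: "s < t" for i s t
  proof -
   have "(s - dl) * (et / (R i - dl)) < (t - dl) * (et / (R i - dl))" using sl(1)[OF i] st by (intro mult_strict_right_mono) auto
   then have "lin i s < lin i t" unfolding lin_def by linarith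
   then show ?thesis unfolding ta_def using st by (auto simp: max_def)
  qed
  have injta: "s = t" if i: "i < g" and e: "ta i s = ta i t" for i s t
   using mono[OF i, of s t] mono[OF i, of t s] e by (cases s t rule: linorder_cases) auto
  have mono': "ta i s <= ta i t" if i: "i < g" and st: "s <= t" for i s t
   using mono[OF i, of s t] st by (cases "s = t") auto
  have T2: "ta i dl = rh i" if "i < g" for i using dlrh[OF that] by (simp add: ta_def lin_def)
  have T4: "ta i t = t" if i: "i < g" and t: "R i <= t" for i t
  proof -
   define s where "s = et / (R i - dl)"
   have 1: "(R i - dl) * s = et" unfolding s_def using dlrh[OF i] by simp
   have "(t - R i) * s <= (t - R i) * 1" unfolding s_def using sl(2)[OF i] t by (intro mult_left_mono) auto
   then have 2: "(t - R i) * s <= t - R i" by simp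
   have "lin i t = rh i + (R i - dl) * s + (t - R i) * s"
    unfolding lin_def s_def[symmetric] by (simp add: algebra_simps)
   also have "\<dots> = R i + (t - R i) * s" unfolding 1 by (simp only: R_def)
   also have "\<dots> <= t" using 2 by simp
   finally have "lin i t <= t" .
   then show ?thesis unfolding ta_def by simp
  qed
  have ct: "continuous_on A (%x. ta i (u x))" if "continuous_on A u" for A u and i :: nat
   unfolding ta_def lin_def by (intro continuous_intros that)
  have T5: "\<exists>t. dl <= t & t <= R i & ta i t = y" if i: "i < g" and y: "rh i <= y" "y <= R i" for i y
   using IVT'[of "ta i" dl y "R i"] T2[OF i] T4[OF i order_refl] y dlrh[OF i] ct[OF continuous_on_id, of "{dl..R i}" i] by auto
  let ?D = "- (\<Union>i<g. ball (a i) dl)"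
  have D: "w \<in> ?D \<longleftrightarrow> (\<forall>i<g. dl <= dist (a i) w)" for w by (auto simp: not_less)
  define q where "q i w = ta i (dist (a i) w) / dist (a i) w" for i w
  \<comment> \<open>Outside the small discs at most one summand is nonzero at each point, since the
    enlarged discs are disjoint; the sum makes continuity evident without pasting.\<close>
  define Th where "Th w = w + (\<Sum>i<g. (w - a i) * of_real (q i w - 1))" for w
  have q1: "q i w = 1" if "i < g" "R i <= dist (a i) w" for i w
  proof -
   have "0 < dist (a i) w" using R0[OF that(1)] that(2) by linarith
   then show ?thesis unfolding q_def T4[OF that] by simp
  qed
  have E1: "Th w = a i + (w - a i) * of_real (q i w)" if i: "i < g" and w: "dist (a i) w <= R i" for i w
  proof -
   have "(\<Sum>i<g. (w - a i) * of_real (q i w - 1)) = (\<Sum>j\<in>{i}. (w - a j) * of_real (q j w - 1))"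
   proof (rule sum.mono_neutral_right)
    show "\<forall>j\<in>{..<g} - {i}. (w - a j) * of_real (q j w - 1) = 0"
    proof
     fix j assume "j \<in> {..<g} - {i}"
     then have j: "j < g" "i ~= j" by auto
     have "q j w = 1" by (rule q1[OF j(1) less_imp_le[OF far[OF i j w]]])
     then show "(w - a j) * of_real (q j w - 1) = 0" by simp
    qed
   qed (use i in auto)
   then show ?thesis unfolding Th_def by (simp add: algebra_simps)
  qed
  have E2: "Th w = w" if "!!i. i < g ==> R i <= dist (a i) w" for w
   unfolding Th_def using q1 that by simp
  have E3: "dist (a i) (Th w) = ta i (dist (a i) w)" if i: "i < g" and w: "w \<in> ?D" "dist (a i) w <= R i" for i w
  proof -
   have d: "dl <= dist (a i) w" using w(1) i unfolding D by blast
   have "rh i <= ta i (dist (a i) w)" using mono'[OF i d] T2[OF i] by simp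
   then have q0: "0 <= q i w" unfolding q_def using rh[OF i] by simp
   have "dist (a i) (Th w) = norm (w - a i) * \<bar>q i w\<bar>" unfolding E1[OF i w(2)] dist_norm
    by (simp add: norm_mult norm_minus_commute)
   also have "\<dots> = dist (a i) w * q i w" using q0 by (simp add: dist_norm norm_minus_commute)
   also have "\<dots> = ta i (dist (a i) w)"
   proof -
    have "dist (a i) w ~= 0" using d dl(1) by linarith
    then show ?thesis unfolding q_def by (rule nonzero_mult_div_cancel_left[THEN trans[OF times_divide_eq_right]])
   qed
   finally show ?thesis .
  qed
  have inD: "dist (a i) (Th w) <= R i \<longleftrightarrow> dist (a i) w <= R i" if i: "i < g" and w: "w \<in> ?D" for i w
  proof (cases "\<exists>j<g. dist (a j) w <= R j")
   case True
   then obtain j where j: "j < g" "dist (a j) w <= R j" by blast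
   have Thj: "dist (a j) (Th w) <= R j" unfolding E3[OF j(1) w j(2)] using mono'[OF j] T4[OF j(1) order_refl] by simp
   show ?thesis
   proof (cases "i = j")
    case False
    have "R i < dist (a i) w" "R i < dist (a i) (Th w)" using far[OF j(1) i _ j(2)] far[OF j(1) i _ Thj] False by blast+
    then show ?thesis by simp
   qed (use j Thj in simp)
  next
   case False
   then have "Th w = w" by (intro E2) (auto simp: not_le less_imp_le)
   then show ?thesis by simp
  qed
  have low: "rh i <= dist (a i) (Th w)" if i: "i < g" and w: "w \<in> ?D" for i w
  proof (cases "dist (a i) w <= R i")
   case True
   have "dl <= dist (a i) w" using w i unfolding D by blast
   then show ?thesis unfolding E3[OF i w True] using mono'[OF i] T2[OF i] by metis
  next
   case False
   then show ?thesis using inD[OF i w] R[of i] by linarith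
  qed
  show "(\<forall>i<g. \<forall>j<g. i ~= j --> sphere (a i) dl Int ball (a j) dl = {}) & (\<exists>Th. continuous_on ?D Th & inj_on Th ?D &
   Th ` ?D = - (\<Union>i<g. ball (a i) (rh i)) &
   (\<forall>w\<in>?D. \<forall>i<g. dist (a i) (Th w) = rh i \<longleftrightarrow> dist (a i) w = dl) &
   (\<forall>w. M <= norm w --> Th w = w & w \<in> ?D))"
  proof (intro conjI exI[of _ Th])
   show "\<forall>i<g. \<forall>j<g. i ~= j --> sphere (a i) dl Int ball (a j) dl = {}"
   proof (intro allI impI equals0I)
    fix i j w assume ij: "i < g" "j < g" "i ~= j" and w: "w \<in> sphere (a i) dl Int ball (a j) dl"
    have "R j < dist (a j) w" by (rule far[OF ij]) (use w dlrh[OF ij(1)] in simp)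
    then show False using w dlrh[OF ij(2)] by simp
   qed
   show "continuous_on ?D Th" unfolding Th_def q_def
   proof (intro continuous_intros ct ballI)
    fix i w assume "i \<in> {..<g}" "w \<in> ?D"
    then have "dl <= dist (a i) w" unfolding D by blast
    then show "dist (a i) w ~= 0" using dl(1) by linarith
   qed
   show "inj_on Th ?D"
   proof (rule inj_onI)
    fix w w' assume w: "w \<in> ?D" "w' \<in> ?D" "Th w = Th w'"
    show "w = w'"
    proof (cases "\<exists>i<g. dist (a i) w <= R i")
     case True
     then obtain i where i: "i < g" "dist (a i) w <= R i" by blast
     then have i': "dist (a i) w' <= R i" using inD[OF i(1) w(1)] inD[OF i(1) w(2)] w(3) by simp
     have "ta i (dist (a i) w) = ta i (dist (a i) w')" using E3[OF i(1) w(1) i(2)] E3[OF i(1) w(2) i'] w(3) by simp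
     then have dd: "dist (a i) w = dist (a i) w'" by (rule injta[OF i(1)])
     then have qq: "q i w = q i w'" by (simp add: q_def)
     have d: "dl <= dist (a i) w" using w(1) i(1) unfolding D by blast
     have "rh i <= ta i (dist (a i) w)" using mono'[OF i(1) d] T2[OF i(1)] by simp
     then have "ta i (dist (a i) w) ~= 0" "dist (a i) w ~= 0" using rh[OF i(1)] d dl(1) by linarith+
     then have "q i w ~= 0" unfolding q_def by (simp only: divide_eq_0_iff simp_thms)
     moreover have "(w - a i) * of_real (q i w) = (w' - a i) * of_real (q i w)"
      using w(3) unfolding E1[OF i] E1[OF i(1) i'] qq by simp
     ultimately show ?thesis by simp
    next
     case False
     have f: "R i <= dist (a i) w" "R i <= dist (a i) w'" if i: "i < g" for i
     proof -
      have n: "~ dist (a i) w <= R i" using False i by blast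
      then have "~ dist (a i) w' <= R i" using inD[OF i w(1)] inD[OF i w(2)] w(3) by simp
      then show "R i <= dist (a i) w" "R i <= dist (a i) w'" using n by simp_all
     qed
     have e: "Th w = w" "Th w' = w'" by (rule E2, rule f, assumption)+
     show ?thesis by (rule trans[OF sym[OF e(1)] trans[OF w(3) e(2)]])
    qed
   qed
   show "Th ` ?D = - (\<Union>i<g. ball (a i) (rh i))"
   proof (intro equalityI subsetI)
    fix y assume "y \<in> Th ` ?D"
    then obtain w where w: "w \<in> ?D" "y = Th w" by blast
    have "y ~: ball (a i) (rh i)" if "i < g" for i using low[OF that w(1)] w(2) by simp
    then show "y \<in> - (\<Union>i<g. ball (a i) (rh i))" by blast
   next
    fix y assume "y \<in> - (\<Union>i<g. ball (a i) (rh i))"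
    then have "y ~: ball (a i) (rh i)" if "i < g" for i using that by blast
    then have y: "rh i <= dist (a i) y" if "i < g" for i using that by (simp add: not_less)
    show "y \<in> Th ` ?D"
    proof (cases "\<exists>i<g. dist (a i) y <= R i")
     case True
     then obtain i where i: "i < g" "dist (a i) y <= R i" by blast
     let ?d = "dist (a i) y"
     have d0: "0 < ?d" using y[OF i(1)] rh[OF i(1)] by linarith
     obtain t where t: "dl <= t" "t <= R i" "ta i t = ?d" using T5[OF i(1) y[OF i(1)] i(2)] by blast
     define w where "w = a i + (y - a i) * of_real (t / ?d)"
     have t0: "0 < t" using t(1) dl(1) by linarith
     have "dist (a i) w = norm ((y - a i) * of_real (t / ?d))" unfolding w_def dist_norm by simp
     also have "\<dots> = norm (y - a i) * \<bar>t / ?d\<bar>" by (simp only: norm_mult norm_of_real)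
     also have "\<bar>t / ?d\<bar> = t / ?d" by (rule abs_of_pos[OF divide_pos_pos[OF t0 d0]])
     also have "norm (y - a i) = ?d" unfolding dist_norm by (rule norm_minus_commute)
     also have "?d * (t / ?d) = t" using d0 by simp
     finally have dw: "dist (a i) w = t" .
     have wD: "w \<in> ?D" unfolding D
     proof (intro allI impI)
      fix j assume j: "j < g"
      show "dl <= dist (a j) w"
      proof (cases "i = j")
       case True then show ?thesis using dw t(1) by simp
      next
       case False
       have "R j < dist (a j) w" by (rule far[OF i(1) j False]) (use dw t(2) in simp)
       then show ?thesis using dlrh(2)[OF j] by linarith
      qed
     qed
     have "Th w = a i + (w - a i) * of_real (q i w)" by (rule E1[OF i(1)]) (use dw t(2) in simp)
     also have "\<dots> = a i + (y - a i) * (of_real (t / ?d) * of_real (?d / t))"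
     proof -
      have wa: "w - a i = (y - a i) * of_real (t / ?d)" by (simp add: w_def)
      show ?thesis unfolding q_def dw t(3) wa by (simp only: mult.assoc)
     qed
     also have "complex_of_real (t / ?d) * of_real (?d / t) = 1" unfolding of_real_mult[symmetric] using t0 d0 by simp
     finally have "Th w = y" by simp
     then show ?thesis using wD by blast
    next
     case False
     then have f: "R i <= dist (a i) y" if "i < g" for i using that by (meson le_cases)
     have "Th y = y" by (rule E2[OF f])
     moreover have "y \<in> ?D" unfolding D
     proof (intro allI impI)
      fix j assume j: "j < g"
      show "dl <= dist (a j) y" using f[OF j] dlrh(2)[OF j] by linarith
     qed
     ultimately show ?thesis by (metis imageI)
    qed
   qed
   show "\<forall>w\<in>?D. \<forall>i<g. dist (a i) (Th w) = rh i \<longleftrightarrow> dist (a i) w = dl"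
   proof (intro ballI allI impI iffI)
    fix w i assume w: "w \<in> ?D" and i: "i < g"
    show "dist (a i) w = dl" if e: "dist (a i) (Th w) = rh i"
    proof -
     have le: "dist (a i) w <= R i" using inD[OF i w] e R[of i] by simp
     have "ta i (dist (a i) w) = ta i dl" using E3[OF i w le] e T2[OF i] by simp
     then show ?thesis by (rule injta[OF i])
    qed
    show "dist (a i) (Th w) = rh i" if e: "dist (a i) w = dl"
     using E3[OF i w] e dlrh[OF i] T2[OF i] by simp
   qed
   show "\<forall>w. M <= norm w --> Th w = w & w \<in> ?D"
   proof (intro allI impI)
    fix w :: complex assume w: "M <= norm w"
    have f: "R i <= dist (a i) w" if "i < g" for i
     using norm_triangle_ineq2[of w "a i"] M[OF that] w by (simp add: dist_norm norm_minus_commute)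
    have "w \<in> ?D" unfolding D
    proof (intro allI impI)
     fix j assume j: "j < g"
     show "dl <= dist (a j) w" using f[OF j] dlrh(2)[OF j] by linarith
    qed
    moreover have "Th w = w" by (rule E2[OF f])
    ultimately show "Th w = w & w \<in> ?D" by blast
   qed
  qed
 qed
qed

text \<open>Four corners minus four sides.\<close>

lemma rc_rim:
 assumes ab: "a < b" "c < d"
 shows "rc euclidean {} (rim a b c d) (rim a b c d) 0"
proof -
 let ?C = "insert (Complex a c) (insert (Complex b c) (insert (Complex a d) (insert (Complex b d) {})))"
 let ?h = "%y x. Complex x y" and ?v = "%x y. Complex x y"
 have ct: "continuous_map (top_of_set S) euclidean (%x. Complex x y)" "continuous_map (top_of_set S) euclidean (%x. Complex y x)" for S :: "real set" and y
  unfolding Complex_eq by (auto intro!: continuous_intros)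
 have inj: "inj_on (%x. Complex x y) S" "inj_on (%x. Complex y x) S" for S y by (auto intro!: inj_onI)
 have m: "z \<in> (%x. Complex x y) ` {s..t} \<longleftrightarrow> s <= Re z & Re z <= t & Im z = y"
  "z \<in> (%x. Complex y x) ` {s..t} \<longleftrightarrow> s <= Im z & Im z <= t & Re z = y" for z s t y
  by (auto simp: image_iff complex_eq_iff)
 have 0: "rc euclidean {} ?C ?C (0 + 1 + 1 + 1 + 1)" by (intro rc_insert rc_refl) (use ab in auto)
 let ?A = "(%x. Complex x c) ` {a..b}" and ?B = "(%x. Complex x d) ` {a..b}"
 let ?E = "(%x. Complex a x) ` {c..d}" and ?F = "(%x. Complex b x) ` {c..d}"
 have 1: "rc euclidean {} (?C Un ?A) (?C Un ?A) (0 + 1 + 1 + 1 + 1 - 1)"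
  by (rule rc_arc[OF 0 ab(1) ct(1) inj(1)]) (use ab in auto)
 have 2: "rc euclidean {} ((?C Un ?A) Un ?B) ((?C Un ?A) Un ?B) (0 + 1 + 1 + 1 + 1 - 1 - 1)"
  by (rule rc_arc[OF 1 ab(1) ct(1) inj(1)]) (use ab in auto)
 have 3: "rc euclidean {} (((?C Un ?A) Un ?B) Un ?E) (((?C Un ?A) Un ?B) Un ?E) (0 + 1 + 1 + 1 + 1 - 1 - 1 - 1)"
  by (rule rc_arc[OF 2 ab(2) ct(2) inj(2)]) (use ab in auto)
 have 4: "rc euclidean {} ((((?C Un ?A) Un ?B) Un ?E) Un ?F) ((((?C Un ?A) Un ?B) Un ?E) Un ?F) (0 + 1 + 1 + 1 + 1 - 1 - 1 - 1 - 1)"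
  by (rule rc_arc[OF 3 ab(2) ct(2) inj(2)]) (use ab in auto)
 have "(((?C Un ?A) Un ?B) Un ?E) Un ?F = rim a b c d"
  unfolding set_eq_iff Un_iff m rim_def rbox_def mem_Collect_eq insert_iff empty_iff complex_eq_iff complex.sel using ab by auto
 then show ?thesis using 4 by simp
qed

text \<open>Meant for the cell around infinity, where the formula does not reach the centre and a
  linear estimate gives continuity.\<close>

lemma continuous_on_puncture:
 fixes F :: "complex => 'b::real_normed_vector"
 assumes F: "continuous_on (S - {0}) F" and b: "!!w. w \<in> S ==> norm (F w - F 0) <= C * supn w"
 shows "continuous_on S F"
proof (rule continuous_on_eq_continuous_within[THEN iffD2], rule ballI)
 fix w assume w: "w \<in> S"
 show "continuous (at w within S) F"
 proof (cases "w = 0")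
  case True
  have "continuous_on S (%w. C * supn w)" by (intro continuous_intros)
  then have "((%w. C * supn w) \<longlongrightarrow> C * supn 0) (at 0 within S)" using w True unfolding continuous_on_def by blast
  then have "((%w. C * supn w) \<longlongrightarrow> 0) (at 0 within S)" by simp
  moreover have "\<forall>\<^sub>F w in at 0 within S. norm (F w - F 0) <= C * supn w" using b by (simp add: eventually_at_filter)
  ultimately have "((%w. F w - F 0) \<longlongrightarrow> 0) (at 0 within S)" by (rule Lim_null_comparison[rotated])
  then show ?thesis unfolding True continuous_within by (rule LIM_zero_cancel)
 next
  case False
  have "at w within S = at w within (S - {0})" by (rule at_within_nhd[of _ "- {0}"]) (use False in auto)
  moreover have "continuous (at w within (S - {0})) F"
   using F w False unfolding continuous_on_eq_continuous_within by simp
  ultimately show ?thesis by simp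
 qed
qed

lemma supn_le_norm: "supn z <= norm z"
 unfolding supn_def using abs_Re_le_cmod[of z] abs_Im_le_cmod[of z] by simp

section \<open>Cellulating a sphere with handles\<close>

text \<open>The sphere is projected from a point outside the discs, and the images of the discs are
  shrunk to one small radius. A large square with these holes contributes 1 - g, one cell around
  infinity contributes 1, and each handle relative to its rim contributes -1.\<close>

theorem genus_cellulation:
 assumes "has_genus X g"
 shows "\<exists>T e K. cellulation X T e K & K ~= {} & e + int (card K) = 2 - 2 * int g"
proof -
 obtain c :: "nat => real ^ 3" and r S ph H ps where
  cr: "\<forall>i<g. c i \<in> sphere 0 1 & 0 < r i & r i < 2"
  and dis: "disjoint_family_on (%i. sphere 0 1 Int cball (c i) (r i)) {..<g}"
  and S: "closedin X S"
  and ph: "homeomorphic_map (top_of_set (sphere 0 1 - (\<Union>i<g. ball (c i) (r i)))) (subtopology X S) ph"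
  and disH: "disjoint_family_on H {..<g}"
  and H: "\<forall>i<g. closedin X (H i) & homeomorphic_map (top_of_set handle) (subtopology X (H i)) (ps i) &
      S Int H i = ph ` (sphere 0 1 Int sphere (c i) (r i)) & S Int H i = ps i ` handle_rim"
  and top: "topspace X = S Un (\<Union>i<g. H i)"
  using assms unfolding has_genus_def by (elim exE conjE)
 have crD: "c i \<in> sphere 0 1 & 0 < r i & r i < 2" if "i < g" for i using cr that by blast
 have disD: "sphere 0 1 Int cball (c i) (r i) Int cball (c j) (r j) = {}" if "i < g" "j < g" "i ~= j" for i j
  using disjoint_family_onD[OF dis, of i j] that by blast
 obtain e where e: "e \<in> sphere 0 1" "!!i. i < g ==> e ~: cball (c i) (r i)"
 proof (rule pole_exists[OF crD disD])
  fix e assume a: "e \<in> sphere 0 1" "!!i. i < g ==> e ~: cball (c i) (r i)"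
  show thesis by (rule that[OF a])
 qed
 have ne: "norm e = 1" using e(1) by simp
 obtain sgm :: "complex => real ^ 3" where sgm: "continuous_on UNIV sgm" "inj sgm" "range sgm = sphere 0 1 - {e}"
  "!!z. (norm (sgm z - e))\<^sup>2 = 4 / ((norm z)\<^sup>2 + 1)"
  "!!c r. norm c = 1 ==> 0 < r ==> r < 2 ==> e ~: cball c r ==>
    \<exists>a rh. 0 < rh & (\<forall>z. (dist c (sgm z) < r \<longleftrightarrow> dist a z < rh) & (dist c (sgm z) <= r \<longleftrightarrow> dist a z <= rh))"
 proof (rule stereographic[OF ne])
  fix sgm :: "complex => real ^ 3" assume a: "continuous_on UNIV sgm" "inj sgm" "range sgm = sphere 0 1 - {e}"
   "!!z. (norm (sgm z - e))\<^sup>2 = 4 / ((norm z)\<^sup>2 + 1)"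
   "!!c r. norm c = 1 ==> 0 < r ==> r < 2 ==> e ~: cball c r ==>
    \<exists>a rh. 0 < rh & (\<forall>z. (dist c (sgm z) < r \<longleftrightarrow> dist a z < rh) & (dist c (sgm z) <= r \<longleftrightarrow> dist a z <= rh))"
  show thesis by (rule that[OF a])
 qed
 have sgmS: "sgm z \<in> sphere 0 1" "sgm z ~= e" for z using sgm(3) by blast+
 have "\<forall>i. \<exists>p. i < g --> 0 < snd p & (\<forall>z. (dist (c i) (sgm z) < r i \<longleftrightarrow> dist (fst p) z < snd p) & (dist (c i) (sgm z) <= r i \<longleftrightarrow> dist (fst p) z <= snd p))"
 proof
  fix i
  show "\<exists>p. i < g --> 0 < snd p & (\<forall>z. (dist (c i) (sgm z) < r i \<longleftrightarrow> dist (fst p) z < snd p) & (dist (c i) (sgm z) <= r i \<longleftrightarrow> dist (fst p) z <= snd p))"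
  proof (cases "i < g")
   case True
   have "norm (c i) = 1" using crD[OF True] by simp
   then obtain a rh where "0 < rh" "\<forall>z. (dist (c i) (sgm z) < r i \<longleftrightarrow> dist a z < rh) & (dist (c i) (sgm z) <= r i \<longleftrightarrow> dist a z <= rh)"
    using sgm(5)[of "c i" "r i"] crD[OF True] e(2)[OF True] by blast
   then show ?thesis by (intro exI[of _ "(a, rh)"]) simp
  qed simp
 qed
 from choice[OF this] obtain p where p: "\<forall>i. i < g --> 0 < snd (p i) &
  (\<forall>z. (dist (c i) (sgm z) < r i \<longleftrightarrow> dist (fst (p i)) z < snd (p i)) & (dist (c i) (sgm z) <= r i \<longleftrightarrow> dist (fst (p i)) z <= snd (p i)))" ..
 define a where "a i = fst (p i)" for i
 define rh where "rh i = snd (p i)" for i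
 have rh0: "0 < rh i" and lt: "dist (c i) (sgm z) < r i \<longleftrightarrow> dist (a i) z < rh i"
  and le: "dist (c i) (sgm z) <= r i \<longleftrightarrow> dist (a i) z <= rh i" if "i < g" for i z
  using p that unfolding a_def rh_def by blast+
 have eqr: "dist (c i) (sgm z) = r i \<longleftrightarrow> dist (a i) z = rh i" if "i < g" for i z
  using lt[OF that, of z] le[OF that, of z] by linarith
 have disa: "cball (a i) (rh i) Int cball (a j) (rh j) = {}" if ij: "i < g" "j < g" "i ~= j" for i j
 proof (rule equals0I)
  fix z assume "z \<in> cball (a i) (rh i) Int cball (a j) (rh j)"
  then have "sgm z \<in> sphere 0 1 Int cball (c i) (r i) Int cball (c j) (r j)" using le[OF ij(1), of z] le[OF ij(2), of z] sgmS(1)[of z] by simp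
  then show False using disD[OF ij] by blast
 qed
 obtain ep M where ep: "0 < ep" and M: "0 < M" "!!i. i < g ==> norm (a i) < M"
  and sh: "!!dl. 0 < dl ==> dl < ep ==> (\<forall>i<g. \<forall>j<g. i ~= j --> sphere (a i) dl Int ball (a j) dl = {}) & (\<exists>Th. continuous_on (- (\<Union>i<g. ball (a i) dl)) Th & inj_on Th (- (\<Union>i<g. ball (a i) dl)) &
   Th ` (- (\<Union>i<g. ball (a i) dl)) = - (\<Union>i<g. ball (a i) (rh i)) &
   (\<forall>w\<in>- (\<Union>i<g. ball (a i) dl). \<forall>i<g. dist (a i) (Th w) = rh i \<longleftrightarrow> dist (a i) w = dl) &
   (\<forall>w. M <= norm w --> Th w = w & w \<in> - (\<Union>i<g. ball (a i) dl)))"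
 proof (rule shrink_discs[OF rh0 disa])
  fix ep M :: real assume a: "0 < ep" "0 < M" "!!i. i < g ==> norm (a i) < M"
   "!!dl. 0 < dl ==> dl < ep ==> (\<forall>i<g. \<forall>j<g. i ~= j --> sphere (a i) dl Int ball (a j) dl = {}) & (\<exists>Th. continuous_on (- (\<Union>i<g. ball (a i) dl)) Th & inj_on Th (- (\<Union>i<g. ball (a i) dl)) &
   Th ` (- (\<Union>i<g. ball (a i) dl)) = - (\<Union>i<g. ball (a i) (rh i)) &
   (\<forall>w\<in>- (\<Union>i<g. ball (a i) dl). \<forall>i<g. dist (a i) (Th w) = rh i \<longleftrightarrow> dist (a i) w = dl) &
   (\<forall>w. M <= norm w --> Th w = w & w \<in> - (\<Union>i<g. ball (a i) dl)))"
  show thesis by (rule that[OF a])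
 qed
 have MM: "- M < M" using M(1) by simp
 have "\<exists>ep>0. \<forall>dl. 0 < dl --> dl < ep --> holed (- M) M (- M) M (a ` {..<g}) dl"
 proof (rule holed_exists[OF _ MM MM])
  fix z assume "z \<in> a ` {..<g}"
  then have "norm z < M" using M(2) by blast
  then show "- M < Re z & Re z < M & - M < Im z & Im z < M" using abs_Re_le_cmod[of z] abs_Im_le_cmod[of z] by auto
 qed simp
 then obtain ep' where ep': "0 < ep'" "\<forall>dl. 0 < dl --> dl < ep' --> holed (- M) M (- M) M (a ` {..<g}) dl" by (elim exE conjE)
 define dl where "dl = min ep ep' / 2"
 have dl: "0 < dl" "dl < ep" "dl < ep'" using ep ep'(1) by (auto simp: dl_def)
 define D where "D = - (\<Union>i<g. ball (a i) dl)"
 obtain Th where Th: "continuous_on D Th" "inj_on Th D" "Th ` D = - (\<Union>i<g. ball (a i) (rh i))"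
  "\<forall>w\<in>D. \<forall>i<g. dist (a i) (Th w) = rh i \<longleftrightarrow> dist (a i) w = dl" "\<forall>w. M <= norm w --> Th w = w & w \<in> D"
  using conjunct2[OF sh[OF dl(1,2)]] unfolding D_def[symmetric] by (elim exE conjE)
 have sphD: "sphere (a i) dl \<subseteq> D" if i: "i < g" for i
 proof
  fix w assume w: "w \<in> sphere (a i) dl"
  have "w ~: ball (a j) dl" if j: "j < g" for j
  proof (cases "i = j")
   case True then show ?thesis using w by simp
  next
   case False
   then have "sphere (a i) dl Int ball (a j) dl = {}" using conjunct1[OF sh[OF dl(1,2)]] i j by blast
   then show ?thesis using w by blast
  qed
  then show "w \<in> D" unfolding D_def by blast
 qed
 have "inj_on a {..<g}"
 proof (rule inj_onI)
  fix i j assume ij: "i \<in> {..<g}" "j \<in> {..<g}" "a i = a j"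
  show "i = j"
  proof (rule ccontr)
   assume ne: "i ~= j"
   have ig: "i < g" "j < g" using ij by simp_all
   have "a i \<in> cball (a i) (rh i)" "a i \<in> cball (a j) (rh j)" using rh0[OF ig(1)] rh0[OF ig(2)] ij(3) by simp_all
   then show False using disa[OF ig ne] by blast
  qed
 qed
 then have card: "card (a ` {..<g}) = g" by (simp add: card_image)
 let ?A = "rbox (- M) M (- M) M" and ?B = "rim (- M) M (- M) M"
 have AD: "?A - (\<Union>p\<in>a ` {..<g}. ball p dl) = ?A Int D" unfolding D_def by auto
 have "holed (- M) M (- M) M (a ` {..<g}) dl" using ep'(2) dl by blast
 then obtain T0 where T0: "rc euclidean ?B (?A Int D) T0 (1 - int g)" "\<forall>p\<in>a ` {..<g}. sphere p dl \<subseteq> T0"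
  unfolding holed_def AD card by (elim exE conjE)
 let ?S0 = "sphere 0 1 - (\<Union>i<g. ball (c i) (r i))"
 have eS: "e \<in> ?S0"
 proof -
  have "e ~: ball (c i) (r i)" if "i < g" for i using e(2)[OF that] by simp
  then show ?thesis using e(1) by blast
 qed
 have sgm0: "sgm z \<in> ?S0 \<longleftrightarrow> z ~: (\<Union>i<g. ball (a i) (rh i))" for z using sgmS(1)[of z] lt by auto
 have "continuous_map (top_of_set ?S0) (subtopology X S) ph" by (rule homeomorphic_imp_continuous_map[OF ph])
 then have phc: "continuous_map (top_of_set ?S0) X ph" by (rule continuous_map_into_fulltopology)
 have phi: "inj_on ph ?S0" using homeomorphic_imp_injective_map[OF ph] by simp
 have phS: "ph ` ?S0 = S"
  using homeomorphic_imp_surjective_map[OF ph] closedin_subset[OF S] by (simp add: topspace_subtopology Int_absorb1)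
 define F where "F w = sgm (Th w)" for w
 have FD: "F ` D = ?S0 - {e}"
 proof (intro equalityI subsetI)
  fix y assume "y \<in> F ` D"
  then obtain w where w: "w \<in> D" "y = sgm (Th w)" unfolding F_def by blast
  have "Th w ~: (\<Union>i<g. ball (a i) (rh i))" using Th(3) w(1) by blast
  then have "y \<in> ?S0" unfolding w(2) sgm0 .
  then show "y \<in> ?S0 - {e}" using sgmS(2)[of "Th w"] w(2) by simp
 next
  fix y assume y: "y \<in> ?S0 - {e}"
  then have "y \<in> range sgm" using sgm(3) by blast
  then obtain z where z: "y = sgm z" by blast
  then have "z \<in> - (\<Union>i<g. ball (a i) (rh i))" using y sgm0[of z] by blast
  then obtain w where "w \<in> D" "z = Th w" using Th(3) by (metis imageE)
  then show "y \<in> F ` D" unfolding z F_def by blast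
 qed
 have Fc: "continuous_on D F" unfolding F_def
  by (rule continuous_on_compose2[OF sgm(1) Th(1)]) simp
 have Fi: "inj_on F D"
 proof (rule inj_onI)
  fix w w' assume w: "w \<in> D" "w' \<in> D" "F w = F w'"
  then have "Th w = Th w'" unfolding F_def by (intro injD[OF sgm(2)])
  then show "w = w'" by (rule inj_onD[OF Th(2) _ w(1,2)])
 qed
 define xi where "xi = ph \<circ> F"
 have "continuous_map (top_of_set D) (top_of_set ?S0) F" using Fc FD by (auto simp: continuous_map_in_subtopology)
 then have xic: "continuous_map (top_of_set D) X xi" unfolding xi_def using phc by (rule continuous_map_compose)
 have FS: "F ` D \<subseteq> ?S0" using FD by blast
 have xii: "inj_on xi D" unfolding xi_def by (rule comp_inj_on[OF Fi inj_on_subset[OF phi FS]])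
 have xiS: "xi ` D = S - {ph e}"
 proof -
  have "xi ` D = ph ` (?S0 - {e})" unfolding xi_def image_comp[symmetric] FD ..
  also have "\<dots> = ph ` ?S0 - ph ` {e}" by (rule inj_on_image_set_diff[OF phi]) (use eS in auto)
  finally show ?thesis unfolding phS by simp
 qed
 \<comment> \<open>The hole circles go to the curves along which the handles are attached.\<close>
 have rimS: "xi ` sphere (a i) dl = S Int H i" if i: "i < g" for i
 proof -
  have "F ` sphere (a i) dl = sphere 0 1 Int sphere (c i) (r i)"
  proof (intro equalityI subsetI)
   fix y assume "y \<in> F ` sphere (a i) dl"
   then obtain w where w: "w \<in> sphere (a i) dl" "y = sgm (Th w)" unfolding F_def by blast
   have "dist (a i) (Th w) = rh i" using Th(4) sphD[OF i] w(1) i by auto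
   then have "dist (c i) y = r i" unfolding w(2) eqr[OF i] .
   then show "y \<in> sphere 0 1 Int sphere (c i) (r i)" using sgmS(1)[of "Th w"] w(2) by simp
  next
   fix y assume y: "y \<in> sphere 0 1 Int sphere (c i) (r i)"
   then have yc: "y \<in> cball (c i) (r i)" by simp
   have "y ~: ball (c j) (r j)" if j: "j < g" for j
   proof (cases "i = j")
    case True then show ?thesis using y by simp
   next
    case False
    show ?thesis using disD[OF i j False] y yc ball_subset_cball[of "c j" "r j"] by blast
   qed
   moreover have "y ~= e" using yc e(2)[OF i] by blast
   ultimately have "y \<in> F ` D" unfolding FD using y by blast
   then obtain w where w: "w \<in> D" "y = sgm (Th w)" unfolding F_def by blast
   have "dist (a i) (Th w) = rh i" using y unfolding w(2) eqr[OF i, symmetric] by simp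
   then have "w \<in> sphere (a i) dl" using Th(4) w(1) i by simp
   then show "y \<in> F ` sphere (a i) dl" unfolding w(2) F_def by blast
  qed
  then show ?thesis unfolding xi_def image_comp[symmetric] using H i by simp
 qed
 have BA: "?B \<subseteq> ?A Int D" using rc_sub[OF T0(1)] by blast
 have c0: "rc X {} (xi ` ?B) (xi ` ?B) 0"
  using rc_push[OF rc_rim[OF MM MM] _ xic xii] BA by simp
 have c1: "rc X (xi ` ?B) (xi ` (?A Int D)) (xi ` T0) (1 - int g)"
  by (rule rc_push[OF T0(1) Int_lower2 xic xii])
 have c2: "rc X {} (xi ` ?B Un xi ` (?A Int D)) (xi ` ?B Un xi ` T0) (0 + (1 - int g))"
  by (rule rc_glue[OF c0 c1]) blast+
 have R1: "xi ` ?B Un xi ` (?A Int D) = xi ` (?A Int D)" using BA by blast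
 have T1: "xi ` ?B Un xi ` T0 = xi ` T0" using rc_sub(1)[OF T0(1)] by blast
 \<comment> \<open>Inversion along rays: \<open>supn\<close> becomes M/\<open>supn\<close>, so the
   punctured square is turned inside out onto the outside of the box, with its boundary going to the
   rim.\<close>
 define out where "out w = complex_of_real (M / (supn w)\<^sup>2) * w" for w
 define G where "G w = (if w = 0 then e else sgm (out w))" for w
 have so: "supn (out w) = M / supn w" if "w ~= 0" for w
  unfolding out_def supn_scale using M(1) that by (simp add: power2_eq_square)
 have sq1: "0 < supn w" "supn w <= 1" if "w \<in> Sq - {0}" for w using that by (auto simp: Sq_def)
 have Mo: "M <= supn (out w)" if w: "w \<in> Sq - {0}" for w
 proof -
  have "M * supn w <= M * 1" using M(1) sq1[OF w] by (intro mult_left_mono) auto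
  then show ?thesis using so[of w] w sq1(1)[OF w] by (simp add: pos_le_divide_eq)
 qed
 have oD: "out w \<in> D" "Th (out w) = out w" if "w \<in> Sq - {0}" for w
  using Th(5) Mo[OF that] supn_le_norm[of "out w"] by (meson order_trans)+
 have GF: "G w = F (out w)" if "w \<in> Sq - {0}" for w using that oD(2)[OF that] by (simp add: G_def F_def)
 have "continuous_on Sq G"
 \<comment> \<open>The constant comes from |sgm z - e| <= 2/|z| and |out w| >=
   M/\<open>supn w\<close>.\<close>
 proof (rule continuous_on_puncture[where C = "2 / M"])
  have 1: "continuous_on (Sq - {0}) out" unfolding out_def by (intro continuous_intros) auto
  have "continuous_on (Sq - {0}) (%w. sgm (out w))" by (rule continuous_on_compose2[OF sgm(1) 1]) simp
  then show "continuous_on (Sq - {0}) G" by (rule continuous_on_eq) (simp add: G_def)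
  fix w assume w: "w \<in> Sq"
  show "norm (G w - G 0) <= 2 / M * supn w"
  proof (cases "w = 0")
   case False
   then have w': "w \<in> Sq - {0}" using w by blast
   let ?n = "norm (out w)"
   have n: "M / supn w <= ?n" using supn_le_norm[of "out w"] so[OF False] by simp
   have n0: "0 < M / supn w" using M(1) sq1(1)[OF w'] by simp
   then have n1: "0 < ?n" using n by linarith
   have "(norm (sgm (out w) - e))\<^sup>2 <= (2 / ?n)\<^sup>2"
    unfolding sgm(4) power_divide using n1 by (intro frac_le) auto
   then have "norm (sgm (out w) - e) <= 2 / ?n" by (rule power2_le_imp_le) (use n1 in simp)
   also have "\<dots> <= 2 / (M / supn w)" by (rule frac_le[OF _ _ n0 n]) simp_all
   finally show ?thesis using False by (simp add: G_def)
  qed (simp add: G_def)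
 qed
 moreover have GS: "G ` Sq \<subseteq> ?S0"
 proof
  fix y assume "y \<in> G ` Sq"
  then obtain w where w: "w \<in> Sq" "y = G w" by blast
  show "y \<in> ?S0"
  proof (cases "w = 0")
   case True then show ?thesis using w(2) eS by (simp add: G_def)
  next
   case False
   then have w0: "w \<in> Sq - {0}" using w(1) by blast
   have "F (out w) \<in> ?S0" using FS oD(1)[OF w0] by blast
   then show ?thesis unfolding w(2) GF[OF w0] .
  qed
 qed
 ultimately have "continuous_map (top_of_set Sq) (top_of_set ?S0) G" by (auto simp: continuous_map_in_subtopology)
 then have kc: "continuous_map (top_of_set Sq) X (ph \<circ> G)" using phc by (rule continuous_map_compose)
 have out2: "out (out w) = w" if "w ~= 0" for w
 proof -
  have s: "supn w ~= 0" using that by simp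
  have "M / (M / supn w)\<^sup>2 * (M / (supn w)\<^sup>2) = 1" using s M(1) by (simp add: power2_eq_square)
  then have "complex_of_real (M / (M / supn w)\<^sup>2) * of_real (M / (supn w)\<^sup>2) = 1" by (metis of_real_1 of_real_mult)
  then have "complex_of_real (M / (M / supn w)\<^sup>2) * (of_real (M / (supn w)\<^sup>2) * w) = w" by (simp only: mult.assoc[symmetric] mult_1)
  then show ?thesis unfolding out_def[of "out w"] so[OF that] unfolding out_def .
 qed
 have "inj_on G Sq"
 proof (rule inj_onI)
  fix w w' assume w: "w \<in> Sq" "w' \<in> Sq" "G w = G w'"
  have z: "G w = e \<longleftrightarrow> w = 0" for w using sgmS(2)[of "out w"] by (simp add: G_def)
  show "w = w'"
  proof (cases "w = 0 | w' = 0")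
   case True then show ?thesis using w(3) z by metis
  next
   case False
   then have "sgm (out w) = sgm (out w')" using w(3) by (simp add: G_def)
   then have e: "out w = out w'" by (rule injD[OF sgm(2)])
   have "out (out w) = w" "out (out w') = w'" by (rule out2, use False in blast)+
   then show ?thesis unfolding e by (rule trans[OF sym])
  qed
 qed
 then have ki: "inj_on (ph \<circ> G) Sq" by (rule comp_inj_on[OF _ inj_on_subset[OF phi GS]])
 have kout: "(ph \<circ> G) w = xi (out w)" if "w \<in> Sq - {0}" for w using GF[OF that] by (simp add: xi_def)
 have c3: "rc X {} (xi ` (?A Int D) Un (ph \<circ> G) ` Sq) (xi ` T0) (0 + (1 - int g) + 1)"
 proof (rule rc_cell[OF c2[unfolded R1 T1] kc ki])
  fix w assume w: "w \<in> Sq"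
  show "(ph \<circ> G) w \<in> xi ` T0" if s: "supn w = 1"
  proof -
   have w0: "w \<in> Sq - {0}" using w s by auto
   have "supn (out w) = M" using so[of w] w0 s by simp
   then have "out w \<in> ?B" using M(1) unfolding supn_def rim_def rbox_def by (auto simp: max_def abs_if split: if_splits)
   then show ?thesis unfolding kout[OF w0] using rc_sub(1)[OF T0(1)] by blast
  qed
  show "(ph \<circ> G) w ~: xi ` (?A Int D)" if s: "supn w ~= 1"
  proof (cases "w = 0")
   case True
   then have "(ph \<circ> G) w = ph e" by (simp add: G_def)
   then show ?thesis using xiS by blast
  next
   case False
   then have w0: "w \<in> Sq - {0}" using w by blast
   have "supn w < 1" using sq1(2)[OF w0] s by simp
   then have "M * supn w < M" using M(1) by simp
   then have "M < supn (out w)" using so[OF False] sq1(1)[OF w0] by (simp add: pos_less_divide_eq)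
   then have "out w ~: ?A" unfolding supn_def rbox_def by (auto simp: max_def abs_if split: if_splits)
   then show ?thesis unfolding kout[OF w0] using inj_on_image_mem_iff[OF xii oD(1)[OF w0], of "?A Int D"] by blast
  qed
 qed
 have RS: "xi ` (?A Int D) Un (ph \<circ> G) ` Sq = S"
 proof (intro equalityI subsetI)
  fix y assume "y \<in> xi ` (?A Int D) Un (ph \<circ> G) ` Sq"
  then show "y \<in> S"
  proof
   assume "y \<in> xi ` (?A Int D)" then show ?thesis using xiS by blast
  next
   assume "y \<in> (ph \<circ> G) ` Sq" then show ?thesis unfolding image_comp[symmetric] using GS phS by blast
  qed
 next
  fix y assume y: "y \<in> S"
  show "y \<in> xi ` (?A Int D) Un (ph \<circ> G) ` Sq"
  proof (cases "y = ph e")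
   case True
   have "y = (ph \<circ> G) 0" using True by (simp add: G_def)
   then show ?thesis using zero_in_Sq by blast
  next
   case False
   then have "y \<in> xi ` D" using y xiS by blast
   then obtain w where w: "w \<in> D" "y = xi w" by blast
   show ?thesis
   proof (cases "w \<in> ?A")
    case True then show ?thesis using w by blast
   next
    case False
    then have s: "M < supn w" unfolding supn_def rbox_def by (auto simp: max_def)
    then have w0: "w ~= 0" using M(1) by auto
    have "0 < supn w" using s M(1) by linarith
    then have "M / supn w < 1" using s by (simp add: pos_divide_less_eq)
    then have "supn (out w) < 1" unfolding so[OF w0] .
    moreover have "out w ~= 0" using out2[OF w0] w0 by (auto simp: out_def)
    ultimately have ow: "out w \<in> Sq - {0}" by (simp add: Sq_def)
    have "(ph \<circ> G) (out w) = y" unfolding kout[OF ow] out2[OF w0] using w(2) by simp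
    then show ?thesis using ow by blast
   qed
  qed
 qed
 have c3': "rc X {} S (xi ` T0) (2 - int g)" using c3 unfolding RS by simp
 have ht: "rc X (ps i ` handle_rim) (H i) (ps i ` hgraph) (- 1)" if i: "i < g" for i
 proof -
  have h: "homeomorphic_map (top_of_set handle) (subtopology X (H i)) (ps i)" "closedin X (H i)" using H i by blast+
  have "continuous_map (top_of_set handle) X (ps i)"
   by (rule continuous_map_into_fulltopology[OF homeomorphic_imp_continuous_map[OF h(1)]])
  moreover have "inj_on (ps i) handle" using homeomorphic_imp_injective_map[OF h(1)] by simp
  moreover have "ps i ` handle = H i"
   using homeomorphic_imp_surjective_map[OF h(1)] closedin_subset[OF h(2)] by (simp add: topspace_subtopology Int_absorb1)
  ultimately show ?thesis using rc_push[OF rc_handle subset_refl, of X "ps i"] by simp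
 qed
 \<comment> \<open>Handles are attached one at a time; being disjoint, each meets what is already
   there in its rim only.\<close>
 have ind: "k <= g ==> rc X {} (S Un (\<Union>i<k. H i)) (xi ` T0 Un (\<Union>i<k. ps i ` hgraph)) (2 - int g - int k)" for k
 proof (induction k)
  case 0 then show ?case using c3' by simp
 next
  case (Suc k)
  then have k: "k < g" by simp
  have IH: "rc X {} (S Un (\<Union>i<k. H i)) (xi ` T0 Un (\<Union>i<k. ps i ` hgraph)) (2 - int g - int k)" using Suc by simp
  have rk: "ps k ` handle_rim = S Int H k"
  proof -
   have "S Int H k = ps k ` handle_rim" using H k by blast
   then show ?thesis by (rule sym)
  qed
  have "rc X {} ((S Un (\<Union>i<k. H i)) Un H k) ((xi ` T0 Un (\<Union>i<k. ps i ` hgraph)) Un ps k ` hgraph) (2 - int g - int k + - 1)"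
  proof (rule rc_glue[OF IH ht[OF k]])
   have "sphere (a k) dl \<subseteq> T0" using T0(2) k by blast
   then show "ps k ` handle_rim \<subseteq> xi ` T0 Un (\<Union>i<k. ps i ` hgraph)" unfolding rk rimS[OF k, symmetric] by blast
   have "H i Int H k = {}" if "i < k" for i using disjoint_family_onD[OF disH, of i k] that k by simp
   then show "(S Un (\<Union>i<k. H i)) Int H k \<subseteq> ps k ` handle_rim" unfolding rk by blast
  qed
  moreover have "(S Un (\<Union>i<k. H i)) Un H k = S Un (\<Union>i<Suc k. H i)"
   "(xi ` T0 Un (\<Union>i<k. ps i ` hgraph)) Un ps k ` hgraph = xi ` T0 Un (\<Union>i<Suc k. ps i ` hgraph)"
   by (auto simp: lessThan_Suc)
  ultimately show ?case by (simp only: of_nat_Suc) (simp add: algebra_simps)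
 qed
 let ?T = "xi ` T0 Un (\<Union>i<g. ps i ` hgraph)"
 have fin: "rc X {} (topspace X) ?T (2 - 2 * int g)" using ind[OF order_refl] unfolding top by simp
 \<comment> \<open>The centre of the cell around infinity is off the graph, so there is at least one
   cell.\<close>
 have eT: "ph e ~: ?T"
 proof
  assume "ph e \<in> ?T"
  moreover have "ph e ~: xi ` T0" using xiS rc_sub(2)[OF T0(1)] by blast
  ultimately obtain i where i: "i < g" "ph e \<in> ps i ` hgraph" by blast
  then have "ph e \<in> H i" using rc_sub(2)[OF ht[OF i(1)]] by blast
  moreover have "ph e \<in> S" using phS eS by blast
  ultimately have "ph e \<in> xi ` sphere (a i) dl" unfolding rimS[OF i(1)] by blast
  then show False using sphD[OF i(1)] xiS by blast
 qed
 from rcE[OF fin] obtain n K where K: "graphext X {} ?T n" "finite K" "\<forall>kp\<in>K. cell X ?T kp"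
   "\<forall>kp\<in>K. \<forall>kp'\<in>K. \<forall>z\<in>Sq. \<forall>z'\<in>Sq. kp z = kp' z' --> kp z ~: ?T --> kp = kp'"
   "topspace X = ?T Un (\<Union>kp\<in>K. kp ` Sq)" "2 - 2 * int g = n + int (card K)" .
 have "cellulation X ?T n K" unfolding cellulation_def by (intro conjI K(1-5))
 moreover have "ph e \<in> topspace X" unfolding top using phS eS by blast
 then have "K ~= {}" using K(5) eT by blast
 ultimately show ?thesis using K(6)[symmetric] by blast
qed

section \<open>The Riemann-Hurwitz count\<close>

theorem theorem7p1:
  fixes X :: "'a topology" and A :: "'a chart set"
    and Y :: "'b topology" and B :: "'b chart set"
    and f :: "'a \<Rightarrow> 'b" and gX gY :: nat
  assumes "riemann_surface X A" and "compact_space X" and "connected_space X"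
    and "has_genus X gX"
    and "riemann_surface Y B" and "compact_space Y" and "connected_space Y"
    and "has_genus Y gY"
    and "holomorphic_map X A Y B f"
    and "\<exists>x\<in>topspace X. \<exists>y\<in>topspace X. f x \<noteq> f y"
  shows "real gX = real (map_degree X A Y B f) * (real gY - 1) + 1
           + real (total_ramification X A Y B f) / 2"
proof -
 let ?N = "mult_at X A Y B f"
 have br: "branched X Y f ?N" by (rule branched_mult[OF assms(1-3,5-7,9,10)])
 have Nr: "?N p = ramification_index X A Y B f p + 1" for p by (rule mult_at_def[OF assms(1-3,5-7,9,10)])
 interpret branched_covering X Y f ?N by unfold_locales (rule br)
 obtain x0 where x0: "x0 \<in> topspace X" using assms(10) by blast
 have y0: "f x0 \<in> topspace Y" using x0 cont_br by (auto simp: continuous_map_def)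
 define m where "m = (\<Sum>x\<in>fib (f x0). ?N x)"
 have m: "(\<Sum>x\<in>fib q. ?N x) = m" if "q \<in> topspace Y" for q
  unfolding m_def by (rule degree_const[OF assms(7) y0 that])
 have deg: "map_degree X A Y B f = m" unfolding map_degree_def
 \<comment> \<open>Y has a point, the image of x0, so the value common to all fibres is
   determined.\<close>
 proof (rule the_equality)
  show "\<forall>q\<in>topspace Y. finite {p \<in> topspace X. f p = q} & m = (\<Sum>p | p \<in> topspace X & f p = q. ramification_index X A Y B f p + 1)"
   using m finite_fib unfolding fib_def Nr by simp
  fix m' assume "\<forall>q\<in>topspace Y. finite {p \<in> topspace X. f p = q} & m' = (\<Sum>p | p \<in> topspace X & f p = q. ramification_index X A Y B f p + 1)"
  then show "m' = m" using m[OF y0] y0 unfolding fib_def Nr by auto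
 qed
 have fb: "finite brs" by (rule finite_brs[OF assms(6)])
 let ?R = "ramification_index X A Y B f"
 \<comment> \<open>Points with nonzero index lie over branch points, so the sum is regrouped by
   finitely many fibres.\<close>
 have "total_ramification X A Y B f = (\<Sum>p\<in>(\<Union>q\<in>brs. fib q). ?R p)"
  unfolding total_ramification_def
 proof (rule sum.mono_neutral_left)
  show "finite (\<Union>q\<in>brs. fib q)" using fb finite_fib by (auto simp: brs_def)
  show "{p. p \<in> topspace X & ?R p ~= 0} \<subseteq> (\<Union>q\<in>brs. fib q)"
  proof
   fix p assume p: "p \<in> {p. p \<in> topspace X & ?R p ~= 0}"
   then have "f p \<in> topspace Y" using cont_br by (auto simp: continuous_map_def)
   moreover have "p \<in> fib (f p)" using p by (simp add: fib_def)
   moreover have "?N p ~= 1" using p Nr[of p] by simp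
   ultimately show "p \<in> (\<Union>q\<in>brs. fib q)" unfolding brs_def by blast
  qed
 qed (auto simp: fib_def)
 also have "\<dots> = (\<Sum>q\<in>brs. \<Sum>p\<in>fib q. ?R p)"
  by (rule sum.UNION_disjoint[OF fb]) (use finite_fib in \<open>auto simp: brs_def fib_def\<close>)
 finally have "int (total_ramification X A Y B f) = (\<Sum>q\<in>brs. \<Sum>p\<in>fib q. int (?R p))" by simp
 \<comment> \<open>Local degrees add up to m in each fibre, and each exceeds the index by one, which
   accounts for the number of points.\<close>
 also have "\<dots> = (\<Sum>q\<in>brs. int m - int (card (fib q)))"
 proof (rule sum.cong[OF refl])
  fix q assume "q \<in> brs"
  then have q: "q \<in> topspace Y" by (simp add: brs_def)
  have "int m = (\<Sum>p\<in>fib q. int (?N p))" using m[OF q] by (metis of_nat_sum)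
  also have "\<dots> = (\<Sum>p\<in>fib q. int (?R p)) + int (card (fib q))" unfolding Nr by (simp add: sum.distrib)
  finally show "(\<Sum>p\<in>fib q. int (?R p)) = int m - int (card (fib q))" by simp
 qed
 finally have V: "(\<Sum>q\<in>brs. int m - int (card (fib q))) = int (total_ramification X A Y B f)" ..
 from genus_cellulation[OF assms(8)] obtain TY eY KY where
  cY: "cellulation Y TY eY KY" "KY ~= {}" "eY + int (card KY) = 2 - 2 * int gY" by (elim exE conjE)
 from genus_cellulation[OF assms(4)] obtain TX eX KX where
  cX: "cellulation X TX eX KX" "KX ~= {}" "eX + int (card KX) = 2 - 2 * int gX" by (elim exE conjE)
 have ne: "topspace X ~= {}" using x0 by blast
 have "\<exists>G' e' K' H L. cellulation Y G' e' K' & K' ~= {} &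
  cellulation X H (int m * e' - (\<Sum>q\<in>brs. int m - int (card (fib q)))) L & L ~= {} & card L = m * card K'"
  by (rule lift_cellulation[OF assms(6) ne _ cY(1,2)]) (rule m)
 then obtain G' e' K' H L where
  l: "cellulation Y G' e' K'" "K' ~= {}"
   "cellulation X H (int m * e' - (\<Sum>q\<in>brs. int m - int (card (fib q)))) L" "L ~= {}" "card L = m * card K'"
  by (elim exE conjE)
 have eqY: "eY + int (card KY) = e' + int (card K')"
  by (rule cellulation_euler_unique[OF assms(5,7) cY(1,2) l(1,2)])
 have eqX: "eX + int (card KX) = int m * e' - (\<Sum>q\<in>brs. int m - int (card (fib q))) + int (card L)"
  by (rule cellulation_euler_unique[OF assms(1,3) cX(1,2) l(3,4)])
 \<comment> \<open>Graph and cells are lifted m-fold alike, so the Euler characteristic of the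
   refined cellulation of Y enters as a whole.\<close>
 have "2 - 2 * int gX = int m * (e' + int (card K')) - int (total_ramification X A Y B f)"
  using eqX unfolding V l(5) cX(3) by (simp add: algebra_simps)
 then have "2 - 2 * int gX = int m * (2 - 2 * int gY) - int (total_ramification X A Y B f)"
  using eqY cY(3) by simp
 then have "real_of_int (2 - 2 * int gX) = real_of_int (int m * (2 - 2 * int gY) - int (total_ramification X A Y B f))" by (rule arg_cong)
 then have "2 - 2 * real gX = real m * (2 - 2 * real gY) - real (total_ramification X A Y B f)" by simp
 then show ?thesis unfolding deg by (simp add: field_simps)
qed

end
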